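(* Over $\mathsf{RCA_0}$, the following are equivalent: (1) $\mathsf{2\text{-}WWKL}$; (2) $\mathsf{2\text{-}POS}$; (3) $\mathsf{B\Sigma_2}+\mathsf{2\text{-}RAN}$.
   Context: Work in second-order arithmetic; $\mathsf{RCA_0}$ is the usual base system; $\mathsf{B\Sigma_2}$ is the collection scheme $\forall x<u\,\exists y\,\varphi(x,y)\rightarrow\exists v\,\forall x<u\,\exists y<v\,\varphi(x,y)$ for $\Sigma^0_2$ formulas $\varphi$ with parameters. Sets are identified with points of $2^\omega$; $[\sigma]$ is the set of $Y$ extending $\sigma$, $\mu([\sigma])=2^{-\mathrm{length}(\sigma)}$. The jump is handled by formulas: $e\in X'$ abbreviates $\exists\sigma\subset X\,\varphi^\sigma_e(0)\downarrow$; a tree computable from $X'$ is given by an index $e$ with $\varphi^{X'}_e$ total and $\{0,1\}$-valued, where $\varphi_e^{X'}(x)\downarrow=y$ abbreviates $\exists\sigma\subset X'\,\varphi^\sigma_e(x)\downarrow=y$. $\mathsf{2\text{-}WWKL}$: for every $X$ and every infinite binary tree $T$ computable from $X'$ such that for some rational $\delta>0$ and all $n$, $|\{\sigma\in T:\mathrm{length}(\sigma)=n\}|/2^n>\delta$, there is a path through $T$. A $\Pi^{0,X}_2$ set is a double sequence $(B_{i,j})$ of basic open sets ($[\sigma]$ or $\emptyset$) computable from $X$, representing $\bigcap_i\bigcup_jB_{i,j}$; it is strict if whenever $i'\ge i$, for every $j'$ there is $j$ with $B_{i',j'}\subseteq B_{i,j}$; for strict $A$, $\mu(A)\ge r$ means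 $\forall i\,\forall\varepsilon>0\,\exists m\,\mu(\bigcup_{j<m}B_{i,j})>r-\varepsilon$ and $\mu(A)>0$ means $\exists\delta>0\,\forall i\,\exists m\,\mu(\bigcup_{j<m}B_{i,j})>\delta$; general $\Pi^{0,X}_2$ sets $\bigcap_iG_i$ are interpreted via their strict equivalents $\bigcap_i(\bigcap_{i'\le i}G_{i'})$. $\mathsf{2\text{-}POS}$: for every $X$ and every $\Pi^{0,X}_2$ set $A$ with $\mu(A)>0$ there is $Y\in A$. A $\Sigma^{0,X}_2$ set is the complement of a $\Pi^{0,X}_2$ set $A$, and has measure $\le s$ if $\mu(A)\ge1-s$. A $\Sigma^{0,X}_2$-test is a sequence $(A_i)$ of $\Sigma^{0,X}_2$ sets uniformly computable from $X$ with $\mu(A_i)\le2^{-i}$; $Y$ is 2-random relative to $X$ if for every such test there is $i$ with $Y\notin A_i$. $\mathsf{2\text{-}RAN}$: every $X$ has some $Y$ 2-random relative to $X$. *)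

theory Defs
  imports Main
begin

section \<open>Structures for second-order arithmetic\<close>

text \<open>
  Statements "over \<open>RCA\<^sub>0\<close>" are read as statements about all models of \<open>RCA\<^sub>0\<close>. The first-order part
  of a structure is the type \<open>'a\<close> (possibly nonstandard), the second-order part is a collection of
  subsets of it. Apart from the two syntactic schemes of \<open>RCA\<^sub>0\<close> and the collection scheme, every notion
  below is written directly as what the corresponding formula means in the structure: number
  quantifiers range over \<open>'a\<close>, set quantifiers over \<open>l2_sets\<close>, and strings, finite sequences,
  cardinalities, powers and computations are elements of \<open>'a\<close> coding them, never Isabelle objects.
\<close>

record 'a l2_structure =
  l2_zero :: 'a (\<open>\<zero>\<index>\<close>)
  l2_one :: 'a (\<open>\<one>\<index>\<close>)
  l2_add :: "'a \<Rightarrow> 'a \<Rightarrow> 'a" (infixl \<open>\<oplus>\<index>\<close> 65)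
  l2_mult :: "'a \<Rightarrow> 'a \<Rightarrow> 'a" (infixl \<open>\<otimes>\<index>\<close> 70)
  l2_less :: "'a \<Rightarrow> 'a \<Rightarrow> bool" (infix \<open>\<prec>\<index>\<close> 50)
  l2_sets :: "'a set set" (\<open>\<S>\<index>\<close>)

text \<open>
  Bounded-quantifier formulas with number and set parameters. Number variables are de Bruijn indices;
  in \<open>BAll t \<phi>\<close> (for all \<open>x < t\<close>, \<open>\<phi>\<close>) the bound \<open>t\<close> is outside the scope of the quantifier. Disjunction
  and bounded existential quantification are definable.
\<close>

datatype tm = Var nat | TZero | TOne | TAdd tm tm | TMul tm tm

datatype bfm = Eq tm tm | Less tm tm | Mem tm nat | Neg bfm | Conj bfm bfm | BAll tm bfm

context
  fixes M :: "'a l2_structure" (structure)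
begin

abbreviation l2_le :: "'a \<Rightarrow> 'a \<Rightarrow> bool" (infix \<open>\<preceq>\<close> 50) where
  "x \<preceq> y \<equiv> x \<prec> y \<or> x = y"

primrec tm_val :: "(nat \<Rightarrow> 'a) \<Rightarrow> tm \<Rightarrow> 'a" where
  "tm_val e (Var n) = e n"
| "tm_val e TZero = \<zero>"
| "tm_val e TOne = \<one>"
| "tm_val e (TAdd s t) = tm_val e s \<oplus> tm_val e t"
| "tm_val e (TMul s t) = tm_val e s \<otimes> tm_val e t"

primrec sat :: "(nat \<Rightarrow> 'a) \<Rightarrow> (nat \<Rightarrow> 'a set) \<Rightarrow> bfm \<Rightarrow> bool" where
  "sat e E (Eq s t) \<longleftrightarrow> tm_val e s = tm_val e t"
| "sat e E (Less s t) \<longleftrightarrow> tm_val e s \<prec> tm_val e t"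
| "sat e E (Mem t n) \<longleftrightarrow> tm_val e t \<in> E n"
| "sat e E (Neg \<phi>) \<longleftrightarrow> \<not> sat e E \<phi>"
| "sat e E (Conj \<phi> \<psi>) \<longleftrightarrow> sat e E \<phi> \<and> sat e E \<psi>"
| "sat e E (BAll t \<phi>) \<longleftrightarrow> (\<forall>a. a \<prec> tm_val e t \<longrightarrow> sat (case_nat a e) E \<phi>)"


section \<open>The axioms\<close>

definition basic_axioms :: bool where
  "basic_axioms \<longleftrightarrow>
     (\<forall>m. m \<oplus> \<one> \<noteq> \<zero>) \<and>
     (\<forall>m n. m \<oplus> \<one> = n \<oplus> \<one> \<longrightarrow> m = n) \<and>
     (\<forall>m. m \<oplus> \<zero> = m) \<and>
     (\<forall>m n. m \<oplus> (n \<oplus> \<one>) = (m \<oplus> n) \<oplus> \<one>) \<and>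
     (\<forall>m. m \<otimes> \<zero> = \<zero>) \<and>
     (\<forall>m n. m \<otimes> (n \<oplus> \<one>) = (m \<otimes> n) \<oplus> m) \<and>
     (\<forall>m. \<not> m \<prec> \<zero>) \<and>
     (\<forall>m n. m \<prec> n \<oplus> \<one> \<longleftrightarrow> m \<prec> n \<or> m = n)"

definition Sigma1_induction :: bool where
  "Sigma1_induction \<longleftrightarrow>
     (\<forall>\<theta> e E. range E \<subseteq> \<S> \<longrightarrow>
       (let \<phi> = (\<lambda>n. \<exists>w. sat (case_nat w (case_nat n e)) E \<theta>)
        in \<phi> \<zero> \<and> (\<forall>n. \<phi> n \<longrightarrow> \<phi> (n \<oplus> \<one>)) \<longrightarrow> (\<forall>n. \<phi> n)))"

definition Delta1_comprehension :: bool where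
  "Delta1_comprehension \<longleftrightarrow>
     (\<forall>\<theta> \<eta> e E. range E \<subseteq> \<S> \<longrightarrow>
       (let \<phi> = (\<lambda>n. \<exists>w. sat (case_nat w (case_nat n e)) E \<theta>);
            \<psi> = (\<lambda>n. \<forall>w. sat (case_nat w (case_nat n e)) E \<eta>)
        in (\<forall>n. \<phi> n \<longleftrightarrow> \<psi> n) \<longrightarrow> (\<exists>X\<in>\<S>. \<forall>n. n \<in> X \<longleftrightarrow> \<phi> n)))"

definition RCA0 :: bool where
  "RCA0 \<longleftrightarrow> \<S> \<noteq> {} \<and> basic_axioms \<and> Sigma1_induction \<and> Delta1_comprehension"

definition BSigma2 :: bool where
  "BSigma2 \<longleftrightarrow>
     (\<forall>\<theta> e E u. range E \<subseteq> \<S> \<longrightarrow>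
       (let \<phi> = (\<lambda>x y. \<exists>w. \<forall>z. sat (case_nat z (case_nat w (case_nat y (case_nat x e)))) E \<theta>)
        in (\<forall>x. x \<prec> u \<longrightarrow> (\<exists>y. \<phi> x y)) \<longrightarrow>
           (\<exists>v. \<forall>x. x \<prec> u \<longrightarrow> (\<exists>y. y \<prec> v \<and> \<phi> x y))))"


section \<open>Coding of finite objects\<close>

text \<open>
  The coding is the one of Simpson's book: \<open>(i, j) = (i + j)\<^sup>2 + i\<close>; a number \<open>(k, (m, n))\<close> represents the
  finite set of all \<open>i < k\<close> with \<open>m (i + 1) + 1\<close> dividing \<open>n\<close>, and the code of a finite set is the least
  number representing it (numbers that are not such triples may be taken to represent the empty set,
  because 0 already does). A finite sequence is a finite set of pairs (argument, value).
\<close>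

primrec nat_elt :: "nat \<Rightarrow> 'a" where
  "nat_elt 0 = \<zero>"
| "nat_elt (Suc n) = nat_elt n \<oplus> \<one>"

definition pr :: "'a \<Rightarrow> 'a \<Rightarrow> 'a" where
  "pr i j = (i \<oplus> j) \<otimes> (i \<oplus> j) \<oplus> i"

definition fin_mem :: "'a \<Rightarrow> 'a \<Rightarrow> bool" where
  "fin_mem i c \<longleftrightarrow>
     (\<exists>k m n d. c = pr k (pr m n) \<and> i \<prec> k \<and> n = d \<otimes> (m \<otimes> (i \<oplus> \<one>) \<oplus> \<one>))"

definition fin_set :: "'a \<Rightarrow> bool" where
  "fin_set c \<longleftrightarrow> (\<forall>c'. c' \<prec> c \<longrightarrow> (\<exists>i. fin_mem i c' \<noteq> fin_mem i c))"

text \<open>\<open>seq s l\<close>: \<open>s\<close> is (the code of) a finite sequence of length \<open>l\<close>.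
  \<open>entry s i v\<close>: the entry of \<open>s\<close> with index \<open>i\<close> is \<open>v\<close>.\<close>

definition entry :: "'a \<Rightarrow> 'a \<Rightarrow> 'a \<Rightarrow> bool" where
  "entry s i v \<longleftrightarrow> fin_mem (pr i v) s"

definition seq :: "'a \<Rightarrow> 'a \<Rightarrow> bool" where
  "seq s l \<longleftrightarrow>
     fin_set s \<and>
     (\<forall>x. fin_mem x s \<longrightarrow> (\<exists>i v. x = pr i v \<and> i \<prec> l)) \<and>
     (\<forall>i. i \<prec> l \<longrightarrow> (\<exists>!v. entry s i v))"

definition bin_string :: "'a \<Rightarrow> 'a \<Rightarrow> bool" where
  "bin_string \<sigma> l \<longleftrightarrow> seq \<sigma> l \<and> (\<forall>i v. entry \<sigma> i v \<longrightarrow> v = \<zero> \<or> v = \<one>)"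

definition prefix :: "'a \<Rightarrow> 'a \<Rightarrow> bool" where
  "prefix \<sigma> \<tau> \<longleftrightarrow> (\<forall>i v. entry \<sigma> i v \<longrightarrow> entry \<tau> i v)"

text \<open>\<open>P\<close> may be any definable subset of the first-order part, for instance a jump.\<close>

definition init_seg :: "'a \<Rightarrow> 'a set \<Rightarrow> bool" where
  "init_seg \<sigma> P \<longleftrightarrow> (\<exists>l. bin_string \<sigma> l \<and> (\<forall>i. i \<prec> l \<longrightarrow> (entry \<sigma> i \<one> \<longleftrightarrow> i \<in> P)))"

definition card_is :: "'a set \<Rightarrow> 'a \<Rightarrow> bool" where
  "card_is A k \<longleftrightarrow>
     (\<exists>s. seq s k \<and>
          (\<forall>i j x y. i \<prec> j \<and> entry s i x \<and> entry s j y \<longrightarrow> x \<prec> y) \<and>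
          (\<forall>x. x \<in> A \<longleftrightarrow> (\<exists>i. entry s i x)))"

definition pow2 :: "'a \<Rightarrow> 'a \<Rightarrow> bool" where
  "pow2 n N \<longleftrightarrow>
     (\<exists>s. seq s (n \<oplus> \<one>) \<and> entry s \<zero> \<one> \<and> entry s n N \<and>
          (\<forall>i v. i \<prec> n \<and> entry s i v \<longrightarrow> entry s (i \<oplus> \<one>) (v \<oplus> v)))"


section \<open>Computations relative to an oracle\<close>

text \<open>
  \<open>comp_step \<sigma> e x y h\<close>: program \<open>e\<close> yields \<open>y\<close> on input \<open>x\<close>, given the facts \<open>h\<close> (of the form \<open>h e' x' y'\<close>)
  about other computations. The programs are the constants, the identity, the two projections, addition,
  multiplication, the characteristic function of \<open><\<close>, the oracle, pairing, composition and minimization;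
  they generate the partial functions that are recursive in the oracle. Oracle queries at or beyond
  the length of \<open>\<sigma>\<close> are undefined.
\<close>

definition comp_step :: "'a \<Rightarrow> 'a \<Rightarrow> 'a \<Rightarrow> 'a \<Rightarrow> ('a \<Rightarrow> 'a \<Rightarrow> 'a \<Rightarrow> bool) \<Rightarrow> bool" where
  "comp_step \<sigma> e x y h \<longleftrightarrow>
     e = pr (nat_elt 0) y \<or>
     (e = pr (nat_elt 1) \<zero> \<and> y = x) \<or>
     (e = pr (nat_elt 2) \<zero> \<and> (\<exists>b. x = pr y b)) \<or>
     (e = pr (nat_elt 3) \<zero> \<and> (\<exists>a. x = pr a y)) \<or>
     (e = pr (nat_elt 4) \<zero> \<and> (\<exists>a b. x = pr a b \<and> y = a \<oplus> b)) \<or>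
     (e = pr (nat_elt 5) \<zero> \<and> (\<exists>a b. x = pr a b \<and> y = a \<otimes> b)) \<or>
     (e = pr (nat_elt 6) \<zero> \<and> (\<exists>a b. x = pr a b \<and> y = (if a \<prec> b then \<one> else \<zero>))) \<or>
     (e = pr (nat_elt 7) \<zero> \<and> entry \<sigma> x y) \<or>
     (\<exists>f g. e = pr (nat_elt 8) (pr f g) \<and> (\<exists>a b. h f x a \<and> h g x b \<and> y = pr a b)) \<or>
     (\<exists>f g. e = pr (nat_elt 9) (pr f g) \<and> (\<exists>a. h g x a \<and> h f a y)) \<or>
     (\<exists>f. e = pr (nat_elt 10) f \<and> h f (pr x y) \<zero> \<and>
          (\<forall>z. z \<prec> y \<longrightarrow> (\<exists>v. v \<noteq> \<zero> \<and> h f (pr x z) v)))"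

text \<open>
  \<open>phi_str \<sigma> e x y\<close> is \<open>\<phi>\<^sub>e\<^sup>\<sigma>(x) = y\<close>: a finite sequence \<open>d\<close> of triples (program, input, output), each
  justified by earlier ones, contains \<open>(e, x, y)\<close>. There is no bound on \<open>d\<close> in terms of the length of
  \<open>\<sigma>\<close>; only \<open>\<exists>\<sigma> \<subset> P. \<phi>\<^sub>e\<^sup>\<sigma>(x) = y\<close> is used, for which such a bound is immaterial.
\<close>

definition phi_str :: "'a \<Rightarrow> 'a \<Rightarrow> 'a \<Rightarrow> 'a \<Rightarrow> bool" where
  "phi_str \<sigma> e x y \<longleftrightarrow>
     (\<exists>d l. seq d l \<and> (\<exists>k. entry d k (pr e (pr x y))) \<and>
        (\<forall>k t. entry d k t \<longrightarrow>
           (\<exists>e' x' y'. t = pr e' (pr x' y') \<and>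
              comp_step \<sigma> e' x' y' (\<lambda>f a b. \<exists>k'. k' \<prec> k \<and> entry d k' (pr f (pr a b))))))"

definition phi :: "'a set \<Rightarrow> 'a \<Rightarrow> 'a \<Rightarrow> 'a \<Rightarrow> bool" where
  "phi P e x y \<longleftrightarrow> (\<exists>\<sigma>. init_seg \<sigma> P \<and> phi_str \<sigma> e x y)"

text \<open>In general the jump is not in the second-order part; membership in it abbreviates a formula.\<close>

definition jump :: "'a set \<Rightarrow> 'a set" where
  "jump X = {e. \<exists>\<sigma>. init_seg \<sigma> X \<and> (\<exists>y. phi_str \<sigma> e \<zero> y)}"


section \<open>2-WWKL\<close>

definition tree_of :: "'a set \<Rightarrow> 'a \<Rightarrow> 'a set" where
  "tree_of P e = {\<sigma>. phi P e \<sigma> \<one>}"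

definition is_binary_tree :: "'a set \<Rightarrow> bool" where
  "is_binary_tree T \<longleftrightarrow>
     (\<forall>\<tau>\<in>T. \<exists>l. bin_string \<tau> l) \<and>
     (\<forall>\<tau>\<in>T. \<forall>\<sigma> l. bin_string \<sigma> l \<and> prefix \<sigma> \<tau> \<longrightarrow> \<sigma> \<in> T)"

definition binary_tree_index :: "'a set \<Rightarrow> 'a \<Rightarrow> bool" where
  "binary_tree_index P e \<longleftrightarrow>
     (\<forall>x. phi P e x \<zero> \<or> phi P e x \<one>) \<and> is_binary_tree (tree_of P e)"

definition unbounded :: "'a set \<Rightarrow> bool" where
  "unbounded T \<longleftrightarrow> (\<forall>m. \<exists>x\<in>T. m \<prec> x)"

text \<open>The rational \<open>\<delta>\<close> is \<open>p / q\<close>, and \<open>|T \<inter> 2\<^sup>n| / 2\<^sup>n > \<delta>\<close> is cross-multiplied.\<close>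

definition positive_density :: "'a set \<Rightarrow> bool" where
  "positive_density T \<longleftrightarrow>
     (\<exists>p q. \<zero> \<prec> p \<and> \<zero> \<prec> q \<and>
        (\<forall>n. \<exists>k N. card_is {\<sigma> \<in> T. bin_string \<sigma> n} k \<and> pow2 n N \<and> p \<otimes> N \<prec> k \<otimes> q))"

definition path_through :: "'a set \<Rightarrow> 'a set \<Rightarrow> bool" where
  "path_through Y T \<longleftrightarrow> (\<forall>\<sigma>. init_seg \<sigma> Y \<longrightarrow> \<sigma> \<in> T)"

definition two_WWKL :: bool where
  "two_WWKL \<longleftrightarrow>
     (\<forall>X\<in>\<S>. \<forall>e. binary_tree_index (jump X) e \<and> unbounded (tree_of (jump X) e) \<and>
         positive_density (tree_of (jump X) e) \<longrightarrow>
       (\<exists>Y\<in>\<S>. path_through Y (tree_of (jump X) e)))"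


section \<open>\<open>\<Pi>\<^sub>2\<close> sets and their measure\<close>

definition cyl :: "'a \<Rightarrow> 'a set set" where
  "cyl \<sigma> = {Y \<in> \<S>. init_seg \<sigma> Y}"

text \<open>
  The output of a program on \<open>x\<close> names a basic open set: \<open>0\<close> names \<open>\<emptyset>\<close> and \<open>\<sigma> + 1\<close> names \<open>[\<sigma>]\<close>.
  The shift is needed because the empty string is coded by 0.
\<close>

definition names_basic_open :: "'a set \<Rightarrow> 'a \<Rightarrow> 'a \<Rightarrow> bool" where
  "names_basic_open X e x \<longleftrightarrow>
     phi X e x \<zero> \<or> (\<exists>\<sigma> l. bin_string \<sigma> l \<and> phi X e x (\<sigma> \<oplus> \<one>))"

definition basic_open :: "'a set \<Rightarrow> 'a \<Rightarrow> 'a \<Rightarrow> 'a set set" where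
  "basic_open X e x = (\<Union>\<sigma>\<in>{\<sigma>. \<exists>l. bin_string \<sigma> l \<and> phi X e x (\<sigma> \<oplus> \<one>)}. cyl \<sigma>)"

definition pi2_set :: "('a \<Rightarrow> 'a \<Rightarrow> 'a set set) \<Rightarrow> 'a set set" where
  "pi2_set B = (\<Inter>i. \<Union>j. B i j)"

definition strict :: "('a \<Rightarrow> 'a \<Rightarrow> 'a set set) \<Rightarrow> bool" where
  "strict B \<longleftrightarrow> (\<forall>i i'. i \<preceq> i' \<longrightarrow> (\<forall>j'. \<exists>j. B i' j' \<subseteq> B i j))"

text \<open>
  \<open>\<Inter>i'\<le>i. \<Union>j. B i' j\<close> as a union of basic open sets, indexed by the sequences \<open>s\<close> of length \<open>i + 1\<close>:
  the set with index \<open>s\<close> is the intersection of all \<open>B i' (s i')\<close> with \<open>i' \<le> i\<close>, which is again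
  \<open>\<emptyset>\<close> or of the form \<open>[\<sigma>]\<close>.
\<close>

definition strict_equiv :: "('a \<Rightarrow> 'a \<Rightarrow> 'a set set) \<Rightarrow> 'a \<Rightarrow> 'a \<Rightarrow> 'a set set" where
  "strict_equiv B i s =
     (if seq s (i \<oplus> \<one>) then {Y \<in> \<S>. \<forall>i' j. i' \<preceq> i \<and> entry s i' j \<longrightarrow> Y \<in> B i' j} else {})"

definition strict_form :: "('a \<Rightarrow> 'a \<Rightarrow> 'a set set) \<Rightarrow> 'a \<Rightarrow> 'a \<Rightarrow> 'a set set" where
  "strict_form B = (if strict B then B else strict_equiv B)"

text \<open>
  \<open>mu_is U c N\<close>: \<open>U\<close> is clopen with \<open>\<mu>(U) = c / N\<close>, where \<open>N = 2\<^sup>n\<close> and \<open>U\<close> is the union of \<open>c\<close> many of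
  the cylinders \<open>[\<tau>]\<close> with \<open>\<tau>\<close> of length \<open>n\<close>, each of which has measure \<open>2\<^sup>-\<^sup>n\<close>.
\<close>

definition mu_is :: "'a set set \<Rightarrow> 'a \<Rightarrow> 'a \<Rightarrow> bool" where
  "mu_is U c N \<longleftrightarrow>
     (\<exists>n. pow2 n N \<and>
        (\<forall>\<tau>. bin_string \<tau> n \<longrightarrow> cyl \<tau> \<subseteq> U \<or> cyl \<tau> \<inter> U = {}) \<and>
        card_is {\<tau>. bin_string \<tau> n \<and> cyl \<tau> \<subseteq> U} c)"

text \<open>
  \<open>mu_ge B a b\<close> is \<open>\<mu> \<ge> a / b\<close> for the \<open>\<Pi>\<^sub>2\<close> set given by \<open>B\<close>. With \<open>\<epsilon> = p / q\<close> the condition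
  \<open>c / N > a / b - p / q\<close> is written without subtraction as \<open>a q N < c b q + p b N\<close>.
\<close>

definition strict_mu_ge :: "('a \<Rightarrow> 'a \<Rightarrow> 'a set set) \<Rightarrow> 'a \<Rightarrow> 'a \<Rightarrow> bool" where
  "strict_mu_ge B a b \<longleftrightarrow>
     (\<forall>i p q. \<zero> \<prec> p \<and> \<zero> \<prec> q \<longrightarrow>
        (\<exists>m c N. mu_is (\<Union>j\<in>{j. j \<prec> m}. B i j) c N \<and>
           a \<otimes> q \<otimes> N \<prec> c \<otimes> b \<otimes> q \<oplus> p \<otimes> b \<otimes> N))"

definition strict_mu_pos :: "('a \<Rightarrow> 'a \<Rightarrow> 'a set set) \<Rightarrow> bool" where
  "strict_mu_pos B \<longleftrightarrow>
     (\<exists>p q. \<zero> \<prec> p \<and> \<zero> \<prec> q \<and>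
        (\<forall>i. \<exists>m c N. mu_is (\<Union>j\<in>{j. j \<prec> m}. B i j) c N \<and> p \<otimes> N \<prec> c \<otimes> q))"

definition mu_ge :: "('a \<Rightarrow> 'a \<Rightarrow> 'a set set) \<Rightarrow> 'a \<Rightarrow> 'a \<Rightarrow> bool" where
  "mu_ge B a b \<longleftrightarrow> strict_mu_ge (strict_form B) a b"

definition mu_pos :: "('a \<Rightarrow> 'a \<Rightarrow> 'a set set) \<Rightarrow> bool" where
  "mu_pos B \<longleftrightarrow> strict_mu_pos (strict_form B)"


section \<open>2-POS and 2-RAN\<close>

definition pi2_index :: "'a set \<Rightarrow> 'a \<Rightarrow> bool" where
  "pi2_index X e \<longleftrightarrow> (\<forall>i j. names_basic_open X e (pr i j))"

definition pi2_seq :: "'a set \<Rightarrow> 'a \<Rightarrow> 'a \<Rightarrow> 'a \<Rightarrow> 'a set set" where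
  "pi2_seq X e i j = basic_open X e (pr i j)"

definition two_POS :: bool where
  "two_POS \<longleftrightarrow>
     (\<forall>X\<in>\<S>. \<forall>e. pi2_index X e \<and> mu_pos (pi2_seq X e) \<longrightarrow> (\<exists>Y\<in>\<S>. Y \<in> pi2_set (pi2_seq X e)))"

definition sigma2_set :: "('a \<Rightarrow> 'a \<Rightarrow> 'a set set) \<Rightarrow> 'a set set" where
  "sigma2_set B = \<S> - pi2_set B"

text \<open>Measure at most \<open>c / d\<close>, for \<open>c \<le> d\<close>: the complement has measure at least \<open>1 - c / d\<close>.\<close>

definition sigma2_mu_le :: "('a \<Rightarrow> 'a \<Rightarrow> 'a set set) \<Rightarrow> 'a \<Rightarrow> 'a \<Rightarrow> bool" where
  "sigma2_mu_le B c d \<longleftrightarrow> (\<exists>a. a \<oplus> c = d \<and> mu_ge B a d)"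

definition test_seq :: "'a set \<Rightarrow> 'a \<Rightarrow> 'a \<Rightarrow> 'a \<Rightarrow> 'a \<Rightarrow> 'a set set" where
  "test_seq X e n i j = basic_open X e (pr n (pr i j))"

definition sigma2_test :: "'a set \<Rightarrow> 'a \<Rightarrow> bool" where
  "sigma2_test X e \<longleftrightarrow>
     (\<forall>n i j. names_basic_open X e (pr n (pr i j))) \<and>
     (\<forall>n. \<exists>N. pow2 n N \<and> sigma2_mu_le (test_seq X e n) \<one> N)"

definition two_random :: "'a set \<Rightarrow> 'a set \<Rightarrow> bool" where
  "two_random X Y \<longleftrightarrow> (\<forall>e. sigma2_test X e \<longrightarrow> (\<exists>n. Y \<notin> sigma2_set (test_seq X e n)))"

definition two_RAN :: bool where
  "two_RAN \<longleftrightarrow> (\<forall>X\<in>\<S>. \<exists>Y\<in>\<S>. two_random X Y)"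

end

end

theory Submission
  imports Defs
begin

text \<open>
  After passing to an isomorphic model, its first-order part is a type, namely a discretely ordered
  semiring. The sets of the model are closed under primitive recursion, so that approximations can be
  handled as functions in the model instead of formulas.

  2-POS implies \<open>B\<Sigma>\<^sub>2\<close>, because a failing instance yields a \<open>\<Pi>\<^sub>2\<close> set of positive measure without a
  point, and 2-RAN, because the complement of a universal test is a \<open>\<Pi>\<^sub>2\<close> set of positive measure.
  Conversely, let \<open>A\<close> be a \<open>\<Pi>\<^sub>2\<close> set of measure at least \<open>1 / q\<close>. Columns of a set are independent, so a
  2-random \<open>Y\<close> has, for some \<open>n\<close> and every \<open>i\<close>, one of its first \<open>q n\<close> columns in the \<open>i\<close>-th open set; if
  none of these columns were in \<open>A\<close>, then by \<open>B\<Sigma>\<^sub>2\<close> some \<open>i\<close> would exclude all of them at once.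

  The paths through a tree computable from \<open>X'\<close> form a \<open>\<Pi>\<^sub>2\<close> set, so 2-POS implies 2-WWKL. For the
  converse, let \<open>m\<^sub>i\<close> be a stage at which most of the \<open>i\<close>-th open set has been enumerated. Each \<open>m\<^sub>i\<close> is
  the limit of an approximation that changes boundedly often, so the strings that are compatible with
  all these finite unions form a tree of positive measure computable from a jump.
\<close>

section \<open>From arbitrary models to a type class of ordered semirings\<close>

section \<open>Isomorphism invariance\<close>

text \<open>The obstacle is that only \<open>\<Sigma>\<^sub>1\<close> induction is at hand: there is
  no collection for limits, and the jump is not a set of the model. A monotone function with a bound
  in the model reaches its maximum (\<open>mono_stabilizes\<close>). Hence initial segments of the
  jump are coded strings, and computations from the jump can be followed inside the model. Separate
  convergence of the stages \<open>m\<^sub>i\<close> for i \<le> n would not give a common stage. So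
  \<open>m\<^sub>i\<close> moves only when measure p / (q 2^(i+2)) has appeared, which bounds the
  total number of moves for i \<le> n in advance. The weights 2^-(i+2) sum to less than 1/2; thus at
  least half of the measure survives both in the tree and in the intersection that defeats all
  tests. Since the oracle of each principle is arbitrary, a function of the model is handed to a
  program as its oracle. Measures are compared only through cross-multiplied counts of strings of a
  given length.\<close>

definition iso_l2 :: "('a \<Rightarrow> 'b \<Rightarrow> bool) \<Rightarrow> 'a l2_structure \<Rightarrow> 'b l2_structure \<Rightarrow> bool" where
  "iso_l2 R M N \<longleftrightarrow>
     R (l2_zero M) (l2_zero N) \<and> R (l2_one M) (l2_one N) \<and>
     rel_fun R (rel_fun R R) (l2_add M) (l2_add N) \<and>
     rel_fun R (rel_fun R R) (l2_mult M) (l2_mult N) \<and>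
     rel_fun R (rel_fun R (=)) (l2_less M) (l2_less N) \<and>
     rel_set (rel_set R) (l2_sets M) (l2_sets N)"

context
  includes lifting_syntax
  fixes R :: "'a \<Rightarrow> 'b \<Rightarrow> bool"
  assumes R [transfer_rule]: "bi_unique R" "bi_total R"
begin

text \<open>Once the field selectors are related, \<open>transfer_prover\<close> handles the
  explicit definitions, and only recursive functions need an induction. As R is the graph of a
  bijection, equality, quantifiers and set membership transfer.\<close>

lemma l2_field_transfer [transfer_rule]:
  "(iso_l2 R ===> R) l2_zero l2_zero"
  "(iso_l2 R ===> R) l2_one l2_one"
  "(iso_l2 R ===> R ===> R ===> R) l2_add l2_add"
  "(iso_l2 R ===> R ===> R ===> R) l2_mult l2_mult"
  "(iso_l2 R ===> R ===> R ===> (=)) l2_less l2_less"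
  "(iso_l2 R ===> rel_set (rel_set R)) l2_sets l2_sets"
  by (auto simp: iso_l2_def rel_fun_def)

lemma case_nat_rel [transfer_rule]:
  "(R ===> ((=) ===> R) ===> (=) ===> R) case_nat case_nat"
  by (auto simp: rel_fun_def split: nat.splits)

lemma tm_val_transfer [transfer_rule]:
  "(iso_l2 R ===> ((=) ===> R) ===> (=) ===> R) tm_val tm_val"
proof (intro rel_funI, clarify)
  fix M N t and e :: "nat \<Rightarrow> 'a" and e' assume M: "iso_l2 R M N" and e: "((=) ===> R) e e'"
  show "R (tm_val M e t) (tm_val N e' t)"
    using M e by (induction t) (auto simp: iso_l2_def rel_fun_def)
qed

lemma sat_transfer [transfer_rule]:
  "(iso_l2 R ===> ((=) ===> R) ===> ((=) ===> rel_set R) ===> (=) ===> (=)) sat sat"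
proof (intro rel_funI, clarify)
  fix M N f and e :: "nat \<Rightarrow> 'a" and e' and E :: "nat \<Rightarrow> 'a set" and E'
  assume M [transfer_rule]: "iso_l2 R M N" and e: "((=) ===> R) e e'"
    and E: "((=) ===> rel_set R) E E'"
  show "sat M e E f = sat N e' E' f"
    using e
  proof (induction f arbitrary: e e')
    case (Eq s t)
    note [transfer_rule] = Eq
    show ?case unfolding sat.simps by transfer_prover
  next
    case (Less s t)
    note [transfer_rule] = Less
    show ?case unfolding sat.simps by transfer_prover
  next
    case (Mem t n)
    note [transfer_rule] = Mem E
    show ?case unfolding sat.simps by transfer_prover
  next
    case (BAll t f)
    note [transfer_rule] = BAll.prems
    \<comment> \<open>The bodies are hidden behind names: that they are related follows from the
      induction hypothesis at the extended assignments, not from a transfer rule.\<close>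
    define P Q where "P = (\<lambda>a. sat M (case_nat a e) E f)" and "Q = (\<lambda>a. sat N (case_nat a e') E' f)"
    have [transfer_rule]: "(R ===> (=)) P Q"
      unfolding P_def Q_def
    proof (rule rel_funI)
      fix a a' assume [transfer_rule]: "R a a'"
      have "((=) ===> R) (case_nat a e) (case_nat a' e')" by transfer_prover
      then show "sat M (case_nat a e) E f = sat N (case_nat a' e') E' f" by (rule BAll.IH)
    qed
    have "(\<forall>a. a \<prec>\<^bsub>M\<^esub> tm_val M e t \<longrightarrow> P a) = (\<forall>a. a \<prec>\<^bsub>N\<^esub> tm_val N e' t \<longrightarrow> Q a)"
      by transfer_prover
    then show ?case by (simp add: P_def Q_def)
  qed auto
qed

lemma basic_axioms_transfer [transfer_rule]: "(iso_l2 R ===> (=)) basic_axioms basic_axioms"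
  unfolding basic_axioms_def[abs_def] by transfer_prover

lemma Sigma1_induction_transfer [transfer_rule]: "(iso_l2 R ===> (=)) Sigma1_induction Sigma1_induction"
  unfolding Sigma1_induction_def[abs_def] by transfer_prover

lemma Delta1_comprehension_transfer [transfer_rule]:
  "(iso_l2 R ===> (=)) Delta1_comprehension Delta1_comprehension"
  unfolding Delta1_comprehension_def[abs_def] by transfer_prover

lemma RCA0_transfer [transfer_rule]: "(iso_l2 R ===> (=)) RCA0 RCA0"
  unfolding RCA0_def[abs_def] by transfer_prover

lemma BSigma2_transfer [transfer_rule]: "(iso_l2 R ===> (=)) BSigma2 BSigma2"
  unfolding BSigma2_def[abs_def] by transfer_prover

lemma nat_elt_transfer [transfer_rule]: "(iso_l2 R ===> (=) ===> R) nat_elt nat_elt"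
proof (intro rel_funI, clarify)
  fix M N n assume M: "iso_l2 R M N"
  show "R (nat_elt M n) (nat_elt N n)"
    using M by (induction n) (auto simp: iso_l2_def rel_fun_def)
qed

lemma pr_transfer [transfer_rule]: "(iso_l2 R ===> R ===> R ===> R) pr pr"
  unfolding pr_def[abs_def] by transfer_prover

lemma fin_mem_transfer [transfer_rule]: "(iso_l2 R ===> R ===> R ===> (=)) fin_mem fin_mem"
  unfolding fin_mem_def[abs_def] by transfer_prover

lemma fin_set_transfer [transfer_rule]: "(iso_l2 R ===> R ===> (=)) fin_set fin_set"
  unfolding fin_set_def[abs_def] by transfer_prover

lemma entry_transfer [transfer_rule]: "(iso_l2 R ===> R ===> R ===> R ===> (=)) entry entry"
  unfolding entry_def[abs_def] by transfer_prover

lemma seq_transfer [transfer_rule]: "(iso_l2 R ===> R ===> R ===> (=)) seq seq"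
  unfolding seq_def[abs_def] Ex1_def by transfer_prover

lemma bin_string_transfer [transfer_rule]: "(iso_l2 R ===> R ===> R ===> (=)) bin_string bin_string"
  unfolding bin_string_def[abs_def] by transfer_prover

lemma prefix_transfer [transfer_rule]: "(iso_l2 R ===> R ===> R ===> (=)) prefix prefix"
  unfolding prefix_def[abs_def] by transfer_prover

lemma init_seg_transfer [transfer_rule]: "(iso_l2 R ===> R ===> rel_set R ===> (=)) init_seg init_seg"
  unfolding init_seg_def[abs_def] by transfer_prover

lemma card_is_transfer [transfer_rule]: "(iso_l2 R ===> rel_set R ===> R ===> (=)) card_is card_is"
  unfolding card_is_def[abs_def] by transfer_prover

lemma pow2_transfer [transfer_rule]: "(iso_l2 R ===> R ===> R ===> (=)) pow2 pow2"
  unfolding pow2_def[abs_def] by transfer_prover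

lemma comp_step_transfer [transfer_rule]:
  "(iso_l2 R ===> R ===> R ===> R ===> R ===> (R ===> R ===> R ===> (=)) ===> (=)) comp_step comp_step"
  unfolding comp_step_def[abs_def] by transfer_prover

lemma phi_str_transfer [transfer_rule]: "(iso_l2 R ===> R ===> R ===> R ===> R ===> (=)) phi_str phi_str"
  unfolding phi_str_def[abs_def] by transfer_prover

lemma phi_transfer [transfer_rule]: "(iso_l2 R ===> rel_set R ===> R ===> R ===> R ===> (=)) phi phi"
  unfolding phi_def[abs_def] by transfer_prover

lemma jump_transfer [transfer_rule]: "(iso_l2 R ===> rel_set R ===> rel_set R) jump jump"
  unfolding jump_def[abs_def] by transfer_prover

lemma tree_of_transfer [transfer_rule]: "(iso_l2 R ===> rel_set R ===> R ===> rel_set R) tree_of tree_of"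
  unfolding tree_of_def[abs_def] by transfer_prover

lemma is_binary_tree_transfer [transfer_rule]: "(iso_l2 R ===> rel_set R ===> (=)) is_binary_tree is_binary_tree"
  unfolding is_binary_tree_def[abs_def] by transfer_prover

lemma binary_tree_index_transfer [transfer_rule]:
  "(iso_l2 R ===> rel_set R ===> R ===> (=)) binary_tree_index binary_tree_index"
  unfolding binary_tree_index_def[abs_def] by transfer_prover

lemma unbounded_transfer [transfer_rule]: "(iso_l2 R ===> rel_set R ===> (=)) unbounded unbounded"
  unfolding unbounded_def[abs_def] by transfer_prover

lemma positive_density_transfer [transfer_rule]:
  "(iso_l2 R ===> rel_set R ===> (=)) positive_density positive_density"
  unfolding positive_density_def[abs_def] by transfer_prover

lemma path_through_transfer [transfer_rule]:
  "(iso_l2 R ===> rel_set R ===> rel_set R ===> (=)) path_through path_through"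
  unfolding path_through_def[abs_def] by transfer_prover

lemma two_WWKL_transfer [transfer_rule]: "(iso_l2 R ===> (=)) two_WWKL two_WWKL"
  unfolding two_WWKL_def[abs_def] by transfer_prover

lemma cyl_transfer [transfer_rule]: "(iso_l2 R ===> R ===> rel_set (rel_set R)) cyl cyl"
  unfolding cyl_def[abs_def] by transfer_prover

lemma names_basic_open_transfer [transfer_rule]:
  "(iso_l2 R ===> rel_set R ===> R ===> R ===> (=)) names_basic_open names_basic_open"
  unfolding names_basic_open_def[abs_def] by transfer_prover

lemma basic_open_transfer [transfer_rule]:
  "(iso_l2 R ===> rel_set R ===> R ===> R ===> rel_set (rel_set R)) basic_open basic_open"
  unfolding basic_open_def[abs_def] by transfer_prover

lemma pi2_set_transfer [transfer_rule]:
  "((R ===> R ===> rel_set (rel_set R)) ===> rel_set (rel_set R)) pi2_set pi2_set"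
  unfolding pi2_set_def[abs_def] by transfer_prover

lemma strict_transfer [transfer_rule]:
  "(iso_l2 R ===> (R ===> R ===> rel_set (rel_set R)) ===> (=)) strict strict"
  unfolding strict_def[abs_def] by transfer_prover

lemma strict_equiv_transfer [transfer_rule]:
  "(iso_l2 R ===> (R ===> R ===> rel_set (rel_set R)) ===> R ===> R ===> rel_set (rel_set R)) strict_equiv strict_equiv"
  unfolding strict_equiv_def[abs_def] by transfer_prover

lemma strict_form_transfer [transfer_rule]:
  "(iso_l2 R ===> (R ===> R ===> rel_set (rel_set R)) ===> R ===> R ===> rel_set (rel_set R)) strict_form strict_form"
  unfolding strict_form_def[abs_def] by transfer_prover

lemma mu_is_transfer [transfer_rule]:
  "(iso_l2 R ===> rel_set (rel_set R) ===> R ===> R ===> (=)) mu_is mu_is"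
  unfolding mu_is_def[abs_def] by transfer_prover

lemma strict_mu_ge_transfer [transfer_rule]:
  "(iso_l2 R ===> (R ===> R ===> rel_set (rel_set R)) ===> R ===> R ===> (=)) strict_mu_ge strict_mu_ge"
  unfolding strict_mu_ge_def[abs_def] by transfer_prover

lemma strict_mu_pos_transfer [transfer_rule]:
  "(iso_l2 R ===> (R ===> R ===> rel_set (rel_set R)) ===> (=)) strict_mu_pos strict_mu_pos"
  unfolding strict_mu_pos_def[abs_def] by transfer_prover

lemma mu_ge_transfer [transfer_rule]:
  "(iso_l2 R ===> (R ===> R ===> rel_set (rel_set R)) ===> R ===> R ===> (=)) mu_ge mu_ge"
  unfolding mu_ge_def[abs_def] by transfer_prover

lemma mu_pos_transfer [transfer_rule]:
  "(iso_l2 R ===> (R ===> R ===> rel_set (rel_set R)) ===> (=)) mu_pos mu_pos"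
  unfolding mu_pos_def[abs_def] by transfer_prover

lemma pi2_index_transfer [transfer_rule]: "(iso_l2 R ===> rel_set R ===> R ===> (=)) pi2_index pi2_index"
  unfolding pi2_index_def[abs_def] by transfer_prover

lemma pi2_seq_transfer [transfer_rule]:
  "(iso_l2 R ===> rel_set R ===> R ===> R ===> R ===> rel_set (rel_set R)) pi2_seq pi2_seq"
  unfolding pi2_seq_def[abs_def] by transfer_prover

lemma two_POS_transfer [transfer_rule]: "(iso_l2 R ===> (=)) two_POS two_POS"
  unfolding two_POS_def[abs_def] by transfer_prover

lemma sigma2_set_transfer [transfer_rule]:
  "(iso_l2 R ===> (R ===> R ===> rel_set (rel_set R)) ===> rel_set (rel_set R)) sigma2_set sigma2_set"
  unfolding sigma2_set_def[abs_def] by transfer_prover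

lemma sigma2_mu_le_transfer [transfer_rule]:
  "(iso_l2 R ===> (R ===> R ===> rel_set (rel_set R)) ===> R ===> R ===> (=)) sigma2_mu_le sigma2_mu_le"
  unfolding sigma2_mu_le_def[abs_def] by transfer_prover

lemma test_seq_transfer [transfer_rule]:
  "(iso_l2 R ===> rel_set R ===> R ===> R ===> R ===> R ===> rel_set (rel_set R)) test_seq test_seq"
  unfolding test_seq_def[abs_def] by transfer_prover

lemma sigma2_test_transfer [transfer_rule]: "(iso_l2 R ===> rel_set R ===> R ===> (=)) sigma2_test sigma2_test"
  unfolding sigma2_test_def[abs_def] by transfer_prover

lemma two_random_transfer [transfer_rule]: "(iso_l2 R ===> rel_set R ===> rel_set R ===> (=)) two_random two_random"
  unfolding two_random_def[abs_def] by transfer_prover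

lemma two_RAN_transfer [transfer_rule]: "(iso_l2 R ===> (=)) two_RAN two_RAN"
  unfolding two_RAN_def[abs_def] by transfer_prover

end


section \<open>Arithmetic from the axioms\<close>

locale rca0_model =
  fixes M :: "'a l2_structure" (structure)
  assumes rca0: "RCA0 M"
begin

lemma ax:
  "m \<oplus> \<one> \<noteq> \<zero>" "m \<oplus> \<one> = n \<oplus> \<one> \<longleftrightarrow> m = n" "m \<oplus> \<zero> = m"
  "m \<oplus> (n \<oplus> \<one>) = (m \<oplus> n) \<oplus> \<one>" "m \<otimes> \<zero> = \<zero>" "m \<otimes> (n \<oplus> \<one>) = (m \<otimes> n) \<oplus> m"
  "\<not> m \<prec> \<zero>" "m \<prec> n \<oplus> \<one> \<longleftrightarrow> m \<prec> n \<or> m = n"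
  using rca0 unfolding RCA0_def basic_axioms_def by blast+

text \<open>Variable 0 is the existential witness and variable 1 the induction variable; parameters
  start at variable 2. The formulas below have no set variables, so any set of the model may fill
  their places.\<close>

lemma sigma_induct:
  assumes "\<exists>w. sat M (case_nat w (case_nat \<zero> e)) (\<lambda>_. SOME X. X \<in> \<S>) \<theta>"
    and "\<And>n. \<exists>w. sat M (case_nat w (case_nat n e)) (\<lambda>_. SOME X. X \<in> \<S>) \<theta>
      \<Longrightarrow> \<exists>w. sat M (case_nat w (case_nat (n \<oplus> \<one>) e)) (\<lambda>_. SOME X. X \<in> \<S>) \<theta>"
  shows "\<exists>w. sat M (case_nat w (case_nat n e)) (\<lambda>_. SOME X. X \<in> \<S>) \<theta>"
proof -
  have "range (\<lambda>_::nat. SOME X. X \<in> \<S>) \<subseteq> \<S>"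
    using rca0 by (auto simp: RCA0_def intro: someI_ex)
  moreover have "Sigma1_induction M" using rca0 by (simp add: RCA0_def)
  ultimately show ?thesis using assms unfolding Sigma1_induction_def Let_def by blast
qed

abbreviation "v1 \<equiv> Var (Suc 0)"
abbreviation "v2 \<equiv> Var (Suc (Suc 0))"
abbreviation "v3 \<equiv> Var (Suc (Suc (Suc 0)))"

lemma zero_add: "\<zero> \<oplus> n = n"
  using sigma_induct[of "\<lambda>_. \<zero>" "Eq (TAdd TZero v1) v1" n] by (simp add: ax)

lemma one_add: "(m \<oplus> \<one>) \<oplus> n = (m \<oplus> n) \<oplus> \<one>"
  using sigma_induct[of "\<lambda>_. m" "Eq (TAdd (TAdd v2 TOne) v1) (TAdd (TAdd v2 v1) TOne)" n]
  by (simp add: ax)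

lemma add_comm: "m \<oplus> n = n \<oplus> m"
  using sigma_induct[of "\<lambda>_. m" "Eq (TAdd v2 v1) (TAdd v1 v2)" n]
  by (simp add: ax zero_add one_add)

lemma add_ass: "(m \<oplus> n) \<oplus> k = m \<oplus> (n \<oplus> k)"
  using sigma_induct[of "case_nat m (\<lambda>_. n)" "Eq (TAdd (TAdd v2 v3) v1) (TAdd v2 (TAdd v3 v1))" k]
  by (simp add: ax)

lemma add_cancel: "m \<oplus> k = n \<oplus> k \<Longrightarrow> m = n"
  using sigma_induct[of "case_nat m (\<lambda>_. n)" "Neg (Conj (Eq (TAdd v2 v1) (TAdd v3 v1)) (Neg (Eq v2 v3)))" k]
  by (simp add: ax)

lemma add_lcomm: "m \<oplus> (n \<oplus> k) = n \<oplus> (m \<oplus> k)"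
  by (metis add_comm add_ass)

lemma zero_mult: "\<zero> \<otimes> n = \<zero>"
  using sigma_induct[of "\<lambda>_. \<zero>" "Eq (TMul TZero v1) TZero" n] by (simp add: ax)

lemma distr: "(m \<oplus> n) \<otimes> k = m \<otimes> k \<oplus> n \<otimes> k"
  using sigma_induct[of "case_nat m (\<lambda>_. n)" "Eq (TMul (TAdd v2 v3) v1) (TAdd (TMul v2 v1) (TMul v3 v1))" k]
  by (simp add: ax(3,5,6) add_ass add_lcomm)

lemma one_mult: "\<one> \<otimes> n = n"
  using sigma_induct[of "\<lambda>_. \<zero>" "Eq (TMul TOne v1) v1" n] by (simp add: ax)

lemma mult_comm: "m \<otimes> n = n \<otimes> m"
  using sigma_induct[of "\<lambda>_. m" "Eq (TMul v2 v1) (TMul v1 v2)" n]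
  by (simp add: ax(5,6) zero_mult one_mult distr)

lemma mult_ass: "(m \<otimes> n) \<otimes> k = m \<otimes> (n \<otimes> k)"
  using sigma_induct[of "case_nat m (\<lambda>_. n)" "Eq (TMul (TMul v2 v3) v1) (TMul v2 (TMul v3 v1))" k]
  by (simp add: ax(5,6) distr mult_comm[of m])

text \<open>Variable 0 carries the predecessor, so the induction formula is properly
  existential.\<close>

lemma zero_or_succ: "n = \<zero> \<or> (\<exists>w. n = w \<oplus> \<one>)"
  using sigma_induct[of "\<lambda>_. \<zero>" "Neg (Conj (Neg (Eq v1 TZero)) (Neg (Eq v1 (TAdd (Var 0) TOne))))" n]
  by (auto simp: ax)

lemma less_add: "m \<prec> m \<oplus> (d \<oplus> \<one>)"
  using sigma_induct[of "\<lambda>_. m" "Less v2 (TAdd v2 (TAdd v1 TOne))" d]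
  by (simp add: ax zero_add)

text \<open>The axioms relate < only to the successor. Induction on n produces the difference as a
  witness, and the order laws then follow algebraically.\<close>

lemma less_iff: "m \<prec> n \<longleftrightarrow> (\<exists>d. n = m \<oplus> (d \<oplus> \<one>))"
proof
  assume "m \<prec> n"
  moreover have "\<exists>w. \<not> (m \<prec> n \<and> n \<noteq> m \<oplus> (w \<oplus> \<one>))"
    using sigma_induct[of "\<lambda>_. m" "Neg (Conj (Less v2 v1) (Neg (Eq v1 (TAdd v2 (TAdd (Var 0) TOne)))))" n]
    by (simp add: ax) (metis ax(3,4))
  ultimately show "\<exists>d. n = m \<oplus> (d \<oplus> \<one>)" by blast
qed (use less_add in blast)

lemma le_iff: "m \<prec> n \<or> m = n \<longleftrightarrow> (\<exists>d. n = m \<oplus> d)"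
  by (metis less_iff zero_or_succ ax(3))

lemma sum_zero: "a \<oplus> b = \<zero> \<Longrightarrow> b = \<zero>"
  by (metis ax(1,4) zero_or_succ)

lemma less_irrefl: "\<not> m \<prec> m"
  by (metis add_cancel add_comm ax(1,3) less_iff)

lemma le_linear: "(m \<prec> n \<or> m = n) \<or> (n \<prec> m \<or> n = m)"
proof -
  have "\<exists>w. n = m \<oplus> w \<or> m = n \<oplus> w"
  proof -
    have "\<exists>w. \<not> (n \<noteq> m \<oplus> w \<and> m \<noteq> n \<oplus> w)"
    proof -
      have *: "\<exists>w. \<not> ((n \<oplus> \<one>) \<noteq> m \<oplus> w \<and> m \<noteq> (n \<oplus> \<one>) \<oplus> w)"
        if "\<exists>w. \<not> (n \<noteq> m \<oplus> w \<and> m \<noteq> n \<oplus> w)" for n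
        using that by (metis add_ass add_comm ax(3) zero_or_succ)
      show ?thesis
        using sigma_induct[of "\<lambda>_. m" "Neg (Conj (Neg (Eq v1 (TAdd v2 (Var 0)))) (Neg (Eq v2 (TAdd v1 (Var 0)))))" n] *
        by (simp add: zero_add) blast
    qed
    then show ?thesis by blast
  qed
  then show ?thesis by (metis le_iff)
qed

lemma le_antisym: "m \<prec> n \<or> m = n \<Longrightarrow> n \<prec> m \<or> n = m \<Longrightarrow> m = n"
  by (metis add_ass add_cancel add_comm ax(3) le_iff sum_zero)

lemma le_trans: "m \<prec> n \<or> m = n \<Longrightarrow> n \<prec> k \<or> n = k \<Longrightarrow> m \<prec> k \<or> m = k"
  by (metis add_ass le_iff)

lemma mult_less: "a \<prec> b \<Longrightarrow> \<zero> \<prec> c \<Longrightarrow> c \<otimes> a \<prec> c \<otimes> b"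
proof -
  assume "a \<prec> b" "\<zero> \<prec> c"
  then obtain d e where "b = a \<oplus> (d \<oplus> \<one>)" "c = e \<oplus> \<one>"
    by (auto simp: less_iff zero_add)
  then have "c \<otimes> b = c \<otimes> a \<oplus> ((c \<otimes> d \<oplus> e) \<oplus> \<one>)"

    by (simp add: mult_comm[of _ a] mult_comm[of _ d] mult_comm[of c] distr one_mult add_ass)
      (metis add_ass add_lcomm distr mult_comm one_mult)
  then show ?thesis using less_add by metis
qed

end


section \<open>Ordered semirings with a second-order part\<close>

class rca = linordered_semidom +
  fixes SS :: "'a set set"
  assumes rca_RCA0: "RCA0 \<lparr>l2_zero = 0, l2_one = 1, l2_add = (+), l2_mult = (*), l2_less = (<), l2_sets = SS\<rparr>"

definition MM :: "'a::rca l2_structure" where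
  "MM = \<lparr>l2_zero = 0, l2_one = 1, l2_add = (+), l2_mult = (*), l2_less = (<), l2_sets = SS\<rparr>"

lemma MM_simps [simp]:
  "l2_zero MM = 0" "l2_one MM = 1" "l2_add MM = (+)" "l2_mult MM = (*)" "l2_less MM = (<)"
  "l2_sets MM = SS"
  by (simp_all add: MM_def)

lemma RCA0_MM: "RCA0 MM"
  using rca_RCA0 by (simp add: MM_def)

definition reversal :: "'a l2_structure \<Rightarrow> bool" where
  "reversal M \<longleftrightarrow> (two_WWKL M \<longleftrightarrow> two_POS M) \<and> (two_POS M \<longleftrightarrow> BSigma2 M \<and> two_RAN M)"

definition cex :: "'a l2_structure" where
  "cex = (SOME M. RCA0 M \<and> \<not> reversal M)"

definition std :: "nat l2_structure" where
  "std = \<lparr>l2_zero = 0, l2_one = 1, l2_add = (+), l2_mult = (*), l2_less = (<), l2_sets = UNIV\<rparr>"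

text \<open>Induction is that of the type \<open>nat\<close>, and every definable set is a set of
  the model because all sets are.\<close>

lemma RCA0_std: "RCA0 std"
proof -
  have "basic_axioms std" by (auto simp: basic_axioms_def std_def)
  moreover have "Sigma1_induction std"
    unfolding Sigma1_induction_def Let_def
  proof (intro allI impI, elim conjE)
    fix \<theta> e E n
    define P where "P = (\<lambda>n. \<exists>w. sat std (case_nat w (case_nat n e)) E \<theta>)"
    assume "\<exists>w. sat std (case_nat w (case_nat (l2_zero std) e)) E \<theta>"
      "\<forall>n. (\<exists>w. sat std (case_nat w (case_nat n e)) E \<theta>) \<longrightarrow>
        (\<exists>w. sat std (case_nat w (case_nat (l2_add std n (l2_one std)) e)) E \<theta>)"
    then have "P 0" "\<And>n. P n \<Longrightarrow> P (Suc n)" unfolding P_def by (simp_all add: std_def)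
    then have "P n" by (induction n) blast+
    then show "\<exists>w. sat std (case_nat w (case_nat n e)) E \<theta>" by (simp only: P_def)
  qed
  moreover have "Delta1_comprehension std"
    unfolding Delta1_comprehension_def Let_def
  proof (intro allI impI)
    fix \<theta> e E
    show "\<exists>X\<in>l2_sets std. \<forall>n. n \<in> X \<longleftrightarrow> (\<exists>w. sat std (case_nat w (case_nat n e)) E \<theta>)"
      by (intro bexI[of _ "{n. \<exists>w. sat std (case_nat w (case_nat n e)) E \<theta>}"]) (simp_all add: std_def)
  qed
  moreover have "l2_sets std \<noteq> {}" by (simp add: std_def)
  ultimately show ?thesis unfolding RCA0_def by blast
qed

text \<open>
  Inside the type \<open>'a mdl\<close>, arithmetic in a model becomes arithmetic in a type class. A type cannot
  depend on the model \<open>M\<close>, so it is built from one particular counterexample to the theorem, if there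
  is any with first-order part \<open>'a\<close>, and is a copy of the standard model otherwise.
\<close>

typedef 'a mdl = "{x :: 'a + nat. isl x \<longleftrightarrow> RCA0 (cex :: 'a l2_structure)}"
  by (cases "RCA0 (cex :: 'a l2_structure)") (auto intro: exI[of _ "Inl _"] exI[of _ "Inr _"])

definition mdl_rel :: "('a \<Rightarrow> 'b) \<Rightarrow> 'a \<Rightarrow> 'b \<Rightarrow> bool" where
  "mdl_rel f x y \<longleftrightarrow> y = f x"

definition map_l2 :: "('a \<Rightarrow> 'b) \<Rightarrow> 'a l2_structure \<Rightarrow> 'b l2_structure" where
  "map_l2 f M = \<lparr>l2_zero = f (l2_zero M), l2_one = f (l2_one M),
     l2_add = (\<lambda>x y. f (l2_add M (inv f x) (inv f y))),
     l2_mult = (\<lambda>x y. f (l2_mult M (inv f x) (inv f y))),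
     l2_less = (\<lambda>x y. l2_less M (inv f x) (inv f y)),
     l2_sets = (`) f ` l2_sets M\<rparr>"

lemma mdl_rel:
  assumes "bij f"
  shows "bi_unique (mdl_rel f)" "bi_total (mdl_rel f)" "iso_l2 (mdl_rel f) M (map_l2 f M)"
proof -
  have i: "inv f (f x) = x" for x using assms by (simp add: bij_is_inj)
  show "bi_unique (mdl_rel f)" "bi_total (mdl_rel f)"
    using assms by (auto simp: bi_unique_def bi_total_def mdl_rel_def bij_def inj_def surj_def)
  show "iso_l2 (mdl_rel f) M (map_l2 f M)"
    by (auto simp: iso_l2_def map_l2_def mdl_rel_def rel_fun_def rel_set_def i)
qed

definition mdl_str :: "'a mdl l2_structure" where
  "mdl_str = (if RCA0 (cex :: 'a l2_structure)
     then map_l2 (Abs_mdl \<circ> Inl) (cex :: 'a l2_structure) else map_l2 (Abs_mdl \<circ> Inr) std)"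

lemma bij_mdl:
  "RCA0 (cex :: 'a l2_structure) \<Longrightarrow> bij (Abs_mdl \<circ> Inl :: 'a \<Rightarrow> 'a mdl)"
  "\<not> RCA0 (cex :: 'a l2_structure) \<Longrightarrow> bij (Abs_mdl \<circ> Inr :: nat \<Rightarrow> 'a mdl)"
proof -
  assume c: "RCA0 (cex :: 'a l2_structure)"
  show "bij (Abs_mdl \<circ> Inl :: 'a \<Rightarrow> 'a mdl)"
  proof (intro bijI injI)
    fix x y :: 'a assume "(Abs_mdl \<circ> Inl) x = (Abs_mdl \<circ> Inl) y"
    then show "x = y" using c by (simp add: Abs_mdl_inject)
  next
    show "surj (Abs_mdl \<circ> Inl :: 'a \<Rightarrow> 'a mdl)"
      unfolding surj_def
    proof
      fix y :: "'a mdl"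
      obtain z where "y = Abs_mdl z" "isl z" using c by (cases y) auto
      then show "\<exists>x. y = (Abs_mdl \<circ> Inl) x" by (auto simp: isl_def)
    qed
  qed
next
  assume c: "\<not> RCA0 (cex :: 'a l2_structure)"
  show "bij (Abs_mdl \<circ> Inr :: nat \<Rightarrow> 'a mdl)"
  proof (intro bijI injI)
    fix x y :: nat assume "(Abs_mdl \<circ> Inr :: _ \<Rightarrow> 'a mdl) x = (Abs_mdl \<circ> Inr) y"
    then show "x = y" using c by (simp add: Abs_mdl_inject)
  next
    show "surj (Abs_mdl \<circ> Inr :: nat \<Rightarrow> 'a mdl)"
      unfolding surj_def
    proof
      fix y :: "'a mdl"
      obtain z where "y = Abs_mdl z" "\<not> isl z" using c by (cases y) auto
      then show "\<exists>x. y = (Abs_mdl \<circ> Inr) x" by (cases z) auto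
    qed
  qed
qed

lemma RCA0_mdl_str: "RCA0 (mdl_str :: 'a mdl l2_structure)"
proof (cases "RCA0 (cex :: 'a l2_structure)")
  case True
  note b = mdl_rel[OF bij_mdl(1)[OF True]]
  show ?thesis
    using rel_funD[OF RCA0_transfer[OF b(1,2)] b(3)] True by (simp add: mdl_str_def)
next
  case False
  note b = mdl_rel[OF bij_mdl(2)[OF False]]
  show ?thesis
    using rel_funD[OF RCA0_transfer[OF b(1,2)] b(3)] RCA0_std False by (simp add: mdl_str_def)
qed

lemma reversal_mdl_str:
  assumes "RCA0 (cex :: 'a l2_structure)" "reversal (mdl_str :: 'a mdl l2_structure)"
  shows "reversal (cex :: 'a l2_structure)"
proof -
  note b = mdl_rel[OF bij_mdl(1)[OF assms(1)]]
  show ?thesis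
    using assms rel_funD[OF two_WWKL_transfer[OF b(1,2)] b(3)] rel_funD[OF two_POS_transfer[OF b(1,2)] b(3)]
      rel_funD[OF two_RAN_transfer[OF b(1,2)] b(3)] rel_funD[OF BSigma2_transfer[OF b(1,2)] b(3)]
    by (simp add: mdl_str_def reversal_def)
qed

instantiation mdl :: (type) rca
begin

definition "0 = l2_zero (mdl_str :: 'a mdl l2_structure)"
definition "1 = l2_one (mdl_str :: 'a mdl l2_structure)"
definition "x + y = l2_add mdl_str x (y :: 'a mdl)"
definition "x * y = l2_mult mdl_str x (y :: 'a mdl)"
definition "x < y = l2_less mdl_str x (y :: 'a mdl)"
definition "x \<le> y \<longleftrightarrow> l2_less mdl_str x (y :: 'a mdl) \<or> x = y"
text \<open>Truncated at 0: the class demands \<open>a - b - c = a - (b + c)\<close> also when b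
  exceeds a.\<close>

definition "x - y = (if y \<le> x then THE d. x = y + d else (0 :: 'a mdl))"
definition "SS = l2_sets (mdl_str :: 'a mdl l2_structure)"

interpretation m: rca0_model "mdl_str :: 'a mdl l2_structure"
  by unfold_locales (rule RCA0_mdl_str)

lemmas mdl_ops = zero_mdl_def one_mdl_def plus_mdl_def times_mdl_def less_mdl_def less_eq_mdl_def SS_mdl_def

lemma mdl_minus: "(y + d) - y = (d :: 'a mdl)"
proof -
  have "y \<le> y + d" using m.le_iff by (auto simp: mdl_ops)
  moreover have "(THE e. y + d = y + e) = d"
    by (rule the_equality) (simp_all add: plus_mdl_def, metis m.add_cancel m.add_comm)
  ultimately show ?thesis by (simp add: minus_mdl_def)
qed

lemma mdl_minus0: "\<not> y \<le> x \<Longrightarrow> x - y = (0 :: 'a mdl)"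
  by (simp add: minus_mdl_def)

lemma mdl_le: "x \<le> y \<longleftrightarrow> (\<exists>d. y = x + (d :: 'a mdl))"
  using m.le_iff by (auto simp: mdl_ops)

lemma mdl_minus_minus: "a - b - c = a - (b + c :: 'a mdl)"
proof (cases "b + c \<le> a")
  case True
  then obtain d where "a = (b + c) + d" using mdl_le by blast
  then show ?thesis using mdl_minus by (metis m.add_ass plus_mdl_def)
next
  case False
  have "a - b - c = 0"
  proof (cases "b \<le> a")
    case True
    then obtain e where e: "a = b + e" using mdl_le by blast
    then have "\<not> c \<le> e" using False mdl_le by (metis m.add_ass plus_mdl_def)
    then show ?thesis by (simp add: e mdl_minus mdl_minus0)
  next
    case False
    show ?thesis
    proof (cases "c \<le> 0")
      case True
      then have "c = 0" using mdl_le m.sum_zero m.add_comm by (metis plus_mdl_def zero_mdl_def)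
      then show ?thesis using False mdl_minus0 mdl_minus[of 0 0] m.zero_add
        by (metis plus_mdl_def zero_mdl_def)
    qed (simp add: False mdl_minus0)
  qed
  then show ?thesis using False by (simp add: mdl_minus0)
qed

instance
proof
  fix a b c x y z :: "'a mdl"
  show "a + b + c = a + (b + c)" by (simp add: mdl_ops m.add_ass)
  show ab: "a + b = b + a" for a b :: "'a mdl" by (simp add: mdl_ops m.add_comm)
  show "a + b - a = b" by (rule mdl_minus)
  show "a - b - c = a - (b + c)" by (rule mdl_minus_minus)
  show "x \<le> x" by (simp add: mdl_ops)
  show "x \<le> y \<Longrightarrow> y \<le> z \<Longrightarrow> x \<le> z" using m.le_trans[of x y z] by (simp add: less_eq_mdl_def)
  show as: "x \<le> y \<Longrightarrow> y \<le> x \<Longrightarrow> x = y" for x y :: "'a mdl"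
    using m.le_antisym[of x y] unfolding less_eq_mdl_def by blast
  show "(x < y) = (x \<le> y \<and> \<not> y \<le> x)"
    using as[of x y] m.less_irrefl[of x] unfolding less_eq_mdl_def less_mdl_def by blast
  show "x \<le> y \<or> y \<le> x" using m.le_linear[of x y] by (simp add: less_eq_mdl_def)
  show "a \<le> b \<Longrightarrow> c + a \<le> c + b"
    by (auto simp: mdl_le) (metis m.add_ass plus_mdl_def)
  show z: "0 + a = a" for a :: "'a mdl" by (simp add: mdl_ops m.zero_add)
  show "a * b * c = a * (b * c)" by (simp add: mdl_ops m.mult_ass)
  show mc: "a * b = b * a" for a b :: "'a mdl" by (simp add: mdl_ops m.mult_comm)
  show "1 * a = a" by (simp add: mdl_ops m.one_mult)
  show di: "(a + b) * c = a * c + b * c" for a b c :: "'a mdl" by (simp add: mdl_ops m.distr)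
  show zm: "0 * a = 0" for a :: "'a mdl" by (simp add: mdl_ops m.zero_mult)
  show "a * 0 = 0" by (simp add: mdl_ops m.ax)
  show "(0 :: 'a mdl) \<noteq> 1" using m.ax(1) m.zero_add by (metis zero_mdl_def one_mdl_def)
  show "a * (b + c) = a * b + a * c" unfolding mc[of a] by (rule di)
  show "0 < (1 :: 'a mdl)" unfolding less_mdl_def zero_mdl_def one_mdl_def
    using m.less_add[of "l2_zero mdl_str" "l2_zero mdl_str"] by (simp add: m.zero_add)
  have mp: "a \<noteq> 0 \<Longrightarrow> 0 < a" for a :: "'a mdl"
    using m.le_iff[of "l2_zero mdl_str" a] by (auto simp: less_mdl_def zero_mdl_def m.zero_add)
  show "a \<noteq> 0 \<Longrightarrow> b \<noteq> 0 \<Longrightarrow> a * b \<noteq> 0"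
    using m.mult_less[of "l2_zero mdl_str" b a] mp[of a] mp[of b] m.less_irrefl
    by (auto simp: mdl_ops m.ax(5))
  show "a < b \<Longrightarrow> 0 < c \<Longrightarrow> c * a < c * b" by (simp add: mdl_ops m.mult_less)
  show "b \<le> a \<Longrightarrow> a - b + b = a" unfolding mdl_le by (metis ab mdl_minus)
  show "a * (b - c) = a * b - a * c"
  proof (cases "c \<le> b")
    case True
    then obtain d where "b = c + d" unfolding mdl_le by blast
    then show ?thesis unfolding mc[of a] by (simp only: mdl_minus di)
  next
    case False
    then have "b \<le> c" using m.le_linear[of b c] unfolding less_eq_mdl_def by blast
    then obtain e where e: "c = b + e" unfolding mdl_le by blast
    have "a * b - (a * b + a * e) = 0"
    proof (cases "a * b + a * e \<le> a * b")
      case True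
      then have "a * b + a * e = a * b" using as[of "a * b + a * e" "a * b"] mdl_le[of "a * b" "a * b + a * e"] by blast
      then show ?thesis by (metis ab mdl_minus z)
    qed (simp add: mdl_minus0)
    moreover have "b - c = 0" using False by (rule mdl_minus0)
    ultimately show ?thesis unfolding mc[of a] e di by (simp add: zm)
  qed
  show "RCA0 \<lparr>l2_zero = 0 :: 'a mdl, l2_one = 1, l2_add = (+), l2_mult = (*), l2_less = (<), l2_sets = SS\<rparr>"
  proof -
    have "\<lparr>l2_zero = 0 :: 'a mdl, l2_one = 1, l2_add = (+), l2_mult = (*), l2_less = (<), l2_sets = SS\<rparr> = mdl_str"
      by (rule l2_structure.equality) (simp_all add: fun_eq_iff mdl_ops)
    then show ?thesis by (simp only: RCA0_mdl_str)
  qed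
qed

end

lemma MM_mdl: "(MM :: 'a mdl l2_structure) = mdl_str"
  unfolding MM_def by (rule l2_structure.equality) (simp_all add: fun_eq_iff mdl_ops)

text \<open>A failure at M makes the chosen \<open>cex\<close> a failure as well, and its copy on
  the type \<open>'a mdl\<close> would then refute the assumption.\<close>

lemma reversal_if_classes:
  fixes M :: "'a l2_structure"
  assumes "reversal (MM :: 'a mdl l2_structure)" "RCA0 M"
  shows "reversal M"
proof (rule ccontr)
  assume "\<not> reversal M"
  then have "\<exists>M :: 'a l2_structure. RCA0 M \<and> \<not> reversal M" using assms(2) by blast
  then have "RCA0 (cex :: 'a l2_structure) \<and> \<not> reversal (cex :: 'a l2_structure)"
    unfolding cex_def by (rule someI_ex)
  then show False using reversal_mdl_str[where 'a = 'a] assms(1) by (simp add: MM_mdl)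
qed


section \<open>The ordered ring of differences\<close>

text \<open>Linear arithmetic is only automated for ordered rings; \<open>zz_simps\<close> moves (in)equations there.\<close>

quotient_type (overloaded) 'a zz = "'a::linordered_semidom \<times> 'a" / "\<lambda>(x, y) (u, v). x + v = u + y"
  morphisms rep_zz mk_zz
proof (rule equivpI)
  show "reflp (\<lambda>(x, y) (u, v). x + v = u + (y :: 'a))" by (auto simp: reflp_def)
  show "symp (\<lambda>(x, y) (u, v). x + v = u + (y :: 'a))" by (auto simp: symp_def)
  show "transp (\<lambda>(x, y) (u, v). x + v = u + (y :: 'a))"
  proof (rule transpI, clarify)
    fix a b c d e f :: 'a assume "a + d = c + b" "c + f = e + d"
    then have "(a + f) + d = (e + b) + d" by (metis add.assoc add.commute)
    then show "a + f = e + b" by simp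
  qed
qed

instantiation zz :: (linordered_semidom) linordered_idom
begin

lift_definition zero_zz :: "'a zz" is "(0, 0)" .
lift_definition one_zz :: "'a zz" is "(1, 0)" .
lift_definition plus_zz :: "'a zz \<Rightarrow> 'a zz \<Rightarrow> 'a zz" is "\<lambda>(x, y) (u, v). (x + u, y + v)"
  by (clarsimp simp: add_ac) (metis add.assoc add.commute)
lift_definition uminus_zz :: "'a zz \<Rightarrow> 'a zz" is "\<lambda>(x, y). (y, x)"
  by (clarsimp simp: add.commute)
lift_definition minus_zz :: "'a zz \<Rightarrow> 'a zz \<Rightarrow> 'a zz" is "\<lambda>(x, y) (u, v). (x + v, y + u)"
  by (clarsimp simp: add_ac) (metis add.assoc add.commute)
lift_definition times_zz :: "'a zz \<Rightarrow> 'a zz \<Rightarrow> 'a zz" is "\<lambda>(x, y) (u, v). (x * u + y * v, x * v + y * u)"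
proof clarsimp
  fix s t u v w x y z :: 'a
  assume "s + v = u + t" and "w + z = y + x"
  \<comment> \<open>The two equations are multiplied so that the sides of the claim appear with the
    same mixed terms, which then cancel.\<close>
  then have "(s + v) * w + (u + t) * x + u * (w + z) + v * (y + x)
       = (u + t) * w + (s + v) * x + u * (y + x) + v * (w + z)"
    by simp
  then have "(s * w + t * x) + (u * z + v * y) + (v * w + u * x + u * w + v * x)
      = (u * y + v * z) + (s * x + t * w) + (v * w + u * x + u * w + v * x)"
    by (simp only: distrib_left distrib_right add_ac)
  then show "(s * w + t * x) + (u * z + v * y) = (u * y + v * z) + (s * x + t * w)"
    by (rule add_right_imp_eq)
qed
lift_definition less_eq_zz :: "'a zz \<Rightarrow> 'a zz \<Rightarrow> bool" is "\<lambda>(x, y) (u, v). x + v \<le> u + y"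
proof clarsimp
  fix x y x' y' u v u' v' :: 'a
  assume "x + y' = x' + y" "u + v' = u' + v"
  then have "x + v + (y' + v') = x' + v' + (y + v)" "u + y + (y' + v') = u' + y' + (y + v)"
    by (metis add.assoc add.commute)+
  then show "(x + v \<le> u + y) = (x' + v' \<le> u' + y')"
    by (metis add_le_cancel_right)
qed
lift_definition less_zz :: "'a zz \<Rightarrow> 'a zz \<Rightarrow> bool" is "\<lambda>(x, y) (u, v). x + v < u + y"
proof clarsimp
  fix x y x' y' u v u' v' :: 'a
  assume "x + y' = x' + y" "u + v' = u' + v"
  then have "x + v + (y' + v') = x' + v' + (y + v)" "u + y + (y' + v') = u' + y' + (y + v)"
    by (metis add.assoc add.commute)+
  then show "(x + v < u + y) = (x' + v' < u' + y')"
    by (metis add_less_cancel_right)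
qed
definition abs_zz :: "'a zz \<Rightarrow> 'a zz" where "abs_zz i = (if i < 0 then - i else i)"
definition sgn_zz :: "'a zz \<Rightarrow> 'a zz" where "sgn_zz i = (if i = 0 then 0 else if 0 < i then 1 else - 1)"

instance
proof
  fix i j k :: "'a zz"
  show "i < j \<Longrightarrow> 0 < k \<Longrightarrow> k * i < k * j"
  proof (transfer, clarsimp)
    fix x y u v z w :: 'a
    assume a: "x + v < u + y" and "w < z"
    then obtain d where z: "z = w + d" "0 < d"
      by (metis add.commute add_less_cancel_left add.right_neutral le_add_diff_inverse2 less_imp_le)
    then have "d * (x + v) < d * (u + y)" using a by (simp add: mult_strict_left_mono)
    then have "d * (x + v) + (w * x + w * y + w * u + w * v) < d * (u + y) + (w * x + w * y + w * u + w * v)"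
      by simp
    then show "z * x + w * y + (z * v + w * u) < z * u + w * v + (z * y + w * x)"
      by (simp add: z algebra_simps)
  qed
  show "i * j * k = i * (j * k)" by transfer (auto simp: algebra_simps)
  show "i * j = j * i" by transfer (auto simp: algebra_simps)
  show "1 * i = i" by transfer auto
  show "(i + j) * k = i * k + j * k" by transfer (auto simp: algebra_simps)
  show "i + j + k = i + (j + k)" by transfer (auto simp: algebra_simps)
  show "i + j = j + i" by transfer (auto simp: algebra_simps)
  show "0 + i = i" by transfer auto
  show "0 * i = 0" "i * 0 = 0" by (transfer; auto)+
  show "i + j - i = j" "i - j - k = i - (j + k)" by (transfer; auto simp: algebra_simps)+
  show "- i + i = 0" by transfer (auto simp: algebra_simps)
  show "i - j = i + - j" by transfer (auto simp: algebra_simps)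
  show "(0 :: 'a zz) \<noteq> 1" by transfer auto
  show "(i < j) = (i \<le> j \<and> \<not> j \<le> i)" by transfer auto
  show "i \<le> i" by transfer auto
  show "i \<le> j \<Longrightarrow> j \<le> k \<Longrightarrow> i \<le> k"
  proof (transfer, clarsimp)
    fix x y u v z w :: 'a
    assume "x + v \<le> u + y" "u + w \<le> z + v"
    then have "(x + v) + (u + w) \<le> (u + y) + (z + v)" by (rule add_mono)
    then have "(x + w) + (u + v) \<le> (z + y) + (u + v)" by (simp add: add_ac)
    then show "x + w \<le> z + y" by simp
  qed
  show "i \<le> j \<Longrightarrow> j \<le> i \<Longrightarrow> i = j" by transfer auto
  show "i \<le> j \<or> j \<le> i" by transfer auto
  show "i \<le> j \<Longrightarrow> k + i \<le> k + j"
  proof (transfer, clarsimp)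
    fix x y u v z w :: 'a
    assume "x + v \<le> u + y"
    then have "(x + v) + (z + w) \<le> (u + y) + (z + w)" by simp
    then show "z + x + (w + v) \<le> z + u + (w + y)" by (simp add: add_ac)
  qed
  show "\<bar>i\<bar> = (if i < 0 then - i else i)" by (rule abs_zz_def)
  show "sgn i = (if i = 0 then 0 else if 0 < i then 1 else - 1)" by (rule sgn_zz_def)
qed

end

lift_definition Z :: "'a::linordered_semidom \<Rightarrow> 'a zz" is "\<lambda>x. (x, 0)" .

lemma Z_hom:
  "Z 0 = 0" "Z 1 = 1" "Z (x + y) = Z x + Z y" "Z (x * y) = Z x * Z y"
  by (transfer; simp)+

lemma Z_numeral: "Z (numeral k) = numeral k"
  by (induction k) (simp_all only: Z_hom numeral.simps)

text \<open>Sort \<open>rca\<close>, which \<open>zz\<close> does not have, keeps these rewrite rules from looping.\<close>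

lemma Z_rel: "x \<le> y \<longleftrightarrow> Z x \<le> Z y" "x < y \<longleftrightarrow> Z x < Z y" "x = y \<longleftrightarrow> Z x = Z (y :: 'a::rca)"
  by (transfer; simp)+


section \<open>Discrete arithmetic, pairing, and closure properties of the sets of the model\<close>

section \<open>Discreteness\<close>

lemma MM_basic: "basic_axioms MM"
  using RCA0_MM unfolding RCA0_def by blast

lemma less_Suc_iff: "m < n + 1 \<longleftrightarrow> m \<le> (n :: 'a::rca)"
  using MM_basic unfolding basic_axioms_def by (auto simp: order_le_less)

lemma ge0 [simp]: "0 \<le> (x :: 'a::rca)"
  using MM_basic unfolding basic_axioms_def by (auto simp: not_less)

lemma not_less_0 [simp]: "\<not> x < (0 :: 'a::rca)"
  by (simp add: not_less)

lemma le_0 [simp]: "x \<le> 0 \<longleftrightarrow> x = (0 :: 'a::rca)"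
  by (simp add: order_antisym_conv)

lemma less_iff_Suc_le: "m < n \<longleftrightarrow> m + 1 \<le> (n :: 'a::rca)"
  by (metis add_le_cancel_right less_Suc_iff not_le)

lemma less_one [simp]: "x < 1 \<longleftrightarrow> x = (0 :: 'a::rca)"
  using less_Suc_iff[of x 0] by (simp add: order_antisym_conv)

lemma pos_iff: "0 < x \<longleftrightarrow> x \<noteq> (0 :: 'a::rca)"
  using ge0[of x] by (auto simp: order_le_less simp del: ge0)

lemma zero_or_Suc: "x = 0 \<or> (\<exists>y. x = y + (1 :: 'a::rca))"
proof (cases "x = 0")
  case False
  then have "1 \<le> x" using less_iff_Suc_le[of 0 x] by (simp add: pos_iff)
  then have "x = (x - 1) + 1" by simp
  then show ?thesis by blast
qed simp

text \<open>A general ordered ring is not discrete, so strict inequalities become gaps of 1 before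
  linear arithmetic sees them.\<close>

lemma Z_disc: "(x :: 'a::rca) < y \<longleftrightarrow> Z x + 1 \<le> Z y"
  by (simp add: less_iff_Suc_le Z_rel Z_hom)

lemmas zz_simps = Z_disc Z_rel(1,3) Z_hom Z_numeral not_less not_le

lemma add_eq_0 [simp]: "x + y = 0 \<longleftrightarrow> x = 0 \<and> y = (0 :: 'a::rca)"
  by (metis add_nonneg_eq_0_iff ge0)


section \<open>Pairs\<close>

abbreviation pp :: "'a::rca \<Rightarrow> 'a \<Rightarrow> 'a" where
  "pp \<equiv> pr MM"

lemma pp_def: "pp i j = (i + j) * (i + j) + i"
  by (simp add: pr_def)

lemma le_square: "x \<le> x * (x :: 'a::rca)"
proof (cases "x = 0")
  case False
  then obtain y where "x = y + 1" using zero_or_Suc by blast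
  then have "x * x = x + (y * y + y)" by (simp add: algebra_simps)
  then show ?thesis using add_left_mono[OF ge0, of x "y * y + y"] by simp
qed simp

lemma pp_bounds: "i \<le> pp i j" "j \<le> pp i j"
proof -
  have "j \<le> i + j" using add_right_mono[OF ge0[of i], of j] by simp
  also have "\<dots> \<le> pp i j" using add_mono[OF le_square[of "i + j"] ge0[of i]] by (simp add: pp_def)
  finally show "j \<le> pp i j" .
  show "i \<le> pp i j" using add_right_mono[OF ge0[of "(i + j) * (i + j)"], of i] by (simp add: pp_def)
qed

text \<open>With s = i + j, the value lies in the interval from s^2 up to but excluding (s + 1)^2.
  These intervals are disjoint, so the value determines s, and then i.\<close>

lemma pp_inject [simp]: "pp i j = pp k l \<longleftrightarrow> i = k \<and> j = (l :: 'a::rca)"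
proof -
  have *: "\<not> i + j < k + l" if e: "pp i j = pp k l" for i j k l :: 'a
  proof
    assume "i + j < k + l"
    then obtain d where d: "k + l = (i + j) + 1 + d"
      by (metis add.commute le_add_diff_inverse2 less_iff_Suc_le)
    have "pp k l = (i + j) * (i + j) + i + (i + j + j + 1 + d + d + (i + j) * (d + d) + d * d + k)"
      by (simp add: pp_def d algebra_simps)
    then show False using e pp_def[of i j] by (metis add_cancel_right_right add_eq_0 zero_neq_one)
  qed
  show ?thesis
  proof
    assume e: "pp i j = pp k l"
    then have "i + j = k + l" using *[of i j k l] *[of k l i j] by (metis linorder_neqE)
    with e show "i = k \<and> j = l" by (simp add: pp_def)
  qed auto
qed

lemma pp_0 [simp]: "pp 0 0 = 0"
  by (simp add: pp_def)

definition ispair :: "'a::rca \<Rightarrow> bool" where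
  "ispair z \<longleftrightarrow> (\<exists>i j. z = pp i j)"

text \<open>Pairing is not onto (3 is no pair), so a default is needed; with 0, both projections
  stay at most their argument.\<close>

definition p1 :: "'a::rca \<Rightarrow> 'a" where
  "p1 z = (if ispair z then SOME i. \<exists>j. z = pp i j else 0)"

definition p2 :: "'a::rca \<Rightarrow> 'a" where
  "p2 z = (if ispair z then SOME j. \<exists>i. z = pp i j else 0)"

lemma p_simps [simp]: "p1 (pp i j) = i" "p2 (pp i j) = j" "ispair (pp i j)"
proof -
  show i: "ispair (pp i j)" by (auto simp: ispair_def)
  show "p1 (pp i j) = i" "p2 (pp i j) = j" using i by (auto simp: p1_def p2_def)
qed

lemma p_not [simp]: "\<not> ispair z \<Longrightarrow> p1 z = 0" "\<not> ispair z \<Longrightarrow> p2 z = 0"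
  by (auto simp: p1_def p2_def)

lemma pp_p [simp]: "ispair z \<Longrightarrow> pp (p1 z) (p2 z) = z"
  by (auto simp: ispair_def)

lemma p_le: "p1 z \<le> z" "p2 z \<le> z"
  using pp_bounds[where 'a = 'a] by (cases "ispair z"; force simp: ispair_def)+


section \<open>Decidable predicates\<close>

text \<open>
  Decidable predicates and functions of several arguments are unary ones via the projections:
  \<open>dec (\<lambda>z. R (p1 z) (p2 z))\<close>. The rules \<open>dec_intros\<close> are applied by resolution.
\<close>

definition dec :: "('a::rca \<Rightarrow> bool) \<Rightarrow> bool" where
  "dec P \<longleftrightarrow> Collect P \<in> SS"

abbreviation dec2 :: "('a::rca \<Rightarrow> 'a \<Rightarrow> bool) \<Rightarrow> bool" where
  "dec2 R \<equiv> dec (\<lambda>z. R (p1 z) (p2 z))"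

text \<open>The form that a bounded formula can query, by one membership atom applied to a pair. It
  agrees with \<open>dec2\<close> once the projections are known to be functions of the
  model.\<close>

definition rel :: "('a::rca \<Rightarrow> 'a \<Rightarrow> bool) \<Rightarrow> bool" where
  "rel R \<longleftrightarrow> dec (\<lambda>z. \<exists>x y. z = pp x y \<and> R x y)"

definition fn :: "('a::rca \<Rightarrow> 'a) \<Rightarrow> bool" where
  "fn f \<longleftrightarrow> rel (\<lambda>x y. y = f x)"

abbreviation "b0 \<equiv> Var 0"
abbreviation "b1 \<equiv> Var (Suc 0)"
abbreviation "b2 \<equiv> Var (Suc (Suc 0))"
abbreviation "b3 \<equiv> Var (Suc (Suc (Suc 0)))"
abbreviation "b4 \<equiv> Var (Suc (Suc (Suc (Suc 0))))"
abbreviation "BEx t \<phi> \<equiv> Neg (BAll t (Neg \<phi>))"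
abbreviation "Disj \<phi> \<psi> \<equiv> Neg (Conj (Neg \<phi>) (Neg \<psi>))"
abbreviation "TPair s t \<equiv> TAdd (TMul (TAdd s t) (TAdd s t)) s"

text \<open>Taking a pair apart needs only bounded quantifiers, since both components are at most
  the pair.\<close>

definition PEx :: "nat \<Rightarrow> bfm \<Rightarrow> bfm" where
  "PEx n \<phi> = BEx (TAdd (Var n) TOne) (BEx (TAdd (Var (Suc n)) TOne)
     (Conj (Eq (TPair b1 b0) (Var (Suc (Suc n)))) \<phi>))"

lemma sat_PEx: "sat MM e E (PEx n \<phi>) \<longleftrightarrow> (\<exists>a b. e n = pp a b \<and> sat MM (case_nat b (case_nat a e)) E \<phi>)"
proof -
  have "sat MM e E (PEx n \<phi>) \<longleftrightarrow> (\<exists>a. a < e n + 1 \<and> (\<exists>b. b < e n + 1 \<and> pp a b = e n \<and> sat MM (case_nat b (case_nat a e)) E \<phi>))"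
    unfolding PEx_def sat.simps tm_val.simps MM_simps by (simp add: pp_def; blast)
  also have "\<dots> \<longleftrightarrow> (\<exists>a b. e n = pp a b \<and> sat MM (case_nat b (case_nat a e)) E \<phi>)"
    by (metis less_Suc_iff pp_bounds)
  finally show ?thesis .
qed

lemma sat_Mem_pair:
  "sat MM e E (Mem (TPair s t) n) \<longleftrightarrow> pp (tm_val MM e s) (tm_val MM e t) \<in> E n"
  "sat MM e E (Eq u (TPair s t)) \<longleftrightarrow> tm_val MM e u = pp (tm_val MM e s) (tm_val MM e t)"
  by (simp_all add: pp_def)

lemmas sat_pair = sat_PEx sat_Mem_pair

lemma Delta1_MM:
  fixes e :: "nat \<Rightarrow> 'a::rca"
  assumes "range E \<subseteq> SS"
    and "\<forall>n. (\<exists>w. sat MM (case_nat w (case_nat n e)) E \<theta>) \<longleftrightarrow> (\<forall>w. sat MM (case_nat w (case_nat n e)) E \<eta>)"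
  shows "\<exists>X\<in>SS. \<forall>n. n \<in> X \<longleftrightarrow> (\<exists>w. sat MM (case_nat w (case_nat n e)) E \<theta>)"
proof -
  have "Delta1_comprehension (MM :: 'a l2_structure)" using RCA0_MM unfolding RCA0_def by blast
  from this[unfolded Delta1_comprehension_def Let_def MM_simps, rule_format, OF assms(1) assms(2)[rule_format]]
  show ?thesis .
qed

lemma dec_comprehension:
  assumes "range E \<subseteq> SS" "\<And>n w. sat MM (case_nat w (case_nat n (\<lambda>_. 0))) E \<theta> \<longleftrightarrow> P n"
  shows "dec P"
proof -
  have "\<exists>X\<in>SS. \<forall>n. n \<in> X \<longleftrightarrow> (\<exists>w. sat MM (case_nat w (case_nat n (\<lambda>_. 0))) E \<theta>)"
    by (rule Delta1_MM[where \<eta> = \<theta>]) (use assms in simp_all)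
  then obtain X where "X \<in> SS" "\<And>n. n \<in> X \<longleftrightarrow> P n" using assms(2) by auto
  then have "X \<in> SS" "Collect P = X" by auto
  then show ?thesis by (simp add: dec_def)
qed

text \<open>R and R' are supplied as set parameters, so the two formulas shrink to single membership
  atoms; from here on comprehension can be used without syntax.\<close>

lemma dec_delta1:
  assumes "rel R" "rel R'" "\<And>x. P x \<longleftrightarrow> (\<exists>w. R x w)" "\<And>x. P x \<longleftrightarrow> (\<forall>w. R' x w)"
  shows "dec P"
proof -
  let ?A = "{z. \<exists>x y. z = pp x y \<and> R x y}" and ?B = "{z. \<exists>x y. z = pp x y \<and> R' x y}"
  let ?E = "case_nat ?A (\<lambda>_. ?B)"
  have E: "range ?E \<subseteq> SS" using assms by (auto simp: rel_def dec_def split: nat.splits)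
  have "\<exists>X\<in>SS. \<forall>n. n \<in> X \<longleftrightarrow> (\<exists>w. sat MM (case_nat w (case_nat n (\<lambda>_. 0))) ?E (Mem (TPair b1 b0) 0))"
    by (rule Delta1_MM[OF E, where \<eta> = "Mem (TPair b1 b0) 1"])
      (simp add: sat_pair del: sat.simps, metis assms(3,4))
  then obtain X where "X \<in> SS" "\<And>n. n \<in> X \<longleftrightarrow> P n"
    by (auto simp: sat_pair assms(3) simp del: sat.simps)
  then have "X \<in> SS" "Collect P = X" by auto
  then show ?thesis by (simp add: dec_def)
qed

lemma SS_E: "dec P \<Longrightarrow> dec Q \<Longrightarrow> range (case_nat (Collect P) (\<lambda>_. Collect Q)) \<subseteq> SS"
  by (auto simp: dec_def split: nat.splits)

lemma dec_not: "dec P \<Longrightarrow> dec (\<lambda>x. \<not> P x)"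
  by (rule dec_comprehension[where \<theta> = "Neg (Mem b1 0)", OF SS_E[of P P]]) auto

lemma dec_conj: "dec P \<Longrightarrow> dec Q \<Longrightarrow> dec (\<lambda>x. P x \<and> Q x)"
  by (rule dec_comprehension[where \<theta> = "Conj (Mem b1 0) (Mem b1 1)", OF SS_E[of P Q]]) auto

lemma dec_disj: "dec P \<Longrightarrow> dec Q \<Longrightarrow> dec (\<lambda>x. P x \<or> Q x)"
  by (rule dec_comprehension[where \<theta> = "Disj (Mem b1 0) (Mem b1 1)", OF SS_E[of P Q]]) auto

lemma dec_cong: "dec P \<Longrightarrow> (\<And>x. P x \<longleftrightarrow> Q x) \<Longrightarrow> dec Q"
proof -
  assume "dec P" "\<And>x. P x \<longleftrightarrow> Q x"
  moreover from this have "P = Q" by blast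
  ultimately show ?thesis by simp
qed

lemma dec_ex: "\<exists>P :: 'a::rca \<Rightarrow> bool. dec P"
proof -
  obtain X :: "'a set" where "X \<in> SS" using RCA0_MM[where 'a = 'a] by (auto simp: RCA0_def)
  then have "dec (\<lambda>x. x \<in> X)" by (simp add: dec_def)
  then show ?thesis by blast
qed

text \<open>The axioms provide just some set; intersecting or uniting it with its complement gives
  the two constants.\<close>

lemma dec_const: "dec (\<lambda>x :: 'a::rca. c)"
proof -
  obtain P :: "'a \<Rightarrow> bool" where P: "dec P" using dec_ex by blast
  show ?thesis
    using dec_conj[OF P dec_not[OF P]] dec_disj[OF P dec_not[OF P]] by (cases c) auto
qed

lemma rel_sat:
  assumes "dec P" "dec Q"
    and "\<And>x y f. sat MM (case_nat y (case_nat x f)) (case_nat (Collect P) (\<lambda>_. Collect Q)) \<theta> \<longleftrightarrow> R x y"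
  shows "rel R"
  unfolding rel_def
  by (rule dec_comprehension[where \<theta> = "PEx 1 \<theta>", OF SS_E[OF assms(1,2)]]) (simp add: sat_PEx assms(3))

lemma rel_bool:
  assumes "rel R" "rel S"
  shows rel_conj: "rel (\<lambda>x y. R x y \<and> S x y)" and rel_not: "rel (\<lambda>x y. \<not> R x y)"
    and rel_disj: "rel (\<lambda>x y. R x y \<or> S x y)"
proof -
  have "rel (\<lambda>x y :: 'a. True)"
    by (rule rel_sat[OF dec_const[of True] dec_const[of True], where \<theta> = "Eq TZero TZero"]) simp
  note p = this[unfolded rel_def]
  note r = assms[unfolded rel_def]
  show "rel (\<lambda>x y. R x y \<and> S x y)" unfolding rel_def
    by (rule dec_cong[OF dec_conj[OF r]]) auto
  show "rel (\<lambda>x y. R x y \<or> S x y)" unfolding rel_def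
    by (rule dec_cong[OF dec_disj[OF r]]) auto
  show "rel (\<lambda>x y. \<not> R x y)" unfolding rel_def
    by (rule dec_cong[OF dec_conj[OF p dec_not[OF r(1)]]]) auto
qed

text \<open>P (f x) holds iff P y for some y = f x, and iff P y for every y = f x, so the
  substitution is \<open>\<Delta>\<^sub>1\<close>.\<close>

lemma dec_fn:
  assumes "dec P" "fn f"
  shows "dec (\<lambda>x. P (f x))"
proof (rule dec_delta1)
  have P: "rel (\<lambda>x y. P y)"
    by (rule rel_sat[OF assms(1) assms(1), where \<theta> = "Mem b0 0"]) simp
  note f = assms(2)[unfolded fn_def]
  show "rel (\<lambda>x y. y = f x \<and> P y)" using rel_conj[OF f P] .
  show "rel (\<lambda>x y. \<not> y = f x \<or> P y)" using rel_disj[OF rel_not[OF f f] P] .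
qed auto

lemma dec_ispair: "dec ispair"
  by (rule dec_comprehension[where \<theta> = "PEx 1 (Eq TZero TZero)", OF SS_E[OF dec_const[of True] dec_const[of True]]])
    (simp add: sat_PEx ispair_def)

lemma p1_iff: "y = p1 x \<longleftrightarrow> (\<exists>i j. x = pp i j \<and> y = i) \<or> (\<not> (\<exists>i j. x = pp i j) \<and> y = 0)"
proof (cases "ispair x")
  case True
  then obtain i j where "x = pp i j" by (auto simp: ispair_def)
  then show ?thesis by simp
next
  case False
  then have "\<not> (\<exists>i j. x = pp i j)" by (simp add: ispair_def)
  then show ?thesis using False by simp
qed

lemma p2_iff: "y = p2 x \<longleftrightarrow> (\<exists>i j. x = pp i j \<and> y = j) \<or> (\<not> (\<exists>i j. x = pp i j) \<and> y = 0)"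
proof (cases "ispair x")
  case True
  then obtain i j where "x = pp i j" by (auto simp: ispair_def)
  then show ?thesis by simp
next
  case False
  then have "\<not> (\<exists>i j. x = pp i j)" by (simp add: ispair_def)
  then show ?thesis using False by simp
qed

lemma fn_p1_base: "fn p1"
  unfolding fn_def
  by (rule rel_sat[OF dec_const[of True] dec_const[of True], where \<theta> = "Disj (PEx 1 (Eq b2 b1))
     (Conj (Neg (PEx 1 (Eq TZero TZero))) (Eq b0 TZero))"]) (simp add: p1_iff sat_PEx)

lemma fn_p2_base: "fn p2"
  unfolding fn_def
  by (rule rel_sat[OF dec_const[of True] dec_const[of True], where \<theta> = "Disj (PEx 1 (Eq b2 b0))
     (Conj (Neg (PEx 1 (Eq TZero TZero))) (Eq b0 TZero))"]) (simp add: p2_iff sat_PEx)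

text \<open>The number c enters through the assignment, as variable 4. Afterwards number parameters
  are expressed by constant functions.\<close>

lemma fn_const: "fn (\<lambda>x :: 'a::rca. c)"
proof -
  let ?E = "\<lambda>_. {} :: 'a set"
  have E: "range ?E \<subseteq> SS" using dec_const[of False, where 'a = 'a] by (auto simp: dec_def)
  have "\<exists>X\<in>SS. \<forall>n. n \<in> X \<longleftrightarrow> (\<exists>w. sat MM (case_nat w (case_nat n (\<lambda>_. c))) ?E (PEx 1 (Eq b0 b4)))"
    by (rule Delta1_MM[OF E, where \<eta> = "PEx 1 (Eq b0 b4)"]) (simp add: sat_PEx)
  then obtain X where "X \<in> SS" "\<And>z. z \<in> X \<longleftrightarrow> (\<exists>x y. z = pp x y \<and> y = c)"
    by (auto simp: sat_PEx)
  then have "X \<in> SS" "{z. \<exists>x y. z = pp x y \<and> y = c} = X" by auto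
  then show ?thesis unfolding fn_def rel_def dec_def by simp
qed

lemma fn_id: "fn (\<lambda>x. x)"
  unfolding fn_def
  by (rule rel_sat[OF dec_const[of True] dec_const[of True], where \<theta> = "Eq b0 b1"]) simp

lemma fn_pair:
  assumes "fn f" "fn g"
  shows "fn (\<lambda>x. pp (f x) (g x))"
  unfolding fn_def
  by (rule rel_sat[OF assms[unfolded fn_def rel_def], where
      \<theta> = "PEx 0 (Conj (Mem (TPair b3 b1) 0) (Mem (TPair b3 b0) 1))"])
    (auto simp: sat_pair simp del: sat.simps(1,3))

lemma fn_comp:
  assumes "fn f" "fn g"
  shows "fn (\<lambda>x. f (g x))"
  unfolding fn_def rel_def
proof (rule dec_delta1)
  note fg = assms[unfolded fn_def rel_def]
  show "rel (\<lambda>z w. \<exists>x y. z = pp x y \<and> (w = g x \<and> y = f w))"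
    by (rule rel_sat[OF fg, where \<theta> = "PEx 1 (Conj (Mem (TPair b1 b2) 1) (Mem (TPair b2 b0) 0))"])
      (simp add: sat_pair del: sat.simps(1,3))
  show "rel (\<lambda>z w. \<exists>x y. z = pp x y \<and> (w = g x \<longrightarrow> y = f w))"
    by (rule rel_sat[OF fg, where \<theta> = "PEx 1 (Disj (Neg (Mem (TPair b1 b2) 1)) (Mem (TPair b2 b0) 0))"])
      (auto simp add: sat_pair simp del: sat.simps(1,3))
  fix x
  show "(\<exists>z y. x = pp z y \<and> y = f (g z)) \<longleftrightarrow> (\<exists>w z y. x = pp z y \<and> (w = g z \<and> y = f w))" by blast
  show "(\<exists>z y. x = pp z y \<and> y = f (g z)) \<longleftrightarrow> (\<forall>w. \<exists>z y. x = pp z y \<and> (w = g z \<longrightarrow> y = f w))"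
  proof
    assume "\<forall>w. \<exists>z y. x = pp z y \<and> (w = g z \<longrightarrow> y = f w)"
    then have "ispair x" "\<exists>z y. x = pp z y \<and> (g (p1 x) = g z \<longrightarrow> y = f (g (p1 x)))" by auto
    then show "\<exists>z y. x = pp z y \<and> y = f (g z)" by auto
  qed blast
qed


lemmas fn_p1 = fn_comp[OF fn_p1_base] and fn_p2 = fn_comp[OF fn_p2_base]

lemma dec2_rel:
  assumes "rel R"
  shows "dec2 R"
  by (rule dec_cong[OF dec_fn[OF assms[unfolded rel_def] fn_pair[OF fn_p1_base fn_p2_base]]]) simp

lemma rel_dec2:
  assumes "dec2 R"
  shows "rel R"
  unfolding rel_def by (rule dec_cong[OF dec_conj[OF dec_ispair assms]]) (auto simp: ispair_def)

lemma dec2_comp: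
  assumes "dec2 R" "fn f" "fn g"
  shows "dec (\<lambda>x. R (f x) (g x))"
  by (rule dec_cong[OF dec_fn[OF assms(1) fn_pair[OF assms(2,3)]]]) simp

lemma dec3_comp:
  assumes "dec (\<lambda>z. R (p1 z) (p1 (p2 z)) (p2 (p2 z)))" "fn f" "fn g" "fn h"
  shows "dec (\<lambda>x. R (f x) (g x) (h x))"
  by (rule dec_cong[OF dec_fn[OF assms(1) fn_pair[OF assms(2) fn_pair[OF assms(3,4)]]]]) simp

lemma fn2_comp:
  assumes "fn (\<lambda>z. F (p1 z) (p2 z))" "fn f" "fn g"
  shows "fn (\<lambda>x. F (f x) (g x))"
  using fn_comp[OF assms(1) fn_pair[OF assms(2,3)]] by simp

lemma fn3_comp:
  assumes "fn (\<lambda>z. F (p1 z) (p1 (p2 z)) (p2 (p2 z)))" "fn f" "fn g" "fn h"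
  shows "fn (\<lambda>x. F (f x) (g x) (h x))"
  using fn_comp[OF assms(1) fn_pair[OF assms(2) fn_pair[OF assms(3,4)]]] by simp

lemma fnI:
  assumes "dec2 R" "\<And>x y. R x y \<longleftrightarrow> y = f x"
  shows "fn f"
  unfolding fn_def using rel_dec2[OF assms(1)] by (simp add: assms(2))

lemma dec_rel_atoms:
  "rel (\<lambda>x y :: 'a::rca. x = y)" "rel (\<lambda>x y :: 'a. x < y)"
  "rel (\<lambda>x y :: 'a. \<exists>a b. x = pp a b \<and> y = a + b)" "rel (\<lambda>x y :: 'a. \<exists>a b. x = pp a b \<and> y = a * b)"
proof -
  note r = rel_sat[OF dec_const[of True] dec_const[of True]]
  show "rel (\<lambda>x y :: 'a::rca. x = y)" by (rule r[where \<theta> = "Eq b1 b0"]) simp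
  show "rel (\<lambda>x y :: 'a::rca. x < y)" by (rule r[where \<theta> = "Less b1 b0"]) simp
  show "rel (\<lambda>x y :: 'a. \<exists>a b. x = pp a b \<and> y = a + b)"
    by (rule r[where \<theta> = "PEx 1 (Eq b2 (TAdd b1 b0))"]) (simp add: sat_PEx)
  show "rel (\<lambda>x y :: 'a. \<exists>a b. x = pp a b \<and> y = a * b)"
    by (rule r[where \<theta> = "PEx 1 (Eq b2 (TMul b1 b0))"]) (simp add: sat_PEx)
qed

lemmas dec_eq = dec2_comp[OF dec2_rel[OF dec_rel_atoms(1)]]
lemmas dec_less = dec2_comp[OF dec2_rel[OF dec_rel_atoms(2)]]

lemma dec_le:
  assumes "fn f" "fn g"
  shows "dec (\<lambda>x. f x \<le> g x)"
  by (rule dec_cong[OF dec_not[OF dec_less[OF assms(2,1)]]]) auto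

lemma fn_add: "fn f \<Longrightarrow> fn g \<Longrightarrow> fn (\<lambda>x. f x + g x)"
  by (rule fnI, rule dec2_comp[OF dec2_rel[OF dec_rel_atoms(3)], where f = "\<lambda>z. pp (f (p1 z)) (g (p1 z))"])
    (simp_all add: fn_pair fn_comp fn_p1_base fn_p2_base)

lemma fn_mult: "fn f \<Longrightarrow> fn g \<Longrightarrow> fn (\<lambda>x. f x * g x)"
  by (rule fnI, rule dec2_comp[OF dec2_rel[OF dec_rel_atoms(4)], where f = "\<lambda>z. pp (f (p1 z)) (g (p1 z))"])
    (simp_all add: fn_pair fn_comp fn_p1_base fn_p2_base)

lemma dec_imp:
  assumes "dec P" "dec Q"
  shows "dec (\<lambda>x. P x \<longrightarrow> Q x)"
  by (rule dec_cong[OF dec_disj[OF dec_not[OF assms(1)] assms(2)]]) auto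

lemma dec_iff:
  assumes "dec P" "dec Q"
  shows "dec (\<lambda>x. P x = Q x)"
  by (rule dec_cong[OF dec_conj[OF dec_imp[OF assms] dec_imp[OF assms(2,1)]]]) auto

lemma dec_if:
  assumes "dec P" "dec Q" "dec R"
  shows "dec (\<lambda>x. if P x then Q x else R x)"
  by (rule dec_cong[OF dec_disj[OF dec_conj[OF assms(1,2)] dec_conj[OF dec_not[OF assms(1)] assms(3)]]]) auto

lemma fn_if:
  assumes "dec P" "fn f" "fn g"
  shows "fn (\<lambda>x. if P x then f x else g x)"
proof (rule fnI)
  show "dec2 (\<lambda>x y. if P x then y = f x else y = g x)"
    by (intro dec_if dec_eq dec_fn[OF assms(1)] fn_comp[OF assms(2)] fn_comp[OF assms(3)] fn_p1_base fn_p2_base)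
qed auto

lemma dec_mem: "X \<in> SS \<Longrightarrow> fn f \<Longrightarrow> dec (\<lambda>x. f x \<in> X)"
  by (rule dec_fn) (simp_all add: dec_def)

lemma dec_all_less:
  assumes "fn t" "dec2 R"
  shows "dec (\<lambda>x. \<forall>y. y < t x \<longrightarrow> R x y)"
proof -
  \<comment> \<open>The syntactic bound must be a term, so it is first taken to be a component of
    the argument; substituting the pair (t x, x) then gives an arbitrary bound. On non-pairs the
    default 0 makes the quantifier vacuous.\<close>
  have base: "dec (\<lambda>u. \<forall>y. y < p1 u \<longrightarrow> T u y)" if T: "dec2 T" for T :: "'a \<Rightarrow> 'a \<Rightarrow> bool"
  proof (rule dec_comprehension[where \<theta> = "Disj (PEx 1 (BAll b1 (Mem (TPair b4 b0) 0))) (Neg (PEx 1 (Eq TZero TZero)))",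
        OF SS_E[OF T T]])
    fix n w :: 'a
    show "sat MM (case_nat w (case_nat n (\<lambda>_. 0))) (case_nat {z. T (p1 z) (p2 z)} (\<lambda>_. {z. T (p1 z) (p2 z)}))
      (Disj (PEx 1 (BAll b1 (Mem (TPair b4 b0) 0))) (Neg (PEx 1 (Eq TZero TZero)))) = (\<forall>y. y < p1 n \<longrightarrow> T n y)"
    proof (cases "ispair n")
      case True
      then obtain a b where "n = pp a b" by (auto simp: ispair_def)
      then show ?thesis by (simp add: sat_PEx del: sat.simps(3)) (simp add: sat_Mem_pair del: sat.simps(3))
    next
      case False
      then show ?thesis by (simp add: sat_PEx) (simp add: ispair_def not_less)
    qed
  qed
  have "dec2 (\<lambda>u y. R (p2 u) y)"
    by (intro dec2_comp[OF assms(2)] fn_comp[OF fn_p2_base] fn_p1_base fn_p2_base)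
  from dec_fn[OF base[OF this] fn_pair[OF assms(1) fn_id]] show ?thesis by simp
qed

lemma dec_ex_less:
  assumes "fn t" "dec2 R"
  shows "dec (\<lambda>x. \<exists>y. y < t x \<and> R x y)"
  by (rule dec_cong[OF dec_not[OF dec_all_less[OF assms(1) dec_not[OF assms(2)]]]]) auto

lemma dec_all_le:
  assumes "fn t" "dec2 R"
  shows "dec (\<lambda>x. \<forall>y. y \<le> t x \<longrightarrow> R x y)"
  by (rule dec_cong[OF dec_all_less[OF fn_add[OF assms(1) fn_const[of 1]] assms(2)]]) (simp add: less_Suc_iff)

lemma dec_ex_le:
  assumes "fn t" "dec2 R"
  shows "dec (\<lambda>x. \<exists>y. y \<le> t x \<and> R x y)"
  by (rule dec_cong[OF dec_ex_less[OF fn_add[OF assms(1) fn_const[of 1]] assms(2)]]) (simp add: less_Suc_iff)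

named_theorems dec_intros
lemmas dec_intros_base [dec_intros] = dec_const dec_not dec_conj dec_disj dec_imp dec_iff dec_if dec_mem
  dec_all_less dec_ex_less dec_all_le dec_ex_le dec_eq dec_less dec_le dec_fn[OF dec_ispair]
  fn_const fn_id fn_if fn_add fn_mult fn_pair fn_p1 fn_p2

lemma dec_delta:
  assumes "dec2 R" "dec2 R'" "\<And>x. P x \<longleftrightarrow> (\<exists>w. R x w)" "\<And>x. P x \<longleftrightarrow> (\<forall>w. R' x w)"
  shows "dec P"
  by (rule dec_delta1[OF rel_dec2[OF assms(1)] rel_dec2[OF assms(2)] assms(3,4)])

text \<open>For a total function, y is not the value iff some other value is witnessed. So a
  \<open>\<Sigma>\<^sub>1\<close> graph is also \<open>\<Pi>\<^sub>1\<close>.\<close>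

lemma fn_sigma:
  assumes R: "dec (\<lambda>z. R (p1 z) (p1 (p2 z)) (p2 (p2 z)))" and f: "\<And>x y. y = f x \<longleftrightarrow> (\<exists>w. R x y w)"
  shows "fn f"
proof (rule fnI)
  show "dec2 (\<lambda>x y. y = f x)"
  proof (rule dec_delta)
    show "dec2 (\<lambda>z w. R (p1 z) (p2 z) w)" by (intro dec3_comp[OF R] dec_intros)
    show "dec2 (\<lambda>z v. R (p1 z) (p1 v) (p2 v) \<longrightarrow> p1 v = p2 z)" by (intro dec3_comp[OF R] dec_intros)
  next
    fix z
    show "p2 z = f (p1 z) \<longleftrightarrow> (\<exists>w. R (p1 z) (p2 z) w)" by (rule f)
    show "p2 z = f (p1 z) \<longleftrightarrow> (\<forall>v. R (p1 z) (p1 v) (p2 v) \<longrightarrow> p1 v = p2 z)"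
    proof
      assume a: "p2 z = f (p1 z)"
      have "y = p2 z" if "R (p1 z) y w" for y w using f[of y "p1 z"] that a by auto
      then show "\<forall>v. R (p1 z) (p1 v) (p2 v) \<longrightarrow> p1 v = p2 z" by blast
    next
      assume a: "\<forall>v. R (p1 z) (p1 v) (p2 v) \<longrightarrow> p1 v = p2 z"
      obtain w where "R (p1 z) (f (p1 z)) w" using f by blast
      then have "f (p1 z) = p2 z" using a[rule_format, of "pp (f (p1 z)) w"] by simp
      then show "p2 z = f (p1 z)" by simp
    qed
  qed
qed simp


section \<open>Induction, least elements and collection\<close>

lemma sigma1_induct:
  fixes R :: "'a::rca \<Rightarrow> 'a \<Rightarrow> bool"
  assumes "dec2 R" "\<exists>w. R 0 w" "\<And>n. \<exists>w. R n w \<Longrightarrow> \<exists>w. R (n + 1) w"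
  shows "\<exists>w. R n w"
proof -
  let ?E = "\<lambda>_ :: nat. {z. R (p1 z) (p2 z)}"
  have E: "range ?E \<subseteq> SS" using assms(1) by (auto simp: dec_def)
  have "Sigma1_induction (MM :: 'a l2_structure)" using RCA0_MM unfolding RCA0_def by blast
  from this[unfolded Sigma1_induction_def Let_def MM_simps, THEN spec, THEN spec, THEN spec, THEN mp, OF E, of "\<lambda>_. 0" "Mem (TPair b1 b0) 0"]
  show ?thesis using assms(2,3) by (simp add: sat_Mem_pair del: sat.simps(3))
qed

lemma dec_induct [consumes 1, case_names 0 Suc]:
  assumes "dec P" "P 0" "\<And>n. P n \<Longrightarrow> P (n + 1)"
  shows "P n"
  using sigma1_induct[of "\<lambda>n w. P n" n] assms dec_fn[OF assms(1) fn_p1_base] by blast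

lemma dec_less_induct [consumes 1, case_names less]:
  assumes "dec P" "\<And>n. (\<And>m. m < n \<Longrightarrow> P m) \<Longrightarrow> P n"
  shows "P n"
proof -
  have "dec (\<lambda>n. \<forall>m. m < n \<longrightarrow> P m)" by (intro dec_intros dec_fn[OF assms(1)])
  then have "\<forall>m. m < n \<longrightarrow> P m" for n
  proof (induction n rule: dec_induct)
    case (Suc n)
    then have "P n" using assms(2) by blast
    then show ?case using Suc by (auto simp: less_Suc_iff order_le_less)
  qed (simp add: not_less)
  then show ?thesis using assms(2) by blast
qed

text \<open>The order of a nonstandard model is not well-founded, so minima are available for
  decidable predicates; this is why the searches by \<open>LEAST\<close> below come with a
  \<open>dec\<close> condition.\<close>

lemma dec_least:
  assumes "dec P" "P a"
  shows "\<exists>m. P m \<and> (\<forall>k. k < m \<longrightarrow> \<not> P k)"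
proof (rule ccontr)
  assume n: "\<not> ?thesis"
  have "\<not> P n" for n
    using dec_not[OF assms(1)]
  proof (induction n rule: dec_less_induct)
    case (less n)
    then show ?case using n by blast
  qed
  then show False using assms(2) by blast
qed

lemma dec_LeastI: "dec P \<Longrightarrow> P a \<Longrightarrow> P (LEAST x. P x)"
  and dec_not_less_Least: "dec P \<Longrightarrow> k < (LEAST x. P x) \<Longrightarrow> \<not> P k"
proof -
  have *: "P (LEAST x. P x) \<and> (\<forall>k. P k \<longrightarrow> (LEAST x. P x) \<le> k)" if Pa: "dec P" "P a" for a
  proof -
    obtain m where m: "P m" "\<And>k. k < m \<Longrightarrow> \<not> P k" using dec_least[OF Pa] by blast
    then have "(LEAST x. P x) = m" by (metis Least_equality not_le)
    then show ?thesis using m by (metis not_le)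
  qed
  show "dec P \<Longrightarrow> P a \<Longrightarrow> P (LEAST x. P x)" using * by blast
  show "dec P \<Longrightarrow> k < (LEAST x. P x) \<Longrightarrow> \<not> P k" using * by (meson not_le)
qed

lemma fn_Least:
  assumes "dec2 R" "\<And>x. \<exists>y. R x y"
  shows "fn (\<lambda>x. LEAST y. R x y)"
proof (rule fnI)
  show "dec2 (\<lambda>x y. R x y \<and> (\<forall>k. k < y \<longrightarrow> \<not> R x k))"
    by (intro dec_intros dec2_comp[OF assms(1)])
  fix x y
  have d: "dec (R x)" by (intro dec2_comp[OF assms(1)] dec_intros)
  obtain a where a: "R x a" using assms(2) by blast
  show "R x y \<and> (\<forall>k. k < y \<longrightarrow> \<not> R x k) \<longleftrightarrow> y = (LEAST y. R x y)"
    using dec_LeastI[OF d a] dec_not_less_Least[OF d] by (metis linorder_neqE)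
qed

text \<open>The common bound is the witness in a \<open>\<Sigma>\<^sub>1\<close> induction on the
  number of arguments treated.\<close>

lemma BSigma1:
  assumes "dec2 R" "\<And>x. x < u \<Longrightarrow> \<exists>y. R x y"
  obtains v where "\<And>x. x < u \<Longrightarrow> \<exists>y. y < v \<and> R x y"
proof -
  have "\<exists>v. n \<le> u \<longrightarrow> (\<forall>x. x < n \<longrightarrow> (\<exists>y. y < v \<and> R x y))" for n
  proof (rule sigma1_induct[of "\<lambda>n v. n \<le> u \<longrightarrow> (\<forall>x. x < n \<longrightarrow> (\<exists>y. y < v \<and> R x y))"])
    show "dec2 (\<lambda>n v. n \<le> u \<longrightarrow> (\<forall>x. x < n \<longrightarrow> (\<exists>y. y < v \<and> R x y)))"
      by (intro dec_intros dec2_comp[OF assms(1)])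
    fix n
    assume "\<exists>v. n \<le> u \<longrightarrow> (\<forall>x. x < n \<longrightarrow> (\<exists>y. y < v \<and> R x y))"
    then obtain v where v: "n \<le> u \<Longrightarrow> x < n \<Longrightarrow> \<exists>y. y < v \<and> R x y" for x by blast
    show "\<exists>v. n + 1 \<le> u \<longrightarrow> (\<forall>x. x < n + 1 \<longrightarrow> (\<exists>y. y < v \<and> R x y))"
    proof (cases "n + 1 \<le> u")
      case True
      then have "n < u" by (simp add: less_iff_Suc_le)
      then obtain y where y: "R n y" using assms(2) by blast
      show ?thesis
      proof (rule exI[of _ "max v (y + 1)"], intro impI allI)
        fix x assume "x < n + 1"
        then have "x = n \<or> x < n" by (auto simp: less_Suc_iff)
        then show "\<exists>y'. y' < max v (y + 1) \<and> R x y'"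
          using v[of x] less_imp_le[OF \<open>n < u\<close>] y by (auto simp: less_max_iff_disj less_Suc_iff)
      qed
    qed blast
  qed (simp add: not_less)
  then show thesis using that[of v for v] by blast
qed

lemma bounded_fn:
  assumes "fn f"
  obtains v where "\<And>x. x < u \<Longrightarrow> f x < v"
proof -
  have "dec2 (\<lambda>x y. y = f x)" by (intro dec_intros fn_comp[OF assms])
  from BSigma1[OF this, of u] show thesis using that by (metis (full_types))
qed


section \<open>Finite combinatorics inside the model: codes, recursion, counting\<close>

section \<open>Codes of finite sets\<close>

lemma mult_ge: "0 < a \<Longrightarrow> k \<le> a * (k :: 'a::rca)"
  using mult_right_mono[of 1 a k] less_iff_Suc_le[of 0 a] by simp

lemma dvd_bounded: "a dvd n \<longleftrightarrow> (\<exists>d. d \<le> n \<and> n = a * (d :: 'a::rca))"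
proof
  assume "a dvd n"
  then obtain k where k: "n = a * k" by (auto simp: dvd_def)
  show "\<exists>d. d \<le> n \<and> n = a * d"
  proof (cases "a = 0")
    case False
    then show ?thesis using k mult_ge[of a k] pos_iff by blast
  qed (use k in auto)
qed (auto simp: dvd_def)

lemma dec_dvd [dec_intros]: "fn f \<Longrightarrow> fn g \<Longrightarrow> dec (\<lambda>x. f x dvd g x)"
  by (rule dec2_comp[of "(dvd)"]; (assumption | (unfold dvd_bounded; intro dec_intros)))

definition fmem :: "'a::rca \<Rightarrow> 'a \<Rightarrow> bool" where
  "fmem i c \<longleftrightarrow> ispair c \<and> ispair (p2 c) \<and> i < p1 c \<and> (p1 (p2 c) * (i + 1) + 1) dvd p2 (p2 c)"

lemma fin_mem_iff: "fin_mem MM i c \<longleftrightarrow> fmem i c"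
proof
  assume "fin_mem MM i c"
  then show "fmem i c" by (auto simp: fin_mem_def fmem_def dvd_def mult.commute)
next
  assume f: "fmem i c"
  then obtain k m n where "c = pp k (pp m n)" unfolding fmem_def ispair_def by (metis p_simps(2))
  with f show "fin_mem MM i c" by (auto simp: fin_mem_def fmem_def dvd_def mult.commute)
qed

lemma dec_fmem [dec_intros]: "fn f \<Longrightarrow> fn g \<Longrightarrow> dec (\<lambda>x. fmem (f x) (g x))"
  unfolding fmem_def by (intro dec_intros)

lemma fmem_less: "fmem i c \<Longrightarrow> i < c"
  using p_le(1)[of c] by (auto simp: fmem_def)

text \<open>
  The moduli \<open>m (i + 1) + 1\<close> behave like distinct primes; a set of indices is coded by the least
  positive common multiple of its moduli.
\<close>

definition fmods :: "'a::rca \<Rightarrow> 'a \<Rightarrow> bool" where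
  "fmods b w \<longleftrightarrow> 0 < p1 w \<and> (\<forall>i. i < b \<longrightarrow> (i + 1) dvd p1 w) \<and>
     0 < p2 w \<and> (\<forall>i. i < b \<longrightarrow> (p1 w * (i + 1) + 1) dvd p2 w)"

lemma dec_fmods [dec_intros]: "fn f \<Longrightarrow> fn g \<Longrightarrow> dec (\<lambda>x. fmods (f x) (g x))"
  by (rule dec2_comp[of fmods]; (assumption | (unfold fmods_def; intro dec_intros)))

lemma fmods_ex: "\<exists>w. fmods b (w :: 'a::rca)"
proof -
  have "\<exists>m :: 'a. 0 < m \<and> (\<forall>i. i < b \<longrightarrow> (i + 1) dvd m)"
  proof (rule sigma1_induct[of "\<lambda>b m :: 'a. 0 < m \<and> (\<forall>i. i < b \<longrightarrow> (i + 1) dvd m)"])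
    show "dec2 (\<lambda>b m :: 'a. 0 < m \<and> (\<forall>i. i < b \<longrightarrow> (i + 1) dvd m))" by (intro dec_intros)
    fix n :: 'a assume "\<exists>m. 0 < m \<and> (\<forall>i. i < n \<longrightarrow> (i + 1) dvd m)"
    then obtain m where "0 < m" "\<And>i. i < n \<Longrightarrow> (i + 1) dvd m" by blast
    then show "\<exists>m. 0 < m \<and> (\<forall>i. i < n + 1 \<longrightarrow> (i + 1) dvd m)"
      by (intro exI[of _ "m * (n + 1)"]) (auto simp: less_Suc_iff order_le_less pos_iff)
  qed (auto intro: exI[of _ 1])
  then obtain m :: 'a where m: "0 < m" "\<And>i. i < b \<Longrightarrow> (i + 1) dvd m" by blast
  have "\<exists>N. 0 < N \<and> (\<forall>i. i < b \<longrightarrow> (m * (i + 1) + 1) dvd N)"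
  proof (rule sigma1_induct[of "\<lambda>b N. 0 < N \<and> (\<forall>i. i < b \<longrightarrow> (m * (i + 1) + 1) dvd N)"])
    show "dec2 (\<lambda>b N. 0 < N \<and> (\<forall>i. i < b \<longrightarrow> (m * (i + 1) + 1) dvd N))" by (intro dec_intros)
    fix n assume "\<exists>N. 0 < N \<and> (\<forall>i. i < n \<longrightarrow> (m * (i + 1) + 1) dvd N)"
    then obtain N where "0 < N" "\<And>i. i < n \<Longrightarrow> (m * (i + 1) + 1) dvd N" by blast
    then show "\<exists>N. 0 < N \<and> (\<forall>i. i < n + 1 \<longrightarrow> (m * (i + 1) + 1) dvd N)"
      by (intro exI[of _ "N * (m * (n + 1) + 1)"]) (auto simp: less_Suc_iff order_le_less pos_iff)
  qed (auto intro: exI[of _ 1])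
  then obtain N where N: "0 < N" "\<And>i. i < b \<Longrightarrow> (m * (i + 1) + 1) dvd N" by blast
  then have "fmods b (pp m N)" using m by (simp add: fmods_def)
  then show ?thesis by blast
qed

text \<open>Combining the moduli of i and j eliminates m and leaves the difference |i - j|, so the
  modulus of i divides |i - j| * x. As |i - j| divides m, it divides m * (i + 1) * x, which is the
  multiple of x by the modulus diminished by 1. Hence it divides x.\<close>

lemma fmods_coprime:
  fixes m :: "'a::rca"
  assumes m: "\<And>i. i < b \<Longrightarrow> (i + 1) dvd m" and ij: "i < b" "j < b" "i \<noteq> j"
    and d: "(m * (i + 1) + 1) dvd (m * (j + 1) + 1) * x"
  shows "(m * (i + 1) + 1) dvd x"
proof -
  let ?a = "m * (i + 1) + 1" and ?c = "m * (j + 1) + 1"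
  have "\<exists>d. d < b \<and> ?a dvd (d + 1) * x"
  proof (cases "i < j")
    case True
    then obtain e where e: "j = i + 1 + e" by (metis add.commute le_add_diff_inverse2 less_iff_Suc_le)
    then have "(i + 1) * (?c * x) + (e + 1) * x = ?a * ((j + 1) * x)" by (simp add: algebra_simps)
    then have "?a dvd (i + 1) * (?c * x) + (e + 1) * x" by simp
    then have "?a dvd (e + 1) * x" using d by (metis dvd_add_right_iff dvd_mult)
    moreover have "e < b"
      using ij(2) e by (metis add.commute add_less_same_cancel1 le_less_trans less_iff_Suc_le not_less not_less_0 order_less_le_trans)
    ultimately show ?thesis by blast
  next
    case False
    then have "j < i" using ij(3) by simp
    then obtain e where e: "i = j + 1 + e" by (metis add.commute le_add_diff_inverse2 less_iff_Suc_le)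
    then have "?a * ((j + 1) * x) + (e + 1) * x = (i + 1) * (?c * x)" by (simp add: algebra_simps)
    moreover have "?a dvd (i + 1) * (?c * x)" using d by (rule dvd_mult)
    ultimately have "?a dvd ?a * ((j + 1) * x) + (e + 1) * x" by simp
    then have "?a dvd (e + 1) * x" by (metis dvd_add_right_iff dvd_triv_left)
    moreover have "e < b"
      using ij(1) e by (metis add.commute add_less_same_cancel1 le_less_trans less_iff_Suc_le not_less not_less_0 order_less_le_trans)
    ultimately show ?thesis by blast
  qed
  then obtain e where e: "e < b" "?a dvd (e + 1) * x" by blast
  obtain q where "m = (e + 1) * q" using m[OF e(1)] by (auto simp: dvd_def)
  then have "m * (i + 1) * x = ((e + 1) * x) * (q * (i + 1))" by (simp add: algebra_simps)
  then have "?a dvd m * (i + 1) * x" using e(2) by (metis dvd_mult2)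
  moreover have "?a dvd m * (i + 1) * x + x" by (metis distrib_right dvd_triv_left mult_1)
  ultimately show ?thesis by (metis dvd_add_right_iff)
qed

text \<open>A bound on codes of subsets of the numbers below b that depends on b alone. It turns
  quantifiers over such codes into bounded ones.\<close>

definition codeB :: "'a::rca \<Rightarrow> 'a" where
  "codeB b = pp b (LEAST w. fmods b w \<and> ispair w) + 1"

lemma fmods_pair_ex: "\<exists>w. fmods b w \<and> ispair w"
proof -
  obtain w where "fmods b w" using fmods_ex by blast
  then have "fmods b (pp (p1 w) (p2 w)) \<and> ispair (pp (p1 w) (p2 w))" by (simp add: fmods_def)
  then show ?thesis by blast
qed

lemma fn_codeB [dec_intros]: "fn f \<Longrightarrow> fn (\<lambda>x. codeB (f x))"
  unfolding codeB_def
  by (rule fn_comp[of "\<lambda>b. pp b (LEAST w. fmods b w \<and> ispair w) + 1"]; (assumption | intro dec_intros fn_Least fmods_pair_ex))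

lemma pp_mono: "a \<le> c \<Longrightarrow> b \<le> d \<Longrightarrow> pp a b \<le> pp c (d :: 'a::rca)"
  unfolding pp_def by (intro add_mono mult_mono) (auto intro: add_mono)

text \<open>If the modulus of an unwanted index divided the least common multiple, the quotient
  would by coprimality still be a common multiple, and smaller. The size bound holds because the
  product of all moduli is a competitor.\<close>

lemma finite_code_ex:
  assumes "dec P"
  shows "\<exists>c. c < codeB b \<and> (\<forall>i. fmem i c \<longleftrightarrow> i < b \<and> P i)"
proof -
  define w where "w = (LEAST w. fmods b w \<and> ispair w)"
  have "dec (\<lambda>w. fmods b w \<and> ispair w)" by (intro dec_intros)
  then have w: "fmods b w" "ispair w" unfolding w_def using dec_LeastI fmods_pair_ex by (metis (mono_tags, lifting))+
  define m N where "m = p1 w" and "N = p2 w"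
  define Q where "Q = (\<lambda>n. 0 < n \<and> (\<forall>i. i < b \<longrightarrow> P i \<longrightarrow> (m * (i + 1) + 1) dvd n))"
  have "dec Q" unfolding Q_def by (intro dec_intros dec_fn[OF assms])
  moreover have QN: "Q N" using w by (auto simp: Q_def fmods_def m_def N_def)
  ultimately obtain n where n: "Q n" "\<And>k. k < n \<Longrightarrow> \<not> Q k" using dec_least[of Q] by blast
  have "n \<le> N" using n(2) QN by (meson not_le)
  then have "pp m n \<le> pp m N" by (simp add: pp_mono)
  then have "pp b (pp m n) \<le> pp b w" using w(2) by (simp add: pp_mono m_def N_def)
  then have "pp b (pp m n) < codeB b" by (simp add: codeB_def w_def less_Suc_iff)
  moreover have "fmem i (pp b (pp m n)) \<longleftrightarrow> i < b \<and> P i" for i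
  proof -
    have "P i" if i: "i < b" "(m * (i + 1) + 1) dvd n"
    proof (rule ccontr)
      assume "\<not> P i"
      obtain q where q: "n = (m * (i + 1) + 1) * q" using i by (auto simp: dvd_def)
      have "0 < q" using n(1) q by (auto simp: Q_def pos_iff)
      moreover have "(m * (j + 1) + 1) dvd q" if "j < b" "P j" for j
      proof (rule fmods_coprime[of b m j i])
        show "\<And>i. i < b \<Longrightarrow> i + 1 dvd m" using w by (simp add: fmods_def m_def)
        show "(m * (j + 1) + 1) dvd (m * (i + 1) + 1) * q" using n(1) that q by (simp add: Q_def)
      qed (use that i \<open>\<not> P i\<close> in auto)
      ultimately have "Q q" by (simp add: Q_def)
      moreover have "q < n"
      proof -
        have "0 < m * (i + 1) * q" using \<open>0 < q\<close> w(1) by (auto simp: fmods_def m_def pos_iff)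
        then show ?thesis using q by (simp add: distrib_right)
      qed
      ultimately show False using n(2) by blast
    qed
    then show ?thesis using n(1) by (auto simp: fmem_def Q_def)
  qed
  ultimately show ?thesis by blast
qed

definition mkset :: "'a::rca \<Rightarrow> ('a \<Rightarrow> bool) \<Rightarrow> 'a" where
  "mkset b P = (LEAST c. \<forall>i. fmem i c \<longleftrightarrow> i < b \<and> P i)"

lemma dec_same_members: "dec Q \<Longrightarrow> dec (\<lambda>c. \<forall>i. fmem i c \<longleftrightarrow> i < b \<and> Q i)"
proof (rule dec_cong)
  assume d: "dec Q"
  show "dec (\<lambda>c. \<forall>i. i < b + c \<longrightarrow> (fmem i c \<longleftrightarrow> i < b \<and> Q i))" by (intro dec_intros dec_fn[OF d])
  fix c :: 'a
  have "i < b + c" if "i < b \<or> fmem i c" for i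
    using that fmem_less[of i c] add_mono[of i b 0 c] add_mono[of 0 b i c]
    by (auto intro: less_le_trans simp: add_strict_increasing2 add_strict_increasing)
  then show "(\<forall>i. i < b + c \<longrightarrow> (fmem i c \<longleftrightarrow> i < b \<and> Q i)) \<longleftrightarrow> (\<forall>i. fmem i c \<longleftrightarrow> i < b \<and> Q i)"
    by blast
qed

lemma fset_ext: "fin_set MM c \<Longrightarrow> fin_set MM c' \<Longrightarrow> (\<And>i. fmem i c \<longleftrightarrow> fmem i c') \<Longrightarrow> c = c'"
  unfolding fin_set_def fin_mem_iff by (metis MM_simps(5) linorder_neqE)

lemma mkset:
  assumes "dec P"
  shows fmem_mkset: "fmem i (mkset b P) \<longleftrightarrow> i < b \<and> P i"
    and fin_set_mkset: "fin_set MM (mkset b P)" and mkset_less: "mkset b P < codeB b"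
proof -
  note d = dec_same_members[OF assms, of b]
  obtain c where c: "c < codeB b" "\<forall>i. fmem i c \<longleftrightarrow> i < b \<and> P i" using finite_code_ex[OF assms] by blast
  have m: "\<forall>i. fmem i (mkset b P) \<longleftrightarrow> i < b \<and> P i"
    unfolding mkset_def using dec_LeastI[OF d c(2)] .
  then show "fmem i (mkset b P) \<longleftrightarrow> i < b \<and> P i" by blast
  show "fin_set MM (mkset b P)"
    unfolding fin_set_def fin_mem_iff MM_simps using m dec_not_less_Least[OF d] unfolding mkset_def by blast
  show "mkset b P < codeB b"
    using c dec_not_less_Least[OF d] unfolding mkset_def by (meson le_less_trans not_less)
qed

lemma fin_set_iff: "fin_set MM c \<longleftrightarrow> (\<forall>c'. c' < c \<longrightarrow> (\<exists>i. i < c \<and> fmem i c' \<noteq> fmem i c))"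
  unfolding fin_set_def fin_mem_iff MM_simps using fmem_less by (metis order.strict_trans)

lemma dec_fin_set [dec_intros]: "fn f \<Longrightarrow> dec (\<lambda>x. fin_set MM (f x))"
  by (rule dec_fn[of "fin_set MM"]; (assumption | (unfold fin_set_iff; intro dec_intros)))


section \<open>Finite sequences\<close>

lemma entry_iff: "entry MM s i v \<longleftrightarrow> fmem (pp i v) s"
  by (simp add: entry_def fin_mem_iff)

lemma dec_entry [dec_intros]: "fn f \<Longrightarrow> fn g \<Longrightarrow> fn h \<Longrightarrow> dec (\<lambda>x. entry MM (f x) (g x) (h x))"
  unfolding entry_iff by (intro dec_intros)

lemma entry_less: "entry MM s i v \<Longrightarrow> i < s" "entry MM s i v \<Longrightarrow> v < s"
  using fmem_less pp_bounds unfolding entry_iff by (meson le_less_trans)+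

lemma seq_iff: "seq MM s l \<longleftrightarrow> fin_set MM s \<and>
   (\<forall>x. x < s \<longrightarrow> fmem x s \<longrightarrow> ispair x \<and> p1 x < l) \<and>
   (\<forall>i. i < l \<longrightarrow> (\<exists>v. v < s \<and> entry MM s i v \<and> (\<forall>v'. v' < s \<longrightarrow> entry MM s i v' \<longrightarrow> v' = v)))"
proof -
  have "(\<forall>x. fmem x s \<longrightarrow> (\<exists>i v. x = pp i v \<and> i < l)) \<longleftrightarrow> (\<forall>x. x < s \<longrightarrow> fmem x s \<longrightarrow> ispair x \<and> p1 x < l)"
    using fmem_less unfolding ispair_def by (metis p_simps(1))
  moreover have "(\<exists>!v. entry MM s i v) \<longleftrightarrow> (\<exists>v. v < s \<and> entry MM s i v \<and> (\<forall>v'. v' < s \<longrightarrow> entry MM s i v' \<longrightarrow> v' = v))" for i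
    using entry_less by blast
  ultimately show ?thesis unfolding seq_def fin_mem_iff MM_simps by simp
qed

lemma dec_seq [dec_intros]: "fn f \<Longrightarrow> fn g \<Longrightarrow> dec (\<lambda>x. seq MM (f x) (g x))"
  by (rule dec2_comp[of "seq MM"]; (assumption | (unfold seq_iff; intro dec_intros)))

lemma seq_dom: "seq MM s l \<Longrightarrow> entry MM s i v \<Longrightarrow> i < l"
  unfolding seq_def fin_mem_iff entry_iff by (metis MM_simps(5) pp_inject)

lemma seq_fun: "seq MM s l \<Longrightarrow> entry MM s i v \<Longrightarrow> entry MM s i v' \<Longrightarrow> v = v'"
  using seq_dom[of s l i v] unfolding seq_def MM_simps by blast

lemma seq_ex: "seq MM s l \<Longrightarrow> i < l \<Longrightarrow> \<exists>v. entry MM s i v"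
  unfolding seq_def MM_simps by blast

lemma seq_ext:
  assumes "seq MM s l" "seq MM s' l'" "\<And>i v. entry MM s i v \<longleftrightarrow> entry MM s' i v"
  shows "s = s'"
proof (rule fset_ext)
  show "fmem x s \<longleftrightarrow> fmem x s'" for x
    using assms unfolding seq_def fin_mem_iff entry_iff by metis
qed (use assms in \<open>auto simp: seq_def\<close>)

lemma seq_length_unique: "seq MM s l \<Longrightarrow> seq MM s l' \<Longrightarrow> l = l'"
  using seq_ex seq_dom by (metis less_irrefl linorder_neqE)

lemma seq_length_le: "seq MM s l \<Longrightarrow> l \<le> s"
  using zero_or_Suc[of l] seq_ex[of s l] entry_less(1)[of s]
  by (metis ge0 less_Suc_iff less_iff_Suc_le order_refl)

text \<open>The disjunct \<open>v = s\<close> makes the search total. Entries are below s, so a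
  genuine entry is found before the default.\<close>

definition at :: "'a::rca \<Rightarrow> 'a \<Rightarrow> 'a" where
  "at s i = (LEAST v. entry MM s i v \<or> v = s)"

lemma fn_at [dec_intros]: "fn f \<Longrightarrow> fn g \<Longrightarrow> fn (\<lambda>x. at (f x) (g x))"
  by (rule fn2_comp[of at]; (assumption | (unfold at_def, rule fn_Least, intro dec_intros, blast)))

lemma entry_at: "seq MM s l \<Longrightarrow> i < l \<Longrightarrow> entry MM s i v \<longleftrightarrow> v = at s i"
proof -
  assume s: "seq MM s l" "i < l"
  then obtain v' where v': "entry MM s i v'" using seq_ex by blast
  have d: "dec (\<lambda>v. entry MM s i v \<or> v = s)" by (intro dec_intros)
  have "at s i \<le> v'" using v' dec_not_less_Least[OF d, of v'] unfolding at_def by (meson not_le)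
  then have "at s i \<noteq> s" using entry_less(2)[OF v'] by auto
  then have "entry MM s i (at s i)" using dec_LeastI[OF d, of s] unfolding at_def by blast
  then show ?thesis using seq_fun[OF s(1)] by blast
qed

text \<open>The default \<open>s + 1\<close> exceeds every length that s could have, by
  \<open>seq_length_le\<close>.\<close>

definition slen :: "'a::rca \<Rightarrow> 'a" where
  "slen s = (LEAST l. seq MM s l \<or> l = s + 1)"

lemma fn_slen [dec_intros]: "fn f \<Longrightarrow> fn (\<lambda>x. slen (f x))"
  by (rule fn_comp[of slen]; (assumption | (unfold slen_def[abs_def], rule fn_Least, intro dec_intros, blast)))

lemma slen: "seq MM s l \<Longrightarrow> slen s = l"
proof -
  assume s: "seq MM s l"
  have d: "dec (\<lambda>l. seq MM s l \<or> l = s + 1)" by (intro dec_intros)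
  have "slen s \<le> l" using s dec_not_less_Least[OF d, of l] unfolding slen_def by (meson not_le)
  then have "slen s \<noteq> s + 1" using seq_length_le[OF s] by (metis less_Suc_iff not_le)
  then have "seq MM s (slen s)" using dec_LeastI[OF d, of "s + 1"] unfolding slen_def by blast
  then show ?thesis using seq_length_unique s by blast
qed

definition mkseq :: "'a::rca \<Rightarrow> ('a \<Rightarrow> 'a) \<Rightarrow> 'a" where
  "mkseq l f = (THE s. seq MM s l \<and> (\<forall>i. i < l \<longrightarrow> entry MM s i (f i)))"

lemma mkseq_unique:
  assumes "seq MM s l" "\<And>i. i < l \<Longrightarrow> entry MM s i (f i)" "seq MM s' l" "\<And>i. i < l \<Longrightarrow> entry MM s' i (f i)"
  shows "s = s'"
proof (rule seq_ext[OF assms(1,3)])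
  fix i v
  show "entry MM s i v \<longleftrightarrow> entry MM s' i v"
    using assms seq_dom seq_fun by metis
qed

text \<open>Collection bounds the pairs (i, f i) for i < l, so that the graph is a bounded decidable
  set and has a code.\<close>

lemma mkseq_ex:
  assumes "fn f"
  shows "\<exists>s. seq MM s l \<and> (\<forall>i. i < l \<longrightarrow> entry MM s i (f i))"
proof -
  obtain b where b: "\<And>i. i < l \<Longrightarrow> pp i (f i) < b"
    using bounded_fn[OF fn_pair[OF fn_id assms]] by blast
  define s where "s = mkset b (\<lambda>x. ispair x \<and> p1 x < l \<and> p2 x = f (p1 x))"
  have d: "dec (\<lambda>x. ispair x \<and> p1 x < l \<and> p2 x = f (p1 x))" by (intro dec_intros fn_comp[OF assms])
  have e: "entry MM s i v \<longleftrightarrow> i < l \<and> v = f i" for i v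
    using b by (auto simp: s_def entry_iff fmem_mkset[OF d])
  have "seq MM s l"
    unfolding seq_def MM_simps
  proof (intro conjI allI impI)
    show "fin_set MM s" unfolding s_def by (rule fin_set_mkset[OF d])
    show "\<exists>i v. x = pp i v \<and> i < l" if "fin_mem MM x s" for x
    proof -
      have "ispair x" "p1 x < l" using that by (auto simp: s_def fin_mem_iff fmem_mkset[OF d])
      then show ?thesis by (metis pp_p)
    qed
    show "\<exists>!v. entry MM s i v" if "i < l" for i using that e by auto
  qed
  then show ?thesis using e by blast
qed

lemma mkseq:
  assumes "fn f"
  shows seq_mkseq: "seq MM (mkseq l f) l" and entry_mkseq: "entry MM (mkseq l f) i v \<longleftrightarrow> i < l \<and> v = f i"
    and at_mkseq: "i < l \<Longrightarrow> at (mkseq l f) i = f i"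
proof -
  have "\<exists>!s. seq MM s l \<and> (\<forall>i. i < l \<longrightarrow> entry MM s i (f i))"
    using mkseq_ex[OF assms, of l] mkseq_unique[of _ l f] by blast
  from theI'[OF this] have m: "seq MM (mkseq l f) l" "\<And>i. i < l \<Longrightarrow> entry MM (mkseq l f) i (f i)"
    unfolding mkseq_def by auto
  show "seq MM (mkseq l f) l" by (rule m)
  show "entry MM (mkseq l f) i v \<longleftrightarrow> i < l \<and> v = f i"
    using m seq_dom seq_fun by metis
  show "i < l \<Longrightarrow> at (mkseq l f) i = f i" using m entry_at by metis
qed

lemma fn_mkseq [dec_intros]:
  assumes "fn l" "fn (\<lambda>z. F (p1 z) (p2 z))"
  shows "fn (\<lambda>x. mkseq (l x) (\<lambda>i. F x i))"
proof (rule fnI)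
  show "dec2 (\<lambda>x y. seq MM y (l x) \<and> (\<forall>i. i < l x \<longrightarrow> entry MM y i (F x i)))"
    by (intro dec_intros fn_comp[OF assms(1)] fn2_comp[OF assms(2)])
  fix x y
  have f: "fn (\<lambda>i. F x i)" by (intro fn2_comp[OF assms(2)] dec_intros)
  show "seq MM y (l x) \<and> (\<forall>i. i < l x \<longrightarrow> entry MM y i (F x i)) \<longleftrightarrow> y = mkseq (l x) (\<lambda>i. F x i)"
    using mkseq_unique[of y "l x" "F x" "mkseq (l x) (\<lambda>i. F x i)"] seq_mkseq[OF f] entry_mkseq[OF f] by auto
qed


section \<open>Primitive recursion and counting\<close>

definition PR :: "'a::rca \<Rightarrow> ('a \<Rightarrow> 'a \<Rightarrow> 'a) \<Rightarrow> 'a \<Rightarrow> 'a \<Rightarrow> bool" where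
  "PR a g n s \<longleftrightarrow> seq MM s (n + 1) \<and> at s 0 = a \<and> (\<forall>i. i < n \<longrightarrow> at s (i + 1) = g i (at s i))"

definition prec :: "'a::rca \<Rightarrow> ('a \<Rightarrow> 'a \<Rightarrow> 'a) \<Rightarrow> 'a \<Rightarrow> 'a" where
  "prec a g n = at (LEAST s. PR a g n s) n"

lemma dec_PR:
  assumes "fn a" "fn (\<lambda>z. G (p1 z) (p1 (p2 z)) (p2 (p2 z)))" "fn n" "fn s"
  shows "dec (\<lambda>x. PR (a x) (G x) (n x) (s x))"
  unfolding PR_def
  by (intro dec_intros assms fn_comp[OF assms(1)] fn_comp[OF assms(3)] fn_comp[OF assms(4)] fn3_comp[OF assms(2)])

text \<open>Histories are coded sequences, so their existence is a \<open>\<Sigma>\<^sub>1\<close>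
  statement about the length, open to induction.\<close>

lemma PR_ex:
  assumes "fn (\<lambda>z. g (p1 z) (p2 z))"
  shows "\<exists>s. PR a g n s"
proof (rule sigma1_induct[of "\<lambda>n s. PR a g n s"])
  show "dec2 (PR a g)"
    by (intro dec_PR[of "\<lambda>_. a" "\<lambda>_. g" p1 p2] dec_intros fn2_comp[OF assms])
  show "\<exists>s. PR a g 0 s"
    unfolding PR_def by (intro exI[of _ "mkseq (0 + 1) (\<lambda>_. a)"]) (simp add: seq_mkseq at_mkseq fn_const)
next
  fix n assume "\<exists>s. PR a g n s"
  then obtain s where s: "seq MM s (n + 1)" "at s 0 = a" "\<And>i. i < n \<Longrightarrow> at s (i + 1) = g i (at s i)"
    unfolding PR_def by blast
  define f where "f = (\<lambda>i. if i \<le> n then at s i else g n (at s n))"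
  have f: "fn f" unfolding f_def by (intro dec_intros)
  have f0: "f 0 = a" using s(2) by (simp add: f_def)
  have n1: "\<not> n + 1 \<le> n" by (simp add: not_le)
  have "at (mkseq (n + 1 + 1) f) (i + 1) = g i (at (mkseq (n + 1 + 1) f) i)" if "i < n + 1" for i
  proof -
    have i: "i \<le> n" "i < n + 1 + 1" "i + 1 < n + 1 + 1" using that by (simp_all add: less_Suc_iff less_imp_le)
    have "f (i + 1) = g i (at s i)"
    proof (cases "i < n")
      case True
      then show ?thesis using s(3) by (simp add: f_def less_iff_Suc_le)
    next
      case False
      then show ?thesis using i n1 by (simp add: f_def)
    qed
    moreover have "f i = at s i" using i(1) by (simp add: f_def)
    ultimately show ?thesis using at_mkseq[OF f i(2)] at_mkseq[OF f i(3)] by metis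
  qed
  then have "PR a g (n + 1) (mkseq (n + 1 + 1) f)"
    unfolding PR_def using at_mkseq[OF f, of 0 "n + 1 + 1"] seq_mkseq[OF f] f0 by (simp add: pos_iff)
  then show "\<exists>s. PR a g (n + 1) s" by blast
qed

text \<open>Histories of different lengths agree where both are defined, so a value does not depend
  on the history from which it is read.\<close>

lemma prec_eq:
  assumes g: "fn (\<lambda>z. g (p1 z) (p2 z))" and s: "PR a g n s" and i: "i \<le> n"
  shows "at s i = prec a g i"
proof -
  define t where "t = (LEAST s. PR a g i s)"
  have "dec (PR a g i)"
    by (intro dec_PR[of "\<lambda>_. a" "\<lambda>_. g" "\<lambda>_. i" "\<lambda>x. x"] dec_intros fn2_comp[OF g])
  then have t: "PR a g i t" unfolding t_def using PR_ex[OF g] dec_LeastI by blast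
  have "k \<le> i \<longrightarrow> at s k = at t k" for k
  proof (rule dec_induct[of "\<lambda>k. k \<le> i \<longrightarrow> at s k = at t k"])
    show "dec (\<lambda>k. k \<le> i \<longrightarrow> at s k = at t k)" by (intro dec_intros)
    fix k assume IH: "k \<le> i \<longrightarrow> at s k = at t k"
    show "k + 1 \<le> i \<longrightarrow> at s (k + 1) = at t (k + 1)"
    proof
      assume "k + 1 \<le> i"
      then have "k < i" by (simp add: less_iff_Suc_le)
      then show "at s (k + 1) = at t (k + 1)" using IH s t i by (auto simp: PR_def)
    qed
  qed (use s t in \<open>simp add: PR_def\<close>)
  then show ?thesis unfolding prec_def t_def by blast
qed

lemma prec_simps:
  assumes "fn (\<lambda>z. g (p1 z) (p2 z))"
  shows "prec a g 0 = a" "prec a g (n + 1) = g n (prec a g n)"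
proof -
  obtain s where s: "PR a g (n + 1) s" using PR_ex[OF assms] by blast
  show "prec a g 0 = a" using prec_eq[OF assms s, of 0] s by (simp add: PR_def)
  show "prec a g (n + 1) = g n (prec a g n)"
    using prec_eq[OF assms s, of n] prec_eq[OF assms s, of "n + 1"] s by (simp add: PR_def less_Suc_iff)
qed

lemma fn_prec [dec_intros]:
  assumes "fn a" "fn (\<lambda>z. G (p1 z) (p1 (p2 z)) (p2 (p2 z)))" "fn n"
  shows "fn (\<lambda>x. prec (a x) (G x) (n x))"
  unfolding prec_def
proof (intro fn_at assms fn_Least)
  show "dec2 (\<lambda>x y. PR (a x) (G x) (n x) y)"
    by (intro dec_PR fn_comp[OF assms(1)] fn_comp[OF assms(3)] fn3_comp[OF assms(2)] dec_intros)
  show "\<exists>y. PR (a x) (G x) (n x) y" for x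
    by (intro PR_ex fn3_comp[OF assms(2)] dec_intros)
qed

definition pw :: "'a::rca \<Rightarrow> 'a" where
  "pw n = prec 1 (\<lambda>i v. v + v) n"

lemma fn_dbl: "fn (\<lambda>z. p2 z + p2 z)"
  by (intro dec_intros)

lemma pw_simps [simp]: "pw 0 = 1" "pw (n + 1) = pw n + pw n"
  using prec_simps[OF fn_dbl] by (simp_all add: pw_def)

lemma fn_pw [dec_intros]: "fn f \<Longrightarrow> fn (\<lambda>x. pw (f x))"
  unfolding pw_def by (intro dec_intros)

lemma pow2_iff: "pow2 MM n N \<longleftrightarrow> N = pw n"
proof
  assume "pow2 MM n N"
  then obtain s where s: "seq MM s (n + 1)" "entry MM s 0 1" "entry MM s n N"
    "\<And>i v. i < n \<Longrightarrow> entry MM s i v \<Longrightarrow> entry MM s (i + 1) (v + v)"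
    by (auto simp: pow2_def)
  have "k \<le> n \<longrightarrow> entry MM s k (pw k)" for k
  proof (rule dec_induct[of "\<lambda>k. k \<le> n \<longrightarrow> entry MM s k (pw k)"])
    show "dec (\<lambda>k. k \<le> n \<longrightarrow> entry MM s k (pw k))" by (intro dec_intros)
  qed (use s in \<open>auto simp flip: less_iff_Suc_le simp: less_imp_le\<close>)
  then show "N = pw n" using s(1,3) seq_fun by blast
next
  assume "N = pw n"
  have f: "fn (pw :: 'a \<Rightarrow> 'a)" by (intro dec_intros)
  show "pow2 MM n N" unfolding pow2_def MM_simps
    by (intro exI[of _ "mkseq (n + 1) pw"])
      (auto simp: \<open>N = pw n\<close> seq_mkseq[OF f] entry_mkseq[OF f] less_Suc_iff pos_iff less_iff_Suc_le)
qed

lemma pw_pos [simp]: "0 < pw n"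
proof (rule dec_induct[of "\<lambda>n. 0 < pw n"])
  show "dec (\<lambda>n. 0 < pw n)" by (intro dec_intros)
qed (auto intro: add_pos_pos)

lemma pw_add: "pw (m + n) = pw m * pw n"
proof (rule dec_induct[of "\<lambda>n. pw (m + n) = pw m * pw n"])
  show "dec (\<lambda>n. pw (m + n) = pw m * pw n)" by (intro dec_intros)
qed (auto simp flip: add.assoc simp: distrib_left)

definition cnt :: "'a::rca \<Rightarrow> ('a \<Rightarrow> bool) \<Rightarrow> 'a" where
  "cnt b P = prec 0 (\<lambda>i v. if P i then v + 1 else v) b"

lemma fn_cnt [dec_intros]:
  assumes "fn b" "dec2 P"
  shows "fn (\<lambda>x. cnt (b x) (P x))"
  unfolding cnt_def by (intro dec_intros assms dec2_comp[OF assms(2)])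

lemma cnt_simps:
  assumes "dec P"
  shows "cnt 0 P = 0" "cnt (n + 1) P = (if P n then cnt n P + 1 else cnt n P)"
proof -
  have "fn (\<lambda>z. if P (p1 z) then p2 z + 1 else p2 z)" by (intro dec_intros dec_fn[OF assms])
  from prec_simps[OF this] show "cnt 0 P = 0" "cnt (n + 1) P = (if P n then cnt n P + 1 else cnt n P)"
    by (simp_all add: cnt_def)
qed

lemma cnt_mono:
  assumes "dec P" "dec Q" "\<And>x. x < b \<Longrightarrow> P x \<Longrightarrow> Q x"
  shows "cnt b P \<le> cnt b Q"
proof -
  have "n \<le> b \<longrightarrow> cnt n P \<le> cnt n Q" for n
  proof (rule dec_induct[of "\<lambda>n. n \<le> b \<longrightarrow> cnt n P \<le> cnt n Q"])
    show "dec (\<lambda>n. n \<le> b \<longrightarrow> cnt n P \<le> cnt n Q)"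
      by (intro dec_intros dec_fn[OF assms(1)] dec_fn[OF assms(2)])
    fix n assume IH: "n \<le> b \<longrightarrow> cnt n P \<le> cnt n Q"
    show "n + 1 \<le> b \<longrightarrow> cnt (n + 1) P \<le> cnt (n + 1) Q"
    proof
      assume "n + 1 \<le> b"
      then have "n < b" by (simp add: less_iff_Suc_le)
      moreover have "cnt n Q \<le> cnt n Q + 1" by simp
      ultimately show "cnt (n + 1) P \<le> cnt (n + 1) Q"
        using IH assms(3)[of n] by (auto simp: cnt_simps assms intro: order_trans)
    qed
  qed (simp add: cnt_simps assms)
  then show ?thesis by blast
qed

lemma cnt_cong:
  assumes "dec P" "dec Q" "\<And>x. x < b \<Longrightarrow> P x \<longleftrightarrow> Q x"
  shows "cnt b P = cnt b Q"
  using cnt_mono[OF assms(1,2)] cnt_mono[OF assms(2,1)] assms(3) by (meson antisym)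

lemma cnt_disj:
  assumes "dec P" "dec Q"
  shows "cnt b (\<lambda>x. P x \<or> Q x) + cnt b (\<lambda>x. P x \<and> Q x) = cnt b P + cnt b Q"
proof (rule dec_induct[of "\<lambda>b. cnt b (\<lambda>x. P x \<or> Q x) + cnt b (\<lambda>x. P x \<and> Q x) = cnt b P + cnt b Q"])
  show "dec (\<lambda>b. cnt b (\<lambda>x. P x \<or> Q x) + cnt b (\<lambda>x. P x \<and> Q x) = cnt b P + cnt b Q)"
    by (intro dec_intros dec_fn[OF assms(1)] dec_fn[OF assms(2)])
qed (auto simp: cnt_simps assms dec_disj dec_conj add_ac)

lemma cnt_False: "cnt b (\<lambda>x. False) = 0"
proof (rule dec_induct[of "\<lambda>b. cnt b (\<lambda>x. False) = 0"])
  show "dec (\<lambda>b. cnt b (\<lambda>x. False) = 0)" by (intro dec_intros)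
qed (auto simp: cnt_simps dec_const)

lemma cnt_extend:
  assumes "dec P" "b \<le> b'" "\<And>x. P x \<Longrightarrow> x < b"
  shows "cnt b' P = cnt b P"
proof -
  obtain d where d: "b' = b + d" using assms(2) by (metis add.commute le_add_diff_inverse2)
  have "cnt (b + d) P = cnt b P" for d
  proof (rule dec_induct[of "\<lambda>d. cnt (b + d) P = cnt b P"])
    show "dec (\<lambda>d. cnt (b + d) P = cnt b P)" by (intro dec_intros dec_fn[OF assms(1)])
    fix n assume "cnt (b + n) P = cnt b P"
    moreover have "\<not> P (b + n)" using assms(3)[of "b + n"] by (auto simp: not_less)
    ultimately show "cnt (b + (n + 1)) P = cnt b P"
      by (simp flip: add.assoc add: cnt_simps assms(1))
  qed simp
  then show ?thesis using d by simp
qed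

lemma cnt_single: "c < b \<Longrightarrow> cnt b (\<lambda>x. x = c) = 1"
proof -
  assume "c < b"
  have d: "dec (\<lambda>x. x = c)" by (intro dec_intros)
  have "cnt c (\<lambda>x. x = c) = cnt c (\<lambda>x. False)"
    by (rule cnt_cong[OF d dec_const]) auto
  then have "cnt (c + 1) (\<lambda>x. x = c) = 1" by (simp add: cnt_simps d cnt_False)
  moreover have "cnt b (\<lambda>x. x = c) = cnt (c + 1) (\<lambda>x. x = c)"
    using \<open>c < b\<close> by (intro cnt_extend d) (auto simp: less_iff_Suc_le)
  ultimately show ?thesis by simp
qed

lemma cnt_union:
  assumes "dec P" "dec Q" "\<And>x. x < b \<Longrightarrow> P x \<Longrightarrow> \<not> Q x"
  shows "cnt b (\<lambda>x. P x \<or> Q x) = cnt b P + cnt b Q"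
proof -
  have "cnt b (\<lambda>x. P x \<and> Q x) = cnt b (\<lambda>x. False)"
    using assms by (intro cnt_cong dec_conj dec_const) auto
  then show ?thesis using cnt_disj[OF assms(1,2), of b] by (simp add: cnt_False)
qed

lemma cnt_bij:
  assumes P: "dec P" and Q: "dec Q" and h: "fn h"
    and "\<And>x. x < a \<Longrightarrow> P x \<Longrightarrow> h x < b \<and> Q (h x)"
    and inj: "\<And>x y. x < a \<Longrightarrow> P x \<Longrightarrow> y < a \<Longrightarrow> P y \<Longrightarrow> h x = h y \<Longrightarrow> x = y"
    and sur: "\<And>y. y < b \<Longrightarrow> Q y \<Longrightarrow> \<exists>x. x < a \<and> P x \<and> h x = y"
  shows "cnt a P = cnt b Q"
proof -
  \<comment> \<open>The image under h of the first n arguments; its cardinality is followed as n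
    grows.\<close>
  define I where "I = (\<lambda>n y. Q y \<and> (\<exists>x. x < n \<and> P x \<and> h x = y))"
  have dI: "dec (I n)" for n unfolding I_def by (intro dec_intros dec_fn[OF P] dec_fn[OF Q] fn_comp[OF h])
  have "n \<le> a \<longrightarrow> cnt b (I n) = cnt n P" for n
  proof (rule dec_induct[of "\<lambda>n. n \<le> a \<longrightarrow> cnt b (I n) = cnt n P"])
    show "dec (\<lambda>n. n \<le> a \<longrightarrow> cnt b (I n) = cnt n P)"
      unfolding I_def by (intro dec_intros dec_fn[OF P] dec_fn[OF Q] fn_comp[OF h])
    have "cnt b (I 0) = cnt b (\<lambda>x. False)" by (rule cnt_cong[OF dI dec_const]) (simp add: I_def)
    then show "0 \<le> a \<longrightarrow> cnt b (I 0) = cnt 0 P" by (simp add: cnt_simps P cnt_False)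
    fix n assume IH: "n \<le> a \<longrightarrow> cnt b (I n) = cnt n P"
    show "n + 1 \<le> a \<longrightarrow> cnt b (I (n + 1)) = cnt (n + 1) P"
    proof
      assume "n + 1 \<le> a"
      then have n: "n < a" by (simp add: less_iff_Suc_le)
      show "cnt b (I (n + 1)) = cnt (n + 1) P"
      proof (cases "P n")
        case True
        have ds: "dec (\<lambda>y. y = h n)" by (intro dec_intros)
        have "cnt b (I (n + 1)) = cnt b (\<lambda>y. I n y \<or> y = h n)"
          using assms(4)[OF n True] True by (intro cnt_cong dI dec_disj ds) (auto simp: I_def less_Suc_iff order_le_less)
        also have "\<dots> = cnt b (I n) + cnt b (\<lambda>y. y = h n)"
          using inj[OF order.strict_trans[OF _ n] _ n True] by (intro cnt_union dI ds) (auto simp: I_def)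
        finally show ?thesis using IH n True assms(4)[OF n True] by (simp add: cnt_single cnt_simps P less_imp_le)
      next
        case False
        have "cnt b (I (n + 1)) = cnt b (I n)"
          using False by (intro cnt_cong dI) (auto simp: I_def less_Suc_iff order_le_less)
        then show ?thesis using IH n False by (simp add: cnt_simps P less_imp_le)
      qed
    qed
  qed
  then have "cnt a P = cnt b (I a)" by simp
  also have "\<dots> = cnt b Q" using sur by (intro cnt_cong dI Q) (auto simp: I_def)
  finally show ?thesis .
qed

lemma cnt_product:
  assumes P: "dec P" and Q: "dec Q" and B: "\<And>x y. x < a \<Longrightarrow> y < b \<Longrightarrow> pp x y < B"
  shows "cnt B (\<lambda>z. ispair z \<and> (p1 z < a \<and> P (p1 z)) \<and> p2 z < b \<and> Q (p2 z)) = cnt a P * cnt b Q"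
proof -
  define I where "I = (\<lambda>n z. ispair z \<and> (p1 z < n \<and> P (p1 z)) \<and> p2 z < b \<and> Q (p2 z))"
  have dI: "dec (I n)" for n unfolding I_def by (intro dec_intros dec_fn[OF P] dec_fn[OF Q])
  have "n \<le> a \<longrightarrow> cnt B (I n) = cnt n P * cnt b Q" for n
  proof (rule dec_induct[of "\<lambda>n. n \<le> a \<longrightarrow> cnt B (I n) = cnt n P * cnt b Q"])
    show "dec (\<lambda>n. n \<le> a \<longrightarrow> cnt B (I n) = cnt n P * cnt b Q)"
      unfolding I_def by (intro dec_intros dec_fn[OF P] dec_fn[OF Q])
    have "cnt B (I 0) = cnt B (\<lambda>x. False)" by (rule cnt_cong[OF dI dec_const]) (simp add: I_def)
    then show "0 \<le> a \<longrightarrow> cnt B (I 0) = cnt 0 P * cnt b Q" by (simp add: cnt_simps P cnt_False)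
    fix n assume IH: "n \<le> a \<longrightarrow> cnt B (I n) = cnt n P * cnt b Q"
    show "n + 1 \<le> a \<longrightarrow> cnt B (I (n + 1)) = cnt (n + 1) P * cnt b Q"
    proof
      assume "n + 1 \<le> a"
      then have n: "n < a" by (simp add: less_iff_Suc_le)
      show "cnt B (I (n + 1)) = cnt (n + 1) P * cnt b Q"
      proof (cases "P n")
        case True
        define J where "J = (\<lambda>z. ispair z \<and> p1 z = n \<and> p2 z < b \<and> Q (p2 z))"
        have dJ: "dec J" unfolding J_def by (intro dec_intros dec_fn[OF Q])
        have "cnt B (I (n + 1)) = cnt B (\<lambda>z. I n z \<or> J z)"
          using True by (intro cnt_cong dI dec_disj dJ) (auto simp: I_def J_def less_Suc_iff order_le_less)
        also have "\<dots> = cnt B (I n) + cnt B J"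
          by (intro cnt_union dI dJ) (auto simp: I_def J_def)
        also have "cnt B J = cnt b Q"
        proof (rule cnt_bij[symmetric, OF Q dJ, of "\<lambda>y. pp n y"])
          show "fn (pp n)" by (intro dec_intros)
          show "\<exists>x. x < b \<and> Q x \<and> pp n x = y" if "y < B" "J y" for y
            using that by (auto simp: J_def intro!: exI[of _ "p2 y"])
        qed (use n B in \<open>auto simp: J_def\<close>)
        finally show ?thesis using IH n True by (simp add: cnt_simps P less_imp_le distrib_right)
      next
        case False
        have "cnt B (I (n + 1)) = cnt B (I n)"
          using False by (intro cnt_cong dI) (auto simp: I_def less_Suc_iff order_le_less)
        then show ?thesis using IH n False by (simp add: cnt_simps P less_imp_le)
      qed
    qed
  qed
  then show ?thesis unfolding I_def by blast
qed

text \<open>\<open>cnt x P\<close> is the rank of x within P. Every rank below the total is attained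
  at the argument where the count passes it.\<close>

lemma cnt_enum:
  assumes "dec P" "i < cnt b P"
  shows "\<exists>x. x < b \<and> P x \<and> cnt x P = i"
proof -
  have "i < cnt n P \<longrightarrow> (\<exists>x. x < n \<and> P x \<and> cnt x P = i)" for n
  proof (rule dec_induct[of "\<lambda>n. i < cnt n P \<longrightarrow> (\<exists>x. x < n \<and> P x \<and> cnt x P = i)"])
    show "dec (\<lambda>n. i < cnt n P \<longrightarrow> (\<exists>x. x < n \<and> P x \<and> cnt x P = i))"
      by (intro dec_intros dec_fn[OF assms(1)])
  qed (auto simp: cnt_simps assms(1) less_Suc_iff order_le_less split: if_splits)
  then show ?thesis using assms(2) by blast
qed

lemma cnt_strict_mono:
  assumes "dec P" "x < y" "P x"
  shows "cnt x P < cnt y P"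
proof -
  obtain d where d: "y = x + 1 + d" using assms(2) by (metis add.commute le_add_diff_inverse2 less_iff_Suc_le)
  have "cnt (x + 1) P \<le> cnt (x + 1 + d) P" for d
  proof (rule dec_induct[of "\<lambda>d. cnt (x + 1) P \<le> cnt (x + 1 + d) P"])
    show "dec (\<lambda>d. cnt (x + 1) P \<le> cnt (x + 1 + d) P)" by (intro dec_intros dec_fn[OF assms(1)])
    fix n assume "cnt (x + 1) P \<le> cnt (x + 1 + n) P"
    moreover have "cnt (x + 1 + (n + 1)) P = (if P (x + 1 + n) then cnt (x + 1 + n) P + 1 else cnt (x + 1 + n) P)"
      using cnt_simps(2)[OF assms(1), of "x + 1 + n"] by (simp add: add.assoc)
    ultimately show "cnt (x + 1) P \<le> cnt (x + 1 + (n + 1)) P"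
      by (auto intro: order_trans add_increasing2)
  qed simp
  then have "cnt (x + 1) P \<le> cnt y P" using d by simp
  then show ?thesis using assms(3) by (simp add: cnt_simps assms(1) less_iff_Suc_le)
qed

lemma card_is_iff:
  assumes "dec P" "\<And>x. P x \<Longrightarrow> x < b"
  shows "card_is MM {x. P x} k \<longleftrightarrow> k = cnt b P"
proof
  assume "card_is MM {x. P x} k"
  then obtain s where s: "seq MM s k" "\<And>i j x y. i < j \<Longrightarrow> entry MM s i x \<Longrightarrow> entry MM s j y \<Longrightarrow> x < y"
    "\<And>x. P x \<longleftrightarrow> (\<exists>i. entry MM s i x)"
    by (auto simp: card_is_def)
  have "cnt k (\<lambda>_. True) = cnt b P"
  proof (rule cnt_bij[OF dec_const assms(1), of "at s"])
    show "fn (at s)" by (intro dec_intros)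
    fix x assume "x < k"
    then have "P (at s x)" using entry_at[OF s(1), of x "at s x"] s(3) by auto
    then show "at s x < b \<and> P (at s x)" using assms(2) by blast
  next
    fix x y assume "x < k" "y < k" "at s x = at s y"
    then have e: "entry MM s x (at s x)" "entry MM s y (at s x)" using entry_at[OF s(1)] by auto
    show "x = y" using s(2)[OF _ e] s(2)[OF _ e(2,1)] by (cases x y rule: linorder_cases) auto
  next
    fix y assume "P y"
    then obtain i where i: "entry MM s i y" using s(3) by blast
    then have "i < k" "at s i = y" using entry_at[OF s(1), of i y] seq_dom[OF s(1) i] by auto
    then show "\<exists>x. x < k \<and> True \<and> at s x = y" by blast
  qed
  moreover have "cnt k (\<lambda>_. True) = k"
  proof (rule dec_induct[of "\<lambda>k. cnt k (\<lambda>_. True) = k"])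
    show "dec (\<lambda>k. cnt k (\<lambda>_. True) = k)" by (intro dec_intros)
  qed (simp_all add: cnt_simps dec_const)
  ultimately show "k = cnt b P" by simp
next
  assume k: "k = cnt b P"
  \<comment> \<open>The element of rank i, which enumerates P in increasing order; the default 0
    from k on keeps the search total.\<close>
  define f where "f = (\<lambda>i. LEAST x. (P x \<and> cnt x P = i) \<or> (k \<le> i \<and> x = 0))"
  have d: "dec (\<lambda>x. (P x \<and> cnt x P = i) \<or> (k \<le> i \<and> x = 0))" for i
    by (intro dec_intros dec_fn[OF assms(1)])
  have ex: "\<exists>x. (P x \<and> cnt x P = i) \<or> (k \<le> i \<and> x = 0)" for i
    using cnt_enum[OF assms(1), of i b] k by (cases "i < cnt b P") auto
  have f: "fn f" unfolding f_def using ex by (intro fn_Least dec_intros dec_fn[OF assms(1)])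
  have fi: "P (f i)" "cnt (f i) P = i" if "i < k" for i
  proof -
    obtain x where "(P x \<and> cnt x P = i) \<or> (k \<le> i \<and> x = 0)" using ex by blast
    from dec_LeastI[OF d this] have "(P (f i) \<and> cnt (f i) P = i) \<or> (k \<le> i \<and> f i = 0)"
      unfolding f_def .
    then show "P (f i)" "cnt (f i) P = i" using that by auto
  qed
  have mono: "x < y" if "P x" "P y" "cnt x P < cnt y P" for x y
    using that cnt_strict_mono[OF assms(1), of y x] by (cases x y rule: linorder_cases) auto
  show "card_is MM {x. P x} k"
    unfolding card_is_def MM_simps
  proof (intro exI[of _ "mkseq k f"] conjI allI impI)
    show "seq MM (mkseq k f) k" by (rule seq_mkseq[OF f])
    fix i j x y assume "i < j \<and> entry MM (mkseq k f) i x \<and> entry MM (mkseq k f) j y"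
    then show "x < y" using fi mono by (auto simp: entry_mkseq[OF f])
  next
    fix x
    have "\<exists>i. i < k \<and> x = f i" if "P x"
    proof (intro exI conjI)
      show *: "cnt x P < k" using cnt_strict_mono[OF assms(1) assms(2)[OF that] that] k by simp
      show "x = f (cnt x P)"
        using fi[OF *] that cnt_strict_mono[OF assms(1), of x "f (cnt x P)"]
          cnt_strict_mono[OF assms(1), of "f (cnt x P)" x] by (cases x "f (cnt x P)" rule: linorder_cases) auto
    qed
    then show "x \<in> {x. P x} \<longleftrightarrow> (\<exists>i. entry MM (mkseq k f) i x)"
      using fi by (auto simp: entry_mkseq[OF f])
  qed
qed


section \<open>Strings, cylinders, and measure by counting\<close>

section \<open>Binary strings\<close>

abbreviation bs :: "'a::rca \<Rightarrow> 'a \<Rightarrow> bool" where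
  "bs \<equiv> bin_string MM"

definition bit :: "'a::rca \<Rightarrow> 'a \<Rightarrow> bool" where
  "bit \<sigma> i \<longleftrightarrow> entry MM \<sigma> i 1"

lemma dec_bit [dec_intros]: "fn f \<Longrightarrow> fn g \<Longrightarrow> dec (\<lambda>x. bit (f x) (g x))"
  unfolding bit_def by (intro dec_intros)

lemma bs_seq: "bs \<sigma> l \<Longrightarrow> seq MM \<sigma> l"
  by (simp add: bin_string_def)

lemma bs_iff: "bs \<sigma> l \<longleftrightarrow> seq MM \<sigma> l \<and> (\<forall>i. i < l \<longrightarrow> at \<sigma> i = 0 \<or> at \<sigma> i = 1)"
proof (cases "seq MM \<sigma> l")
  case True
  have "(\<forall>i v. entry MM \<sigma> i v \<longrightarrow> v = 0 \<or> v = 1) \<longleftrightarrow> (\<forall>i. i < l \<longrightarrow> at \<sigma> i = 0 \<or> at \<sigma> i = 1)"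
  proof (intro iffI allI impI)
    fix i assume "\<forall>i v. entry MM \<sigma> i v \<longrightarrow> v = 0 \<or> v = 1" "i < l"
    then show "at \<sigma> i = 0 \<or> at \<sigma> i = 1" using entry_at[OF True, of i "at \<sigma> i"] by blast
  next
    fix i v assume "\<forall>i. i < l \<longrightarrow> at \<sigma> i = 0 \<or> at \<sigma> i = 1" "entry MM \<sigma> i v"
    then show "v = 0 \<or> v = 1" using entry_at[OF True, of i v] seq_dom[OF True] by blast
  qed
  then show ?thesis using True by (simp add: bin_string_def)
qed (simp add: bin_string_def)

lemma dec_bs [dec_intros]: "fn f \<Longrightarrow> fn g \<Longrightarrow> dec (\<lambda>x. bs (f x) (g x))"
  by (rule dec2_comp[of bs]; (assumption | (unfold bs_iff; intro dec_intros)))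

lemma bs_entry:
  assumes "bs \<sigma> l"
  shows "entry MM \<sigma> i v \<longleftrightarrow> i < l \<and> v = (if bit \<sigma> i then 1 else 0)"
proof
  note s = bs_seq[OF assms]
  assume e: "entry MM \<sigma> i v"
  then have "v = 0 \<or> v = 1" using assms by (auto simp: bin_string_def)
  then show "i < l \<and> v = (if bit \<sigma> i then 1 else 0)"
    using e seq_dom[OF s e] seq_fun[OF s e, of 1] by (auto simp: bit_def)
next
  note s = bs_seq[OF assms]
  assume i: "i < l \<and> v = (if bit \<sigma> i then 1 else 0)"
  then obtain v' where v': "entry MM \<sigma> i v'" using seq_ex[OF s] by blast
  then have "v' = 0 \<or> v' = 1" using assms by (auto simp: bin_string_def)
  then show "entry MM \<sigma> i v" using v' i seq_fun[OF s v', of 1] by (auto simp: bit_def)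
qed

lemma bs_ext: "bs \<sigma> l \<Longrightarrow> bs \<tau> l \<Longrightarrow> (\<And>i. i < l \<Longrightarrow> bit \<sigma> i \<longleftrightarrow> bit \<tau> i) \<Longrightarrow> \<sigma> = \<tau>"
  by (rule seq_ext[OF bs_seq bs_seq]) (auto simp: bs_entry)

lemma bit_less: "bs \<sigma> l \<Longrightarrow> bit \<sigma> i \<Longrightarrow> i < l"
  using bs_entry[of \<sigma> l i 1] by (simp add: bit_def)

lemma bs_unique: "bs \<sigma> l \<Longrightarrow> bs \<sigma> l' \<Longrightarrow> l = l'"
  using seq_length_unique bs_seq by blast

lemma bs_slen: "bs \<sigma> l \<Longrightarrow> slen \<sigma> = l"
  by (simp add: slen bs_seq)

lemma bs_length_le: "bs \<sigma> l \<Longrightarrow> l \<le> \<sigma>"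
  by (simp add: seq_length_le bs_seq)

definition mk :: "'a::rca \<Rightarrow> ('a \<Rightarrow> bool) \<Rightarrow> 'a" where
  "mk L P = mkseq L (\<lambda>i. if P i then 1 else 0)"

lemma mk:
  assumes "dec P"
  shows bs_mk: "bs (mk L P) L" and bit_mk: "bit (mk L P) i \<longleftrightarrow> i < L \<and> P i"
proof -
  have f: "fn (\<lambda>i. if P i then 1 else 0 :: 'a)" by (intro dec_intros assms)
  show "bs (mk L P) L" using seq_mkseq[OF f] by (auto simp: bin_string_def mk_def entry_mkseq[OF f])
  show "bit (mk L P) i \<longleftrightarrow> i < L \<and> P i" by (simp add: bit_def mk_def entry_mkseq[OF f])
qed

lemma fn_mk [dec_intros]: "fn L \<Longrightarrow> dec2 P \<Longrightarrow> fn (\<lambda>x. mk (L x) (P x))"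
  unfolding mk_def by (intro dec_intros)

text \<open>Bits past the end of a string count as 0, so a longer string is truncated and a shorter
  one padded with zeros.\<close>

definition res :: "'a::rca \<Rightarrow> 'a \<Rightarrow> 'a" where
  "res n \<sigma> = mk n (bit \<sigma>)"

lemma fn_res [dec_intros]: "fn f \<Longrightarrow> fn g \<Longrightarrow> fn (\<lambda>x. res (f x) (g x))"
  by (rule fn2_comp[of res]; (assumption | (unfold res_def; intro dec_intros)))

lemma dec_bit1: "dec (bit \<sigma>)"
  by (intro dec_intros)

lemma bs_res [simp]: "bs (res n \<sigma>) n"
  by (simp add: res_def bs_mk dec_bit1)

lemma bit_res [simp]: "bit (res n \<sigma>) i \<longleftrightarrow> i < n \<and> bit \<sigma> i"
  by (simp add: res_def bit_mk dec_bit1)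

lemma res_res: "n \<le> m \<Longrightarrow> res n (res m \<sigma>) = res n \<sigma>"
  by (rule bs_ext[of _ n]) auto

text \<open>The elements of a binary string of length l are pairs (i, v) with i < l and v \<le> 1,
  all below \<open>pp l 1 + 1\<close>.\<close>

definition SB :: "'a::rca \<Rightarrow> 'a" where
  "SB l = codeB (pp l 1 + 1)"

lemma fn_SB [dec_intros]: "fn f \<Longrightarrow> fn (\<lambda>x. SB (f x))"
  unfolding SB_def by (intro dec_intros)

lemma seq_bound:
  assumes "seq MM s l" "\<And>i v. entry MM s i v \<Longrightarrow> v \<le> m"
  shows "s < codeB (pp l m + 1)"
proof -
  have d: "dec (\<lambda>x. fmem x s)" by (intro dec_intros)
  have "s = mkset (pp l m + 1) (\<lambda>x. fmem x s)"
  proof (rule fset_ext)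
    show "fin_set MM s" using assms by (simp add: seq_def)
    show "fin_set MM (mkset (pp l m + 1) (\<lambda>x. fmem x s))" by (rule fin_set_mkset[OF d])
    fix x
    have "x < pp l m + 1" if x: "fmem x s"
    proof -
      obtain i v where iv: "x = pp i v" "i < l" using assms(1) x by (auto simp: seq_def fin_mem_iff)
      then have "v \<le> m" using assms(2) x by (simp add: entry_iff)
      then show ?thesis using iv by (simp add: less_Suc_iff pp_mono)
    qed
    then show "fmem x s \<longleftrightarrow> fmem x (mkset (pp l m + 1) (\<lambda>x. fmem x s))"
      by (auto simp: fmem_mkset[OF d])
  qed
  then show ?thesis using mkset_less[OF d, of "pp l m + 1"] by simp
qed

lemma bs_less_SB: "bs \<sigma> l \<Longrightarrow> \<sigma> < SB l"
  unfolding SB_def by (rule seq_bound) (auto simp: bs_seq bs_entry)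

lemma prefix_iff:
  assumes "bs \<sigma> l" "bs \<tau> m"
  shows "prefix MM \<sigma> \<tau> \<longleftrightarrow> l \<le> m \<and> (\<forall>i. i < l \<longrightarrow> (bit \<sigma> i \<longleftrightarrow> bit \<tau> i))"
proof
  assume p: "prefix MM \<sigma> \<tau>"
  have *: "i < m \<and> (bit \<sigma> i \<longleftrightarrow> bit \<tau> i)" if "i < l" for i
  proof -
    have "entry MM \<sigma> i (if bit \<sigma> i then 1 else 0)" using that by (simp add: bs_entry[OF assms(1)])
    then have "entry MM \<tau> i (if bit \<sigma> i then 1 else 0)" using p unfolding prefix_def by blast
    then show ?thesis unfolding bs_entry[OF assms(2)] by (auto split: if_splits)
  qed
  have "l \<le> m"
    using zero_or_Suc[of l] *[of "l - 1"] * by (auto simp: less_Suc_iff) (metis less_Suc_iff less_iff_Suc_le order_refl)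
  then show "l \<le> m \<and> (\<forall>i. i < l \<longrightarrow> (bit \<sigma> i \<longleftrightarrow> bit \<tau> i))" using * by blast
next
  assume "l \<le> m \<and> (\<forall>i. i < l \<longrightarrow> (bit \<sigma> i \<longleftrightarrow> bit \<tau> i))"
  then show "prefix MM \<sigma> \<tau>"
    unfolding prefix_def by (auto simp: bs_entry[OF assms(1)] bs_entry[OF assms(2)])
qed

lemma prefix_bounded: "prefix MM \<sigma> \<tau> \<longleftrightarrow> (\<forall>i. i < \<sigma> \<longrightarrow> (\<forall>v. v < \<sigma> \<longrightarrow> entry MM \<sigma> i v \<longrightarrow> entry MM \<tau> i v))"
  unfolding prefix_def using entry_less by blast

lemma dec_prefix [dec_intros]: "fn f \<Longrightarrow> fn g \<Longrightarrow> dec (\<lambda>x. prefix MM (f x) (g x))"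
  by (rule dec2_comp[of "prefix MM"]; (assumption | (unfold prefix_bounded; intro dec_intros)))

lemma prefix_refl: "prefix MM \<sigma> \<sigma>"
  by (simp add: prefix_def)

lemma prefix_trans: "prefix MM \<sigma> \<tau> \<Longrightarrow> prefix MM \<tau> \<rho> \<Longrightarrow> prefix MM \<sigma> \<rho>"
  by (simp add: prefix_def)

lemma prefix_res: "bs \<tau> l \<Longrightarrow> n \<le> l \<Longrightarrow> prefix MM (res n \<tau>) \<tau>"
  by (simp add: prefix_iff[of _ n _ l])

lemma prefix_eq_res: "bs \<sigma> n \<Longrightarrow> bs \<tau> l \<Longrightarrow> prefix MM \<sigma> \<tau> \<Longrightarrow> n \<le> l \<and> res n \<tau> = \<sigma>"
  by (auto simp: prefix_iff intro: bs_ext[of _ n])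

lemma init_seg_iff:
  assumes "bs \<sigma> l"
  shows "init_seg MM \<sigma> Y \<longleftrightarrow> (\<forall>i. i < l \<longrightarrow> (bit \<sigma> i \<longleftrightarrow> i \<in> Y))"
  unfolding init_seg_def bit_def[symmetric] MM_simps using assms bs_unique[OF assms] by blast

lemma init_seg_bs: "init_seg MM \<sigma> Y \<Longrightarrow> \<exists>l. bs \<sigma> l"
  unfolding init_seg_def by blast

lemma ex_bs_iff: "(\<exists>l. bs \<sigma> l) \<longleftrightarrow> bs \<sigma> (slen \<sigma>)"
  using bs_slen by blast

lemma init_seg_iff2: "init_seg MM \<sigma> Y \<longleftrightarrow> bs \<sigma> (slen \<sigma>) \<and> (\<forall>i. i < slen \<sigma> \<longrightarrow> (bit \<sigma> i \<longleftrightarrow> i \<in> Y))"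
  using init_seg_iff init_seg_bs ex_bs_iff by metis

lemma dec_init_seg [dec_intros]: "Y \<in> SS \<Longrightarrow> fn f \<Longrightarrow> dec (\<lambda>x. init_seg MM (f x) Y)"
  unfolding init_seg_iff2 by (rule dec_fn[of "\<lambda>\<sigma>. bs \<sigma> (slen \<sigma>) \<and> (\<forall>i. i < slen \<sigma> \<longrightarrow> (bit \<sigma> i \<longleftrightarrow> i \<in> Y))"];
    (assumption | intro dec_intros))

lemma init_seg_ex: "Y \<in> SS \<Longrightarrow> \<exists>\<sigma>. bs \<sigma> l \<and> init_seg MM \<sigma> Y"
proof -
  assume Y: "Y \<in> SS"
  have d: "dec (\<lambda>i. i \<in> Y)" by (intro dec_intros Y)
  have "bs (mk l (\<lambda>i. i \<in> Y)) l" by (rule bs_mk[OF d])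
  then show ?thesis using init_seg_iff bit_mk[OF d] by blast
qed

lemma init_seg_prefix: "init_seg MM \<tau> Y \<Longrightarrow> bs \<sigma> l \<Longrightarrow> prefix MM \<sigma> \<tau> \<Longrightarrow> init_seg MM \<sigma> Y"
proof -
  assume t: "init_seg MM \<tau> Y" and s: "bs \<sigma> l" "prefix MM \<sigma> \<tau>"
  obtain m where m: "bs \<tau> m" using t init_seg_bs by blast
  show ?thesis
    using t s(2) unfolding init_seg_iff[OF m] init_seg_iff[OF s(1)] prefix_iff[OF s(1) m] by auto
qed

lemma init_seg_linear:
  assumes "init_seg MM \<sigma> Y" "init_seg MM \<tau> Y" "bs \<sigma> l" "bs \<tau> m" "l \<le> m"
  shows "prefix MM \<sigma> \<tau>"
  using assms unfolding prefix_iff[OF assms(3,4)] init_seg_iff[OF assms(3)] init_seg_iff[OF assms(4)] by auto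

text \<open>The string followed by zeros: a point of the model that witnesses that cylinders are
  nonempty.\<close>

definition support :: "'a::rca \<Rightarrow> 'a set" where
  "support \<sigma> = {i. bit \<sigma> i}"

lemma support: "support \<sigma> \<in> SS" "bs \<sigma> l \<Longrightarrow> init_seg MM \<sigma> (support \<sigma>)"
proof -
  show "support \<sigma> \<in> SS" using dec_bit1[of \<sigma>] by (simp add: support_def dec_def)
qed (simp add: init_seg_iff support_def)

lemma mem_cyl: "Y \<in> cyl MM \<sigma> \<longleftrightarrow> Y \<in> SS \<and> init_seg MM \<sigma> Y"
  by (simp add: cyl_def)

lemma support_in_cyl: "bs \<sigma> l \<Longrightarrow> support \<sigma> \<in> cyl MM \<sigma>"
  by (simp add: mem_cyl support)

text \<open>The cylinder of \<sigma> contains points that differ at position l, the length of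
  \<sigma>. Both lie in the cylinder of \<tau>, so \<tau> cannot be longer than \<sigma>.\<close>

lemma cyl_subset_prefix:
  assumes \<sigma>: "bs \<sigma> l" and \<tau>: "bs \<tau> m" and "cyl MM \<sigma> \<subseteq> cyl MM \<tau>"
  shows "prefix MM \<tau> \<sigma>"
proof -
  have "init_seg MM \<tau> (support \<sigma>)" using support_in_cyl[OF \<sigma>] assms(3) by (auto simp: mem_cyl)
  then have 1: "\<And>i. i < m \<Longrightarrow> bit \<tau> i \<longleftrightarrow> bit \<sigma> i" by (simp add: init_seg_iff[OF \<tau>] support_def)
  have "m \<le> l"
  proof (rule ccontr)
    assume "\<not> m \<le> l"
    then have "l < m" by simp
    have "dec (\<lambda>i. bit \<sigma> i \<or> i = l)" by (intro dec_intros)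
    moreover have "\<forall>i. i < l \<longrightarrow> (bit \<sigma> i \<longleftrightarrow> i \<in> {i. bit \<sigma> i \<or> i = l})" by auto
    ultimately have "{i. bit \<sigma> i \<or> i = l} \<in> cyl MM \<sigma>"
      unfolding mem_cyl init_seg_iff[OF \<sigma>] dec_def by blast
    then have "init_seg MM \<tau> {i. bit \<sigma> i \<or> i = l}" using assms(3) unfolding mem_cyl[symmetric] by (auto simp: mem_cyl)
    then have "bit \<tau> l" using \<open>l < m\<close> by (simp add: init_seg_iff[OF \<tau>])
    then show False using 1[OF \<open>l < m\<close>] bit_less[OF \<sigma>, of l] by simp
  qed
  then show ?thesis using 1 by (simp add: prefix_iff[OF \<tau> \<sigma>])
qed


section \<open>Counting strings\<close>

text \<open>\<open>nstr L Q / pw L\<close> is the measure of the clopen set that Q describes at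
  level L. All measure estimates become inequalities between such counts.\<close>

definition nstr :: "'a::rca \<Rightarrow> ('a \<Rightarrow> bool) \<Rightarrow> 'a" where
  "nstr L Q = cnt (SB L) (\<lambda>\<tau>. bs \<tau> L \<and> Q \<tau>)"

lemma fn_nstr [dec_intros]:
  assumes "fn L" "dec2 Q"
  shows "fn (\<lambda>x. nstr (L x) (Q x))"
  unfolding nstr_def by (intro dec_intros assms fn_comp[OF assms(1)])

lemma dec_bsP: "dec P \<Longrightarrow> dec (\<lambda>\<tau>. bs \<tau> L \<and> P \<tau>)"
  by (intro dec_conj dec_intros)

lemma nstr_mono:
  assumes "dec P" "dec Q" "\<And>\<tau>. bs \<tau> L \<Longrightarrow> P \<tau> \<Longrightarrow> Q \<tau>"
  shows "nstr L P \<le> nstr L Q"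
  unfolding nstr_def using assms(3) by (intro cnt_mono dec_bsP assms(1,2)) auto

lemma nstr_cong:
  assumes "dec P" "dec Q" "\<And>\<tau>. bs \<tau> L \<Longrightarrow> P \<tau> \<longleftrightarrow> Q \<tau>"
  shows "nstr L P = nstr L Q"
  unfolding nstr_def using assms(3) by (intro cnt_cong dec_bsP assms(1,2)) auto

lemma nstr_False: "nstr L (\<lambda>_. False) = 0"
  by (simp add: nstr_def cnt_False)

lemma nstr_disj_le:
  assumes "dec P" "dec Q"
  shows "nstr L (\<lambda>\<tau>. P \<tau> \<or> Q \<tau>) \<le> nstr L P + nstr L Q"
proof -
  note d = dec_bsP[OF assms(1), of L] dec_bsP[OF assms(2), of L]
  have "nstr L (\<lambda>\<tau>. P \<tau> \<or> Q \<tau>) = cnt (SB L) (\<lambda>\<tau>. (bs \<tau> L \<and> P \<tau>) \<or> (bs \<tau> L \<and> Q \<tau>))"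
    unfolding nstr_def by (intro cnt_cong dec_disj dec_bsP assms) auto
  also have "\<dots> \<le> \<dots> + cnt (SB L) (\<lambda>\<tau>. (bs \<tau> L \<and> P \<tau>) \<and> (bs \<tau> L \<and> Q \<tau>))" by simp
  also have "\<dots> = nstr L P + nstr L Q" unfolding nstr_def by (rule cnt_disj[OF d])
  finally show ?thesis .
qed

lemma nstr_split:
  assumes "dec P" "dec Q"
  shows "nstr L P = nstr L (\<lambda>\<tau>. P \<tau> \<and> Q \<tau>) + nstr L (\<lambda>\<tau>. P \<tau> \<and> \<not> Q \<tau>)"
proof -
  note d = dec_bsP[OF dec_conj[OF assms], of L] dec_bsP[OF dec_conj[OF assms(1) dec_not[OF assms(2)]], of L]
  have "nstr L P = cnt (SB L) (\<lambda>\<tau>. (bs \<tau> L \<and> P \<tau> \<and> Q \<tau>) \<or> (bs \<tau> L \<and> P \<tau> \<and> \<not> Q \<tau>))"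
    unfolding nstr_def by (intro cnt_cong dec_disj d dec_bsP assms) auto
  also have "\<dots> = nstr L (\<lambda>\<tau>. P \<tau> \<and> Q \<tau>) + nstr L (\<lambda>\<tau>. P \<tau> \<and> \<not> Q \<tau>)"
    unfolding nstr_def by (intro cnt_union d) auto
  finally show ?thesis .
qed

lemma nstr_bij:
  assumes "dec P" "dec Q" "fn h"
    and "\<And>\<tau>. bs \<tau> L \<Longrightarrow> P \<tau> \<Longrightarrow> bs (h \<tau>) L' \<and> Q (h \<tau>)"
    and "\<And>\<tau> \<tau>'. bs \<tau> L \<Longrightarrow> P \<tau> \<Longrightarrow> bs \<tau>' L \<Longrightarrow> P \<tau>' \<Longrightarrow> h \<tau> = h \<tau>' \<Longrightarrow> \<tau> = \<tau>'"
    and "\<And>\<tau>. bs \<tau> L' \<Longrightarrow> Q \<tau> \<Longrightarrow> \<exists>\<tau>'. bs \<tau>' L \<and> P \<tau>' \<and> h \<tau>' = \<tau>"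
  shows "nstr L P = nstr L' Q"
  unfolding nstr_def
proof (rule cnt_bij[OF dec_bsP[OF assms(1)] dec_bsP[OF assms(2)] assms(3)])
  show "h x < SB L' \<and> bs (h x) L' \<and> Q (h x)" if "bs x L \<and> P x" for x
    using assms(4)[of x] that bs_less_SB by blast
  show "x = y" if "bs x L \<and> P x" "bs y L \<and> P y" "h x = h y" for x y
    using assms(5)[of x y] that by blast
  show "\<exists>x. x < SB L \<and> (bs x L \<and> P x) \<and> h x = y" if "bs y L' \<and> Q y" for y
    using assms(6)[of y] that bs_less_SB by blast
qed

lemma nstr_all: "nstr L (\<lambda>_. True) = pw L"
proof (rule dec_induct[of "\<lambda>L. nstr L (\<lambda>_. True) = pw L"])
  show "dec (\<lambda>L. nstr L (\<lambda>_. True) = pw L)" by (intro dec_intros)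
  have e: "bs \<tau> 0 \<Longrightarrow> \<tau> = res 0 0" for \<tau> :: 'a by (rule bs_ext[of _ 0]) auto
  have "nstr 0 (\<lambda>_. True) = cnt (SB 0) (\<lambda>\<tau>. \<tau> = res 0 (0 :: 'a))"
    unfolding nstr_def by (intro cnt_cong dec_intros) (use e bs_res in blast)
  also have "\<dots> = 1" by (rule cnt_single, rule bs_less_SB, rule bs_res)
  finally show "nstr 0 (\<lambda>_. True) = pw (0 :: 'a)" by simp
next
  fix L :: 'a assume IH: "nstr L (\<lambda>_. True) = pw L"
  have d: "dec (\<lambda>\<tau>. bit \<tau> L)" "dec (\<lambda>\<tau>. \<not> bit \<tau> L)" by (intro dec_intros)+
  \<comment> \<open>Appending a 1, or a 0 by the padding of \<open>res\<close>, matches the strings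
    of length L with either half of those of length L + 1.\<close>
  define h where "h = (\<lambda>\<tau>. mk (L + 1) (\<lambda>i. bit \<tau> i \<or> i = L))"
  have i1: "dec (\<lambda>i. bit \<tau> i \<or> i = L)" for \<tau> by (intro dec_intros)
  have h: "bs (h \<tau>) (L + 1)" "bit (h \<tau>) i \<longleftrightarrow> i < L + 1 \<and> (bit \<tau> i \<or> i = L)" for \<tau> i
    by (simp_all add: h_def bs_mk[OF i1] bit_mk[OF i1])
  have "nstr L (\<lambda>_. True) = nstr (L + 1) (\<lambda>\<tau>. bit \<tau> L)"
  proof (rule nstr_bij[OF dec_const d(1), of h])
    show "fn h" unfolding h_def by (intro dec_intros)
    show "\<tau> = \<tau>'" if "bs \<tau> L" "bs \<tau>' L" "h \<tau> = h \<tau>'" for \<tau> \<tau>'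
    proof (rule bs_ext[OF that(1,2)])
      fix i assume "i < L"
      then show "bit \<tau> i = bit \<tau>' i" using h(2)[of \<tau> i] h(2)[of \<tau>' i] that(3)
        by (auto simp: less_Suc_iff)
    qed
    show "\<exists>\<tau>'. bs \<tau>' L \<and> True \<and> h \<tau>' = \<tau>" if "bs \<tau> (L + 1)" "bit \<tau> L" for \<tau>
      by (intro exI[of _ "res L \<tau>"] conjI bs_ext[OF h(1) that(1)])
        (use that in \<open>auto simp: h less_Suc_iff order_le_less\<close>)
  qed (simp_all add: h less_Suc_iff)
  moreover have "nstr L (\<lambda>_. True) = nstr (L + 1) (\<lambda>\<tau>. \<not> bit \<tau> L)"
  proof (rule nstr_bij[OF dec_const d(2), of "res (L + 1)"])
    show "fn (res (L + 1))" by (intro dec_intros)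
    show "\<tau> = \<tau>'" if "bs \<tau> L" "bs \<tau>' L" "res (L + 1) \<tau> = res (L + 1) \<tau>'" for \<tau> \<tau>'
    proof (rule bs_ext[OF that(1,2)])
      fix i assume "i < L"
      then show "bit \<tau> i = bit \<tau>' i" using bit_res[of "L + 1" \<tau> i] bit_res[of "L + 1" \<tau>' i] that(3)
        by (auto simp: less_Suc_iff)
    qed
    show "\<exists>\<tau>'. bs \<tau>' L \<and> True \<and> res (L + 1) \<tau>' = \<tau>" if "bs \<tau> (L + 1)" "\<not> bit \<tau> L" for \<tau>
      by (intro exI[of _ "res L \<tau>"] conjI bs_ext[of _ "L + 1"] bs_res that(1))
        (use that in \<open>auto simp: less_Suc_iff order_le_less\<close>)
  qed (auto dest: bit_less)
  moreover have "nstr (L + 1) (\<lambda>_. True) = nstr (L + 1) (\<lambda>\<tau>. bit \<tau> L) + nstr (L + 1) (\<lambda>\<tau>. \<not> bit \<tau> L)"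
    using nstr_split[OF dec_const[of True] d(1)] by simp
  ultimately show "nstr (L + 1) (\<lambda>_. True) = pw (L + 1)" using IH by simp
qed

lemma nstr_le: "dec P \<Longrightarrow> nstr L P \<le> pw L"
  using nstr_mono[OF _ dec_const[of True], of P L] by (simp add: nstr_all)

lemma nstr_compl: "dec P \<Longrightarrow> nstr L P + nstr L (\<lambda>\<tau>. \<not> P \<tau>) = pw L"
  using nstr_split[OF dec_const[of True], of P L] by (simp add: nstr_all)

text \<open>Exchanging parts of two strings is a map on pairs that is its own inverse, hence a
  bijection between the pairs counted on the two sides. Projection and independence are both
  instances.\<close>

lemma nstr_pairs:
  assumes d: "dec A" "dec B" "dec C" "dec D"
    and f: "fn (\<lambda>z. f (p1 z) (p2 z))" and g: "fn (\<lambda>z. g (p1 z) (p2 z))"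
    and str: "\<And>\<sigma> \<tau>. bs \<sigma> L \<Longrightarrow> bs \<tau> n \<Longrightarrow> bs (f \<sigma> \<tau>) L \<and> bs (g \<sigma> \<tau>) n"
    and inv: "\<And>\<sigma> \<tau>. bs \<sigma> L \<Longrightarrow> bs \<tau> n \<Longrightarrow> f (f \<sigma> \<tau>) (g \<sigma> \<tau>) = \<sigma> \<and> g (f \<sigma> \<tau>) (g \<sigma> \<tau>) = \<tau>"
    and iff: "\<And>\<sigma> \<tau>. bs \<sigma> L \<Longrightarrow> bs \<tau> n \<Longrightarrow> A \<sigma> \<and> B \<tau> \<longleftrightarrow> C (f \<sigma> \<tau>) \<and> D (g \<sigma> \<tau>)"
  shows "nstr L A * nstr n B = nstr L C * nstr n D"
proof -
  let ?b = "pp (SB L) (SB n)"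
  let ?S = "\<lambda>A B z. ispair z \<and> (p1 z < SB L \<and> bs (p1 z) L \<and> A (p1 z)) \<and> p2 z < SB n \<and> bs (p2 z) n \<and> B (p2 z)"
  have b: "pp x y < ?b" if "x < SB L" "y < SB n" for x y
    using pp_mono[of x "SB L" y "SB n"] that pp_inject[of x y "SB L" "SB n"] by (auto simp: less_imp_le order_less_le)
  have S: "dec (?S A B)" if "dec A" "dec B" for A B
    by (intro dec_intros dec_fn[OF that(1)] dec_fn[OF that(2)])
  have "cnt ?b (?S A B) = cnt ?b (?S C D)"
  proof (rule cnt_bij[OF S[OF d(1,2)] S[OF d(3,4)], of "\<lambda>z. pp (f (p1 z) (p2 z)) (g (p1 z) (p2 z))"])
    show "fn (\<lambda>z. pp (f (p1 z) (p2 z)) (g (p1 z) (p2 z)))" by (intro dec_intros f g)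
    fix x assume "?S A B x"
    then have x: "bs (p1 x) L" "bs (p2 x) n" "A (p1 x)" "B (p2 x)" by auto
    then show "pp (f (p1 x) (p2 x)) (g (p1 x) (p2 x)) < ?b \<and> ?S C D (pp (f (p1 x) (p2 x)) (g (p1 x) (p2 x)))"
      using str[OF x(1,2)] iff[OF x(1,2)] b by (simp add: bs_less_SB)
  next
    fix x y assume "?S A B x" "?S A B y" and e: "pp (f (p1 x) (p2 x)) (g (p1 x) (p2 x)) = pp (f (p1 y) (p2 y)) (g (p1 y) (p2 y))"
    then have x: "bs (p1 x) L" "bs (p2 x) n" and y: "bs (p1 y) L" "bs (p2 y) n" and xy: "ispair x" "ispair y" by auto
    have fe: "f (p1 x) (p2 x) = f (p1 y) (p2 y)" "g (p1 x) (p2 x) = g (p1 y) (p2 y)" using e by simp_all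
    have "p1 x = p1 y \<and> p2 x = p2 y" using inv[OF x] inv[OF y] unfolding fe by simp
    then have "pp (p1 x) (p2 x) = pp (p1 y) (p2 y)" by (simp del: pp_p)
    then show "x = y" unfolding pp_p[OF xy(1)] pp_p[OF xy(2)] .
  next
    fix y assume "?S C D y"
    then have y: "bs (p1 y) L" "bs (p2 y) n" "C (p1 y)" "D (p2 y)" "ispair y" by auto
    let ?s = "f (p1 y) (p2 y)" and ?t = "g (p1 y) (p2 y)"
    note st = str[OF y(1,2)] and iv = inv[OF y(1,2)]
    have "A ?s \<and> B ?t" using iff[of ?s ?t] st iv y by simp
    then have "?S A B (pp ?s ?t)" using st by (simp add: bs_less_SB)
    moreover have "pp ?s ?t < ?b" using b st bs_less_SB by blast
    moreover have "pp (f (p1 (pp ?s ?t)) (p2 (pp ?s ?t))) (g (p1 (pp ?s ?t)) (p2 (pp ?s ?t))) = y"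
      using iv y(5) by simp
    ultimately show "\<exists>x. x < ?b \<and> ?S A B x \<and> pp (f (p1 x) (p2 x)) (g (p1 x) (p2 x)) = y" by blast
  qed
  moreover have "cnt ?b (?S A B) = nstr L A * nstr n B" if "dec A" "dec B" for A B
    unfolding nstr_def using cnt_product[OF dec_bsP[OF that(1)] dec_bsP[OF that(2)] b] by simp
  ultimately show ?thesis using d by simp
qed

text \<open>The projection to the positions e i maps the uniform measure to the uniform measure:
  swap the bits of \<sigma> at these positions with those of \<tau>. The case of the identity is
  restriction to a shorter length; \<open>e = pp m\<close> selects a column.\<close>

lemma nstr_proj:
  assumes e: "fn e" "inj e" "\<And>i. i < n \<Longrightarrow> e i < L" and U: "dec U"
  shows "nstr L (\<lambda>\<sigma>. U (mk n (\<lambda>i. bit \<sigma> (e i)))) * pw n = pw L * nstr n U"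
proof -
  define f where "f = (\<lambda>\<sigma> \<tau>. mk L (\<lambda>i. (\<exists>j. j < n \<and> i = e j \<and> bit \<tau> j) \<or> ((\<forall>j. j < n \<longrightarrow> i \<noteq> e j) \<and> bit \<sigma> i)))"
  define g where "g = (\<lambda>\<sigma>. mk n (\<lambda>i. bit \<sigma> (e i)))"
  have df: "dec (\<lambda>i. (\<exists>j. j < n \<and> i = e j \<and> bit \<tau> j) \<or> ((\<forall>j. j < n \<longrightarrow> i \<noteq> e j) \<and> bit \<sigma> i))" for \<sigma> \<tau>
    by (intro dec_intros fn_comp[OF e(1)])
  have dg: "dec (\<lambda>i. bit \<sigma> (e i))" for \<sigma> by (intro dec_intros fn_comp[OF e(1)])
  have f: "bs (f \<sigma> \<tau>) L" "bit (f \<sigma> \<tau>) i \<longleftrightarrow> i < L \<and> ((\<exists>j. j < n \<and> i = e j \<and> bit \<tau> j) \<or> ((\<forall>j. j < n \<longrightarrow> i \<noteq> e j) \<and> bit \<sigma> i))" for \<sigma> \<tau> i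
    by (simp_all add: f_def bs_mk[OF df] bit_mk[OF df])
  have g: "bs (g \<sigma>) n" "bit (g \<sigma>) i \<longleftrightarrow> i < n \<and> bit \<sigma> (e i)" for \<sigma> i
    by (simp_all add: g_def bs_mk[OF dg] bit_mk[OF dg])
  have fng: "fn g" unfolding g_def by (intro dec_intros fn_comp[OF e(1)])
  have ei: "e i = e j \<longleftrightarrow> i = j" for i j using e(2) by (auto simp: inj_def)
  have "nstr L (\<lambda>\<sigma>. U (g \<sigma>)) * nstr n (\<lambda>_. True) = nstr L (\<lambda>_. True) * nstr n U"
  proof (rule nstr_pairs[where f = f and g = "\<lambda>\<sigma> \<tau>. g \<sigma>"])
    show "dec (\<lambda>\<sigma>. U (g \<sigma>))" by (rule dec_fn[OF U fng])
    show "fn (\<lambda>z. f (p1 z) (p2 z))" unfolding f_def by (intro dec_intros fn_comp[OF e(1)])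
    show "fn (\<lambda>z. g (p1 z))" by (intro fn_comp[OF fng] dec_intros)
    show "bs (f \<sigma> \<tau>) L \<and> bs (g \<sigma>) n" for \<sigma> \<tau> by (simp add: f g)
    have gf: "g (f \<sigma> \<tau>) = \<tau>" if "bs \<tau> n" for \<sigma> \<tau>
      using e(3) by (intro bs_ext[OF g(1) that]) (auto simp: f g ei)
    show "f (f \<sigma> \<tau>) (g \<sigma>) = \<sigma> \<and> g (f \<sigma> \<tau>) = \<tau>" if "bs \<sigma> L" "bs \<tau> n" for \<sigma> \<tau>
      by (intro conjI gf that bs_ext[OF f(1) that(1)]) (auto simp: f g)
    show "U (g \<sigma>) \<and> True \<longleftrightarrow> True \<and> U (g \<sigma>)" for \<sigma> by simp
  qed (intro dec_const U)+
  then show ?thesis by (simp add: nstr_all g_def)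
qed

lemma nstr_res:
  assumes "n \<le> L" "dec Q"
  shows "nstr L (\<lambda>\<tau>. Q (res n \<tau>)) * pw n = pw L * nstr n Q"
  using nstr_proj[of "\<lambda>i. i" n L Q] assms by (simp add: res_def fn_id order.strict_trans2)

text \<open>P looks only at positions in V and Q only at the others. Swapping two strings outside V
  turns a pair with P on the left and Q on the right into one whose left string satisfies
  both.\<close>

lemma nstr_indep:
  assumes d: "dec P" "dec Q" "dec V"
    and P: "\<And>\<sigma> \<tau>. bs \<sigma> L \<Longrightarrow> bs \<tau> L \<Longrightarrow> (\<And>i. i < L \<Longrightarrow> V i \<Longrightarrow> bit \<sigma> i \<longleftrightarrow> bit \<tau> i) \<Longrightarrow> P \<sigma> \<Longrightarrow> P \<tau>"
    and Q: "\<And>\<sigma> \<tau>. bs \<sigma> L \<Longrightarrow> bs \<tau> L \<Longrightarrow> (\<And>i. i < L \<Longrightarrow> \<not> V i \<Longrightarrow> bit \<sigma> i \<longleftrightarrow> bit \<tau> i) \<Longrightarrow> Q \<sigma> \<Longrightarrow> Q \<tau>"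
  shows "nstr L P * nstr L Q = nstr L (\<lambda>\<sigma>. P \<sigma> \<and> Q \<sigma>) * pw L"
proof -
  define f where "f = (\<lambda>\<sigma> \<tau>. mk L (\<lambda>i. if V i then bit \<sigma> i else bit \<tau> i))"
  have df: "dec (\<lambda>i. if V i then bit \<sigma> i else bit \<tau> i)" for \<sigma> \<tau>
    by (intro dec_intros d(3))
  have f: "bs (f \<sigma> \<tau>) L" "bit (f \<sigma> \<tau>) i \<longleftrightarrow> i < L \<and> (if V i then bit \<sigma> i else bit \<tau> i)" for \<sigma> \<tau> i
    by (simp_all add: f_def bs_mk[OF df] bit_mk[OF df])
  have "nstr L P * nstr L Q = nstr L (\<lambda>\<sigma>. P \<sigma> \<and> Q \<sigma>) * nstr L (\<lambda>_. True)"
  proof (rule nstr_pairs[where f = f and g = "\<lambda>\<sigma> \<tau>. f \<tau> \<sigma>"])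
    show "fn (\<lambda>z. f (p1 z) (p2 z))" "fn (\<lambda>z. f (p2 z) (p1 z))"
      unfolding f_def by (intro dec_intros dec_fn[OF d(3)])+
    fix \<sigma> \<tau> :: 'a assume s: "bs \<sigma> L" "bs \<tau> L"
    show "bs (f \<sigma> \<tau>) L \<and> bs (f \<tau> \<sigma>) L" by (simp add: f)
    show "f (f \<sigma> \<tau>) (f \<tau> \<sigma>) = \<sigma> \<and> f (f \<tau> \<sigma>) (f \<sigma> \<tau>) = \<tau>"
      by (intro conjI bs_ext[OF f(1) s(1)] bs_ext[OF f(1) s(2)]) (auto simp: f)
    have "P \<sigma> \<longleftrightarrow> P (f \<sigma> \<tau>)" using P[OF s(1) f(1)] P[OF f(1) s(1)] by (auto simp: f)
    moreover have "Q \<tau> \<longleftrightarrow> Q (f \<sigma> \<tau>)" using Q[OF s(2) f(1)] Q[OF f(1) s(2)] by (auto simp: f)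
    ultimately show "P \<sigma> \<and> Q \<tau> \<longleftrightarrow> (P (f \<sigma> \<tau>) \<and> Q (f \<sigma> \<tau>)) \<and> True" by blast
  qed (intro d dec_conj dec_const)+
  then show ?thesis by (simp add: nstr_all)
qed


section \<open>Approximating \<open>\<Pi>\<^sub>2\<close> sets\<close>

definition names :: "('a::rca \<Rightarrow> 'a) \<Rightarrow> bool" where
  "names b \<longleftrightarrow> fn b \<and> (\<forall>x. b x = 0 \<or> (\<exists>\<sigma> l. b x = \<sigma> + 1 \<and> bs \<sigma> l))"

definition opn :: "('a::rca \<Rightarrow> 'a) \<Rightarrow> 'a \<Rightarrow> 'a set set" where
  "opn b x = {Y \<in> SS. \<exists>\<sigma>. b x = \<sigma> + 1 \<and> init_seg MM \<sigma> Y}"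

definition inb :: "'a::rca \<Rightarrow> 'a \<Rightarrow> bool" where
  "inb \<tau> v \<longleftrightarrow> (\<exists>\<sigma>. \<sigma> < v \<and> v = \<sigma> + 1 \<and> prefix MM \<sigma> \<tau>)"

lemma dec_inb [dec_intros]: "fn f \<Longrightarrow> fn g \<Longrightarrow> dec (\<lambda>x. inb (f x) (g x))"
  by (rule dec2_comp[of inb]; (assumption | (unfold inb_def; intro dec_intros)))

lemma inb_Suc [simp]: "inb \<tau> (\<sigma> + 1) \<longleftrightarrow> prefix MM \<sigma> \<tau>"
  by (auto simp: inb_def less_Suc_iff)

lemma inb_prefix: "inb \<tau> v \<Longrightarrow> prefix MM \<tau> \<tau>' \<Longrightarrow> inb \<tau>' v"
  unfolding inb_def using prefix_trans by blast

lemma inb_opn: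
  assumes "names b" "Y \<in> cyl MM \<tau>" "inb \<tau> (b x)"
  shows "Y \<in> opn b x"
proof -
  obtain \<sigma> where s: "b x = \<sigma> + 1" "prefix MM \<sigma> \<tau>" using assms(3) by (auto simp: inb_def)
  then obtain l where "bs \<sigma> l" using assms(1) unfolding names_def by (metis add_eq_0 add_right_imp_eq zero_neq_one)
  then show ?thesis using s assms(2) init_seg_prefix by (auto simp: opn_def mem_cyl)
qed

text \<open>A string is at most as long as its code, so strings of length L decide every basic open
  set whose name is at most L + 1.\<close>

lemma opn_inb:
  assumes "names b" "Y \<in> opn b x" "bs \<tau> L" "Y \<in> cyl MM \<tau>" "b x \<le> L + 1"
  shows "inb \<tau> (b x)"
proof -
  obtain \<sigma> where s: "b x = \<sigma> + 1" "init_seg MM \<sigma> Y" using assms(2) by (auto simp: opn_def)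
  obtain l where l: "bs \<sigma> l" using init_seg_bs[OF s(2)] by blast
  have "l \<le> L" using bs_length_le[OF l] assms(5) s(1) by simp
  then show ?thesis using init_seg_linear[OF s(2) _ l assms(3)] assms(4) s(1) by (simp add: mem_cyl)
qed

text \<open>Stage m of the i-th open set of the strict equivalent: in each row up to i, the first m
  basic open sets are united, and the unions are intersected.\<close>

definition DD :: "('a::rca \<Rightarrow> 'a) \<Rightarrow> 'a \<Rightarrow> 'a \<Rightarrow> 'a \<Rightarrow> bool" where
  "DD b i m \<tau> \<longleftrightarrow> (\<forall>i'. i' \<le> i \<longrightarrow> (\<exists>j. j < m \<and> inb \<tau> (b (pp i' j))))"

lemma dec_DD:
  assumes "fn b" "fn i" "fn m" "fn t"
  shows "dec (\<lambda>x. DD b (i x) (m x) (t x))"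
  unfolding DD_def
  by (intro dec_intros assms fn_comp[OF assms(1)] fn_comp[OF assms(3)] fn_comp[OF assms(4)])

lemma DD_mono: "DD b i m \<tau> \<Longrightarrow> i' \<le> i \<Longrightarrow> m \<le> m' \<Longrightarrow> prefix MM \<tau> \<tau>' \<Longrightarrow> DD b i' m' \<tau>'"
  unfolding DD_def using inb_prefix by (meson order_trans order_less_le_trans)

lemma DD_mem:
  assumes "names b" "Y \<in> cyl MM \<tau>" "DD b i m \<tau>" "i' \<le> i"
  shows "\<exists>j. Y \<in> opn b (pp i' j)"
  using assms inb_opn unfolding DD_def by blast

lemma mu_isI:
  assumes "dec P" "U \<subseteq> SS" "\<And>\<tau> Y. bs \<tau> L \<Longrightarrow> Y \<in> cyl MM \<tau> \<Longrightarrow> Y \<in> U \<longleftrightarrow> P \<tau>"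
  shows "mu_is MM U (nstr L P) (pw L)"
proof -
  have "cyl MM \<tau> \<subseteq> U \<longleftrightarrow> P \<tau>" "cyl MM \<tau> \<subseteq> U \<or> cyl MM \<tau> \<inter> U = {}" if "bs \<tau> L" for \<tau>
    using assms(3)[OF that] support_in_cyl[OF that] by blast+
  moreover from this have "{\<tau>. bs \<tau> L \<and> cyl MM \<tau> \<subseteq> U} = {\<tau>. bs \<tau> L \<and> P \<tau>}" by auto
  moreover have "card_is MM {\<tau>. bs \<tau> L \<and> P \<tau>} (nstr L P)"
    unfolding nstr_def by (subst card_is_iff[OF dec_bsP[OF assms(1)]]) (auto simp: bs_less_SB)
  ultimately have "(\<forall>\<tau>. bs \<tau> L \<longrightarrow> cyl MM \<tau> \<subseteq> U \<or> cyl MM \<tau> \<inter> U = {})"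
    "card_is MM {\<tau>. bs \<tau> L \<and> cyl MM \<tau> \<subseteq> U} (nstr L P)" by simp_all
  then show ?thesis unfolding mu_is_def pow2_iff by blast
qed

text \<open>A cardinality is witnessed by a coded enumeration, which decides membership even when A
  was given by a formula outside the model.\<close>

lemma card_is_dec: "card_is MM A k \<Longrightarrow> dec (\<lambda>x. x \<in> A)"
proof -
  assume "card_is MM A k"
  then obtain s where s: "seq MM s k" "\<And>x. x \<in> A \<longleftrightarrow> (\<exists>i. entry MM s i x)" unfolding card_is_def by blast
  have "dec (\<lambda>x. \<exists>i. i < k \<and> entry MM s i x)" by (intro dec_intros)
  then show ?thesis using s seq_dom[OF s(1)] by (auto elim!: dec_cong)
qed

lemma mu_isD:
  assumes "mu_is MM U c N"
  obtains n P where "N = pw n" "dec P" "\<And>\<tau>. bs \<tau> n \<Longrightarrow> P \<tau> \<Longrightarrow> cyl MM \<tau> \<subseteq> U" "c = nstr n P"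
proof -
  obtain n where n: "N = pw n" "card_is MM {\<tau>. bs \<tau> n \<and> cyl MM \<tau> \<subseteq> U} c"
    using assms unfolding mu_is_def pow2_iff by blast
  define P where "P = (\<lambda>\<tau>. bs \<tau> n \<and> cyl MM \<tau> \<subseteq> U)"
  have d: "dec P" using card_is_dec[OF n(2)] by (simp add: P_def)
  have "c = cnt (SB n) P"
    using n(2) card_is_iff[OF d, of "SB n" c] by (auto simp: P_def bs_less_SB)
  also have "\<dots> = nstr n P" unfolding nstr_def
    by (intro cnt_cong d dec_bsP) (auto simp: P_def)
  finally show thesis using that n(1) d by (simp add: P_def)
qed

lemma names_level:
  assumes "names b"
  shows "\<exists>L. n \<le> L \<and> (\<forall>x. x < k \<longrightarrow> b x \<le> L + 1)"
proof -
  have "fn b" using assms by (simp add: names_def)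
  then obtain v where v: "\<And>x. x < k \<Longrightarrow> b x < v" using bounded_fn by blast
  have "\<forall>x. x < k \<longrightarrow> b x \<le> n + v + 1"
    using v by (metis add.commute add_increasing2 ge0 less_imp_le order_trans)
  then show ?thesis by (intro exI[of _ "n + v"]) simp
qed

lemma pp_less: "i \<le> i' \<Longrightarrow> j < m \<Longrightarrow> pp i j < pp i' m + (1 :: 'a::rca)"
  by (simp add: less_Suc_iff pp_mono)

definition strict_seq :: "('a::rca \<Rightarrow> 'a) \<Rightarrow> 'a \<Rightarrow> 'a \<Rightarrow> 'a set set" where
  "strict_seq b = strict_form MM (\<lambda>i j. opn b (pp i j))"

text \<open>Every finite union in the official definition is covered by \<open>DD\<close> at some
  stage. If the sequence is strict, rows below i contain each basic set of row i, and collection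
  bounds where. Otherwise the index s is a sequence of choices, and its entries are below s.\<close>

lemma mu_is_DD:
  assumes b: "names b" and mu: "mu_is MM (\<Union>j\<in>{j. j < m}. strict_seq b i j) c N"
  shows "\<exists>m' L. c * pw L \<le> N * nstr L (DD b i m')"
proof -
  let ?B = "\<lambda>i j. opn b (pp i j)"
  have fb: "fn b" using b by (simp add: names_def)
  obtain n P where N: "N = pw n" and P: "dec P" "\<And>\<tau>. bs \<tau> n \<Longrightarrow> P \<tau> \<Longrightarrow> cyl MM \<tau> \<subseteq> (\<Union>j\<in>{j. j < m}. strict_seq b i j)"
    "c = nstr n P" using mu_isD[OF mu] by blast
  have "\<exists>m' L. n \<le> L \<and> (\<forall>\<tau>. bs \<tau> L \<longrightarrow> P (res n \<tau>) \<longrightarrow> DD b i m' \<tau>)"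
  proof (cases "strict MM ?B")
    case False
    then have B: "strict_seq b = strict_equiv MM ?B" by (simp add: strict_seq_def strict_form_def)
    obtain L where L: "n \<le> L" "\<And>x. x < pp i m + 1 \<Longrightarrow> b x \<le> L + 1" using names_level[OF b] by blast
    have "DD b i m \<tau>" if \<tau>: "bs \<tau> L" "P (res n \<tau>)" for \<tau>
    proof -
      have Y: "support \<tau> \<in> cyl MM \<tau>" "support \<tau> \<in> cyl MM (res n \<tau>)"
        using support_in_cyl[OF \<tau>(1)] init_seg_prefix[OF _ bs_res prefix_res[OF \<tau>(1) L(1)]] by (auto simp: mem_cyl)
      then have "support \<tau> \<in> (\<Union>j\<in>{j. j < m}. strict_seq b i j)" using P(2)[OF bs_res \<tau>(2)] by blast
      then obtain s where s0: "s < m" "support \<tau> \<in> strict_seq b i s" by blast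
      have s: "s < m" "seq MM s (i + 1)" "\<And>i' j. i' \<le> i \<Longrightarrow> entry MM s i' j \<Longrightarrow> support \<tau> \<in> ?B i' j"
        using s0 by (auto simp: B strict_equiv_def order_le_less split: if_splits)
      show ?thesis
        unfolding DD_def
      proof (intro allI impI)
        fix i' assume i': "i' \<le> i"
        then obtain j where j: "entry MM s i' j" using seq_ex[OF s(2), of i'] by (auto simp: less_Suc_iff)
        then have "j < m" using entry_less(2)[OF j] s(1) by simp
        moreover have "inb \<tau> (b (pp i' j))"
          by (rule opn_inb[OF b s(3)[OF i' j] \<tau>(1) Y(1) L(2)[OF pp_less[OF i' \<open>j < m\<close>]]])
        ultimately show "\<exists>j. j < m \<and> inb \<tau> (b (pp i' j))" by blast
      qed
    qed
    then show ?thesis using L(1) by blast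
  next
    case True
    then have B: "strict_seq b = ?B" by (simp add: strict_seq_def strict_form_def)
    \<comment> \<open>For z = (j, i'), this expresses the inclusion of basic set j of row i in basic
      set j' of row i' by the prefix order, which makes it decidable.\<close>
    define R where "R = (\<lambda>z j'. p2 z \<le> i \<longrightarrow> (\<forall>\<sigma>. \<sigma> < b (pp i (p1 z)) \<longrightarrow> b (pp i (p1 z)) = \<sigma> + 1 \<longrightarrow> inb \<sigma> (b (pp (p2 z) j'))))"
    have "dec2 R" unfolding R_def by (intro dec_intros fn_comp[OF fb])
    moreover have "\<exists>j'. R z j'" for z
    proof (cases "p2 z \<le> i")
      case le: True
      show ?thesis
      proof (cases "b (pp i (p1 z)) = 0")
        case False
        then obtain \<sigma> l where s: "b (pp i (p1 z)) = \<sigma> + 1" "bs \<sigma> l" using b unfolding names_def by blast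
        obtain j' where j': "?B i (p1 z) \<subseteq> ?B (p2 z) j'"
          using True le unfolding strict_def MM_simps order_le_less by blast
        have eq: "?B i (p1 z) = cyl MM \<sigma>" using s by (auto simp: opn_def cyl_def)
        then have "support \<sigma> \<in> ?B (p2 z) j'" using j' support_in_cyl[OF s(2)] by blast
        then obtain \<sigma>' where s': "b (pp (p2 z) j') = \<sigma>' + 1" "init_seg MM \<sigma>' (support \<sigma>)" by (auto simp: opn_def)
        then obtain l' where l': "bs \<sigma>' l'" using init_seg_bs by blast
        have "cyl MM \<sigma> \<subseteq> cyl MM \<sigma>'" using j' unfolding eq by (auto simp: opn_def s' mem_cyl)
        then have "prefix MM \<sigma>' \<sigma>" by (rule cyl_subset_prefix[OF s(2) l'])
        then show ?thesis unfolding R_def using s s' by (intro exI[of _ j']) auto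
      qed (simp add: R_def)
    qed (simp add: R_def)
    ultimately obtain v where v: "\<And>z. z < pp m i + 1 \<Longrightarrow> \<exists>j'. j' < v \<and> R z j'" using BSigma1[of R] by blast
    obtain L where L: "n \<le> L" "\<And>x. x < pp i m + 1 \<Longrightarrow> b x \<le> L + 1" using names_level[OF b] by blast
    have "DD b i v \<tau>" if \<tau>: "bs \<tau> L" "P (res n \<tau>)" for \<tau>
    proof -
      have Y: "support \<tau> \<in> cyl MM \<tau>" "support \<tau> \<in> cyl MM (res n \<tau>)"
        using support_in_cyl[OF \<tau>(1)] init_seg_prefix[OF _ bs_res prefix_res[OF \<tau>(1) L(1)]] by (auto simp: mem_cyl)
      then obtain j where j: "j < m" "support \<tau> \<in> ?B i j" using P(2)[OF bs_res \<tau>(2)] by (auto simp: B)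
      have "inb \<tau> (b (pp i j))" by (rule opn_inb[OF b j(2) \<tau>(1) Y(1) L(2)[OF pp_less[OF order_refl j(1)]]])
      then obtain \<sigma> where s: "\<sigma> < b (pp i j)" "b (pp i j) = \<sigma> + 1" "prefix MM \<sigma> \<tau>" by (auto simp: inb_def)
      show ?thesis
        unfolding DD_def
      proof (intro allI impI)
        fix i' assume "i' \<le> i"
        moreover from this have "pp j i' < pp m i + 1" using j(1) by (simp add: less_Suc_iff pp_mono less_imp_le)
        ultimately obtain j' where "j' < v" "inb \<sigma> (b (pp i' j'))" using v[of "pp j i'"] s by (auto simp: R_def)
        then show "\<exists>j. j < v \<and> inb \<tau> (b (pp i' j))" using s(3) inb_prefix by blast
      qed
    qed
    then show ?thesis using L(1) by blast
  qed
  then obtain m' L where L: "n \<le> L" "\<And>\<tau>. bs \<tau> L \<Longrightarrow> P (res n \<tau>) \<Longrightarrow> DD b i m' \<tau>" by blast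
  have "nstr L (\<lambda>\<tau>. P (res n \<tau>)) \<le> nstr L (DD b i m')"
    by (intro nstr_mono L(2) dec_fn[OF P(1)] dec_DD fb dec_intros) simp_all
  then have "pw n * nstr L (\<lambda>\<tau>. P (res n \<tau>)) \<le> pw n * nstr L (DD b i m')" by (rule mult_left_mono) simp
  then have "c * pw L \<le> N * nstr L (DD b i m')"
    using nstr_res[OF L(1) P(1)] by (simp add: P(3) N mult.commute)
  then show ?thesis by blast
qed

lemma DD_mu_is:
  assumes b: "names b"
  shows "\<exists>m' c N. mu_is MM (\<Union>j\<in>{j. j < m'}. strict_seq b i j) c N \<and> nstr n (DD b i m) * N \<le> c * pw n"
proof -
  let ?B = "\<lambda>i j. opn b (pp i j)"
  have fb: "fn b" using b by (simp add: names_def)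
  have "\<exists>m' L P. n \<le> L \<and> dec P \<and> mu_is MM (\<Union>j\<in>{j. j < m'}. strict_seq b i j) (nstr L P) (pw L) \<and>
    (\<forall>\<tau>. bs \<tau> L \<longrightarrow> DD b i m (res n \<tau>) \<longrightarrow> P \<tau>)"
  proof (cases "strict MM ?B")
    case True
    then have B: "strict_seq b = ?B" by (simp add: strict_seq_def strict_form_def)
    obtain L where L: "n \<le> L" "\<And>x. x < pp i m + 1 \<Longrightarrow> b x \<le> L + 1" using names_level[OF b] by blast
    define P where "P = (\<lambda>\<tau>. \<exists>j. j < m \<and> inb \<tau> (b (pp i j)))"
    have d: "dec P" unfolding P_def by (intro dec_intros fn_comp[OF fb])
    have "mu_is MM (\<Union>j\<in>{j. j < m}. strict_seq b i j) (nstr L P) (pw L)"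
    proof (rule mu_isI[OF d])
      show "(\<Union>j\<in>{j. j < m}. strict_seq b i j) \<subseteq> SS" by (auto simp: B opn_def)
      fix \<tau> Y assume t: "bs \<tau> L" "Y \<in> cyl MM \<tau>"
      have "Y \<in> ?B i j \<longleftrightarrow> inb \<tau> (b (pp i j))" if "j < m" for j
        using inb_opn[OF b t(2)] opn_inb[OF b _ t L(2)[OF pp_less[OF order_refl that]]] by blast
      then show "Y \<in> (\<Union>j\<in>{j. j < m}. strict_seq b i j) \<longleftrightarrow> P \<tau>" by (auto simp: B P_def)
    qed
    moreover have "P \<tau>" if "bs \<tau> L" "DD b i m (res n \<tau>)" for \<tau>
      using that(2) inb_prefix[OF _ prefix_res[OF that(1) L(1)]] unfolding DD_def P_def by blast
    ultimately show ?thesis using L(1) d by blast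
  next
    case False
    then have B: "strict_seq b = strict_equiv MM ?B" by (simp add: strict_seq_def strict_form_def)
    \<comment> \<open>Above the code of every sequence of length i + 1 with entries at most
      m.\<close>
    define m' where "m' = codeB (pp (i + 1) m + 1)"
    obtain L where L: "n \<le> L" "\<And>x. x < pp i m' + 1 \<Longrightarrow> b x \<le> L + 1" using names_level[OF b] by blast
    define P where "P = (\<lambda>\<tau>. \<exists>s. s < m' \<and> seq MM s (i + 1) \<and> (\<forall>i'. i' \<le> i \<longrightarrow> inb \<tau> (b (pp i' (at s i')))))"
    have d: "dec P" unfolding P_def by (intro dec_intros fn_comp[OF fb])
    have "mu_is MM (\<Union>j\<in>{j. j < m'}. strict_seq b i j) (nstr L P) (pw L)"
    proof (rule mu_isI[OF d])
      show "(\<Union>j\<in>{j. j < m'}. strict_seq b i j) \<subseteq> SS" by (auto simp: B strict_equiv_def split: if_splits)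
      fix \<tau> Y assume t: "bs \<tau> L" "Y \<in> cyl MM \<tau>"
      have *: "Y \<in> ?B i' j \<longleftrightarrow> inb \<tau> (b (pp i' j))" if "j < m'" "i' \<le> i" for i' j
        using inb_opn[OF b t(2)] opn_inb[OF b _ t L(2)[OF pp_less[OF that(2,1)]]] by blast
      have "Y \<in> strict_seq b i s \<longleftrightarrow> seq MM s (i + 1) \<and> (\<forall>i'. i' \<le> i \<longrightarrow> inb \<tau> (b (pp i' (at s i'))))" if "s < m'" for s
      proof (cases "seq MM s (i + 1)")
        case True
        have e: "(\<forall>j. entry MM s i' j \<longrightarrow> Y \<in> ?B i' j) \<longleftrightarrow> inb \<tau> (b (pp i' (at s i')))" if i': "i' \<le> i" for i'
        proof -
          have a: "entry MM s i' j \<longleftrightarrow> j = at s i'" for j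
            using entry_at[OF True, of i'] i' by (simp add: less_Suc_iff)
          then have m: "at s i' < m'" using entry_less(2)[of s i' "at s i'"] \<open>s < m'\<close> by simp
          show ?thesis using *[OF m i'] by (simp add: a)
        qed
        have "Y \<in> SS" using t(2) by (simp add: mem_cyl)
        then have "Y \<in> strict_seq b i s \<longleftrightarrow> (\<forall>i'. i' \<le> i \<longrightarrow> (\<forall>j. entry MM s i' j \<longrightarrow> Y \<in> ?B i' j))"
          using True by (auto simp: B strict_equiv_def order_le_less)
        then show ?thesis using True e by simp
      qed (simp add: B strict_equiv_def)
      then show "Y \<in> (\<Union>j\<in>{j. j < m'}. strict_seq b i j) \<longleftrightarrow> P \<tau>" by (auto simp: P_def)
    qed
    moreover have "P \<tau>" if \<tau>: "bs \<tau> L" "DD b i m (res n \<tau>)" for \<tau>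
    proof -
      \<comment> \<open>Chooses in each row the first basic set containing \<tau>; the default m
        keeps the search total and the entries bounded in rows past i.\<close>
      define f where "f = (\<lambda>i'. LEAST j. inb \<tau> (b (pp i' j)) \<or> j = m)"
      have dj: "dec (\<lambda>j. inb \<tau> (b (pp i' j)) \<or> j = m)" for i' by (intro dec_intros fn_comp[OF fb])
      have f: "fn f" unfolding f_def by (intro fn_Least dec_intros fn_comp[OF fb]) blast
      have fi: "inb \<tau> (b (pp i' (f i')))" "f i' \<le> m" if "i' \<le> i" for i'
      proof -
        obtain j where j: "j < m" "inb (res n \<tau>) (b (pp i' j))" using \<tau>(2) \<open>i' \<le> i\<close> unfolding DD_def by blast
        then have "inb \<tau> (b (pp i' j))" using inb_prefix[OF _ prefix_res[OF \<tau>(1) L(1)]] by blast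
        then have "\<not> j < f i'" using dec_not_less_Least[OF dj, of j i'] unfolding f_def by blast
        then have "f i' < m" using j(1) by simp
        moreover have "inb \<tau> (b (pp i' (f i'))) \<or> f i' = m"
          using dec_LeastI[OF dj[of i'], where a = m] unfolding f_def by blast
        ultimately show "inb \<tau> (b (pp i' (f i')))" "f i' \<le> m" by auto
      qed
      have "mkseq (i + 1) f < m'" unfolding m'_def
        by (rule seq_bound[OF seq_mkseq[OF f]]) (auto simp: entry_mkseq[OF f] less_Suc_iff fi)
      then show ?thesis unfolding P_def
        by (intro exI[of _ "mkseq (i + 1) f"]) (auto simp: seq_mkseq[OF f] at_mkseq[OF f] less_Suc_iff fi)
    qed
    ultimately show ?thesis using L(1) d by blast
  qed
  then obtain m' L P where L: "n \<le> L" "dec P" "mu_is MM (\<Union>j\<in>{j. j < m'}. strict_seq b i j) (nstr L P) (pw L)"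
    "\<And>\<tau>. bs \<tau> L \<Longrightarrow> DD b i m (res n \<tau>) \<Longrightarrow> P \<tau>" by blast
  have dD: "dec (DD b i m)" by (intro dec_DD fb dec_intros)
  have "nstr L (\<lambda>\<tau>. DD b i m (res n \<tau>)) \<le> nstr L P"
    by (intro nstr_mono L(2,4) dec_fn[OF dD] dec_intros)
  then have "nstr L (\<lambda>\<tau>. DD b i m (res n \<tau>)) * pw n \<le> nstr L P * pw n" by (rule mult_right_mono) simp
  then have "nstr n (DD b i m) * pw L \<le> nstr L P * pw n"
    using nstr_res[OF L(1) dD] by (simp add: mult.commute)
  then show ?thesis using L(3) by blast
qed


lemma mult_less_cancel: "c * a < c * b \<Longrightarrow> a < (b :: 'a::rca)"
  using mult_left_less_imp_less ge0 by blast

text \<open>The official notion distinguishes strict sequences, \<open>DD\<close> does not. Passing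
  between them changes stage and level, but keeps the bound p / q.\<close>

lemma mu_pos_iff:
  assumes b: "names b"
  shows "mu_pos MM (\<lambda>i j. opn b (pp i j)) \<longleftrightarrow>
    (\<exists>p q. 0 < p \<and> 0 < q \<and> (\<forall>i. \<exists>m n. p * pw n < nstr n (DD b i m) * q))"
proof
  assume "mu_pos MM (\<lambda>i j. opn b (pp i j))"
  then obtain p q where pq: "0 < p" "0 < q"
    "\<And>i. \<exists>m c N. mu_is MM (\<Union>j\<in>{j. j < m}. strict_seq b i j) c N \<and> p * N < c * q"
    unfolding mu_pos_def strict_mu_pos_def strict_seq_def[symmetric] MM_simps by blast
  have "\<exists>m n. p * pw n < nstr n (DD b i m) * q" for i
  proof -
    obtain m c N where m: "mu_is MM (\<Union>j\<in>{j. j < m}. strict_seq b i j) c N" "p * N < c * q" using pq(3) by blast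
    obtain m' L where L: "c * pw L \<le> N * nstr L (DD b i m')" using mu_is_DD[OF b m(1)] by blast
    have "N * (p * pw L) = (p * N) * pw L" by (simp add: ac_simps)
    also have "\<dots> < (c * q) * pw L" using m(2) by (rule mult_strict_right_mono) simp
    also have "\<dots> = (c * pw L) * q" by (simp add: ac_simps)
    also have "\<dots> \<le> (N * nstr L (DD b i m')) * q" by (rule mult_right_mono[OF L ge0])
    finally have "N * (p * pw L) < N * (nstr L (DD b i m') * q)" by (simp add: ac_simps)
    then show ?thesis using mult_less_cancel by blast
  qed
  then show "\<exists>p q. 0 < p \<and> 0 < q \<and> (\<forall>i. \<exists>m n. p * pw n < nstr n (DD b i m) * q)" using pq by blast
next
  assume "\<exists>p q. 0 < p \<and> 0 < q \<and> (\<forall>i. \<exists>m n. p * pw n < nstr n (DD b i m) * q)"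
  then obtain p q where pq: "0 < p" "0 < q" "\<And>i. \<exists>m n. p * pw n < nstr n (DD b i m) * q" by blast
  have "\<exists>m c N. mu_is MM (\<Union>j\<in>{j. j < m}. strict_seq b i j) c N \<and> p * N < c * q" for i
  proof -
    obtain m n where m: "p * pw n < nstr n (DD b i m) * q" using pq(3) by blast
    obtain m' c N where c: "mu_is MM (\<Union>j\<in>{j. j < m'}. strict_seq b i j) c N" "nstr n (DD b i m) * N \<le> c * pw n"
      using DD_mu_is[OF b] by blast
    have N: "0 < N" using mu_isD[OF c(1)] by (metis pw_pos)
    have "pw n * (p * N) = (p * pw n) * N" by (simp add: ac_simps)
    also have "\<dots> < (nstr n (DD b i m) * q) * N" using m N by (rule mult_strict_right_mono)
    also have "\<dots> = (nstr n (DD b i m) * N) * q" by (simp add: ac_simps)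
    also have "\<dots> \<le> (c * pw n) * q" by (rule mult_right_mono[OF c(2) ge0])
    finally have "pw n * (p * N) < pw n * (c * q)" by (simp add: ac_simps)
    then show ?thesis using c(1) mult_less_cancel by blast
  qed
  then show "mu_pos MM (\<lambda>i j. opn b (pp i j))"
    unfolding mu_pos_def strict_mu_pos_def strict_seq_def[symmetric] MM_simps using pq by blast
qed

lemma mu_ge_iff:
  assumes b: "names b"
  shows "mu_ge MM (\<lambda>i j. opn b (pp i j)) a d \<longleftrightarrow>
    (\<forall>i p q. 0 < p \<and> 0 < q \<longrightarrow> (\<exists>m n. a * q * pw n < nstr n (DD b i m) * d * q + p * d * pw n))"
proof
  assume "mu_ge MM (\<lambda>i j. opn b (pp i j)) a d"
  then have g: "\<And>i p q. 0 < p \<Longrightarrow> 0 < q \<Longrightarrow>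
    \<exists>m c N. mu_is MM (\<Union>j\<in>{j. j < m}. strict_seq b i j) c N \<and> a * q * N < c * d * q + p * d * N"
    unfolding mu_ge_def strict_mu_ge_def strict_seq_def[symmetric] MM_simps by blast
  show "\<forall>i p q. 0 < p \<and> 0 < q \<longrightarrow> (\<exists>m n. a * q * pw n < nstr n (DD b i m) * d * q + p * d * pw n)"
  proof (intro allI impI)
    fix i p q :: 'a assume "0 < p \<and> 0 < q"
    then obtain m c N where m: "mu_is MM (\<Union>j\<in>{j. j < m}. strict_seq b i j) c N" "a * q * N < c * d * q + p * d * N"
      using g by blast
    obtain m' L where L: "c * pw L \<le> N * nstr L (DD b i m')" using mu_is_DD[OF b m(1)] by blast
    have "N * (a * q * pw L) = (a * q * N) * pw L" by (simp add: ac_simps)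
    also have "\<dots> < (c * d * q + p * d * N) * pw L" using m(2) by (rule mult_strict_right_mono) simp
    also have "\<dots> = (c * pw L) * (d * q) + p * d * N * pw L" by (simp add: algebra_simps)
    also have "\<dots> \<le> (N * nstr L (DD b i m')) * (d * q) + p * d * N * pw L"
      by (intro add_right_mono mult_right_mono[OF L ge0])
    finally have "N * (a * q * pw L) < N * (nstr L (DD b i m') * d * q + p * d * pw L)" by (simp add: algebra_simps)
    then show "\<exists>m n. a * q * pw n < nstr n (DD b i m) * d * q + p * d * pw n" using mult_less_cancel by blast
  qed
next
  assume g: "\<forall>i p q. 0 < p \<and> 0 < q \<longrightarrow> (\<exists>m n. a * q * pw n < nstr n (DD b i m) * d * q + p * d * pw n)"
  have "\<exists>m c N. mu_is MM (\<Union>j\<in>{j. j < m}. strict_seq b i j) c N \<and> a * q * N < c * d * q + p * d * N"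
    if pq: "0 < p" "0 < q" for i p q
  proof -
    obtain m n where m: "a * q * pw n < nstr n (DD b i m) * d * q + p * d * pw n" using g pq by blast
    obtain m' c N where c: "mu_is MM (\<Union>j\<in>{j. j < m'}. strict_seq b i j) c N" "nstr n (DD b i m) * N \<le> c * pw n"
      using DD_mu_is[OF b] by blast
    have N: "0 < N" using mu_isD[OF c(1)] by (metis pw_pos)
    have "pw n * (a * q * N) = (a * q * pw n) * N" by (simp add: ac_simps)
    also have "\<dots> < (nstr n (DD b i m) * d * q + p * d * pw n) * N" using m N by (rule mult_strict_right_mono)
    also have "\<dots> = (nstr n (DD b i m) * N) * (d * q) + p * d * pw n * N" by (simp add: algebra_simps)
    also have "\<dots> \<le> (c * pw n) * (d * q) + p * d * pw n * N" by (intro add_right_mono mult_right_mono[OF c(2) ge0])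
    finally have "pw n * (a * q * N) < pw n * (c * d * q + p * d * N)" by (simp add: algebra_simps)
    then show ?thesis using c(1) mult_less_cancel by blast
  qed
  then show "mu_ge MM (\<lambda>i j. opn b (pp i j)) a d"
    unfolding mu_ge_def strict_mu_ge_def strict_seq_def[symmetric] MM_simps by blast
qed


section \<open>Limits and computations under \<open>\<Sigma>\<^sub>1\<close> induction\<close>

section \<open>Monotone bounded functions\<close>

text \<open>Otherwise the \<open>\<Sigma>\<^sub>1\<close> property would be inductive and reach
  K.\<close>

lemma sigma1_max:
  assumes "dec2 R" "\<exists>w. R 0 w" "\<And>w. \<not> R K w"
  shows "\<exists>k. (\<exists>w. R k w) \<and> (\<forall>w. \<not> R (k + 1) w)"
proof (rule ccontr)
  assume "\<not> ?thesis"
  then have "\<exists>w. R k w \<Longrightarrow> \<exists>w. R (k + 1) w" for k by blast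
  from sigma1_induct[of R, OF assms(1,2) this] show False using assms(3) by blast
qed

text \<open>The largest k with k \<le> f s for some s exists by \<open>sigma1_max\<close>; from such
  an s on, the value is k. This takes the place of collection for limits.\<close>

lemma mono_stabilizes:
  assumes "fn f" "\<And>s t. s \<le> t \<Longrightarrow> f s \<le> f t" "\<And>s. f s \<le> K"
  shows "\<exists>s. \<forall>t. s \<le> t \<longrightarrow> f t = f s"
proof -
  have "dec2 (\<lambda>k s. k \<le> f s)" by (intro dec_intros fn_comp[OF assms(1)])
  moreover have "\<not> K + 1 \<le> f w" for w using assms(3)[of w] by (simp add: not_le less_Suc_iff)
  ultimately obtain k s where k: "k \<le> f s" "\<And>t. \<not> k + 1 \<le> f t"
    using sigma1_max[of "\<lambda>k s. k \<le> f s" "K + 1"] by auto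
  then have "f t = k" if "s \<le> t" for t
    using assms(2)[OF that] k(1) k(2)[of t] by (simp add: not_le less_Suc_iff order_antisym order_trans)
  then show ?thesis by (intro exI[of _ s]) auto
qed

lemma cnt_True: "cnt k (\<lambda>_. True) = k"
proof (rule dec_induct[of "\<lambda>k. cnt k (\<lambda>_. True) = k"])
  show "dec (\<lambda>k. cnt k (\<lambda>_. True) = k)" by (intro dec_intros)
qed (simp_all add: cnt_simps dec_const)

lemma cnt_le: "dec P \<Longrightarrow> cnt k P \<le> k"
  using cnt_mono[OF _ dec_const[of True], of P k] by (simp add: cnt_True)

lemma cnt_less_strict:
  assumes "dec P" "dec Q" "\<And>x. x < b \<Longrightarrow> P x \<Longrightarrow> Q x" "c < b" "Q c" "\<not> P c"
  shows "cnt b P < cnt b Q"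
proof -
  have d: "dec (\<lambda>x. x = c)" by (intro dec_intros)
  have "cnt b P + 1 = cnt b P + cnt b (\<lambda>x. x = c)" using assms(4) by (simp add: cnt_single)
  also have "\<dots> = cnt b (\<lambda>x. P x \<or> x = c)" using assms(6) by (intro cnt_union[symmetric] assms(1) d) auto
  also have "\<dots> \<le> cnt b Q" using assms by (intro cnt_mono dec_disj d) auto
  finally show ?thesis by (simp add: less_iff_Suc_le)
qed

text \<open>The number of i < L with a witness below s is monotone in s and at most L. A witness
  appearing after it has stabilized would increase it once more.\<close>

lemma bounded_sigma1_decided:
  assumes "dec2 R"
  shows "\<exists>s. \<forall>i. i < L \<longrightarrow> (\<exists>w. R i w) \<longrightarrow> (\<exists>w. w < s \<and> R i w)"
proof -
  have R: "dec (\<lambda>i. \<exists>w. w < s \<and> R i w)" for s by (intro dec_intros dec2_comp[OF assms])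
  have "\<exists>s. \<forall>t. s \<le> t \<longrightarrow> cnt L (\<lambda>i. \<exists>w. w < t \<and> R i w) = cnt L (\<lambda>i. \<exists>w. w < s \<and> R i w)"
  proof (rule mono_stabilizes)
    show "fn (\<lambda>s. cnt L (\<lambda>i. \<exists>w. w < s \<and> R i w))" by (intro dec_intros dec2_comp[OF assms])
    show "cnt L (\<lambda>i. \<exists>w. w < s \<and> R i w) \<le> cnt L (\<lambda>i. \<exists>w. w < t \<and> R i w)" if "s \<le> t" for s t
      using that by (intro cnt_mono R) (meson less_le_trans)
  qed (rule cnt_le[OF R])
  then obtain s where s: "\<And>t. s \<le> t \<Longrightarrow> cnt L (\<lambda>i. \<exists>w. w < t \<and> R i w) = cnt L (\<lambda>i. \<exists>w. w < s \<and> R i w)" by blast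
  have "\<exists>w. w < s \<and> R i w" if "i < L" "R i w" for i w
  proof (rule ccontr)
    assume n: "\<not> ?thesis"
    have "cnt L (\<lambda>i. \<exists>w. w < s \<and> R i w) < cnt L (\<lambda>i. \<exists>w'. w' < s + w + 1 \<and> R i w')"
    proof (rule cnt_less_strict[OF R R _ that(1) _ n])
      show "\<exists>w'. w' < s + w + 1 \<and> R i w'" using that(2) by (intro exI[of _ w]) (simp add: less_Suc_iff)
      show "\<exists>w'. w' < s + w + 1 \<and> R x w'" if "\<exists>w. w < s \<and> R x w" for x
        using that by (metis add.assoc add_increasing2 ge0 less_le_trans order_refl)
    qed
    then show False using s[of "s + w + 1"] by (simp add: add.assoc)
  qed
  then show ?thesis by blast
qed

text \<open>The case of interest is the jump: it need not be a set of the model, but each of its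
  initial segments is a coded string.\<close>

lemma bounded_sigma1_comprehension:
  assumes "dec2 R"
  shows "\<exists>\<sigma>. bs \<sigma> L \<and> (\<forall>i. i < L \<longrightarrow> (bit \<sigma> i \<longleftrightarrow> (\<exists>w. R i w)))"
proof -
  obtain s where s: "\<And>i. i < L \<Longrightarrow> \<exists>w. R i w \<Longrightarrow> \<exists>w. w < s \<and> R i w"
    using bounded_sigma1_decided[OF assms] by blast
  have d: "dec (\<lambda>i. \<exists>w. w < s \<and> R i w)" by (intro dec_intros dec2_comp[OF assms])
  show ?thesis
    by (intro exI[of _ "mk L (\<lambda>i. \<exists>w. w < s \<and> R i w)"]) (use s in \<open>auto simp: bs_mk[OF d] bit_mk[OF d]\<close>)
qed


section \<open>Computations\<close>

lemma nat_elt_MM [simp]: "nat_elt MM n = of_nat n"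
  by (induction n) (simp_all add: add.commute)

definition comp_mem :: "'a::rca \<Rightarrow> 'a \<Rightarrow> 'a \<Rightarrow> 'a \<Rightarrow> 'a \<Rightarrow> bool" where
  "comp_mem d k f a b \<longleftrightarrow> (\<exists>k'. k' < k \<and> entry MM d k' (pp f (pp a b)))"

lemma comp_mem_less: "comp_mem d k f a b \<Longrightarrow> b < d"
  unfolding comp_mem_def using entry_less(2) pp_bounds(2) by (meson le_less_trans)

lemma dec_comp_mem [dec_intros]:
  assumes "fn d" "fn k" "fn f" "fn a" "fn b"
  shows "dec (\<lambda>x. comp_mem (d x) (k x) (f x) (a x) (b x))"
  unfolding comp_mem_def
  by (intro dec_intros assms fn_comp[OF assms(1)] fn_comp[OF assms(3)] fn_comp[OF assms(4)] fn_comp[OF assms(5)])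

text \<open>\<open>comp_step\<close> with decidable content: outputs of earlier computations are
  below the code d, and programs and inputs are taken apart by projections.\<close>

definition dstep :: "'a::rca \<Rightarrow> 'a \<Rightarrow> 'a \<Rightarrow> 'a \<Rightarrow> 'a \<Rightarrow> 'a \<Rightarrow> bool" where
  "dstep \<sigma> e x y d k \<longleftrightarrow>
     e = pp 0 y \<or> (e = pp 1 0 \<and> y = x) \<or> (e = pp 2 0 \<and> ispair x \<and> y = p1 x) \<or>
     (e = pp 3 0 \<and> ispair x \<and> y = p2 x) \<or> (e = pp 4 0 \<and> ispair x \<and> y = p1 x + p2 x) \<or>
     (e = pp 5 0 \<and> ispair x \<and> y = p1 x * p2 x) \<or>
     (e = pp 6 0 \<and> ispair x \<and> y = (if p1 x < p2 x then 1 else 0)) \<or>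
     (e = pp 7 0 \<and> entry MM \<sigma> x y) \<or>
     (ispair e \<and> p1 e = 8 \<and> ispair (p2 e) \<and> ispair y \<and>
        comp_mem d k (p1 (p2 e)) x (p1 y) \<and> comp_mem d k (p2 (p2 e)) x (p2 y)) \<or>
     (ispair e \<and> p1 e = 9 \<and> ispair (p2 e) \<and>
        (\<exists>a. a < d \<and> comp_mem d k (p2 (p2 e)) x a \<and> comp_mem d k (p1 (p2 e)) a y)) \<or>
     (ispair e \<and> p1 e = 10 \<and> comp_mem d k (p2 e) (pp x y) 0 \<and>
        (\<forall>z. z < y \<longrightarrow> (\<exists>v. v < d \<and> v \<noteq> 0 \<and> comp_mem d k (p2 e) (pp x z) v)))"

lemma ispair_ex: "ispair x \<and> P (p1 x) (p2 x) \<longleftrightarrow> (\<exists>a b. x = pp a b \<and> P a b)"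
  by (auto simp: ispair_def)

lemma comp_step_iff: "comp_step MM \<sigma> e x y (comp_mem d k) \<longleftrightarrow> dstep \<sigma> e x y d k"
proof -
  have 1: "ispair x \<and> y = p1 x \<longleftrightarrow> (\<exists>b. x = pp y b)" "ispair x \<and> y = p2 x \<longleftrightarrow> (\<exists>a. x = pp a y)" for x y :: 'a
    by (auto simp: ispair_def)
  have 2: "(ispair e \<and> p1 e = t \<and> ispair (p2 e) \<and> P (p1 (p2 e)) (p2 (p2 e))) \<longleftrightarrow> (\<exists>f g. e = pp t (pp f g) \<and> P f g)" for e t :: 'a and P
    by (auto simp: ispair_def)
  have 3: "(ispair e \<and> p1 e = t \<and> P (p2 e)) \<longleftrightarrow> (\<exists>f. e = pp t f \<and> P f)" for e t :: 'a and P
    by (auto simp: ispair_def)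
  have 4: "ispair y \<and> comp_mem d k f x (p1 y) \<and> comp_mem d k g x (p2 y) \<longleftrightarrow>
      (\<exists>a b. comp_mem d k f x a \<and> comp_mem d k g x b \<and> y = pp a b)" for f g
    by (auto simp: ispair_def)
  have 5: "(\<exists>a. a < d \<and> comp_mem d k g x a \<and> comp_mem d k f a y) \<longleftrightarrow> (\<exists>a. comp_mem d k g x a \<and> comp_mem d k f a y)" for f g
    using comp_mem_less by blast
  have 6: "(\<exists>v. v < d \<and> v \<noteq> 0 \<and> comp_mem d k f u v) \<longleftrightarrow> (\<exists>v. v \<noteq> 0 \<and> comp_mem d k f u v)" for f u
    using comp_mem_less by blast
  show ?thesis
    unfolding dstep_def comp_step_def 4 5 6 1
      2[of e 8 "\<lambda>f g. \<exists>a b. comp_mem d k f x a \<and> comp_mem d k g x b \<and> y = pp a b"]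
      2[of e 9 "\<lambda>f g. \<exists>a. comp_mem d k g x a \<and> comp_mem d k f a y"]
      3[of e 10 "\<lambda>f. comp_mem d k f (pp x y) 0 \<and> (\<forall>z. z < y \<longrightarrow> (\<exists>v. v \<noteq> 0 \<and> comp_mem d k f (pp x z) v))"]
      ispair_ex[of x "\<lambda>a b. y = a + b"] ispair_ex[of x "\<lambda>a b. y = a * b"]
      ispair_ex[of x "\<lambda>a b. y = (if a < b then 1 else 0)"] by simp
qed

lemma dec_dstep [dec_intros]:
  assumes "fn s" "fn e" "fn x" "fn y" "fn d" "fn k"
  shows "dec (\<lambda>z. dstep (s z) (e z) (x z) (y z) (d z) (k z))"
  unfolding dstep_def
  by (intro dec_intros assms fn_comp[OF assms(2)] fn_comp[OF assms(3)] fn_comp[OF assms(4)] fn_comp[OF assms(5)] fn_comp[OF assms(6)])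

definition valid :: "'a::rca \<Rightarrow> 'a \<Rightarrow> bool" where
  "valid \<sigma> d \<longleftrightarrow> seq MM d (slen d) \<and>
     (\<forall>k. k < d \<longrightarrow> (\<forall>t. t < d \<longrightarrow> entry MM d k t \<longrightarrow>
        ispair t \<and> ispair (p2 t) \<and> dstep \<sigma> (p1 t) (p1 (p2 t)) (p2 (p2 t)) d k))"

lemma dec_valid [dec_intros]: "fn f \<Longrightarrow> fn g \<Longrightarrow> dec (\<lambda>x. valid (f x) (g x))"
  by (rule dec2_comp[of valid]; (assumption | (unfold valid_def; intro dec_intros)))

definition occ :: "'a::rca \<Rightarrow> 'a \<Rightarrow> bool" where
  "occ d t \<longleftrightarrow> (\<exists>k. k < d \<and> entry MM d k t)"

lemma dec_occ [dec_intros]: "fn f \<Longrightarrow> fn g \<Longrightarrow> dec (\<lambda>x. occ (f x) (g x))"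
  by (rule dec2_comp[of occ]; (assumption | (unfold occ_def; intro dec_intros)))

lemma occ_iff: "occ d t \<longleftrightarrow> (\<exists>k. entry MM d k t)"
  unfolding occ_def using entry_less(1) by blast

lemma valid_iff: "valid \<sigma> d \<longleftrightarrow> (\<exists>l. seq MM d l) \<and>
   (\<forall>k t. entry MM d k t \<longrightarrow> (\<exists>e x y. t = pp e (pp x y) \<and> comp_step MM \<sigma> e x y (comp_mem d k)))"
proof -
  have *: "(ispair t \<and> ispair (p2 t) \<and> dstep \<sigma> (p1 t) (p1 (p2 t)) (p2 (p2 t)) d k) \<longleftrightarrow>
     (\<exists>e x y. t = pp e (pp x y) \<and> comp_step MM \<sigma> e x y (comp_mem d k))" for t k
    unfolding comp_step_iff by (auto simp: ispair_def)
  have "(\<forall>k. k < d \<longrightarrow> (\<forall>t. t < d \<longrightarrow> entry MM d k t \<longrightarrow> P k t)) \<longleftrightarrow> (\<forall>k t. entry MM d k t \<longrightarrow> P k t)" for P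
    using entry_less[of d] by blast
  moreover have "seq MM d (slen d) \<longleftrightarrow> (\<exists>l. seq MM d l)" using slen by blast
  ultimately show ?thesis unfolding valid_def * by simp
qed

lemma phi_str_iff: "phi_str MM \<sigma> e x y \<longleftrightarrow> (\<exists>d. valid \<sigma> d \<and> occ d (pp e (pp x y)))"
  unfolding phi_str_def valid_iff occ_iff comp_mem_def[abs_def] MM_simps by blast

text \<open>The strings agree where both are defined, being initial segments of one P, which may lie
  outside the model. For minimization, the smaller of two outputs would have both a zero and a
  nonzero value.\<close>

lemma step_det:
  assumes \<sigma>: "init_seg MM \<sigma> P" "init_seg MM \<sigma>' P"
    and 1: "comp_step MM \<sigma> e x y h" and 2: "comp_step MM \<sigma>' e x y' h'"
    and det: "\<And>f a b b'. h f a b \<Longrightarrow> h' f a b' \<Longrightarrow> b = b'"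
  shows "y = y'"
proof -
  have en: "y = y'" if "entry MM \<sigma> x y" "entry MM \<sigma>' x y'" for x y y'
  proof -
    obtain l l' where l: "bs \<sigma> l" "bs \<sigma>' l'" using \<sigma> init_seg_bs by blast
    then have "bit \<sigma> x = bit \<sigma>' x"
      using \<sigma> that unfolding init_seg_iff[OF l(1)] init_seg_iff[OF l(2)] bs_entry[OF l(1)] bs_entry[OF l(2)] by blast
    then show ?thesis using that unfolding bs_entry[OF l(1)] bs_entry[OF l(2)] by simp
  qed
  have mn: "y = y'" if m: "h f (pp x y) 0" "\<And>z. z < y \<Longrightarrow> \<exists>v. v \<noteq> 0 \<and> h f (pp x z) v"
    "h' f (pp x y') 0" "\<And>z. z < y' \<Longrightarrow> \<exists>v. v \<noteq> 0 \<and> h' f (pp x z) v" for f y y'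
  proof (cases y y' rule: linorder_cases)
    case less
    then show ?thesis using m(4) det[OF m(1)] by metis
  next
    case greater
    then show ?thesis using m(2) det[OF _ m(3)] by metis
  qed
  note two = 2[unfolded comp_step_def nat_elt_MM MM_simps]
  show ?thesis
    using 1[unfolded comp_step_def nat_elt_MM MM_simps]
  proof (elim disjE exE conjE)
    fix f assume f: "e = pp (of_nat 10) f" "h f (pp x y) 0" "\<forall>z. z < y \<longrightarrow> (\<exists>v. v \<noteq> 0 \<and> h f (pp x z) v)"
    then have "h' f (pp x y') 0 \<and> (\<forall>z. z < y' \<longrightarrow> (\<exists>v. v \<noteq> 0 \<and> h' f (pp x z) v))"
      using two by simp
    then show ?thesis using mn[of f y y'] f by blast
  next
    fix f g a assume f: "e = pp (of_nat 9) (pp f g)" "h g x a" "h f a y"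
    then have "\<exists>a. h' g x a \<and> h' f a y'" using two by simp
    then show ?thesis using f det by blast
  next
    fix f g a b assume f: "e = pp (of_nat 8) (pp f g)" "h f x a" "h g x b" "y = pp a b"
    then have "\<exists>a b. h' f x a \<and> h' g x b \<and> y' = pp a b" using two by simp
    then show ?thesis using f det by blast
  next
    assume "e = pp (of_nat 7) 0" "entry MM \<sigma> x y"
    then show ?thesis using two en by simp
  qed (use two in \<open>simp; (blast | fastforce)?\<close>)+
qed

text \<open>Induction on the position in the first computation. All quantifiers are bounded by the
  two codes, which makes the induction predicate decidable.\<close>

lemma valid_det:
  assumes \<sigma>: "init_seg MM \<sigma> P" "init_seg MM \<sigma>' P" and d: "valid \<sigma> d" "valid \<sigma>' d'"
    and "entry MM d k (pp e (pp x y))" "entry MM d' k' (pp e (pp x y'))"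
  shows "y = y'"
proof -
  define Q where "Q = (\<lambda>k. \<forall>t. t < d \<longrightarrow> (\<forall>k'. k' < d' \<longrightarrow> (\<forall>t'. t' < d' \<longrightarrow>
     entry MM d k t \<longrightarrow> entry MM d' k' t' \<longrightarrow> p1 t = p1 t' \<longrightarrow> p1 (p2 t) = p1 (p2 t') \<longrightarrow> p2 (p2 t) = p2 (p2 t'))))"
  have "dec Q" unfolding Q_def by (intro dec_intros)
  then have "Q k" for k
  proof (induction k rule: dec_less_induct)
    case (less k)
    have det: "b = b'" if h: "comp_mem d k f a b" "entry MM d' k' (pp f (pp a b'))" for f a b b' k'
    proof -
      obtain j where j: "j < k" "entry MM d j (pp f (pp a b))" using h(1) by (auto simp: comp_mem_def)
      from less[OF j(1), unfolded Q_def, rule_format, OF entry_less(2)[OF j(2)] entry_less[OF h(2)] j(2) h(2)]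
      show ?thesis by simp
    qed
    show ?case unfolding Q_def
    proof (intro allI impI)
      fix t k' t' assume a: "entry MM d k t" "entry MM d' k' t'" "p1 t = p1 t'" "p1 (p2 t) = p1 (p2 t')"
      obtain e x y where t: "t = pp e (pp x y)" "comp_step MM \<sigma> e x y (comp_mem d k)"
        using d(1) a(1) unfolding valid_iff by blast
      obtain e' x' y' where t': "t' = pp e' (pp x' y')" "comp_step MM \<sigma>' e' x' y' (comp_mem d' k')"
        using d(2) a(2) unfolding valid_iff by blast
      have "e' = e" "x' = x" using a t t' by simp_all
      then have s': "comp_step MM \<sigma>' e x y' (comp_mem d' k')" using t'(2) by simp
      have "b = b'" if "comp_mem d k f a b" "comp_mem d' k' f a b'" for f a b b'
        using that(2) det[OF that(1)] unfolding comp_mem_def[of d'] by blast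
      from step_det[OF \<sigma> t(2) s' this] have "y = y'" .
      then show "p2 (p2 t) = p2 (p2 t')" by (simp add: t t')
    qed
  qed
  from this[unfolded Q_def, rule_format, OF entry_less(2)[OF assms(5)] entry_less[OF assms(6)] assms(5,6)]
  show ?thesis by simp
qed

lemma phi_det: "phi MM P e x y \<Longrightarrow> phi MM P e x y' \<Longrightarrow> y = y'"
  unfolding phi_def phi_str_iff occ_iff using valid_det by blast


text \<open>Facts about other computations occur only positively, so a step stays justified inside a
  longer computation.\<close>

lemma comp_step_mono:
  assumes "comp_step MM \<sigma> e x y h" "\<And>f a b. h f a b \<Longrightarrow> h' f a b"
  shows "comp_step MM \<sigma> e x y h'"
proof -
  have "comp_step MM \<sigma> e x y h \<longrightarrow> comp_step MM \<sigma> e x y h'"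
    unfolding comp_step_def
    by (intro imp_refl disj_mono conj_mono ex_mono all_mono imp_mono; rule impI, erule assms(2))
  then show ?thesis using assms(1) by blast
qed

text \<open>Truncated subtraction as a search, so that it is visibly a function of the
  model.\<close>

definition sub :: "'a::rca \<Rightarrow> 'a \<Rightarrow> 'a" where
  "sub k l = (LEAST j. k \<le> l + j)"

lemma fn_sub [dec_intros]: "fn f \<Longrightarrow> fn g \<Longrightarrow> fn (\<lambda>x. sub (f x) (g x))"
proof (rule fn2_comp[of sub])
  show "fn (\<lambda>z :: 'a. sub (p1 z) (p2 z))"
    unfolding sub_def
  proof (rule fn_Least)
    show "dec2 (\<lambda>x y :: 'a. p1 x \<le> p2 x + y)" by (intro dec_intros)
    show "\<exists>y. p1 x \<le> p2 x + y" for x :: 'a by (intro exI[of _ "p1 x"]) simp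
  qed
qed

lemma sub_add [simp]: "sub (l + j) l = j"
  unfolding sub_def by (rule Least_equality) simp_all

lemma valid_append:
  assumes d: "valid \<sigma> d" and d': "valid \<sigma> d'"
  shows "\<exists>d''. valid \<sigma> d'' \<and> (\<forall>t. occ d t \<or> occ d' t \<longrightarrow> occ d'' t)"
proof -
  obtain l l' where l: "seq MM d l" "seq MM d' l'" using d d' valid_iff by blast
  define f where "f = (\<lambda>k. if k < l then at d k else at d' (sub k l))"
  have f: "fn f" unfolding f_def by (intro dec_intros)
  define c where "c = mkseq (l + l') f"
  have c: "entry MM c k t \<longleftrightarrow> k < l + l' \<and> t = f k" "seq MM c (l + l')" for k t
    by (simp_all add: c_def entry_mkseq[OF f] seq_mkseq[OF f])
  have c1: "entry MM c k t \<longleftrightarrow> entry MM d k t" if "k < l" for k t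
    using that entry_at[OF l(1) that] less_le_trans[OF that, of "l + l'"] by (auto simp: c f_def)
  have c2: "entry MM c (l + k) t \<longleftrightarrow> entry MM d' k t" for k t
    using entry_at[OF l(2), of k] seq_dom[OF l(2), of k] by (auto simp: c f_def not_less)
  have "valid \<sigma> c"
    unfolding valid_iff
  proof (intro conjI allI impI)
    show "\<exists>l. seq MM c l" using c by blast
    fix k t assume e: "entry MM c k t"
    show "\<exists>e x y. t = pp e (pp x y) \<and> comp_step MM \<sigma> e x y (comp_mem c k)"
    proof (cases "k < l")
      case True
      then obtain e x y where t: "t = pp e (pp x y)" "comp_step MM \<sigma> e x y (comp_mem d k)"
        using d e c1 unfolding valid_iff by blast
      have "comp_mem d k g a b \<Longrightarrow> comp_mem c k g a b" for g a b
        using c1 True unfolding comp_mem_def by (meson less_trans)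
      from comp_step_mono[OF t(2), of "comp_mem c k", OF this] show ?thesis using t(1) by blast
    next
      case False
      then obtain j where j: "k = l + j" by (metis add.commute le_add_diff_inverse2 not_less)
      then have "entry MM d' j t" using e c2 by simp
      then obtain e x y where t: "t = pp e (pp x y)" "comp_step MM \<sigma> e x y (comp_mem d' j)"
        using d' unfolding valid_iff by blast
      have "comp_mem d' j g a b \<Longrightarrow> comp_mem c k g a b" for g a b
        using c2 j unfolding comp_mem_def by (meson add_strict_left_mono)
      from comp_step_mono[OF t(2), of "comp_mem c k", OF this] show ?thesis using t(1) by blast
    qed
  qed
  moreover have "occ c t" if "occ d t \<or> occ d' t" for t
    using that c1 c2 seq_dom[OF l(1)] unfolding occ_iff by blast
  ultimately show ?thesis by blast
qed

lemma valid_snoc: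
  assumes d: "valid \<sigma> d" and s: "comp_step MM \<sigma> e x y (\<lambda>f a b. occ d (pp f (pp a b)))"
  shows "\<exists>d'. valid \<sigma> d' \<and> occ d' (pp e (pp x y)) \<and> (\<forall>t. occ d t \<longrightarrow> occ d' t)"
proof -
  obtain l where l: "seq MM d l" using d valid_iff by blast
  define f where "f = (\<lambda>k. if k < l then at d k else pp e (pp x y))"
  have f: "fn f" unfolding f_def by (intro dec_intros)
  define c where "c = mkseq (l + 1) f"
  have c: "entry MM c k t \<longleftrightarrow> k < l + 1 \<and> t = f k" "seq MM c (l + 1)" for k t
    by (simp_all add: c_def entry_mkseq[OF f] seq_mkseq[OF f])
  have c1: "entry MM c k t \<longleftrightarrow> entry MM d k t" if "k < l" for k t
    using that entry_at[OF l(1) that] by (auto simp: c f_def less_Suc_iff)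
  have c2: "entry MM c l t \<longleftrightarrow> t = pp e (pp x y)" for t
    by (auto simp: c f_def less_Suc_iff)
  have mem: "comp_mem d k g a b \<Longrightarrow> comp_mem c k g a b" if "k \<le> l" for k g a b
    using c1 that unfolding comp_mem_def by (meson less_le_trans)
  have "valid \<sigma> c"
    unfolding valid_iff
  proof (intro conjI allI impI)
    show "\<exists>l. seq MM c l" using c by blast
    fix k t assume en: "entry MM c k t"
    then have k: "k = l \<or> k < l" by (auto simp: c less_Suc_iff)
    show "\<exists>e x y. t = pp e (pp x y) \<and> comp_step MM \<sigma> e x y (comp_mem c k)"
    proof (cases "k < l")
      case True
      then obtain e x y where t: "t = pp e (pp x y)" "comp_step MM \<sigma> e x y (comp_mem d k)"
        using d en c1 unfolding valid_iff by blast
      from comp_step_mono[OF t(2), of "comp_mem c k", OF mem[OF less_imp_le[OF True]]] show ?thesis using t(1) by blast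
    next
      case False
      then have "k = l" using k by blast
      moreover have "occ d (pp g (pp a b)) \<Longrightarrow> comp_mem c l g a b" for g a b
        using seq_dom[OF l] c1 unfolding occ_iff comp_mem_def by blast
      ultimately show ?thesis using comp_step_mono[OF s, of "comp_mem c l"] en c2 by blast
    qed
  qed
  moreover have "occ c t" if "occ d t" for t
    using that c1 seq_dom[OF l] unfolding occ_iff by blast
  moreover have "occ c (pp e (pp x y))" using c2 unfolding occ_iff by blast
  ultimately show ?thesis by blast
qed

lemma valid_empty: "valid \<sigma> (mkseq 0 (\<lambda>_. 0))"
  unfolding valid_iff using seq_mkseq[OF fn_const[of 0], of 0] by (auto simp: entry_mkseq[OF fn_const[of 0]])

lemma phi_str_step:
  assumes "comp_step MM \<sigma> e x y (\<lambda>f a b. False)"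
  shows "phi_str MM \<sigma> e x y"
  using valid_snoc[OF valid_empty comp_step_mono[OF assms]] unfolding phi_str_iff by blast

lemma phi_str_id: "phi_str MM \<sigma> (pp 1 0) x x"
  by (rule phi_str_step) (simp add: comp_step_def)

lemma phi_str_const: "phi_str MM \<sigma> (pp 0 c) x c"
  by (rule phi_str_step) (simp add: comp_step_def)

lemma phi_str_oracle: "entry MM \<sigma> x y \<Longrightarrow> phi_str MM \<sigma> (pp 7 0) x y"
  by (rule phi_str_step) (simp add: comp_step_def)

lemma phi_str_pair:
  assumes "phi_str MM \<sigma> f x a" "phi_str MM \<sigma> g x b"
  shows "phi_str MM \<sigma> (pp 8 (pp f g)) x (pp a b)"
proof -
  obtain d d' where "valid \<sigma> d" "occ d (pp f (pp x a))" "valid \<sigma> d'" "occ d' (pp g (pp x b))"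
    using assms phi_str_iff by blast
  then obtain c where c: "valid \<sigma> c" "occ c (pp f (pp x a))" "occ c (pp g (pp x b))" using valid_append by blast
  then have "comp_step MM \<sigma> (pp 8 (pp f g)) x (pp a b) (\<lambda>f a b. occ c (pp f (pp a b)))"
    by (simp add: comp_step_def)
  from valid_snoc[OF c(1) this] show ?thesis unfolding phi_str_iff by blast
qed

lemma phi_str_comp:
  assumes "phi_str MM \<sigma> g x a" "phi_str MM \<sigma> f a y"
  shows "phi_str MM \<sigma> (pp 9 (pp f g)) x y"
proof -
  obtain d d' where "valid \<sigma> d" "occ d (pp g (pp x a))" "valid \<sigma> d'" "occ d' (pp f (pp a y))"
    using assms phi_str_iff by blast
  then obtain c where c: "valid \<sigma> c" "occ c (pp g (pp x a))" "occ c (pp f (pp a y))" using valid_append by blast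
  then have "comp_step MM \<sigma> (pp 9 (pp f g)) x y (\<lambda>f a b. occ c (pp f (pp a b)))"
    by (auto simp: comp_step_def)
  from valid_snoc[OF c(1) this] show ?thesis unfolding phi_str_iff by blast
qed

text \<open>The computations for all z \<le> y must be assembled in one coded sequence. Since y may
  be nonstandard, this takes a \<open>\<Sigma>\<^sub>1\<close> induction on the number of
  computations already joined.\<close>

lemma phi_str_min:
  assumes v: "fn v" and f: "\<And>z. z \<le> y \<Longrightarrow> phi_str MM \<sigma> f (pp x z) (v z)"
    and y: "v y = 0" "\<And>z. z < y \<Longrightarrow> v z \<noteq> 0"
  shows "phi_str MM \<sigma> (pp 10 f) x y"
proof -
  have "\<exists>d. valid \<sigma> d \<and> (n \<le> y + 1 \<longrightarrow> (\<forall>z. z < n \<longrightarrow> occ d (pp f (pp (pp x z) (v z)))))" for n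
  proof (rule sigma1_induct[of "\<lambda>n d. valid \<sigma> d \<and> (n \<le> y + 1 \<longrightarrow> (\<forall>z. z < n \<longrightarrow> occ d (pp f (pp (pp x z) (v z)))))"])
    show "dec2 (\<lambda>n d. valid \<sigma> d \<and> (n \<le> y + 1 \<longrightarrow> (\<forall>z. z < n \<longrightarrow> occ d (pp f (pp (pp x z) (v z))))))"
      by (intro dec_intros fn_comp[OF v])
    show "\<exists>d. valid \<sigma> d \<and> (0 \<le> y + 1 \<longrightarrow> (\<forall>z. z < 0 \<longrightarrow> occ d (pp f (pp (pp x z) (v z)))))"
      using valid_empty by auto
    fix n assume "\<exists>d. valid \<sigma> d \<and> (n \<le> y + 1 \<longrightarrow> (\<forall>z. z < n \<longrightarrow> occ d (pp f (pp (pp x z) (v z)))))"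
    then obtain d where d: "valid \<sigma> d" "n \<le> y + 1 \<Longrightarrow> z < n \<Longrightarrow> occ d (pp f (pp (pp x z) (v z)))" for z by blast
    show "\<exists>d. valid \<sigma> d \<and> (n + 1 \<le> y + 1 \<longrightarrow> (\<forall>z. z < n + 1 \<longrightarrow> occ d (pp f (pp (pp x z) (v z)))))"
    proof (cases "n \<le> y")
      case True
      then obtain d' where d': "valid \<sigma> d'" "occ d' (pp f (pp (pp x n) (v n)))" using f phi_str_iff by blast
      obtain c where c: "valid \<sigma> c" "\<And>t. occ d t \<or> occ d' t \<Longrightarrow> occ c t" using valid_append[OF d(1) d'(1)] by blast
      have "n \<le> y + 1" using True by (simp add: add_increasing2)
      then have "\<forall>z. z < n + 1 \<longrightarrow> occ c (pp f (pp (pp x z) (v z)))"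
        using c(2) d(2) d'(2) by (auto simp: less_Suc_iff order_le_less)
      then show ?thesis using c(1) by blast
    qed (use d in auto)
  qed
  from this[of "y + 1"] obtain d where d: "valid \<sigma> d" "\<And>z. z \<le> y \<Longrightarrow> occ d (pp f (pp (pp x z) (v z)))"
    by (auto simp: less_Suc_iff)
  have "occ d (pp f (pp (pp x y) 0))" using d(2)[of y] y(1) by simp
  moreover have "\<exists>v. v \<noteq> 0 \<and> occ d (pp f (pp (pp x z) v))" if "z < y" for z
    using d(2)[OF less_imp_le[OF that]] y(2)[OF that] by blast
  ultimately have "comp_step MM \<sigma> (pp 10 f) x y (\<lambda>f a b. occ d (pp f (pp a b)))"
    by (simp add: comp_step_def)
  from valid_snoc[OF d(1) this] show ?thesis unfolding phi_str_iff by blast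
qed

text \<open>
  Since the oracle may be chosen, no function has to be programmed: minimization applied to an oracle
  query computes \<open>f\<close> from the complement of its graph.
\<close>

definition ograph :: "('a::rca \<Rightarrow> 'a) \<Rightarrow> 'a set" where
  "ograph f = {z. \<not> (ispair z \<and> p2 z = f (p1 z))}"

lemma ograph_SS: "fn f \<Longrightarrow> ograph f \<in> SS"
proof -
  assume f: "fn f"
  have "dec (\<lambda>z. \<not> (ispair z \<and> p2 z = f (p1 z)))" by (intro dec_intros fn_comp[OF f])
  then show ?thesis by (simp add: ograph_def dec_def)
qed

lemma phi_ograph:
  assumes f: "fn f"
  shows "phi MM (ograph f) (pp 10 (pp 7 0)) x y \<longleftrightarrow> y = f x"
proof -
  have "phi MM (ograph f) (pp 10 (pp 7 0)) x (f x)"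
  proof -
    obtain \<sigma> where s: "bs \<sigma> (pp x (f x) + 1)" "init_seg MM \<sigma> (ograph f)"
      using init_seg_ex[OF ograph_SS[OF f]] by blast
    have "phi_str MM \<sigma> (pp 10 (pp 7 0)) x (f x)"
    proof (rule phi_str_min)
      show "fn (\<lambda>z. if z = f x then 0 else 1 :: 'a)" by (intro dec_intros)
      fix z assume "z \<le> f x"
      then have z: "pp x z < pp x (f x) + 1" by (simp add: less_Suc_iff pp_mono)
      have "bit \<sigma> (pp x z) \<longleftrightarrow> z \<noteq> f x" using s(2) z by (simp add: init_seg_iff[OF s(1)] ograph_def)
      then show "phi_str MM \<sigma> (pp 7 0) (pp x z) (if z = f x then 0 else 1)"
        using z by (intro phi_str_oracle) (simp add: bs_entry[OF s(1)])
    qed auto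
    then show ?thesis using s(2) unfolding phi_def by blast
  qed
  then show ?thesis using phi_det by blast
qed

lemma UN_cyl: "(\<Union>\<sigma>\<in>{\<sigma>. \<exists>l. bs \<sigma> l \<and> \<sigma> + 1 = v}. cyl MM \<sigma>) = {Y \<in> SS. \<exists>\<sigma>. v = \<sigma> + 1 \<and> init_seg MM \<sigma> Y}"
  (is "?A = ?B")
proof
  show "?A \<subseteq> ?B" by (auto simp: mem_cyl)
  show "?B \<subseteq> ?A"
  proof
    fix Y assume "Y \<in> ?B"
    then obtain \<sigma> where s: "Y \<in> SS" "v = \<sigma> + 1" "init_seg MM \<sigma> Y" by blast
    then have "\<sigma> \<in> {\<sigma>. \<exists>l. bs \<sigma> l \<and> \<sigma> + 1 = v}" "Y \<in> cyl MM \<sigma>" using init_seg_bs by (auto simp: mem_cyl)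
    then show "Y \<in> ?A" by (rule UN_I)
  qed
qed

lemma names_phi:
  assumes "names b"
  shows "names_basic_open MM (ograph b) (pp 10 (pp 7 0)) x"
    and "basic_open MM (ograph b) (pp 10 (pp 7 0)) x = opn b x"
proof -
  have f: "fn b" using assms by (simp add: names_def)
  show "names_basic_open MM (ograph b) (pp 10 (pp 7 0)) x"
    using assms unfolding names_basic_open_def phi_ograph[OF f] names_def MM_simps by metis
  show "basic_open MM (ograph b) (pp 10 (pp 7 0)) x = opn b x"
    unfolding basic_open_def phi_ograph[OF f] MM_simps opn_def
    by (rule UN_cyl)
qed

lemma phi_sigma1:
  assumes "X \<in> SS"
  shows "\<exists>R. dec2 R \<and> (\<forall>t. (\<exists>w. R t w) \<longleftrightarrow> phi MM X (p1 t) (p1 (p2 t)) (p2 (p2 t)))"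
proof (intro exI conjI allI)
  let ?R = "\<lambda>t w. init_seg MM (p1 w) X \<and> valid (p1 w) (p2 w) \<and> occ (p2 w) (pp (p1 t) (pp (p1 (p2 t)) (p2 (p2 t))))"
  show "dec2 ?R" by (intro dec_intros assms)
  fix t
  have "(\<exists>w. ?R t w) \<longleftrightarrow> (\<exists>\<sigma> d. ?R t (pp \<sigma> d))" by (metis p_simps(1,2))
  then show "(\<exists>w. ?R t w) \<longleftrightarrow> phi MM X (p1 t) (p1 (p2 t)) (p2 (p2 t))"
    unfolding phi_def phi_str_iff by auto
qed

text \<open>Totality and determinism make the outputs a function with
  \<open>\<Sigma>\<^sub>1\<close> graph, hence a function of the model. Afterwards indices are
  replaced by such functions.\<close>

lemma phi_names:
  assumes X: "X \<in> SS" and n: "\<And>x. names_basic_open MM X e (g x)" and g: "fn g"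
  obtains b where "names b" "\<And>x. basic_open MM X e (g x) = opn b x" "\<And>x y. phi MM X e (g x) y \<longleftrightarrow> y = b x"
proof -
  have "\<exists>!y. phi MM X e (g x) y" for x
    using n[of x] phi_det unfolding names_basic_open_def by blast
  then obtain b where b: "\<And>x y. phi MM X e (g x) y \<longleftrightarrow> y = b x" by metis
  obtain R where R: "dec2 R" "\<And>t. (\<exists>w. R t w) \<longleftrightarrow> phi MM X (p1 t) (p1 (p2 t)) (p2 (p2 t))"
    using phi_sigma1[OF X] by blast
  have "fn b"
  proof (rule fn_sigma[of "\<lambda>x y w. R (pp e (pp (g x) y)) w"])
    show "dec (\<lambda>z. R (pp e (pp (g (p1 z)) (p1 (p2 z)))) (p2 (p2 z)))"
      by (intro dec2_comp[OF R(1)] dec_intros fn_comp[OF g])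
    show "y = b x \<longleftrightarrow> (\<exists>w. R (pp e (pp (g x) y)) w)" for x y by (simp add: R(2) b)
  qed
  moreover have "b x = 0 \<or> (\<exists>\<sigma> l. b x = \<sigma> + 1 \<and> bs \<sigma> l)" for x
    using n[of x] unfolding names_basic_open_def b MM_simps by metis
  moreover have "basic_open MM X e (g x) = opn b x" for x
    unfolding basic_open_def b MM_simps opn_def
    by (rule UN_cyl)
  ultimately show thesis using that[OF _ _ b] unfolding names_def by blast
qed


section \<open>The equivalence of 2-POS with collection and 2-RAN\<close>

section \<open>2-POS in terms of approximations\<close>

lemma pi2_ograph:
  assumes "names b"
  shows "pi2_index MM (ograph b) (pp 10 (pp 7 0))"
    and "pi2_seq MM (ograph b) (pp 10 (pp 7 0)) = (\<lambda>i j. opn b (pp i j))"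
  using names_phi[OF assms] by (auto simp: pi2_index_def pi2_seq_def fun_eq_iff)

lemma two_POS_D:
  fixes b :: "'a::rca \<Rightarrow> 'a"
  assumes POS: "two_POS (MM :: 'a l2_structure)" and b: "names b" and pq: "0 < p" "0 < q"
    and D: "\<And>i. \<exists>m n. p * pw n < nstr n (DD b i m) * q"
  shows "\<exists>Y\<in>SS. \<forall>i. \<exists>j. Y \<in> opn b (pp i j)"
proof -
  have "mu_pos MM (\<lambda>i j. opn b (pp i j))" unfolding mu_pos_iff[OF b] using pq D by blast
  moreover have "ograph b \<in> SS" using b by (simp add: names_def ograph_SS)
  ultimately obtain Y where "Y \<in> SS" "Y \<in> pi2_set (\<lambda>i j. opn b (pp i j))"
    using POS pi2_ograph[OF b] unfolding two_POS_def MM_simps by metis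
  then show ?thesis unfolding pi2_set_def by blast
qed

lemma two_POS_I:
  assumes "\<And>(b :: 'a::rca \<Rightarrow> 'a) p q. names b \<Longrightarrow> 0 < p \<Longrightarrow> 0 < q \<Longrightarrow> (\<And>i. \<exists>m n. p * pw n < nstr n (DD b i m) * q) \<Longrightarrow>
    \<exists>Y\<in>SS. \<forall>i. \<exists>j. Y \<in> opn b (pp i j)"
  shows "two_POS (MM :: 'a l2_structure)"
  unfolding two_POS_def MM_simps
proof (intro ballI allI impI)
  fix X :: "'a set" and e assume X: "X \<in> SS" and a: "pi2_index MM X e \<and> mu_pos MM (pi2_seq MM X e)"
  have fp: "fn (\<lambda>s :: 'a. pp (p1 s) (p2 s))" by (intro dec_intros)
  have "names_basic_open MM X e (pp (p1 s) (p2 s))" for s using a by (simp add: pi2_index_def)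
  then obtain b where b: "names b" "\<And>s. basic_open MM X e (pp (p1 s) (p2 s)) = opn b s"
    using phi_names[OF X _ fp] by metis
  have s: "pi2_seq MM X e = (\<lambda>i j. opn b (pp i j))"
    using b(2)[of "pp _ _"] by (simp add: pi2_seq_def fun_eq_iff)
  obtain p q where pq: "0 < p" "0 < q" "\<forall>i. \<exists>m n. p * pw n < nstr n (DD b i m) * q"
    using a unfolding s mu_pos_iff[OF b(1)] by blast
  have "\<exists>Y\<in>SS. \<forall>i. \<exists>j. Y \<in> opn b (pp i j)"
    by (rule assms[OF b(1) pq(1,2)]) (rule pq(3)[rule_format])
  then obtain Y where Y: "Y \<in> SS" "\<And>i. \<exists>j. Y \<in> opn b (pp i j)" by blast
  have "Y \<in> pi2_set (\<lambda>i j. opn b (pp i j))" by (simp add: pi2_set_def Y(2))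
  then show "\<exists>Y\<in>SS. Y \<in> pi2_set (pi2_seq MM X e)" unfolding s using Y(1) by (rule bexI)
qed


section \<open>2-POS implies \<open>B\<Sigma>\<^sub>2\<close>\<close>

lemma fn_tm_val: "(\<And>n. fn (f n)) \<Longrightarrow> fn (\<lambda>s. tm_val MM (\<lambda>n. f n s) t)"
  by (induction t) (auto intro: dec_intros)

text \<open>Collection is a scheme, so the matrix must be decidable for arbitrary syntax. Every
  variable is a function of a single argument s, which absorbs parameters and quantified variables
  alike.\<close>

lemma dec_sat:
  assumes E: "range E \<subseteq> SS"
  shows "(\<And>n. fn (f n)) \<Longrightarrow> dec (\<lambda>s. sat MM (\<lambda>n. f n s) E \<theta>)"
proof (induction \<theta> arbitrary: f)
  case (Mem t n)
  have "E n \<in> SS" using E by auto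
  then show ?case by (simp, intro dec_intros fn_tm_val Mem)
next
  case (BAll t \<theta>)
  \<comment> \<open>Under the quantifier the argument becomes a pair: the new variable is its second
    component, and the old variables read the first.\<close>
  have "dec (\<lambda>z. sat MM (\<lambda>n. (case n of 0 \<Rightarrow> p2 | Suc m \<Rightarrow> (\<lambda>z. f m (p1 z))) z) E \<theta>)"
  proof (rule BAll.IH)
    show "fn (case n of 0 \<Rightarrow> p2 | Suc m \<Rightarrow> (\<lambda>z. f m (p1 z)))" for n
      by (cases n) (auto intro: fn_p2_base fn_comp[OF BAll.prems fn_p1_base])
  qed
  moreover have "(\<lambda>n. (case n of 0 \<Rightarrow> p2 | Suc m \<Rightarrow> (\<lambda>z. f m (p1 z))) z) = case_nat (p2 z) (\<lambda>n. f n (p1 z))" for z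
    by (auto simp: fun_eq_iff split: nat.splits)
  ultimately have "dec2 (\<lambda>s a. sat MM (case_nat a (\<lambda>n. f n s)) E \<theta>)" by simp
  then show ?case by (simp, intro dec_all_less fn_tm_val BAll.prems)
qed (simp_all add: dec_eq dec_less dec_not dec_conj fn_tm_val)

lemma prefix_single:
  assumes "bs \<tau> (x + 1)" "\<And>k. bit \<tau> k \<longleftrightarrow> k = x" "init_seg MM \<tau> Y"
  shows "x \<in> Y" "\<And>k. k < x \<Longrightarrow> k \<notin> Y"
proof -
  have *: "k < x + 1 \<Longrightarrow> k = x \<longleftrightarrow> k \<in> Y" for k
    using assms(3) by (simp add: init_seg_iff[OF assms(1)] assms(2))
  show "x \<in> Y" using *[of x] by (simp add: less_Suc_iff)
  show "k \<notin> Y" if "k < x" for k using *[of k] that less_imp_le[OF that] by (auto simp: less_Suc_iff)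
qed

lemma nstr_pos:
  assumes "dec P" "bs \<tau> L" "P \<tau>"
  shows "1 \<le> nstr L P"
proof -
  have d: "dec (\<lambda>x. x = \<tau>)" by (intro dec_intros)
  have "cnt (SB L) (\<lambda>x. x = \<tau>) \<le> nstr L P"
    unfolding nstr_def using assms(2,3) by (intro cnt_mono d dec_bsP assms(1)) auto
  then show ?thesis using cnt_single[OF bs_less_SB[OF assms(2)]] by simp
qed

text \<open>
  If collection fails for \<open>x < u\<close>, then the open sets \<open>\<Union>{[0\<^sup>x1] | x has no witness \<le> i}\<close> all contain
  one of these cylinders, but a point of their intersection picks a single \<open>x\<close> without any witness.
\<close>

lemma two_POS_imp_BSigma2:
  assumes POS: "two_POS (MM :: 'a::rca l2_structure)"
  shows "BSigma2 (MM :: 'a l2_structure)"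
  unfolding BSigma2_def Let_def MM_simps
proof (intro allI impI)
  fix \<theta> and e :: "nat \<Rightarrow> 'a" and E :: "nat \<Rightarrow> 'a set" and u
  assume E: "range E \<subseteq> SS"
  define T where "T = (\<lambda>x y w z. sat MM (case_nat z (case_nat w (case_nat y (case_nat x e)))) E \<theta>)"
  assume "\<forall>x. x < u \<longrightarrow> (\<exists>y w. \<forall>z. sat MM (case_nat z (case_nat w (case_nat y (case_nat x e)))) E \<theta>)"
  then have ex: "\<And>x. x < u \<Longrightarrow> \<exists>y w. \<forall>z. T x y w z" by (simp add: T_def)
  have T: "dec (\<lambda>s. T (x s) (y s) (w s) (z s))" if f: "fn x" "fn y" "fn w" "fn z" for x y w z
  proof -
    let ?f = "\<lambda>n. case n of 0 \<Rightarrow> z | Suc n \<Rightarrow> (case n of 0 \<Rightarrow> w | Suc n \<Rightarrow> (case n of 0 \<Rightarrow> y | Suc n \<Rightarrow>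
        (case n of 0 \<Rightarrow> x | Suc n \<Rightarrow> (\<lambda>_. e n))))"
    have "dec (\<lambda>s. sat MM (\<lambda>n. ?f n s) E \<theta>)"
      by (rule dec_sat[OF E]) (auto intro: f fn_const split: nat.splits)
    moreover have "(\<lambda>n. ?f n s) = case_nat (z s) (case_nat (w s) (case_nat (y s) (case_nat (x s) e)))" for s
      by (auto simp: fun_eq_iff split: nat.splits)
    ultimately show ?thesis by (simp add: T_def)
  qed
  have "\<exists>v. \<forall>x. x < u \<longrightarrow> (\<exists>y. y < v \<and> (\<exists>w. \<forall>z. T x y w z))"
  proof (rule ccontr)
    assume "\<not> ?thesis"
    then have nc: "\<exists>x. x < u \<and> (\<forall>y. y < v \<longrightarrow> (\<forall>w. \<exists>z. \<not> T x y w z))" for v by blast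
    define S where "S = (\<lambda>x :: 'a. mk (x + 1) (\<lambda>k. k = x))"
    have d1: "dec (\<lambda>k. k = x)" for x :: 'a by (intro dec_intros)
    have S: "bs (S x) (x + 1)" "bit (S x) k \<longleftrightarrow> k = x" for x k
      by (auto simp: S_def bs_mk[OF d1] bit_mk[OF d1] less_Suc_iff)
    have fS: "fn S" unfolding S_def by (intro dec_intros)
    \<comment> \<open>Counterexamples are collected below z. This makes the
      \<open>\<Sigma>\<^sub>1\<close> condition that x has no witness up to i decidable in
      stages.\<close>
    define C where "C = (\<lambda>i x z. x < u \<and> (\<forall>y. y \<le> i \<longrightarrow> (\<forall>w. w \<le> i \<longrightarrow> (\<exists>z'. z' < z \<and> \<not> T x y w z'))))"
    have C: "dec (\<lambda>s. C (i s) (x s) (z s))" if f: "fn i" "fn x" "fn z" for i x z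
      unfolding C_def by (intro dec_intros T fn_comp[OF f(1)] fn_comp[OF f(2)] fn_comp[OF f(3)] f)
    define b where "b = (\<lambda>s. if C (p1 s) (p1 (p2 s)) (p2 (p2 s)) then S (p1 (p2 s)) + 1 else 0)"
    have b: "names b"
      unfolding names_def
    proof (intro conjI allI)
      show "fn b" unfolding b_def by (intro dec_intros C fn_comp[OF fS])
      show "b s = 0 \<or> (\<exists>\<sigma> l. b s = \<sigma> + 1 \<and> bs \<sigma> l)" for s using S(1) by (auto simp: b_def)
    qed
    \<comment> \<open>The approximation contains one of the 2^u strings of length u, with its only 1
      at x; hence the measure bound 1 / (2^u + 1).\<close>
    have "\<exists>m n. 1 * pw n < nstr n (DD b i m) * (pw u + 1)" for i
    proof -
      obtain x where x: "x < u" "\<And>y w. y \<le> i \<Longrightarrow> \<exists>z. \<not> T x y w z"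
        using nc[of "i + 1"] by (auto simp: less_Suc_iff)
      define R where "R = (\<lambda>s z. p1 s \<le> i \<longrightarrow> \<not> T x (p1 s) (p2 s) z)"
      have "dec2 R" unfolding R_def by (intro dec_intros T)
      moreover have "\<exists>z. R s z" for s using x(2)[of "p1 s" "p2 s"] by (auto simp: R_def)
      ultimately obtain v where v: "\<And>s. s < pp i i + 1 \<Longrightarrow> \<exists>z. z < v \<and> R s z" using BSigma1[of R] by blast
      have Cv: "C i' x v" if "i' \<le> i" for i'
        unfolding C_def
      proof (intro conjI allI impI x(1))
        fix y w assume yw: "y \<le> i'" "w \<le> i'"
        then have "pp y w < pp i i + 1" using \<open>i' \<le> i\<close> by (simp add: less_Suc_iff pp_mono order_trans)
        from v[OF this] show "\<exists>z'. z' < v \<and> \<not> T x y w z'" using yw \<open>i' \<le> i\<close> by (auto simp: R_def)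
      qed
      define \<tau> where "\<tau> = mk u (\<lambda>k. k = x)"
      have t: "bs \<tau> u" and bt: "\<And>k. bit \<tau> k \<longleftrightarrow> k < u \<and> k = x"
        by (simp_all add: \<tau>_def bs_mk[OF d1] bit_mk[OF d1])
      have "prefix MM (S x) \<tau>"
        using x(1) unfolding prefix_iff[OF S(1) t] S(2) bt by (auto simp: less_iff_Suc_le intro: order_trans)
      moreover have "b (pp i' (pp x v)) = S x + 1" if "i' \<le> i" for i' using Cv[OF that] by (simp add: b_def)
      ultimately have "DD b i (pp x v + 1) \<tau>"
        unfolding DD_def by (intro allI impI exI[of _ "pp x v"]) (simp add: less_Suc_iff)
      then have "1 \<le> nstr u (DD b i (pp x v + 1))"
        using b by (intro nstr_pos[OF _ t] dec_DD dec_intros) (simp add: names_def)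
      then have "pw u + 1 \<le> nstr u (DD b i (pp x v + 1)) * (pw u + 1)"
        using mult_right_mono[of 1 _ "pw u + 1"] by fastforce
      then show ?thesis by (intro exI[of _ "pp x v + 1"] exI[of _ u]) (simp add: less_iff_Suc_le)
    qed
    then obtain Y where Y: "Y \<in> SS" "\<And>i. \<exists>j. Y \<in> opn b (pp i j)"
      using two_POS_D[OF POS b, of 1 "pw u + 1"] by (auto simp: pos_iff)
    have Yi: "\<exists>x z. C i x z \<and> init_seg MM (S x) Y" for i
    proof -
      obtain j where "Y \<in> opn b (pp i j)" using Y(2) by blast
      then show ?thesis by (auto simp: opn_def b_def split: if_splits)
    qed
    obtain x z where x: "C 0 x z" "init_seg MM (S x) Y" using Yi by blast
    then have "x < u" by (simp add: C_def)
    then obtain y w where yw: "\<forall>z. T x y w z" using ex by blast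
    \<comment> \<open>Row y + w excludes the witness y, w for its own x'. Both cylinders contain Y,
      so x' and x are the position of its first 1.\<close>
    obtain x' z' where x': "C (y + w) x' z'" "init_seg MM (S x') Y" using Yi by blast
    have "x' = x"
      using prefix_single[OF S(1,2) x(2)] prefix_single[OF S(1,2) x'(2)] by (metis linorder_neqE)
    moreover have "y \<le> y + w" "w \<le> y + w" by simp_all
    ultimately have "\<exists>z'. \<not> T x y w z'" using x'(1) unfolding C_def by blast
    then show False using yw by blast
  qed
  then show "\<exists>v. \<forall>x. x < u \<longrightarrow> (\<exists>y. y < v \<and> (\<exists>w. \<forall>z. sat MM (case_nat z (case_nat w (case_nat y (case_nat x e)))) E \<theta>))"
    by (simp add: T_def)
qed


section \<open>\<open>B\<Sigma>\<^sub>2\<close> and 2-RAN imply 2-POS\<close>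

definition col :: "'a::rca \<Rightarrow> 'a \<Rightarrow> 'a \<Rightarrow> 'a" where
  "col k l \<tau> = mk l (\<lambda>i. bit \<tau> (pp k i))"

lemma fn_col [dec_intros]: "fn f \<Longrightarrow> fn g \<Longrightarrow> fn h \<Longrightarrow> fn (\<lambda>x. col (f x) (g x) (h x))"
  by (rule fn3_comp[of col]; (assumption | (unfold col_def; intro dec_intros)))

lemma col: "bs (col k l \<tau>) l" "bit (col k l \<tau>) i \<longleftrightarrow> i < l \<and> bit \<tau> (pp k i)"
proof -
  have d: "dec (\<lambda>i. bit \<tau> (pp k i))" by (intro dec_intros)
  show "bs (col k l \<tau>) l" "bit (col k l \<tau>) i \<longleftrightarrow> i < l \<and> bit \<tau> (pp k i)"
    by (simp_all add: col_def bs_mk[OF d] bit_mk[OF d])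
qed

lemma pp_strict: "k \<le> K \<Longrightarrow> i < l \<Longrightarrow> pp k i < pp K (l :: 'a::rca)"
  using pp_mono[of k K i l] pp_inject[of k i K l] by (auto simp: order_less_le)

text \<open>
  The columns of a string are independent, so avoiding \<open>U\<close>, which has measure at least \<open>1 / q\<close>, in all
  of the first \<open>q n\<close> columns has measure at most \<open>(1 - 1 / q)\<^sup>q\<^sup>n \<le> 2\<^sup>-\<^sup>n\<close>.
\<close>

lemma columns_avoid_bound:
  assumes U: "dec U" and q: "pw l \<le> nstr l U * q" and q0: "0 < q"
    and L: "pp (q * n) l \<le> L"
  shows "nstr L (\<lambda>\<tau>. \<forall>k. k < q * n \<longrightarrow> \<not> U (col k l \<tau>)) * pw n \<le> pw L"
proof -
  define R where "R = (\<lambda>m \<tau>. \<forall>k. k < m \<longrightarrow> \<not> U (col k l \<tau>))"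
  define r where "r = (\<lambda>m. nstr L (R m))"
  have dR: "dec (\<lambda>x. R (f x) (g x))" if f: "fn f" "fn g" for f g
    unfolding R_def by (intro dec_intros dec_fn[OF U] f fn_comp[OF f(2)])
  have fr: "fn (\<lambda>x. r (f x))" if "fn f" for f unfolding r_def by (intro dec_intros dR that fn_comp[OF that])
  have dR1: "dec (R m)" for m by (intro dR dec_intros)
  let ?u = "nstr l (\<lambda>\<tau>. \<not> U \<tau>)"
  have u: "q * ?u + pw l \<le> q * pw l"
  proof -
    have "q * ?u + pw l \<le> q * ?u + nstr l U * q" using q by simp
    also have "\<dots> = q * (nstr l U + ?u)" by (simp add: algebra_simps)
    also have "\<dots> = q * pw l" by (simp add: nstr_compl[OF U])
    finally show ?thesis .
  qed
  \<comment> \<open>One more column to avoid multiplies the measure by at most 1 - 1/q, because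
    column m is independent of the earlier ones.\<close>
  have step: "q * r (m + 1) + r m \<le> q * r m" if m: "m < q * n" for m
  proof -
    define c where "c = nstr L (\<lambda>\<tau>. \<not> U (col m l \<tau>))"
    have dU: "dec (\<lambda>\<tau>. \<not> U \<tau>)" "dec (\<lambda>\<tau>. \<not> U (col m l \<tau>))" by (intro dec_intros dec_fn[OF U])+
    have cu: "c * pw l = pw L * ?u"
      unfolding c_def col_def
    proof (rule nstr_proj[OF _ _ _ dU(1), of "pp m"])
      show "fn (pp m)" by (intro dec_intros)
      show "inj (pp m)" by (simp add: inj_def)
      show "pp m i < L" if "i < l" for i
        using pp_strict[OF less_imp_le[OF m] that] L by (rule less_le_trans)
    qed
    have "pw l * (q * c + pw L) = q * (c * pw l) + pw l * pw L" by (simp add: algebra_simps)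
    also have "\<dots> = pw L * (q * ?u + pw l)" unfolding cu by (simp add: algebra_simps)
    also have "\<dots> \<le> pw L * (q * pw l)" by (rule mult_left_mono[OF u]) simp
    finally have "pw l * (q * c + pw L) \<le> pw l * (q * pw L)" by (simp add: ac_simps)
    then have c: "q * c + pw L \<le> q * pw L" by (meson mult_less_cancel not_le mult_strict_left_mono pw_pos)
    have "nstr L (R m) * nstr L (\<lambda>\<tau>. \<not> U (col m l \<tau>)) = nstr L (\<lambda>\<tau>. R m \<tau> \<and> \<not> U (col m l \<tau>)) * pw L"
    proof (rule nstr_indep[OF dR1 dU(2), of "\<lambda>i. \<not> (ispair i \<and> p1 i = m)"])
      show "dec (\<lambda>i. \<not> (ispair i \<and> p1 i = m))" by (intro dec_intros)
      have colL: "i < l \<Longrightarrow> k \<le> m \<Longrightarrow> pp k i < L" for i k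
        using pp_strict[of k "q * n" i l] m L by (meson less_le_trans less_imp_le order_trans)
      fix \<sigma> \<tau> assume st: "bs \<sigma> L" "bs \<tau> L"
      { assume e: "\<And>i. i < L \<Longrightarrow> \<not> (ispair i \<and> p1 i = m) \<Longrightarrow> bit \<sigma> i \<longleftrightarrow> bit \<tau> i"
        have "col k l \<sigma> = col k l \<tau>" if "k < m" for k
          by (rule bs_ext[OF col(1) col(1)]) (use e colL[OF _ less_imp_le[OF that]] that in \<open>auto simp: col\<close>)
        then show "R m \<sigma> \<Longrightarrow> R m \<tau>" by (simp add: R_def) }
      { assume e: "\<And>i. i < L \<Longrightarrow> \<not> \<not> (ispair i \<and> p1 i = m) \<Longrightarrow> bit \<sigma> i \<longleftrightarrow> bit \<tau> i"
        have "col m l \<sigma> = col m l \<tau>"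
          by (rule bs_ext[OF col(1) col(1)]) (use e colL in \<open>auto simp: col\<close>)
        then show "\<not> U (col m l \<sigma>) \<Longrightarrow> \<not> U (col m l \<tau>)" by simp }
    qed
    moreover have "(\<lambda>\<tau>. R m \<tau> \<and> \<not> U (col m l \<tau>)) = R (m + 1)"
      by (auto simp: R_def fun_eq_iff less_Suc_iff order_le_less)
    ultimately have rc: "r m * c = r (m + 1) * pw L" by (simp add: r_def c_def)
    have "pw L * (q * r (m + 1) + r m) = q * (r (m + 1) * pw L) + r m * pw L" by (simp add: algebra_simps)
    also have "\<dots> = r m * (q * c + pw L)" unfolding rc[symmetric] by (simp add: algebra_simps)
    also have "\<dots> \<le> r m * (q * pw L)" by (rule mult_left_mono[OF c ge0])
    finally have "pw L * (q * r (m + 1) + r m) \<le> pw L * (q * r m)" by (simp add: ac_simps)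
    then show ?thesis by (meson mult_less_cancel not_le mult_strict_left_mono pw_pos)
  qed
  have half: "r (m + q) + r (m + q) \<le> r m" if m: "m + q \<le> q * n" for m
  proof -
    \<comment> \<open>The invariant is (1 - 1/q)^j \<le> q / (q + j) with denominators cleared; at j
      = q the factor is 1/2, and no power has to be estimated.\<close>
    have "j \<le> q \<longrightarrow> (q + j) * r (m + j) \<le> q * r m" for j
    proof (rule dec_induct[of "\<lambda>j. j \<le> q \<longrightarrow> (q + j) * r (m + j) \<le> q * r m"])
      show "dec (\<lambda>j. j \<le> q \<longrightarrow> (q + j) * r (m + j) \<le> q * r m)" by (intro dec_intros fr)
      fix j assume IH: "j \<le> q \<longrightarrow> (q + j) * r (m + j) \<le> q * r m"
      show "j + 1 \<le> q \<longrightarrow> (q + (j + 1)) * r (m + (j + 1)) \<le> q * r m"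
      proof
        assume "j + 1 \<le> q"
        then have j: "j < q" by (simp add: less_iff_Suc_le)
        then have "m + j < q * n" using m by (meson add_strict_left_mono less_le_trans)
        define A B where "A = r (m + j)" and "B = r (m + (j + 1))"
        have s: "q * B + A \<le> q * A" using step[OF \<open>m + j < q * n\<close>] by (simp add: A_def B_def add.assoc)
        have "q * ((q + (j + 1)) * B) + (q + (j + 1)) * A = (q + (j + 1)) * (q * B + A)" by (simp add: algebra_simps)
        also have "\<dots> \<le> (q + (j + 1)) * (q * A)" by (rule mult_left_mono[OF s ge0])
        also have "\<dots> = q * ((q + j) * A) + q * A" by (simp add: algebra_simps)
        also have "\<dots> \<le> q * ((q + j) * A) + (q + (j + 1)) * A" by (intro add_left_mono mult_right_mono) simp_all
        finally have "q * ((q + (j + 1)) * B) \<le> q * ((q + j) * A)" by simp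
        then have "(q + (j + 1)) * B \<le> (q + j) * A" using q0 by (meson mult_less_cancel not_le mult_strict_left_mono)
        then show "(q + (j + 1)) * r (m + (j + 1)) \<le> q * r m" using IH j by (auto simp: A_def B_def intro: order_trans)
      qed
    qed simp
    from this[of q] have "q * (r (m + q) + r (m + q)) \<le> q * r m" by (simp add: algebra_simps)
    then show ?thesis using q0 by (meson mult_less_cancel not_le mult_strict_left_mono)
  qed
  \<comment> \<open>Each further block of q columns halves the measure.\<close>
  have "i \<le> n \<longrightarrow> r (q * i) * pw i \<le> pw L" for i
  proof (rule dec_induct[of "\<lambda>i. i \<le> n \<longrightarrow> r (q * i) * pw i \<le> pw L"])
    show "dec (\<lambda>i. i \<le> n \<longrightarrow> r (q * i) * pw i \<le> pw L)" by (intro dec_intros fr)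
    show "0 \<le> n \<longrightarrow> r (q * 0) * pw 0 \<le> pw L" using nstr_le[OF dR1] by (simp add: r_def)
    fix i assume IH: "i \<le> n \<longrightarrow> r (q * i) * pw i \<le> pw L"
    show "i + 1 \<le> n \<longrightarrow> r (q * (i + 1)) * pw (i + 1) \<le> pw L"
    proof
      assume i: "i + 1 \<le> n"
      have "q * (i + 1) \<le> q * n" by (rule mult_left_mono[OF i ge0])
      then have "r (q * i + q) + r (q * i + q) \<le> r (q * i)" by (intro half) (simp add: distrib_left)
      then have "(r (q * i + q) + r (q * i + q)) * pw i \<le> r (q * i) * pw i" by (rule mult_right_mono) simp
      also have "\<dots> \<le> pw L" using IH i by (meson less_iff_Suc_le less_imp_le)
      finally show "r (q * (i + 1)) * pw (i + 1) \<le> pw L"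
        unfolding pw_simps by (simp add: distrib_left distrib_right)
    qed
  qed
  then show ?thesis by (simp add: r_def R_def)
qed

lemma test_ograph:
  assumes "names b"
  shows "\<And>n i j. names_basic_open MM (ograph b) (pp 10 (pp 7 0)) (pp n (pp i j))"
    and "test_seq MM (ograph b) (pp 10 (pp 7 0)) n = (\<lambda>i j. opn b (pp n (pp i j)))"
  using names_phi[OF assms] by (auto simp: test_seq_def fun_eq_iff)

lemma sigma2_mu_le_1: "sigma2_mu_le MM B 1 N \<longleftrightarrow> (\<exists>a. a + 1 = N \<and> mu_ge MM B a N)"
  by (simp add: sigma2_mu_le_def)

text \<open>Collection for \<open>\<Pi>\<^sub>1\<close> matrices as an instance of the scheme: x, y,
  z are variables 3, 2, 0, and W enters as a set parameter.\<close>

lemma BSigma2_D: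
  assumes BS: "BSigma2 (MM :: 'a::rca l2_structure)"
    and W: "dec (\<lambda>s. W (p1 s) (p1 (p2 s)) (p2 (p2 s)))"
    and ex: "\<And>k. k < u \<Longrightarrow> \<exists>i :: 'a. \<forall>j. W k i j"
  obtains v where "\<And>k. k < u \<Longrightarrow> \<exists>i. i < v \<and> (\<forall>j. W k i j)"
proof -
  let ?E = "\<lambda>_ :: nat. {s. W (p1 s) (p1 (p2 s)) (p2 (p2 s))}"
  let ?t = "Mem (TPair b3 (TPair b2 b0)) 0"
  have E: "range ?E \<subseteq> SS" using W by (auto simp: dec_def)
  have s: "sat MM (case_nat z (case_nat w (case_nat y (case_nat x e)))) ?E ?t \<longleftrightarrow> W x y z" for x y z w :: 'a and e
    unfolding sat_Mem_pair by (simp add: pp_def[symmetric])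
  from BS[unfolded BSigma2_def Let_def MM_simps, rule_format, OF E, of u "\<lambda>_. 0" ?t, unfolded s]
  obtain v where "\<forall>x. x < u \<longrightarrow> (\<exists>y. y < v \<and> (\<forall>z. W x y z))" using ex by auto
  then show thesis using that by blast
qed

lemma BSigma2_RAN_imp_POS:
  assumes BS: "BSigma2 (MM :: 'a::rca l2_structure)" and RAN: "two_RAN (MM :: 'a l2_structure)"
  shows "two_POS (MM :: 'a l2_structure)"
proof (rule two_POS_I)
  fix b :: "'a \<Rightarrow> 'a" and p q
  assume b: "names b" and pq: "0 < p" "0 < q" and D: "\<And>i. \<exists>m n. p * pw n < nstr n (DD b i m) * q"
  have fb: "fn b" using b by (simp add: names_def)
  \<comment> \<open>The cylinder of \<tau> enters row i of component n when one of the first q n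
    columns of \<tau> is seen to satisfy \<open>DD b i\<close>. The bound on \<open>pp k l\<close>
    ensures that the first l bits of that column are bits of \<tau> and not padding.\<close>
  define C where "C = (\<lambda>n i \<tau> t l. bs \<tau> (slen \<tau>) \<and> (\<exists>k. k < q * n \<and> pp k l \<le> slen \<tau> \<and> DD b i t (col k l \<tau>)))"
  define b' where "b' = (\<lambda>s. if C (p1 s) (p1 (p2 s)) (p1 (p2 (p2 s))) (p1 (p2 (p2 (p2 s)))) (p2 (p2 (p2 (p2 s))))
     then p1 (p2 (p2 s)) + 1 else 0)"
  have b': "names b'"
    unfolding names_def
  proof (intro conjI allI)
    show "fn b'" unfolding b'_def C_def by (intro dec_intros dec_DD fb)
    show "b' s = 0 \<or> (\<exists>\<sigma> l. b' s = \<sigma> + 1 \<and> bs \<sigma> l)" for s by (auto simp: b'_def C_def)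
  qed
  have fb': "fn b'" using b' by (simp add: names_def)
  define c where "c = (\<lambda>n s. b' (pp n (pp (p1 s) (p2 s))))"
  have c: "names (c n)" for n
    using b' unfolding names_def c_def by (auto intro!: dec_intros fn_comp[OF fb'])
  have c_pp: "c n (pp i j) = b' (pp n (pp i j))" for n i j by (simp add: c_def)
  have test_eq: "test_seq MM (ograph b') (pp 10 (pp 7 0)) n = (\<lambda>i j. opn (c n) (pp i j))" for n
    unfolding test_ograph(2)[OF b'] by (simp add: opn_def c_pp)
  have small: "\<exists>m L. nstr L (\<lambda>\<tau>. \<not> DD (c n) i m \<tau>) * pw n \<le> pw L" for n i
  proof -
    obtain m0 l where ml: "p * pw l < nstr l (DD b i m0) * q" using D by blast
    have dU: "dec (DD b i m0)" by (intro dec_DD fb dec_intros)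
    have "pw l \<le> p * pw l" using mult_ge[OF pq(1)] .
    then have ml': "pw l \<le> nstr l (DD b i m0) * q" using ml by simp
    define L where "L = pp (q * n) l"
    \<comment> \<open>Above the index (\<tau>, (m0, l)) of every string \<tau> of length L.\<close>
    define m where "m = pp (SB L) (pp m0 l)"
    note av = columns_avoid_bound[OF dU ml' pq(2), of n L, OF eq_refl[OF L_def[symmetric]]]
    have "nstr L (\<lambda>\<tau>. \<not> DD (c n) i m \<tau>) \<le> nstr L (\<lambda>\<tau>. \<forall>k. k < q * n \<longrightarrow> \<not> DD b i m0 (col k l \<tau>))"
    proof (rule nstr_mono)
      show "dec (\<lambda>\<tau>. \<not> DD (c n) i m \<tau>)" using c by (intro dec_not dec_DD dec_intros) (simp add: names_def)
      show "dec (\<lambda>\<tau>. \<forall>k. k < q * n \<longrightarrow> \<not> DD b i m0 (col k l \<tau>))" by (intro dec_intros dec_DD fb)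
      fix \<tau> assume t: "bs \<tau> L" and n: "\<not> DD (c n) i m \<tau>"
      show "\<forall>k. k < q * n \<longrightarrow> \<not> DD b i m0 (col k l \<tau>)"
      proof (intro allI impI notI)
        fix k assume k: "k < q * n" "DD b i m0 (col k l \<tau>)"
        have "pp k l \<le> slen \<tau>" using k(1) by (simp add: bs_slen[OF t] L_def pp_mono less_imp_le)
        then have "C n i' \<tau> m0 l" if "i' \<le> i" for i'
          using k DD_mono[OF k(2) that order_refl prefix_refl] t unfolding C_def bs_slen[OF t] by blast
        then have e: "c n (pp i' (pp \<tau> (pp m0 l))) = \<tau> + 1" if "i' \<le> i" for i' using that by (simp add: c_pp b'_def)
        have "pp \<tau> (pp m0 l) < m"
          unfolding m_def using pp_mono[OF less_imp_le[OF bs_less_SB[OF t]] order_refl, of "pp m0 l"] bs_less_SB[OF t]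
          by (simp add: order_less_le)
        then have "DD (c n) i m \<tau>" unfolding DD_def using e prefix_refl by (metis inb_Suc)
        then show False using n by blast
      qed
    qed
    then have "nstr L (\<lambda>\<tau>. \<not> DD (c n) i m \<tau>) * pw n \<le> nstr L (\<lambda>\<tau>. \<forall>k. k < q * n \<longrightarrow> \<not> DD b i m0 (col k l \<tau>)) * pw n"
      by (rule mult_right_mono) simp
    then show ?thesis using av order_trans by blast
  qed
  have test: "sigma2_test MM (ograph b') (pp 10 (pp 7 0))"
    unfolding sigma2_test_def test_eq MM_simps sigma2_mu_le_1 pow2_iff
  proof (intro conjI allI)
    fix n :: 'a
    show "names_basic_open MM (ograph b') (pp 10 (pp 7 0)) (pp n (pp i j))" for i j by (rule test_ograph(1)[OF b'])
    \<comment> \<open>The test consists of complements, so component n needs measure at least 1 -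
      2^-n = (2^n - 1) / 2^n.\<close>
    define a where "a = pw n - 1"
    have a1: "a + 1 = pw n" using less_iff_Suc_le[of 0 "pw n"] by (simp add: a_def)
    have "mu_ge MM (\<lambda>i j. opn (c n) (pp i j)) a (pw n)"
      unfolding mu_ge_iff[OF c]
    proof (intro allI impI)
      fix i p' q' :: 'a assume p': "0 < p' \<and> 0 < q'"
      obtain m L where mL: "nstr L (\<lambda>\<tau>. \<not> DD (c n) i m \<tau>) * pw n \<le> pw L" using small by blast
      have dd: "dec (DD (c n) i m)" using c by (intro dec_DD dec_intros) (simp add: names_def)
      define G H where "G = nstr L (DD (c n) i m)" and "H = nstr L (\<lambda>\<tau>. \<not> DD (c n) i m \<tau>)"
      have GH: "G + H = pw L" unfolding G_def H_def by (rule nstr_compl[OF dd])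
      have "a * pw L + pw L = pw n * pw L" by (simp add: a1[symmetric] algebra_simps)
      also have "\<dots> = G * pw n + H * pw n" unfolding GH[symmetric] by (simp add: algebra_simps)
      also have "\<dots> \<le> G * pw n + pw L" using mL by (simp add: H_def)
      finally have "a * pw L \<le> G * pw n" by simp
      then have "a * pw L * q' \<le> G * pw n * q'" by (rule mult_right_mono) simp
      moreover have "0 < p' * pw n * pw L" using p' by simp
      ultimately have "a * q' * pw L < G * pw n * q' + p' * pw n * pw L"
        by (metis add_strict_increasing2 ge0 mult.assoc mult.commute add.commute add_le_less_mono add.right_neutral)
      then show "\<exists>m L. a * q' * pw L < nstr L (DD (c n) i m) * pw n * q' + p' * pw n * pw L"
        unfolding G_def by blast
    qed
    then show "\<exists>N. N = pw n \<and> (\<exists>a. a + 1 = N \<and> mu_ge MM (\<lambda>i j. opn (c n) (pp i j)) a N)" using a1 by blast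
  qed
  have "ograph b' \<in> SS" by (rule ograph_SS[OF fb'])
  then obtain Y where Y: "Y \<in> SS" "two_random MM (ograph b') Y" using RAN unfolding two_RAN_def MM_simps by blast
  then obtain n where "Y \<notin> sigma2_set MM (test_seq MM (ograph b') (pp 10 (pp 7 0)) n)"
    using test unfolding two_random_def by blast
  then have Yn: "\<exists>j. Y \<in> opn (c n) (pp i j)" for i using Y(1) unfolding test_eq by (auto simp: sigma2_set_def pi2_set_def)
  define Z where "Z = (\<lambda>k. {x. pp k x \<in> Y})"
  have Z: "Z k \<in> SS" for k
  proof -
    have "dec (\<lambda>x. pp k x \<in> Y)" by (intro dec_intros Y(1))
    then show ?thesis by (simp add: dec_def Z_def)
  qed
  \<comment> \<open>Membership of a column is expressed through Y, so that W is decidable uniformly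
    in k, i and j.\<close>
  define W where "W = (\<lambda>k i j. \<not> (\<exists>\<sigma>. \<sigma> < b (pp i j) \<and> b (pp i j) = \<sigma> + 1 \<and> bs \<sigma> (slen \<sigma>) \<and>
    (\<forall>x. x < slen \<sigma> \<longrightarrow> (bit \<sigma> x \<longleftrightarrow> pp k x \<in> Y))))"
  have W: "W k i j \<longleftrightarrow> Z k \<notin> opn b (pp i j)" for k i j
    using Z[of k] unfolding W_def opn_def init_seg_iff2 Z_def by (auto simp: less_Suc_iff)
  have cols: "\<exists>k. k < q * n \<and> (\<forall>i'. i' \<le> i \<longrightarrow> (\<exists>j. Z k \<in> opn b (pp i' j)))" for i
  proof -
    obtain j where "Y \<in> opn (c n) (pp i j)" using Yn by blast
    then obtain \<tau> where t: "c n (pp i j) = \<tau> + 1" "init_seg MM \<tau> Y" by (auto simp: opn_def)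
    then have "C n i \<tau> (p1 (p2 j)) (p2 (p2 j))" by (simp add: c_pp b'_def split: if_splits)
    then obtain k where k: "bs \<tau> (slen \<tau>)" "k < q * n" "pp k (p2 (p2 j)) \<le> slen \<tau>"
      "DD b i (p1 (p2 j)) (col k (p2 (p2 j)) \<tau>)" by (auto simp: C_def)
    have "init_seg MM (col k (p2 (p2 j)) \<tau>) (Z k)"
      unfolding init_seg_iff[OF col(1)] col(2) Z_def
    proof (intro allI impI)
      fix x assume x: "x < p2 (p2 j)"
      have "pp k x < slen \<tau>" by (rule less_le_trans[OF pp_strict[OF order_refl x] k(3)])
      then show "(x < p2 (p2 j) \<and> bit \<tau> (pp k x)) \<longleftrightarrow> x \<in> {x. pp k x \<in> Y}"
        using t(2) x unfolding init_seg_iff[OF k(1)] by blast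
    qed
    then have "Z k \<in> cyl MM (col k (p2 (p2 j)) \<tau>)" using Z by (simp add: mem_cyl)
    from DD_mem[OF b this k(4)] show ?thesis using k(2) by blast
  qed
  have "\<exists>k. k < q * n \<and> (\<forall>i. \<exists>j. Z k \<in> opn b (pp i j))"
  proof (rule ccontr)
    assume "\<not> ?thesis"
    then have ex: "\<exists>i. \<forall>j. W k i j" if "k < q * n" for k using that unfolding W by blast
    have "dec (\<lambda>s. W (p1 s) (p1 (p2 s)) (p2 (p2 s)))"
      unfolding W_def by (intro dec_intros fn_comp[OF fb] Y(1))
    from BSigma2_D[OF BS this ex] obtain v where v: "\<And>k. k < q * n \<Longrightarrow> \<exists>i. i < v \<and> (\<forall>j. W k i j)" by blast
    obtain k where k: "k < q * n" "\<And>i. i \<le> v \<Longrightarrow> \<exists>j. Z k \<in> opn b (pp i j)" using cols by blast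
    obtain i where "i < v" "\<forall>j. W k i j" using v[OF k(1)] by blast
    then show False using k(2)[of i] unfolding W by (simp add: less_imp_le)
  qed
  then show "\<exists>Y\<in>SS. \<forall>i. \<exists>j. Y \<in> opn b (pp i j)" using Z by blast
qed


section \<open>2-POS implies 2-RAN\<close>

lemma dec_max:
  assumes "dec P" "P a" "\<And>x. P x \<Longrightarrow> x \<le> K"
  shows "\<exists>m. P m \<and> (\<forall>x. P x \<longrightarrow> x \<le> m)"
proof -
  have "dec (\<lambda>m. \<forall>x. x < K + 1 \<longrightarrow> P x \<longrightarrow> x \<le> m)" by (intro dec_intros dec_fn[OF assms(1)])
  moreover have "\<forall>x. x < K + 1 \<longrightarrow> P x \<longrightarrow> x \<le> K" by (simp add: less_Suc_iff)
  ultimately obtain m where m: "\<forall>x. x < K + 1 \<longrightarrow> P x \<longrightarrow> x \<le> m"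
      "\<And>k. k < m \<Longrightarrow> \<not> (\<forall>x. x < K + 1 \<longrightarrow> P x \<longrightarrow> x \<le> k)"
    using dec_least[of "\<lambda>m. \<forall>x. x < K + 1 \<longrightarrow> P x \<longrightarrow> x \<le> m" K] by blast
  have le: "x \<le> m" if "P x" for x using m(1) assms(3) that by (simp add: less_Suc_iff)
  have "P m"
  proof (rule ccontr)
    assume "\<not> P m"
    then have lt: "x < m" if "P x" for x using le[OF that] that by (metis order_le_less)
    then have "m \<noteq> 0" using assms(2) by auto
    then obtain k where k: "m = k + 1" using zero_or_Suc by blast
    then have "\<forall>x. x < K + 1 \<longrightarrow> P x \<longrightarrow> x \<le> k" using lt by (simp add: less_Suc_iff)
    moreover have "k < m" using k by (simp add: less_Suc_iff)
    ultimately show False using m(2) by blast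
  qed
  then show ?thesis using le by blast
qed

text \<open>The sum of 2^-(e+2) over e < k is 1/2 - 2^-(k+1). The induction carries this exact
  partial sum with denominators cleared, since the bound 1/2 alone would not be inductive.\<close>

lemma union_bound:
  assumes B: "dec2 B" and s: "\<And>e. e < n \<Longrightarrow> r * pw (e + 2) * nstr L (B e) \<le> p * pw L"
  shows "r * (nstr L (\<lambda>\<tau>. \<exists>e. e < n \<and> B e \<tau>) + nstr L (\<lambda>\<tau>. \<exists>e. e < n \<and> B e \<tau>)) \<le> p * pw L"
proof -
  define U where "U = (\<lambda>k. nstr L (\<lambda>\<tau>. \<exists>e. e < k \<and> B e \<tau>))"
  have dU: "dec (\<lambda>\<tau>. \<exists>e. e < k \<and> B e \<tau>)" for k by (intro dec_intros dec2_comp[OF B])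
  have dB: "dec (B e)" for e by (intro dec2_comp[OF B] dec_intros)
  have "k \<le> n \<longrightarrow> r * (pw k + pw k) * U k + p * pw L \<le> p * pw L * pw k" for k
  proof (rule dec_induct[of "\<lambda>k. k \<le> n \<longrightarrow> r * (pw k + pw k) * U k + p * pw L \<le> p * pw L * pw k"])
    show "dec (\<lambda>k. k \<le> n \<longrightarrow> r * (pw k + pw k) * U k + p * pw L \<le> p * pw L * pw k)"
      unfolding U_def by (intro dec_intros dec2_comp[OF B])
    show "0 \<le> n \<longrightarrow> r * (pw 0 + pw 0) * U 0 + p * pw L \<le> p * pw L * pw 0" by (simp add: U_def nstr_False)
    fix k assume IH: "k \<le> n \<longrightarrow> r * (pw k + pw k) * U k + p * pw L \<le> p * pw L * pw k"
    show "k + 1 \<le> n \<longrightarrow> r * (pw (k + 1) + pw (k + 1)) * U (k + 1) + p * pw L \<le> p * pw L * pw (k + 1)"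
    proof
      assume "k + 1 \<le> n"
      then have k: "k < n" by (simp add: less_iff_Suc_le)
      have "U (k + 1) = nstr L (\<lambda>\<tau>. (\<exists>e. e < k \<and> B e \<tau>) \<or> B k \<tau>)"
        unfolding U_def by (intro nstr_cong dU dec_disj dB) (auto simp: less_Suc_iff order_le_less)
      also have "\<dots> \<le> U k + nstr L (B k)" unfolding U_def by (rule nstr_disj_le[OF dU dB])
      finally have u: "U (k + 1) \<le> U k + nstr L (B k)" .
      have p4: "pw (k + 2) = pw k + pw k + (pw k + pw k)" using pw_simps(2)[of "k + 1"] by (simp add: add.assoc)
      have "r * pw (k + 2) * U (k + 1) + p * pw L \<le> r * pw (k + 2) * (U k + nstr L (B k)) + p * pw L"
        by (intro add_right_mono mult_left_mono u) simp
      also have "\<dots> = r * pw (k + 2) * U k + r * pw (k + 2) * nstr L (B k) + p * pw L" by (simp add: distrib_left)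
      also have "\<dots> \<le> r * pw (k + 2) * U k + p * pw L + p * pw L" by (intro add_right_mono add_left_mono s[OF k])
      also have "\<dots> = (r * (pw k + pw k) * U k + p * pw L) + (r * (pw k + pw k) * U k + p * pw L)"
        by (simp add: p4 algebra_simps)
      also have "\<dots> \<le> p * pw L * pw k + p * pw L * pw k" using IH k by (intro add_mono) (auto simp: less_imp_le)
      also have "\<dots> = p * pw L * pw (k + 1)" by (simp add: distrib_left)
      finally show "r * (pw (k + 1) + pw (k + 1)) * U (k + 1) + p * pw L \<le> p * pw L * pw (k + 1)"
        unfolding p4 pw_simps(2) .
    qed
  qed
  from this[of n] have "r * (pw n + pw n) * U n + p * pw L \<le> p * pw L * pw n" by simp
  then have "r * (pw n + pw n) * U n \<le> p * pw L * pw n" by (meson add_increasing2 ge0 order_trans order_refl le_add_same_cancel1)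
  then have "pw n * (r * (U n + U n)) \<le> pw n * (p * pw L)" by (simp add: algebra_simps)
  then show ?thesis unfolding U_def by (meson mult_less_cancel not_le mult_strict_left_mono pw_pos)
qed

lemma mult_le_cancel_pw: "pw n * a \<le> pw n * b \<Longrightarrow> a \<le> (b :: 'a::rca)"
  by (meson not_le mult_strict_left_mono pw_pos)

text \<open>
  A universal test: approximation \<open>i\<close> of a purported test \<open>e\<close> is taken into account only if at some
  stage \<open>s\<close> it is seen to have measure at least \<open>1 - 2\<^sup>-\<^sup>e\<^sup>-\<^sup>2\<close>.
\<close>

lemma two_POS_imp_RAN:
  assumes POS: "two_POS (MM :: 'a::rca l2_structure)"
  shows "two_RAN (MM :: 'a l2_structure)"
  unfolding two_RAN_def MM_simps
proof
  fix X :: "'a set" assume X: "X \<in> SS"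
  obtain R where R: "dec2 R" "\<And>t. (\<exists>w. R t w) \<longleftrightarrow> phi MM X (p1 t) (p1 (p2 t)) (p2 (p2 t))"
    using phi_sigma1[OF X] by blast
  \<comment> \<open>Program e need not be total, so a basic set counts only when its name and the
    computation of it appear below t. Component e + 3 leaves room: its error 2^-(e+3) and an equal
    loss by approximation add up to 2^-(e+2).\<close>
  define De where "De = (\<lambda>e i t \<tau>. \<forall>i'. i' \<le> i \<longrightarrow> (\<exists>j. j < t \<and> (\<exists>v. v < t \<and>
     (\<exists>w. w < t \<and> R (pp e (pp (pp (e + 3) (pp i' j)) v)) w) \<and> inb \<tau> v)))"
  have dDe: "dec (\<lambda>x. De (e x) (i x) (t x) (s x))" if f: "fn e" "fn i" "fn t" "fn s" for e i t s
    unfolding De_def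
    by (intro dec_intros dec2_comp[OF R(1)] f fn_comp[OF f(1)] fn_comp[OF f(3)] fn_comp[OF f(4)])
  have De_mono: "De e i t \<tau> \<Longrightarrow> i' \<le> i \<Longrightarrow> t \<le> t' \<Longrightarrow> prefix MM \<tau> \<tau>' \<Longrightarrow> De e i' t' \<tau>'" for e i t \<tau> i' t' \<tau>'
    unfolding De_def using inb_prefix by (meson less_le_trans order_trans)
  define check where "check = (\<lambda>x. pw (p1 x + 2) * nstr (p2 (p2 x)) (\<lambda>\<tau>. \<not> De (p1 x) (p1 (p2 x)) (p2 (p2 x)) \<tau>) \<le> pw (p2 (p2 x)))"
  have dch: "dec check" unfolding check_def by (intro dec_intros dDe)
  \<comment> \<open>Row (e, (i, s)) is the whole space unless its check succeeds, so an index e that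
    is not a test cannot spoil the measure.\<close>
  define b where "b = (\<lambda>s. if bs (p1 (p2 s)) (slen (p1 (p2 s))) \<and>
      (check (p1 s) \<longrightarrow> De (p1 (p1 s)) (p1 (p2 (p1 s))) (p2 (p2 s)) (p1 (p2 s))) then p1 (p2 s) + 1 else 0)"
  have b: "names b"
    unfolding names_def
  proof (intro conjI allI)
    show "fn b" unfolding b_def by (intro dec_intros dec_fn[OF dch] dDe)
    show "b s = 0 \<or> (\<exists>\<sigma> l. b s = \<sigma> + 1 \<and> bs \<sigma> l)" for s by (auto simp: b_def)
  qed
  \<comment> \<open>By the union bound at least half of the strings survive; the fraction 1/3 makes
    the inequality strict.\<close>
  have "\<exists>m n. 1 * pw n < nstr n (DD b L m) * 3" for L
  proof -
    define Bad where "Bad = (\<lambda>e \<tau>. \<exists>x. x \<le> L \<and> p1 x = e \<and> check x \<and> \<not> De e (p1 (p2 x)) L \<tau>)"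
    have dBad: "dec2 Bad" unfolding Bad_def by (intro dec_intros dec_fn[OF dch] dDe)
    have dB: "dec (Bad e)" for e unfolding Bad_def by (intro dec_intros dec_fn[OF dch] dDe)
    have small: "1 * pw (e + 2) * nstr L (Bad e) \<le> 1 * pw L" for e
    proof (cases "\<exists>x. x \<le> L \<and> p1 x = e \<and> check x")
      case False
      then have "nstr L (Bad e) = nstr L (\<lambda>_. False)" by (intro nstr_cong dB dec_const) (auto simp: Bad_def)
      then show ?thesis by (simp add: nstr_False)
    next
      case True
      \<comment> \<open>Adding up the losses of all checked rows of one e would be too costly. But
        \<open>De\<close> shrinks as i grows, so whatever one of these rows excludes is excluded by
        the row with the largest i, which loses at most 2^-(e+2).\<close>
      define P where "P = (\<lambda>i. \<exists>x. x \<le> L \<and> p1 x = e \<and> check x \<and> i = p1 (p2 x))"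
      have "dec P" unfolding P_def by (intro dec_intros dec_fn[OF dch])
      moreover obtain i where "P i" using True unfolding P_def by blast
      moreover have "i \<le> L" if "P i" for i using that p_le unfolding P_def by (meson order_trans)
      ultimately obtain i where i: "P i" "\<And>j. P j \<Longrightarrow> j \<le> i" using dec_max[of P] by blast
      then obtain x where x: "x \<le> L" "p1 x = e" "check x" "i = p1 (p2 x)" unfolding P_def by blast
      define s where "s = p2 (p2 x)"
      have sL: "s \<le> L" using p_le(2)[of "p2 x"] p_le(2)[of x] x(1) by (simp add: s_def)
      have dN: "dec (\<lambda>\<tau>. \<not> De e i s \<tau>)" by (intro dec_not dDe dec_intros)
      have "nstr L (Bad e) \<le> nstr L (\<lambda>\<tau>. \<not> De e i s (res s \<tau>))"
      proof (rule nstr_mono)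
        show "dec (Bad e)" by (rule dB)
        show "dec (\<lambda>\<tau>. \<not> De e i s (res s \<tau>))" by (intro dec_not dDe dec_intros)
        fix \<tau> assume t: "bs \<tau> L" "Bad e \<tau>"
        then obtain y where y: "y \<le> L" "p1 y = e" "check y" "\<not> De e (p1 (p2 y)) L \<tau>" unfolding Bad_def by blast
        then have "p1 (p2 y) \<le> i" by (intro i(2)) (auto simp: P_def)
        then show "\<not> De e i s (res s \<tau>)" using y(4) De_mono[OF _ _ sL prefix_res[OF t(1) sL]] by blast
      qed
      then have "pw (e + 2) * (pw s * nstr L (Bad e)) \<le> pw (e + 2) * (pw s * nstr L (\<lambda>\<tau>. \<not> De e i s (res s \<tau>)))"
        by (intro mult_left_mono) simp_all
      also have "\<dots> = pw L * (pw (e + 2) * nstr s (\<lambda>\<tau>. \<not> De e i s \<tau>))"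
        using nstr_res[OF sL dN] by (simp add: ac_simps)
      also have "\<dots> \<le> pw L * pw s" using x by (intro mult_left_mono) (simp_all add: check_def s_def)
      finally have "pw s * (pw (e + 2) * nstr L (Bad e)) \<le> pw s * pw L" by (simp add: ac_simps)
      then show ?thesis by (simp add: mult_le_cancel_pw)
    qed
    define m where "m = pp (SB L) L"
    define G H where "G = nstr L (DD b L m)" and "H = nstr L (\<lambda>\<tau>. \<exists>e. e < L + 1 \<and> Bad e \<tau>)"
    have dG: "dec (DD b L m)" using b by (intro dec_DD dec_intros) (simp add: names_def)
    have dH: "dec (\<lambda>\<tau>. \<exists>e. e < L + 1 \<and> Bad e \<tau>)" by (intro dec_intros dec2_comp[OF dBad])
    have "DD b L m \<tau>" if t: "bs \<tau> L" "\<not> (\<exists>e. e < L + 1 \<and> Bad e \<tau>)" for \<tau>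
      unfolding DD_def
    proof (intro allI impI)
      fix x assume x: "x \<le> L"
      have "p1 x < L + 1" using p_le(1)[of x] x by (simp add: less_Suc_iff)
      then have "\<not> Bad (p1 x) \<tau>" using t(2) by blast
      then have "b (pp x (pp \<tau> L)) = \<tau> + 1" using x t(1) unfolding Bad_def by (simp add: b_def bs_slen[OF t(1)])
      moreover have "pp \<tau> L < m"
        unfolding m_def using pp_mono[OF less_imp_le[OF bs_less_SB[OF t(1)]] order_refl, of L] bs_less_SB[OF t(1)]
        by (simp add: order_less_le)
      ultimately show "\<exists>j. j < m \<and> inb \<tau> (b (pp x j))" using prefix_refl by (metis inb_Suc)
    qed
    then have "nstr L (\<lambda>\<tau>. \<not> (\<exists>e. e < L + 1 \<and> Bad e \<tau>)) \<le> G"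
      unfolding G_def by (intro nstr_mono dG dec_not dH)
    then have GH: "pw L \<le> H + G" using nstr_compl[OF dH, of L] by (metis H_def add_left_mono)
    have "H + H \<le> pw L" using union_bound[OF dBad, of "L + 1" 1 L 1] small by (simp add: H_def)
    moreover have "0 < G"
    proof (rule ccontr)
      assume "\<not> 0 < G"
      then have "pw L \<le> H" using GH by (simp add: pos_iff)
      with \<open>H + H \<le> pw L\<close> have "H + H \<le> H" by (rule order_trans)
      then show False using \<open>pw L \<le> H\<close> pw_pos[of L] by (simp add: pos_iff)
    qed
    ultimately have "pw L < G * 3" using GH unfolding zz_simps by linarith
    then show ?thesis unfolding G_def by auto
  qed
  then obtain Y where Y: "Y \<in> SS" "\<And>i. \<exists>j. Y \<in> opn b (pp i j)"
    using two_POS_D[OF POS b, of 1 3] by auto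
  have "two_random MM X Y"
    unfolding two_random_def
  proof (intro allI impI)
    fix e assume e: "sigma2_test MM X e"
    define n where "n = e + 3"
    have nb: "names_basic_open MM X e (pp n (pp i j))" for i j using e by (simp add: sigma2_test_def)
    obtain c where c: "names c" "\<And>s. basic_open MM X e (pp n (pp (p1 s) (p2 s))) = opn c s"
        "\<And>s y. phi MM X e (pp n (pp (p1 s) (p2 s))) y \<longleftrightarrow> y = c s"
    proof (rule phi_names[OF X nb])
      show "fn (\<lambda>s. pp n (pp (p1 s) (p2 s)))" by (intro dec_intros)
    qed (rule that)
    have test: "test_seq MM X e n = (\<lambda>i j. opn c (pp i j))"
      using c(2)[of "pp _ _"] by (simp add: test_seq_def fun_eq_iff)
    have cR: "(\<exists>w. R (pp e (pp (pp n (pp i j)) v)) w) \<longleftrightarrow> v = c (pp i j)" for i j v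
      using c(3)[of "pp i j"] by (simp add: R(2))
    obtain a where a: "a + 1 = pw n" "mu_ge MM (\<lambda>i j. opn c (pp i j)) a (pw n)"
      using e unfolding sigma2_test_def sigma2_mu_le_1 MM_simps pow2_iff test[symmetric] by metis
    have "Y \<in> pi2_set (test_seq MM X e n)"
      unfolding test pi2_set_def
    proof (intro INT_I)
      fix i
      \<comment> \<open>The tolerance is 2^-n, so the approximation misses less than 2 * 2^-n =
        2^-(e+2).\<close>
      obtain m l where ml: "a * pw n * pw l < nstr l (DD c i m) * pw n * pw n + 1 * pw n * pw l"
        using a(2) unfolding mu_ge_iff[OF c(1)] using pw_pos[of n] zero_less_one by blast
      have dc: "dec (DD c i m)" using c(1) by (intro dec_DD dec_intros) (simp add: names_def)
      define G H where "G = nstr l (DD c i m)" and "H = nstr l (\<lambda>\<tau>. \<not> DD c i m \<tau>)"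
      have GH: "G + H = pw l" unfolding G_def H_def by (rule nstr_compl[OF dc])
      have "pw n * (a * pw l) < pw n * (G * pw n + pw l)" using ml by (simp add: G_def algebra_simps)
      then have 1: "a * pw l < G * pw n + pw l" by (rule mult_less_cancel)
      have "G * pw n + H * pw n = (a + 1) * pw l" unfolding GH[symmetric] a(1) by (simp add: algebra_simps)
      also have "\<dots> < G * pw n + (pw l + pw l)"
        using add_strict_right_mono[OF 1, of "pw l"] unfolding add.assoc[symmetric] by (simp add: distrib_right)
      finally have 2: "H * pw n < pw l + pw l" by simp
      have pn: "pw n = pw (e + 2) + pw (e + 2)" using pw_simps(2)[of "e + 2"] by (simp add: n_def add.assoc)
      have H: "pw (e + 2) * H \<le> pw l"
      proof (rule ccontr)
        assume "\<not> ?thesis"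
        then have "pw l + pw l < pw (e + 2) * H + pw (e + 2) * H" by (intro add_strict_mono) simp_all
        then show False using 2 by (simp add: pn algebra_simps)
      qed
      have fc: "fn c" using c(1) by (simp add: names_def)
      obtain v0 where v0: "\<And>z. z < pp i m + 1 \<Longrightarrow> c z < v0" using bounded_fn[OF fc] by blast
      have "dec2 (\<lambda>z w. R (pp e (pp (pp n (pp (p1 z) (p2 z))) (c z))) w)"
        by (intro dec2_comp[OF R(1)] dec_intros fn_comp[OF fc])
      moreover have "\<exists>w. R (pp e (pp (pp n (pp (p1 z) (p2 z))) (c z))) w" for z
        using c(3)[of z] by (simp add: R(2))
      ultimately obtain w0 where w0: "\<And>z. z < pp i m + 1 \<Longrightarrow> \<exists>w. w < w0 \<and> R (pp e (pp (pp n (pp (p1 z) (p2 z))) (c z))) w"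
        using BSigma1[of "\<lambda>z w. R (pp e (pp (pp n (pp (p1 z) (p2 z))) (c z))) w"] by blast
      \<comment> \<open>Late enough for all names relevant to i and m, and for their computations,
        to be found; then the check of row (e, (i, s)) succeeds.\<close>
      define s where "s = l + m + v0 + w0"
      have le: "l \<le> s" "m \<le> s" "v0 \<le> s" "w0 \<le> s"
        unfolding s_def by (simp_all add: add.assoc add_increasing add_increasing2)
      have De: "De e i s \<tau>" if t: "bs \<tau> s" "DD c i m (res l \<tau>)" for \<tau>
        unfolding De_def
      proof (intro allI impI)
        fix i' assume i': "i' \<le> i"
        then obtain j where j: "j < m" "inb (res l \<tau>) (c (pp i' j))" using t(2) unfolding DD_def by blast
        have z: "pp i' j < pp i m + 1" by (rule pp_less[OF i' j(1)])
        obtain w where w: "w < w0" "R (pp e (pp (pp n (pp i' j)) (c (pp i' j)))) w" using w0[OF z] by auto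
        have "inb \<tau> (c (pp i' j))" using j(2) prefix_res[OF t(1) le(1)] inb_prefix by blast
        then show "\<exists>j. j < s \<and> (\<exists>v. v < s \<and> (\<exists>w. w < s \<and> R (pp e (pp (pp (e + 3) (pp i' j)) v)) w) \<and> inb \<tau> v)"
          using w j(1) v0[OF z] le unfolding n_def by (meson less_le_trans)
      qed
      have dDD: "dec (\<lambda>\<tau>. \<not> DD c i m \<tau>)" by (rule dec_not[OF dc])
      have "nstr s (\<lambda>\<tau>. \<not> De e i s \<tau>) \<le> nstr s (\<lambda>\<tau>. \<not> DD c i m (res l \<tau>))"
      proof (rule nstr_mono)
        show "dec (\<lambda>\<tau>. \<not> De e i s \<tau>)" by (intro dec_not dDe dec_intros)
        show "dec (\<lambda>\<tau>. \<not> DD c i m (res l \<tau>))" by (intro dec_fn[OF dDD] dec_intros)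
      qed (use De in blast)
      then have "pw (e + 2) * (pw l * nstr s (\<lambda>\<tau>. \<not> De e i s \<tau>)) \<le> pw (e + 2) * (pw l * nstr s (\<lambda>\<tau>. \<not> DD c i m (res l \<tau>)))"
        by (intro mult_left_mono) simp_all
      also have "\<dots> = pw s * (pw (e + 2) * H)" using nstr_res[OF le(1) dDD] by (simp add: H_def ac_simps)
      also have "\<dots> \<le> pw s * pw l" using H by (rule mult_left_mono) simp
      finally have "pw l * (pw (e + 2) * nstr s (\<lambda>\<tau>. \<not> De e i s \<tau>)) \<le> pw l * pw s" by (simp add: ac_simps)
      then have ch: "check (pp e (pp i s))" by (simp add: check_def mult_le_cancel_pw)
      obtain j where "Y \<in> opn b (pp (pp e (pp i s)) j)" using Y(2) by blast
      then obtain \<tau> where t: "b (pp (pp e (pp i s)) j) = \<tau> + 1" "init_seg MM \<tau> Y" by (auto simp: opn_def)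
      then have "De e i (p2 j) \<tau>" using ch by (auto simp: b_def split: if_splits)
      then obtain j' v w where v: "R (pp e (pp (pp n (pp i j')) v)) w" "inb \<tau> v"
        unfolding De_def n_def[symmetric] by blast
      have "v = c (pp i j')" using cR[of i j' v] v(1) by blast
      then have "inb \<tau> (c (pp i j'))" using v(2) by simp
      then have "Y \<in> opn c (pp i j')" using Y(1) t(2) by (intro inb_opn[OF c(1)]) (auto simp: mem_cyl)
      then show "Y \<in> (\<Union>j. opn c (pp i j))" by blast
    qed
    then show "\<exists>n. Y \<notin> sigma2_set MM (test_seq MM X e n)" by (auto simp: sigma2_set_def)
  qed
  then show "\<exists>Y\<in>SS. two_random MM X Y" using Y(1) by blast
qed


section \<open>The equivalence of 2-POS with 2-WWKL\<close>

section \<open>2-POS implies 2-WWKL\<close>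

lemma pp_eq_0 [simp]: "pp i j = 0 \<longleftrightarrow> i = 0 \<and> j = 0" "0 = pp i j \<longleftrightarrow> i = 0 \<and> j = 0"
  using pp_inject[of i j 0 0] pp_inject[of 0 0 i j] by auto

lemma jump_sigma1:
  fixes X :: "'a::rca set"
  assumes "X \<in> SS"
  shows "\<exists>J. dec2 J \<and> (\<forall>i. (\<exists>w. J i w) \<longleftrightarrow> i \<in> jump MM X)"
proof (intro exI conjI allI)
  let ?J = "\<lambda>i w. init_seg MM (p1 w) X \<and> valid (p1 w) (p2 w) \<and> (\<exists>y. y < p2 w \<and> occ (p2 w) (pp i (pp 0 y)))"
  show "dec2 ?J" by (intro dec_intros assms)
  fix i :: 'a
  have *: "(\<exists>y. y < d \<and> occ d (pp i (pp 0 y))) \<longleftrightarrow> (\<exists>y. occ d (pp i (pp 0 y)))" for d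
    using entry_less(2) pp_bounds(2) unfolding occ_iff by (meson le_less_trans)
  have "(\<exists>w. ?J i w) \<longleftrightarrow> (\<exists>\<sigma> d. ?J i (pp \<sigma> d))" by (metis p_simps(1,2))
  then show "(\<exists>w. ?J i w) \<longleftrightarrow> i \<in> jump MM X"
    unfolding jump_def phi_str_iff * by auto
qed

lemma card_is_strings:
  assumes "card_is MM {\<sigma> \<in> T. bs \<sigma> n} k"
  obtains A where "dec A" "\<And>\<sigma>. A \<sigma> \<longleftrightarrow> \<sigma> \<in> T \<and> bs \<sigma> n" "k = nstr n A"
proof -
  define A where "A = (\<lambda>\<sigma>. \<sigma> \<in> T \<and> bs \<sigma> n)"
  have d: "dec A" using card_is_dec[OF assms] by (simp add: A_def)
  have "k = cnt (SB n) A"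
    using assms card_is_iff[OF d, of "SB n" k] by (auto simp: A_def bs_less_SB)
  also have "\<dots> = nstr n A" unfolding nstr_def by (intro cnt_cong d dec_bsP) (auto simp: A_def)
  finally show thesis using that d by (simp add: A_def)
qed

text \<open>
  A path must avoid \<open>\<sigma>\<^sub>0\<close> if some \<open>\<rho> \<subset> X'\<close> computes that \<open>\<sigma>\<^sub>0\<close> is not in the tree. For given
  \<open>\<sigma>\<^sub>0, \<rho>\<close> and a computation, this is a \<open>\<Pi>\<^sub>2\<close> condition, since \<open>\<rho> \<not>\<subset> X'\<close> means that for all \<open>s\<close> there is
  \<open>t\<close> such that \<open>\<rho>\<close> has a 1 outside \<open>X'\<^sub>s\<close> or a 0 inside \<open>X'\<^sub>t\<close>.
\<close>

lemma two_POS_imp_WWKL: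
  assumes POS: "two_POS (MM :: 'a::rca l2_structure)"
  shows "two_WWKL (MM :: 'a l2_structure)"
  unfolding two_WWKL_def MM_simps
proof (intro ballI allI impI, elim conjE)
  fix X :: "'a set" and e
  assume X: "X \<in> SS" and bti: "binary_tree_index MM (jump MM X) e" and pd: "positive_density MM (tree_of MM (jump MM X) e)"
  define T where "T = tree_of MM (jump MM X) e"
  have tot: "phi MM (jump MM X) e x 0 \<or> phi MM (jump MM X) e x 1" for x
    using bti unfolding binary_tree_index_def MM_simps by blast
  have T: "\<sigma> \<in> T \<longleftrightarrow> phi MM (jump MM X) e \<sigma> 1" for \<sigma> by (simp add: T_def tree_of_def)
  have tree: "\<tau> \<in> T \<Longrightarrow> bs \<sigma> l \<Longrightarrow> prefix MM \<sigma> \<tau> \<Longrightarrow> \<sigma> \<in> T" for \<sigma> \<tau> l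
    using bti unfolding binary_tree_index_def is_binary_tree_def T_def by blast
  obtain p q where pq: "0 < p" "0 < q"
      "\<And>n. \<exists>k N. card_is MM {\<sigma> \<in> T. bs \<sigma> n} k \<and> N = pw n \<and> p * N < k * q"
    using pd unfolding positive_density_def T_def[symmetric] MM_simps pow2_iff by blast
  obtain J where J: "dec2 J" "\<And>i. (\<exists>w. J i w) \<longleftrightarrow> i \<in> jump MM X" using jump_sigma1[OF X] by blast
  define Jt where "Jt = (\<lambda>s i. \<exists>w. w < s \<and> J i w)"
  have dJt: "dec (\<lambda>x. Jt (s x) (i x))" if f: "fn s" "fn i" for s i
    unfolding Jt_def by (intro dec_intros dec2_comp[OF J(1)] f fn_comp[OF f(2)])
  define wrong where "wrong = (\<lambda>\<rho> s t. \<exists>i. i < slen \<rho> \<and> ((bit \<rho> i \<and> \<not> Jt s i) \<or> (\<not> bit \<rho> i \<and> Jt t i)))"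
  have dwr: "dec (\<lambda>x. wrong (r x) (s x) (t x))" if f: "fn r" "fn s" "fn t" for r s t
    unfolding wrong_def by (intro dec_intros dJt f fn_comp[OF f(1)] fn_comp[OF f(2)] fn_comp[OF f(3)])
  define cond where "cond = (\<lambda>\<sigma> \<rho> d. bs \<rho> (slen \<rho>) \<and> bs \<sigma> (slen \<sigma>) \<and> valid \<rho> d \<and> occ d (pp e (pp \<sigma> 0)))"
  \<comment> \<open>Row (\<sigma>, (\<rho>, (d, s))) admits \<tau> once it is long enough to be seen
    not to extend \<sigma>, or once \<rho> is refuted. If \<open>cond\<close> fails, the row is the
    whole space.\<close>
  define enum where "enum = (\<lambda>\<sigma> \<rho> d s \<tau> t. bs \<tau> (slen \<tau>) \<and> (cond \<sigma> \<rho> d \<longrightarrow>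
     (slen \<sigma> \<le> slen \<tau> \<and> \<not> prefix MM \<sigma> \<tau>) \<or> wrong \<rho> s t))"
  define b where "b = (\<lambda>s. if enum (p1 (p1 s)) (p1 (p2 (p1 s))) (p1 (p2 (p2 (p1 s)))) (p2 (p2 (p2 (p1 s)))) (p1 (p2 s)) (p2 (p2 s))
     then p1 (p2 s) + 1 else 0)"
  have b: "names b"
    unfolding names_def
  proof (intro conjI allI)
    show "fn b" unfolding b_def enum_def cond_def by (intro dec_intros dwr)
    show "b s = 0 \<or> (\<exists>\<sigma> l. b s = \<sigma> + 1 \<and> bs \<sigma> l)" for s by (auto simp: b_def enum_def)
  qed
  have fb: "fn b" using b by (simp add: names_def)
  have "\<exists>m n. p * pw n < nstr n (DD b i m) * q" for i
  proof -
    obtain k where k: "card_is MM {\<sigma> \<in> T. bs \<sigma> i} k" "p * pw i < k * q" using pq(3) by blast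
    obtain A where A: "dec A" "\<And>\<sigma>. A \<sigma> \<longleftrightarrow> \<sigma> \<in> T \<and> bs \<sigma> i" "k = nstr i A" using card_is_strings[OF k(1)] by blast
    define R where "R = (\<lambda>z t. p1 z \<le> i \<and> A (p2 z) \<longrightarrow> b (pp (p1 z) (pp (p2 z) t)) = p2 z + 1)"
    have "dec2 R" unfolding R_def by (intro dec_intros dec_fn[OF A(1)] fn_comp[OF fb])
    moreover have "\<exists>t. R z t" for z
    proof (cases "p1 z \<le> i \<and> A (p2 z)")
      case True
      define \<sigma> \<rho> d s \<tau> where "\<sigma> = p1 (p1 z)" and "\<rho> = p1 (p2 (p1 z))" and "d = p1 (p2 (p2 (p1 z)))"
        and "s = p2 (p2 (p2 (p1 z)))" and "\<tau> = p2 z"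
      have t: "\<tau> \<in> T" "bs \<tau> i" "slen \<tau> = i" using True A(2) by (auto simp: \<tau>_def bs_slen)
      have "\<exists>t. enum \<sigma> \<rho> d s \<tau> t"
      proof (cases "cond \<sigma> \<rho> d \<and> prefix MM \<sigma> \<tau>")
        case False
        \<comment> \<open>The code of the row is at most i and bounds \<sigma>, hence the length of
          \<sigma>.\<close>
        have "slen \<sigma> \<le> slen \<tau>" if "cond \<sigma> \<rho> d"
        proof -
          have "slen \<sigma> \<le> \<sigma>" using that bs_length_le unfolding cond_def by blast
          also have "\<sigma> \<le> i" using order_trans[OF p_le(1)[of "p1 z"]] True by (simp add: \<sigma>_def)
          finally show ?thesis by (simp add: t)
        qed
        then show ?thesis using False t unfolding enum_def by auto
      next
        case c: True
        \<comment> \<open>As a prefix of \<tau>, \<sigma> is in the tree. So \<rho>, which computes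
          the opposite, is not an initial segment of the jump, and one of its bits is eventually
          seen to be wrong.\<close>
        have "phi MM (jump MM X) e \<sigma> 1" using tree[OF t(1)] c unfolding cond_def T by blast
        moreover have "phi MM (jump MM X) e \<sigma> 0" if "init_seg MM \<rho> (jump MM X)"
          using that c unfolding phi_def phi_str_iff cond_def by blast
        ultimately have "\<not> init_seg MM \<rho> (jump MM X)" using phi_det zero_neq_one by metis
        then obtain j where j: "j < slen \<rho>" "bit \<rho> j \<noteq> (\<exists>w. J j w)"
          using c unfolding init_seg_iff2 J(2) cond_def by blast
        have "\<exists>t. wrong \<rho> s t"
        proof (cases "bit \<rho> j")
          case True
          then show ?thesis using j unfolding wrong_def Jt_def by blast
        next
          case False
          then obtain w where "J j w" using j(2) by blast
          moreover have "w < w + 1" by (simp add: less_Suc_iff)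
          ultimately show ?thesis using j(1) False unfolding wrong_def Jt_def by blast
        qed
        then show ?thesis using t unfolding enum_def by auto
      qed
      then show ?thesis unfolding R_def b_def by (simp add: \<sigma>_def \<rho>_def d_def s_def \<tau>_def)
    next
      case False
      then show ?thesis unfolding R_def by blast
    qed
    ultimately obtain v where v: "\<And>z. z < pp i (SB i) + 1 \<Longrightarrow> \<exists>t. t < v \<and> R z t" using BSigma1[of R] by blast
    define m where "m = pp (SB i) v"
    have "DD b i m \<tau>" if "A \<tau>" for \<tau>
      unfolding DD_def
    proof (intro allI impI)
      fix x assume x: "x \<le> i"
      have lt: "\<tau> < SB i" using that A(2) bs_less_SB by blast
      obtain t where t: "t < v" "R (pp x \<tau>) t" using v[OF pp_less[OF x lt]] by blast
      then have "b (pp x (pp \<tau> t)) = \<tau> + 1" using x that by (simp add: R_def)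
      moreover have "pp \<tau> t < m" unfolding m_def by (rule pp_strict[OF less_imp_le[OF lt] t(1)])
      ultimately show "\<exists>j. j < m \<and> inb \<tau> (b (pp x j))" using prefix_refl by (metis inb_Suc)
    qed
    then have "nstr i A \<le> nstr i (DD b i m)" by (intro nstr_mono A(1) dec_DD fb dec_intros)
    then have "k * q \<le> nstr i (DD b i m) * q" unfolding A(3) by (rule mult_right_mono) simp
    then show ?thesis using k(2) less_le_trans by blast
  qed
  then obtain Y where Y: "Y \<in> SS" "\<And>i. \<exists>j. Y \<in> opn b (pp i j)" using two_POS_D[OF POS b pq(1,2)] by blast
  have "path_through MM Y T"
    unfolding path_through_def
  proof (intro allI impI, rule ccontr)
    fix \<sigma> assume \<sigma>: "init_seg MM \<sigma> Y" "\<sigma> \<notin> T"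
    then have "phi MM (jump MM X) e \<sigma> 0" using tot T by blast
    then obtain \<rho> d where \<rho>: "init_seg MM \<rho> (jump MM X)" "valid \<rho> d" "occ d (pp e (pp \<sigma> 0))"
      unfolding phi_def phi_str_iff by blast
    \<comment> \<open>By stage s the enumeration of the jump is complete below the length of \<rho>,
      so in the row with this s the true \<rho> is never refuted.\<close>
    obtain s where s: "\<And>i. i < slen \<rho> \<Longrightarrow> \<exists>w. J i w \<Longrightarrow> Jt s i"
      using bounded_sigma1_decided[OF J(1), of "slen \<rho>"] unfolding Jt_def by blast
    have c: "cond \<sigma> \<rho> d" using \<rho> \<sigma>(1) unfolding cond_def init_seg_iff2 by blast
    obtain j where "Y \<in> opn b (pp (pp \<sigma> (pp \<rho> (pp d s))) j)" using Y(2) by blast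
    then obtain \<tau> where \<tau>: "b (pp (pp \<sigma> (pp \<rho> (pp d s))) j) = \<tau> + 1" "init_seg MM \<tau> Y" by (auto simp: opn_def)
    then have en: "enum \<sigma> \<rho> d s \<tau> (p2 j)" by (auto simp: b_def split: if_splits)
    then have "prefix MM \<sigma> \<tau>" if "slen \<sigma> \<le> slen \<tau>"
      using init_seg_linear[OF \<sigma>(1) \<tau>(2) _ _ that] c unfolding enum_def cond_def by blast
    then have "wrong \<rho> s (p2 j)" using en c unfolding enum_def by blast
    then obtain i where i: "i < slen \<rho>" "(bit \<rho> i \<and> \<not> Jt s i) \<or> (\<not> bit \<rho> i \<and> Jt (p2 j) i)" unfolding wrong_def by blast
    have "bit \<rho> i \<longleftrightarrow> (\<exists>w. J i w)" using \<rho>(1) i(1) unfolding init_seg_iff2 J(2) by blast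
    then show False using i s unfolding Jt_def by blast
  qed
  then show "\<exists>Y\<in>SS. path_through MM Y (tree_of MM (jump MM X) e)" using Y(1) unfolding T_def by blast
qed


section \<open>Computing limits from the jump\<close>

lemma valid_inv: "valid \<sigma> d \<Longrightarrow> comp_mem d k f a b \<Longrightarrow> \<exists>k'. comp_step MM \<sigma> f a b (comp_mem d k')"
proof -
  assume v: "valid \<sigma> d" and "comp_mem d k f a b"
  then obtain k' where "entry MM d k' (pp f (pp a b))" unfolding comp_mem_def by blast
  then obtain e x y where t: "pp f (pp a b) = pp e (pp x y)" "comp_step MM \<sigma> e x y (comp_mem d k')"
    using v unfolding valid_iff by blast
  then show ?thesis by auto
qed

text \<open>A program with z built in: whatever its input, it searches for t such that
  \<open>pp z t\<close> is outside the oracle.\<close>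

definition halt_index :: "'a::rca \<Rightarrow> 'a" where
  "halt_index z = pp 9 (pp (pp 10 (pp 7 0)) (pp 0 z))"

text \<open>Lets the largest query bound the length of the oracle segment that a computation
  needs.\<close>

lemma halt_index_mono: "z \<le> z' \<Longrightarrow> halt_index z \<le> halt_index z'"
  unfolding halt_index_def by (intro pp_mono) simp_all

lemma halt_index_jump:
  assumes X: "X \<in> SS"
  shows "halt_index z \<in> jump MM X \<longleftrightarrow> (\<exists>t. pp z t \<notin> X)"
proof
  assume "halt_index z \<in> jump MM X"
  then obtain \<sigma> y d where \<sigma>: "init_seg MM \<sigma> X" and d: "valid \<sigma> d" "occ d (pp (halt_index z) (pp 0 y))"
    unfolding jump_def phi_str_iff MM_simps by blast
  obtain k where "entry MM d k (pp (halt_index z) (pp 0 y))" using d(2) occ_iff by blast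
  then have "comp_mem d (k + 1) (halt_index z) 0 y" unfolding comp_mem_def by (auto simp: less_Suc_iff)
  then obtain k1 where "comp_step MM \<sigma> (halt_index z) 0 y (comp_mem d k1)" using valid_inv[OF d(1)] by blast
  then obtain a where a: "comp_mem d k1 (pp 0 z) 0 a" "comp_mem d k1 (pp 10 (pp 7 0)) a y"
    unfolding comp_step_def halt_index_def by auto
  obtain k2 where "comp_step MM \<sigma> (pp 0 z) 0 a (comp_mem d k2)" using valid_inv[OF d(1) a(1)] by blast
  then have az: "a = z" unfolding comp_step_def by auto
  obtain k3 where "comp_step MM \<sigma> (pp 10 (pp 7 0)) a y (comp_mem d k3)" using valid_inv[OF d(1) a(2)] by blast
  then have "comp_mem d k3 (pp 7 0) (pp z y) 0" unfolding comp_step_def az by auto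
  then obtain k4 where "comp_step MM \<sigma> (pp 7 0) (pp z y) 0 (comp_mem d k4)" using valid_inv[OF d(1)] by blast
  then have en: "entry MM \<sigma> (pp z y) 0" unfolding comp_step_def by auto
  obtain l where l: "bs \<sigma> l" using init_seg_bs[OF \<sigma>] by blast
  have "pp z y < l" "\<not> bit \<sigma> (pp z y)" using en unfolding bs_entry[OF l] by (auto split: if_splits)
  then have "pp z y \<notin> X" using \<sigma> unfolding init_seg_iff[OF l] by blast
  then show "\<exists>t. pp z t \<notin> X" by blast
next
  assume "\<exists>t. pp z t \<notin> X"
  moreover have "dec (\<lambda>t. pp z t \<notin> X)" by (intro dec_intros X)
  ultimately obtain t where t: "pp z t \<notin> X" "\<And>k. k < t \<Longrightarrow> pp z k \<in> X" using dec_least[of "\<lambda>t. pp z t \<notin> X"] by blast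
  obtain \<sigma> where s: "bs \<sigma> (pp z t + 1)" "init_seg MM \<sigma> X" using init_seg_ex[OF X] by blast
  have "phi_str MM \<sigma> (pp 10 (pp 7 0)) z t"
  proof (rule phi_str_min)
    show "fn (\<lambda>k. if k = t then 0 else 1 :: 'a)" by (intro dec_intros)
    fix k assume k: "k \<le> t"
    then have z: "pp z k < pp z t + 1" by (simp add: less_Suc_iff pp_mono)
    have "bit \<sigma> (pp z k) \<longleftrightarrow> k \<noteq> t" using s(2) z t k by (auto simp: init_seg_iff[OF s(1)])
    then show "phi_str MM \<sigma> (pp 7 0) (pp z k) (if k = t then 0 else 1)"
      using z by (intro phi_str_oracle) (simp add: bs_entry[OF s(1)])
  qed auto
  then have "phi_str MM \<sigma> (halt_index z) 0 t" unfolding halt_index_def by (rule phi_str_comp[OF phi_str_const])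
  then show "halt_index z \<in> jump MM X" using s(2) unfolding jump_def MM_simps by blast
qed

text \<open>On input y this program assembles the code \<open>halt_index (pp u y)\<close> from
  constants and pairing, and passes it to the oracle.\<close>

definition query :: "'a::rca \<Rightarrow> 'a" where
  "query u = pp 9 (pp (pp 7 0) (pp 8 (pp (pp 0 9) (pp 8 (pp (pp 0 (pp 10 (pp 7 0)))
     (pp 8 (pp (pp 0 0) (pp 8 (pp (pp 0 u) (pp 1 0))))))))))"

lemma phi_str_query:
  assumes "entry MM \<sigma> (halt_index (pp u y)) v"
  shows "phi_str MM \<sigma> (query u) y v"
  unfolding query_def
proof (rule phi_str_comp[OF _ phi_str_oracle[OF assms]])
  show "phi_str MM \<sigma> (pp 8 (pp (pp 0 9) (pp 8 (pp (pp 0 (pp 10 (pp 7 0)))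
     (pp 8 (pp (pp 0 0) (pp 8 (pp (pp 0 u) (pp 1 0))))))))) y (halt_index (pp u y))"
    unfolding halt_index_def by (intro phi_str_pair phi_str_const phi_str_id)
qed

text \<open>The limit lemma: with suitable questions built into X, its jump tells whether a guess is
  final. The program works for each x at which g becomes constant, with no uniform bound on the
  stage.\<close>

lemma jump_computes_limits:
  fixes g :: "'a::rca \<Rightarrow> 'a \<Rightarrow> bool"
  assumes g: "dec2 g"
  shows "\<exists>X\<in>SS. \<exists>e. \<forall>x s. (\<forall>t. s \<le> t \<longrightarrow> (g x t \<longleftrightarrow> g x s)) \<longrightarrow> phi MM (jump MM X) e x (if g x s then 1 else 0)"
proof -
  \<comment> \<open>X omits the witnesses of two kinds of questions
    \<open>halt_index (pp u (pp x s))\<close>: u = 0 asks whether g x differs after s from its value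
    at s, and u = 1 asks whether g x s holds.\<close>
  define X where "X = {w. if p1 (p1 w) = 0
      then \<not> (p2 (p2 (p1 w)) \<le> p2 w \<and> (g (p1 (p2 (p1 w))) (p2 w) \<noteq> g (p1 (p2 (p1 w))) (p2 (p2 (p1 w)))))
      else \<not> g (p1 (p2 (p1 w))) (p2 (p2 (p1 w)))}"
  have "dec (\<lambda>w. if p1 (p1 w) = 0
      then \<not> (p2 (p2 (p1 w)) \<le> p2 w \<and> \<not> (g (p1 (p2 (p1 w))) (p2 w) = g (p1 (p2 (p1 w))) (p2 (p2 (p1 w)))))
      else \<not> g (p1 (p2 (p1 w))) (p2 (p2 (p1 w))))"
    by (intro dec_intros dec2_comp[OF g])
  then have X: "X \<in> SS" by (simp add: X_def dec_def)
  have q0: "halt_index (pp 0 (pp x s)) \<in> jump MM X \<longleftrightarrow> \<not> (\<forall>t. s \<le> t \<longrightarrow> (g x t \<longleftrightarrow> g x s))" for x s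
    unfolding halt_index_jump[OF X] by (auto simp: X_def)
  have q1: "halt_index (pp 1 (pp x s)) \<in> jump MM X \<longleftrightarrow> g x s" for x s
    unfolding halt_index_jump[OF X] by (auto simp: X_def)
  obtain J where J: "dec2 J" "\<And>i. (\<exists>w. J i w) \<longleftrightarrow> i \<in> jump MM X" using jump_sigma1[OF X] by blast
  \<comment> \<open>Search for the least s with no later difference, then ask for the value at that
    s.\<close>
  let ?e = "pp 9 (pp (query 1) (pp 8 (pp (pp 1 0) (pp 10 (query 0)))))"
  have "phi MM (jump MM X) ?e x (if g x s then 1 else 0)" if st: "\<forall>t. s \<le> t \<longrightarrow> (g x t \<longleftrightarrow> g x s)" for x s
  proof -
    \<comment> \<open>Finality of k is a \<open>\<Pi>\<^sub>1\<close> property. For k \<le> s a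
      single stage S decides it, so a least final m exists.\<close>
    define R where "R = (\<lambda>k t. k \<le> t \<and> \<not> (g x t \<longleftrightarrow> g x k))"
    have dR: "dec2 R" unfolding R_def by (intro dec_intros dec2_comp[OF g])
    obtain S where S: "\<And>k. k < s + 1 \<Longrightarrow> \<exists>t. R k t \<Longrightarrow> \<exists>t. t < S \<and> R k t"
      using bounded_sigma1_decided[OF dR, of "s + 1"] by blast
    have "dec (\<lambda>k. \<not> (\<exists>t. t < S \<and> R k t))" by (intro dec_intros dec2_comp[OF dR])
    moreover have ns: "\<not> (\<exists>t. t < S \<and> R s t)" using st unfolding R_def by blast
    ultimately obtain m where m: "\<not> (\<exists>t. t < S \<and> R m t)" "\<And>k. k < m \<Longrightarrow> \<exists>t. t < S \<and> R k t"
      using dec_least[of "\<lambda>k. \<not> (\<exists>t. t < S \<and> R k t)" s] by blast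
    have "m \<le> s" using m(2)[of s] ns by (cases "m \<le> s") (auto simp: not_le)
    then have "\<not> (\<exists>t. R m t)" using S[of m] m(1) by (auto simp: less_Suc_iff)
    then have ms: "\<forall>t. m \<le> t \<longrightarrow> (g x t \<longleftrightarrow> g x m)" unfolding R_def by blast
    have gms: "g x m \<longleftrightarrow> g x s" using ms \<open>m \<le> s\<close> by blast
    \<comment> \<open>Past every query that is made, since u \<le> 1 and k \<le> m.\<close>
    define L where "L = halt_index (pp 1 (pp x m)) + 1"
    obtain \<sigma> where \<sigma>: "bs \<sigma> L" "\<And>i. i < L \<Longrightarrow> bit \<sigma> i \<longleftrightarrow> i \<in> jump MM X"
      using bounded_sigma1_comprehension[OF J(1), of L] unfolding J(2) by blast
    have en: "phi_str MM \<sigma> (query u) (pp x k) (if halt_index (pp u (pp x k)) \<in> jump MM X then 1 else 0)"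
      if "u \<le> 1" "k \<le> m" for u k
    proof (rule phi_str_query)
      have "halt_index (pp u (pp x k)) < L"
        unfolding L_def less_Suc_iff using that by (intro halt_index_mono pp_mono) simp_all
      then show "entry MM \<sigma> (halt_index (pp u (pp x k))) (if halt_index (pp u (pp x k)) \<in> jump MM X then 1 else 0)"
        using \<sigma>(2) by (simp add: bs_entry[OF \<sigma>(1)])
    qed
    have "phi_str MM \<sigma> (pp 10 (query 0)) x m"
    proof (rule phi_str_min)
      show "fn (\<lambda>k. if k = m then 0 else 1 :: 'a)" by (intro dec_intros)
      fix k assume k: "k \<le> m"
      have "halt_index (pp 0 (pp x k)) \<in> jump MM X \<longleftrightarrow> k \<noteq> m"
      proof (cases "k = m")
        case True
        then show ?thesis unfolding q0 using ms by blast
      next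
        case False
        then have "k < m" using k by simp
        from m(2)[OF this] show ?thesis unfolding q0 R_def using False by blast
      qed
      then show "phi_str MM \<sigma> (query 0) (pp x k) (if k = m then 0 else 1)" using en[OF _ k, of 0] by auto
    qed auto
    then have "phi_str MM \<sigma> (pp 8 (pp (pp 1 0) (pp 10 (query 0)))) x (pp x m)" by (rule phi_str_pair[OF phi_str_id])
    moreover have "phi_str MM \<sigma> (query 1) (pp x m) (if g x s then 1 else 0)" using en[of 1 m] unfolding q1 gms by simp
    ultimately have "phi_str MM \<sigma> ?e x (if g x s then 1 else 0)" by (rule phi_str_comp)
    moreover have "init_seg MM \<sigma> (jump MM X)" using \<sigma>(2) by (simp add: init_seg_iff[OF \<sigma>(1)])
    ultimately show ?thesis unfolding phi_def by blast
  qed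
  then show ?thesis using X by blast
qed


section \<open>2-WWKL implies 2-POS\<close>

text \<open>A length at which strings decide all basic open sets whose row and column are at most
  t.\<close>

definition level :: "('a::rca \<Rightarrow> 'a) \<Rightarrow> 'a \<Rightarrow> 'a" where
  "level b t = (LEAST L. t \<le> L \<and> (\<forall>x. x < pp t t + 1 \<longrightarrow> b x \<le> L + 1))"

lemma fn_level:
  assumes "names b" "fn f"
  shows "fn (\<lambda>x. level b (f x))"
proof (rule fn_comp[OF _ assms(2)])
  have fb: "fn b" using assms(1) by (simp add: names_def)
  show "fn (level b)" unfolding level_def[abs_def]
  proof (rule fn_Least)
    show "dec2 (\<lambda>t L. t \<le> L \<and> (\<forall>x. x < pp t t + 1 \<longrightarrow> b x \<le> L + 1))" by (intro dec_intros fn_comp[OF fb])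
  qed (rule names_level[OF assms(1)])
qed

lemma level:
  assumes "names b"
  shows "t \<le> level b t" "x < pp t t + 1 \<Longrightarrow> b x \<le> level b t + 1" "t \<le> t' \<Longrightarrow> level b t \<le> level b t'"
proof -
  have fb: "fn b" using assms(1) by (simp add: names_def)
  have d: "dec (\<lambda>L. t \<le> L \<and> (\<forall>x. x < pp t t + 1 \<longrightarrow> b x \<le> L + 1))" for t by (intro dec_intros fn_comp[OF fb])
  have l: "t \<le> level b t \<and> (\<forall>x. x < pp t t + 1 \<longrightarrow> b x \<le> level b t + 1)" for t
    using names_level[OF assms, of t "pp t t + 1"] dec_LeastI[OF d] unfolding level_def by blast
  show "t \<le> level b t" "x < pp t t + 1 \<Longrightarrow> b x \<le> level b t + 1" using l by blast+
  show "level b t \<le> level b t'" if "t \<le> t'"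
  proof -
    have "pp t t + 1 \<le> pp t' t' + 1" using that by (simp add: pp_mono)
    then have "t \<le> level b t' \<and> (\<forall>x. x < pp t t + 1 \<longrightarrow> b x \<le> level b t' + 1)"
      using l[of t'] that by (meson order_trans less_le_trans)
    then have "\<not> level b t' < level b t" using dec_not_less_Least[OF d[of t], of "level b t'"] unfolding level_def[of b t] by blast
    then show ?thesis by simp
  qed
qed

text \<open>The names involved are at most l + 1, so they denote strings of length at most l, and
  later bits have no influence.\<close>

lemma DD_level:
  assumes b: "names b" and "i \<le> t" "m \<le> t" "level b t \<le> l" "l \<le> L" and \<tau>: "bs \<tau> L"
  shows "DD b i m \<tau> \<longleftrightarrow> DD b i m (res l \<tau>)"
proof
  assume "DD b i m (res l \<tau>)"
  then show "DD b i m \<tau>" using DD_mono[OF _ order_refl order_refl prefix_res[OF \<tau> assms(5)]] by blast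
next
  assume D: "DD b i m \<tau>"
  show "DD b i m (res l \<tau>)"
    unfolding DD_def
  proof (intro allI impI)
    fix i' assume i': "i' \<le> i"
    then obtain j where j: "j < m" "inb \<tau> (b (pp i' j))" using D unfolding DD_def by blast
    have "pp i' j < pp t t + 1" using i' j(1) assms(2,3) by (auto simp: less_Suc_iff intro!: pp_mono)
    then have "b (pp i' j) \<le> level b t + 1" by (rule level(2)[OF b])
    also have "\<dots> \<le> l + 1" using assms(4) by simp
    finally have bl: "b (pp i' j) \<le> l + 1" .
    obtain \<sigma> where s: "b (pp i' j) = \<sigma> + 1" "prefix MM \<sigma> \<tau>" using j(2) by (auto simp: inb_def)
    then obtain k where k: "bs \<sigma> k" using b unfolding names_def by (metis add_eq_0 add_right_imp_eq zero_neq_one)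
    have "k \<le> l" using bs_length_le[OF k] bl s(1) by simp
    then have "prefix MM \<sigma> (res l \<tau>)" using s(2) unfolding prefix_iff[OF k \<tau>] prefix_iff[OF k bs_res] by (auto intro: less_le_trans)
    then show "\<exists>j. j < m \<and> inb (res l \<tau>) (b (pp i' j))" using j(1) s(1) by auto
  qed
qed

lemma nstr_level:
  assumes "dec P" "l \<le> L" "\<And>\<tau>. bs \<tau> L \<Longrightarrow> P \<tau> \<longleftrightarrow> P (res l \<tau>)"
  shows "nstr L P * pw l = pw L * nstr l P"
proof -
  have "nstr L P = nstr L (\<lambda>\<tau>. P (res l \<tau>))"
    by (intro nstr_cong assms(1,3) dec_fn[OF assms(1)] dec_intros)
  then show ?thesis using nstr_res[OF assms(2,1)] by simp
qed

text \<open>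
  \<open>mm i s\<close> approximates a stage \<open>m\<close> at which all but \<open>p / (q 2\<^sup>i\<^sup>+\<^sup>2)\<close> of the \<open>i\<close>-th open set has been
  enumerated. It changes only if that much measure has appeared since its last change, hence only
  boundedly often.
\<close>

locale positive_class =
  fixes b :: "'a::rca \<Rightarrow> 'a" and p q :: 'a
  assumes b: "names b" and p: "0 < p" and q: "0 < q"
    and D: "\<And>i. \<exists>m n. p * pw n < nstr n (DD b i m) * q"
begin

lemma fb: "fn b"
  using b by (simp add: names_def)

text \<open>The threshold p / (q 2^(i+2)) is the weight of \<open>union_bound\<close>: what all the
  open sets miss together then amounts to at most p / (2 q), half of the guaranteed measure.\<close>

definition unst :: "'a \<Rightarrow> 'a \<Rightarrow> 'a \<Rightarrow> bool" where
  "unst i m t \<longleftrightarrow> p * pw (level b (i + t)) <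
     q * pw (i + 2) * nstr (level b (i + t)) (\<lambda>\<tau>. DD b i t \<tau> \<and> \<not> DD b i m \<tau>)"

lemma dec_unst:
  assumes "fn i" "fn m" "fn t"
  shows "dec (\<lambda>x. unst (i x) (m x) (t x))"
  unfolding unst_def
  by (intro dec_intros fn_level[OF b] dec_DD fb assms fn_comp[OF assms(1)] fn_comp[OF assms(2)] fn_comp[OF assms(3)])

definition mm :: "'a \<Rightarrow> 'a \<Rightarrow> 'a" where
  "mm i s = prec 0 (\<lambda>k v. if unst i v (k + 1) then k + 1 else v) s"

lemma fn_mm:
  assumes "fn i" "fn s"
  shows "fn (\<lambda>x. mm (i x) (s x))"
  unfolding mm_def by (intro dec_intros dec_unst assms fn_comp[OF assms(1)])

definition ch :: "'a \<Rightarrow> 'a \<Rightarrow> bool" where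
  "ch i s \<longleftrightarrow> unst i (mm i s) (s + 1)"

lemma dec_ch:
  assumes "fn i" "fn s"
  shows "dec (\<lambda>x. ch (i x) (s x))"
  unfolding ch_def by (intro dec_unst dec_intros fn_mm assms)

lemma dec_ch1: "dec (ch i)"
  by (intro dec_ch dec_intros)

lemma mm_simps: "mm i 0 = 0" "mm i (s + 1) = (if ch i s then s + 1 else mm i s)"
proof -
  have f: "fn (\<lambda>z. if unst i (p2 z) (p1 z + 1) then p1 z + 1 else p2 z)" by (intro dec_intros dec_unst)
  from prec_simps[OF f] show "mm i 0 = 0" "mm i (s + 1) = (if ch i s then s + 1 else mm i s)"
    by (simp_all add: mm_def ch_def)
qed

lemma mm_le: "mm i s \<le> s"
proof (rule dec_induct[of "\<lambda>s. mm i s \<le> s"])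
  show "dec (\<lambda>s. mm i s \<le> s)" by (intro dec_intros fn_mm)
qed (auto simp: mm_simps add_increasing2)

text \<open>Each move adds more than the threshold to the measure of the current approximation,
  which only grows. The counts are rescaled to the next level at every step.\<close>

lemma ch_count: "cnt s (ch i) * p * pw (level b (i + s)) \<le> q * pw (i + 2) * nstr (level b (i + s)) (DD b i (mm i s))"
proof (rule dec_induct[of "\<lambda>s. cnt s (ch i) * p * pw (level b (i + s)) \<le> q * pw (i + 2) * nstr (level b (i + s)) (DD b i (mm i s))"])
  show "dec (\<lambda>s. cnt s (ch i) * p * pw (level b (i + s)) \<le> q * pw (i + 2) * nstr (level b (i + s)) (DD b i (mm i s)))"
    by (intro dec_intros dec_ch fn_level[OF b] dec_DD fb fn_mm)
  show "cnt 0 (ch i) * p * pw (level b (i + 0)) \<le> q * pw (i + 2) * nstr (level b (i + 0)) (DD b i (mm i 0))"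
    by (simp add: cnt_simps dec_ch1)
  fix s
  define c l L m K where "c = cnt s (ch i)" and "l = level b (i + s)" and "L = level b (i + (s + 1))"
    and "m = mm i s" and "K = q * pw (i + 2)"
  define A A' where "A = nstr l (DD b i m)" and "A' = nstr L (DD b i m)"
  assume "cnt s (ch i) * p * pw (level b (i + s)) \<le> q * pw (i + 2) * nstr (level b (i + s)) (DD b i (mm i s))"
  then have IH: "c * p * pw l \<le> K * A" by (simp add: c_def l_def m_def K_def A_def)
  have dm: "dec (DD b i k)" for k by (intro dec_DD fb dec_intros)
  have lL: "l \<le> L" unfolding l_def L_def by (intro level(3)[OF b]) (simp add: add_increasing2)
  have ms: "m \<le> s" unfolding m_def by (rule mm_le)
  have aa: "A' * pw l = pw L * A"
    unfolding A_def A'_def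
  proof (rule nstr_level[OF dm lL])
    fix \<tau> assume t: "bs \<tau> L"
    show "DD b i m \<tau> \<longleftrightarrow> DD b i m (res l \<tau>)"
      by (rule DD_level[OF b, of i "i + s" m l L]) (use lL t ms in \<open>auto simp: l_def intro: add_increasing\<close>)
  qed
  have "pw l * (K * A') = K * (A' * pw l)" by (simp add: ac_simps)
  then have AA: "pw l * (K * A') = pw L * (K * A)" unfolding aa by (simp add: ac_simps)
  have "pw l * (c * p * pw L) = pw L * (c * p * pw l)" by (simp add: ac_simps)
  also have "\<dots> \<le> pw L * (K * A)" using IH by (rule mult_left_mono) simp
  finally have old: "c * p * pw L \<le> K * A'" unfolding AA[symmetric] by (rule mult_le_cancel_pw)
  have "(if ch i s then c + 1 else c) * p * pw L \<le> K * nstr L (DD b i (mm i (s + 1)))"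
  proof (cases "ch i s")
    case False
    then show ?thesis using old by (simp add: mm_simps A'_def m_def)
  next
    case True
    define d where "d = nstr L (\<lambda>\<tau>. DD b i (s + 1) \<tau> \<and> \<not> DD b i m \<tau>)"
    have new: "p * pw L \<le> K * d" using True unfolding ch_def unst_def by (simp add: L_def K_def d_def m_def less_imp_le)
    have "m \<le> s + 1" using ms by (simp add: add_increasing2)
    then have "A' \<le> nstr L (\<lambda>\<tau>. DD b i (s + 1) \<tau> \<and> DD b i m \<tau>)"
      unfolding A'_def using DD_mono[OF _ order_refl _ prefix_refl] by (intro nstr_mono dec_conj dm) blast
    then have "A' + d \<le> nstr L (DD b i (s + 1))"
      using nstr_split[OF dm[of "s + 1"] dm[of m], of L] by (simp add: d_def)
    then have "K * (A' + d) \<le> K * nstr L (DD b i (s + 1))" by (rule mult_left_mono) simp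
    moreover have "(c + 1) * p * pw L \<le> K * (A' + d)"
      using add_mono[OF old new] by (simp add: distrib_left distrib_right)
    ultimately show ?thesis using True by (simp add: mm_simps)
  qed
  then show "cnt (s + 1) (ch i) * p * pw (level b (i + (s + 1))) \<le>
      q * pw (i + 2) * nstr (level b (i + (s + 1))) (DD b i (mm i (s + 1)))"
    unfolding cnt_simps(2)[OF dec_ch1] c_def L_def K_def .
qed

lemma ch_bound: "cnt s (ch i) \<le> q * pw (i + 2)"
proof -
  have dm: "dec (DD b i (mm i s))" by (intro dec_DD fb dec_intros)
  let ?L = "level b (i + s)"
  have "pw ?L * (cnt s (ch i) * p) \<le> q * pw (i + 2) * nstr ?L (DD b i (mm i s))"
    using ch_count[of s i] by (simp add: ac_simps)
  also have "\<dots> \<le> q * pw (i + 2) * pw ?L" using nstr_le[OF dm] by (rule mult_left_mono) simp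
  finally have "pw ?L * (cnt s (ch i) * p) \<le> pw ?L * (q * pw (i + 2))" by (simp add: ac_simps)
  then have "cnt s (ch i) * p \<le> q * pw (i + 2)" by (rule mult_le_cancel_pw)
  then show ?thesis using mult_ge[OF p, of "cnt s (ch i)"] by (simp add: mult.commute)
qed

lemma pw_mono: "i \<le> n \<Longrightarrow> pw i \<le> pw n"
  using pw_add[of i] mult_ge[OF pw_pos, of "pw i"]
  by (metis add.commute le_add_diff_inverse2 mult.commute)

text \<open>The stages at which some i \<le> n moves number at most (n + 1) q 2^(n+2). Counting them
  gives a monotone bounded function, and where it stabilizes all these values are final
  together.\<close>

lemma mm_stable: "\<exists>s. \<forall>t i. s \<le> t \<longrightarrow> i \<le> n \<longrightarrow> mm i t = mm i s"
proof -
  define K where "K = q * pw (n + 2)"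
  define F where "F = (\<lambda>s. cnt s (\<lambda>k. \<exists>i. i < n + 1 \<and> ch i k))"
  have dF: "dec (\<lambda>k. \<exists>i. i < j \<and> ch i k)" for j by (intro dec_intros dec_ch)
  have "j \<le> n + 1 \<longrightarrow> cnt s (\<lambda>k. \<exists>i. i < j \<and> ch i k) \<le> j * K" for s j
  proof (rule dec_induct[of "\<lambda>j. j \<le> n + 1 \<longrightarrow> cnt s (\<lambda>k. \<exists>i. i < j \<and> ch i k) \<le> j * K"])
    show "dec (\<lambda>j. j \<le> n + 1 \<longrightarrow> cnt s (\<lambda>k. \<exists>i. i < j \<and> ch i k) \<le> j * K)" by (intro dec_intros dec_ch)
    show "0 \<le> n + 1 \<longrightarrow> cnt s (\<lambda>k. \<exists>i. i < 0 \<and> ch i k) \<le> 0 * K" by (simp add: cnt_False)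
    fix j assume IH: "j \<le> n + 1 \<longrightarrow> cnt s (\<lambda>k. \<exists>i. i < j \<and> ch i k) \<le> j * K"
    show "j + 1 \<le> n + 1 \<longrightarrow> cnt s (\<lambda>k. \<exists>i. i < j + 1 \<and> ch i k) \<le> (j + 1) * K"
    proof
      assume "j + 1 \<le> n + 1"
      then have j: "j \<le> n" "j \<le> n + 1" by (auto intro: add_increasing2)
      have "cnt s (\<lambda>k. \<exists>i. i < j + 1 \<and> ch i k) = cnt s (\<lambda>k. (\<exists>i. i < j \<and> ch i k) \<or> ch j k)"
        by (intro cnt_cong dF dec_disj dec_ch1) (auto simp: less_Suc_iff order_le_less)
      also have "\<dots> \<le> \<dots> + cnt s (\<lambda>k. (\<exists>i. i < j \<and> ch i k) \<and> ch j k)" by simp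
      also have "\<dots> = cnt s (\<lambda>k. \<exists>i. i < j \<and> ch i k) + cnt s (ch j)" by (rule cnt_disj[OF dF dec_ch1])
      also have "cnt s (ch j) \<le> K"
        using ch_bound[of s j] mult_left_mono[OF pw_mono[of "j + 2" "n + 2"], of q] j(1) unfolding K_def by simp
      finally show "cnt s (\<lambda>k. \<exists>i. i < j + 1 \<and> ch i k) \<le> (j + 1) * K"
        using IH j(2) add_mono[of "cnt s (\<lambda>k. \<exists>i. i < j \<and> ch i k)" "j * K" K K]
        by (simp add: distrib_right order_trans)
    qed
  qed
  then have bound: "F s \<le> (n + 1) * K" for s unfolding F_def by blast
  have mono: "F s \<le> F t" if "s \<le> t" for s t
  proof (cases "s = t")
    case False
    have d: "t = s + (t - s)" using le_add_diff_inverse2[OF that] by (simp add: add.commute)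
    have "F s \<le> F (s + d)" for d
    proof (rule dec_induct[of "\<lambda>d. F s \<le> F (s + d)"])
      show "dec (\<lambda>d. F s \<le> F (s + d))" unfolding F_def by (intro dec_intros dec_ch)
      fix d assume IH: "F s \<le> F (s + d)"
      have "F (s + (d + 1)) = (if \<exists>i. i < n + 1 \<and> ch i (s + d) then F (s + d) + 1 else F (s + d))"
        unfolding F_def add.assoc[symmetric] by (rule cnt_simps(2)[OF dF])
      then show "F s \<le> F (s + (d + 1))" using IH by (auto intro: add_increasing2)
    qed simp
    from this[of "t - s"] show ?thesis using d by simp
  qed simp
  have "fn F" unfolding F_def by (intro dec_intros dec_ch)
  from mono_stabilizes[OF this mono bound] obtain s where s: "\<And>t. s \<le> t \<Longrightarrow> F t = F s" by blast
  have noch: "\<not> ch i (s + d)" if "i \<le> n" for i d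
  proof
    assume c: "ch i (s + d)"
    have "F (s + d + 1) = F (s + d) + 1"
      unfolding F_def cnt_simps(2)[OF dF] using c that by (auto simp: less_Suc_iff)
    then show False using s[of "s + d"] s[of "s + d + 1"] by (simp add: add.assoc)
  qed
  have st: "mm i (s + d) = mm i s" if i: "i \<le> n" for i d
  proof (rule dec_induct[of "\<lambda>d. mm i (s + d) = mm i s"])
    show "dec (\<lambda>d. mm i (s + d) = mm i s)" by (intro dec_intros fn_mm)
    fix d assume "mm i (s + d) = mm i s"
    then show "mm i (s + (d + 1)) = mm i s" unfolding add.assoc[symmetric] mm_simps using noch[OF i] by simp
  qed simp
  have "mm i t = mm i s" if "s \<le> t" "i \<le> n" for t i
    using st[OF that(2), of "t - s"] le_add_diff_inverse2[OF that(1)] by (simp add: add.commute)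
  then show ?thesis by blast
qed

text \<open>Fixing the length of the extension makes the search finite; by \<open>DD_level\<close>,
  longer extensions add nothing.\<close>

definition compat :: "'a \<Rightarrow> 'a \<Rightarrow> 'a \<Rightarrow> bool" where
  "compat i m \<sigma> \<longleftrightarrow> (\<exists>\<tau>. \<tau> < SB (slen \<sigma> + level b (i + m)) \<and> bs \<tau> (slen \<sigma> + level b (i + m)) \<and>
     prefix MM \<sigma> \<tau> \<and> DD b i m \<tau>)"

lemma compatI:
  assumes \<tau>: "bs \<tau> L" and L: "n + level b (i + m) \<le> L" and "DD b i m \<tau>"
  shows "compat i m (res n \<tau>)"
proof -
  let ?l = "n + level b (i + m)"
  have "DD b i m (res ?l \<tau>)"
    using DD_level[OF b _ _ _ L \<tau>, of i "i + m" m] assms(3) by (simp add: add_increasing add_increasing2)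
  moreover have "prefix MM (res n \<tau>) (res ?l \<tau>)"
    using prefix_res[OF bs_res, of n ?l] res_res[of n ?l \<tau>] by (metis le_add_same_cancel1 ge0)
  ultimately show ?thesis
    unfolding compat_def bs_slen[OF bs_res] using bs_less_SB[OF bs_res] bs_res by blast
qed

lemma compat_prefix:
  assumes "compat i m \<sigma>" "bs \<sigma> n" "bs \<sigma>' n'" "prefix MM \<sigma>' \<sigma>"
  shows "compat i m \<sigma>'"
proof -
  obtain \<tau> where t: "bs \<tau> (n + level b (i + m))" "prefix MM \<sigma> \<tau>" "DD b i m \<tau>"
    using assms(1) unfolding compat_def bs_slen[OF assms(2)] by blast
  have "res n' \<tau> = \<sigma>'" using prefix_eq_res[OF assms(3) t(1) prefix_trans[OF assms(4) t(2)]] by blast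
  moreover have "n' \<le> n" using assms(4) by (simp add: prefix_iff[OF assms(3,2)])
  ultimately show ?thesis using compatI[OF t(1) _ t(3), of n'] by (simp add: add_right_mono)
qed

text \<open>Only the sets up to the length of \<sigma> are tested. So a guess depends on finitely
  many \<open>mm i s\<close>, and shorter strings face fewer conditions, as a tree requires.\<close>

definition gg :: "'a \<Rightarrow> 'a \<Rightarrow> bool" where
  "gg \<sigma> s \<longleftrightarrow> bs \<sigma> (slen \<sigma>) \<and> (\<forall>i. i \<le> slen \<sigma> \<longrightarrow> compat i (mm i s) \<sigma>)"

lemma dec_gg: "dec2 gg"
  unfolding gg_def compat_def by (intro dec_intros dec_DD fb fn_level[OF b] fn_mm)

lemma gg_stable:
  assumes "\<And>t i. s \<le> t \<Longrightarrow> i \<le> n \<Longrightarrow> mm i t = mm i s" "bs \<sigma> l" "l \<le> n"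
  shows "\<forall>t. s \<le> t \<longrightarrow> (gg \<sigma> t \<longleftrightarrow> gg \<sigma> s)"
  unfolding gg_def bs_slen[OF assms(2)] using assms(1,3) by (metis order_trans)

text \<open>A string in a late approximation of the n-th set is lost only if it lies outside the
  final \<open>mm i s\<close> approximation for some i \<le> n. These losses cost at most half of p
  / q.\<close>

lemma gg_density:
  assumes s: "\<And>t i. s \<le> t \<Longrightarrow> i \<le> n \<Longrightarrow> mm i t = mm i s"
  shows "p * pw n < nstr n (\<lambda>\<sigma>. gg \<sigma> s) * (q + q)"
proof -
  obtain m0 n0 where m0: "p * pw n0 < nstr n0 (DD b n m0) * q" using D by blast
  have "fn (\<lambda>i. n + level b (i + mm i s))" by (intro dec_intros fn_level[OF b] fn_mm)
  then obtain v where v: "\<And>i. i < n + 1 \<Longrightarrow> n + level b (i + mm i s) < v" using bounded_fn by blast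
  \<comment> \<open>After stabilization, past the stage m0 and level n0 that exhibit the measure of
    the n-th set, and past the lengths of all extensions that \<open>compat\<close> asks
    for.\<close>
  define t where "t = s + n + m0 + n0 + v"
  have t: "s \<le> t" "n \<le> t + 1" "m0 \<le> t + 1" "n0 \<le> t + 1" "v \<le> t + 1"
    unfolding t_def by (simp_all add: add.assoc add_increasing add_increasing2)
  define L where "L = level b (n + (t + 1))"
  have tL: "t + 1 \<le> L" unfolding L_def using level(1)[OF b, of "n + (t + 1)"] by (rule order_trans[rotated]) (simp add: add_increasing)
  have dm: "dec (DD b i m)" for i m by (intro dec_DD fb dec_intros)
  define Bad where "Bad = (\<lambda>i \<tau>. DD b i (t + 1) \<tau> \<and> \<not> DD b i (mm i s) \<tau>)"
  have dBad: "dec2 Bad" unfolding Bad_def by (intro dec_intros dec_DD fb fn_mm)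
  have dBi: "dec (Bad i)" for i unfolding Bad_def by (intro dec_conj dec_not dm)
  have small: "q * pw (i + 2) * nstr L (Bad i) \<le> p * pw L" if "i < n + 1" for i
  proof -
    have i: "i \<le> n" using that by (simp add: less_Suc_iff)
    have st: "s \<le> t + 1" using t(1) by (simp add: add_increasing2)
    have mi: "mm i t = mm i s" "mm i (t + 1) = mm i s" using s i t(1) st by blast+
    \<comment> \<open>A move at t would set the value to t + 1, whereas the final value is at most
      s, hence at most t.\<close>
    have "\<not> ch i t"
    proof
      assume "ch i t"
      then have "mm i s = t + 1" using mm_simps(2)[of i t] mi by simp
      then show False using mm_le[of i s] t(1) by (metis less_Suc_iff not_le order_refl order_trans)
    qed
    then have u: "q * pw (i + 2) * nstr (level b (i + (t + 1))) (Bad i) \<le> p * pw (level b (i + (t + 1)))"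
      unfolding ch_def unst_def mi Bad_def by (simp add: not_less)
    define l where "l = level b (i + (t + 1))"
    have lL: "l \<le> L" unfolding l_def L_def using i by (intro level(3)[OF b]) simp
    have ms: "mm i s \<le> i + (t + 1)" using mm_le[of i s] st by (meson add_increasing ge0 order_trans)
    have bb: "nstr L (Bad i) * pw l = pw L * nstr l (Bad i)"
    proof (rule nstr_level[OF dBi lL])
      fix \<tau> assume tau: "bs \<tau> L"
      show "Bad i \<tau> \<longleftrightarrow> Bad i (res l \<tau>)"
        unfolding Bad_def
        using DD_level[OF b _ _ _ lL tau, of i "i + (t + 1)" "t + 1"] DD_level[OF b _ ms _ lL tau, of i]
        by (simp add: l_def add_increasing)
    qed
    have "pw l * (q * pw (i + 2) * nstr L (Bad i)) = q * pw (i + 2) * (nstr L (Bad i) * pw l)"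
      by (simp add: ac_simps)
    also have "\<dots> = pw L * (q * pw (i + 2) * nstr l (Bad i))" unfolding bb by (simp add: ac_simps)
    also have "\<dots> \<le> pw L * (p * pw l)" using u unfolding l_def by (rule mult_left_mono) simp
    finally have "pw l * (q * pw (i + 2) * nstr L (Bad i)) \<le> pw l * (p * pw L)" by (simp add: ac_simps)
    then show ?thesis by (rule mult_le_cancel_pw)
  qed
  define U where "U = nstr L (\<lambda>\<tau>. \<exists>i. i < n + 1 \<and> Bad i \<tau>)"
  have U: "q * (U + U) \<le> p * pw L" unfolding U_def by (rule union_bound[OF dBad small])
  have dU: "dec (\<lambda>\<tau>. \<exists>i. i < n + 1 \<and> Bad i \<tau>)" by (intro dec_intros dec2_comp[OF dBad])
  have big: "p * pw L < nstr L (DD b n (t + 1)) * q"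
  proof -
    have n0L: "n0 \<le> L" using t(4) tL by (rule order_trans)
    have "nstr L (\<lambda>\<tau>. DD b n m0 (res n0 \<tau>)) \<le> nstr L (DD b n (t + 1))"
      by (intro nstr_mono dm dec_fn[OF dm] dec_intros) (use DD_mono[OF _ order_refl t(3)] prefix_res[OF _ n0L] in blast)
    then have "pw n0 * (nstr L (\<lambda>\<tau>. DD b n m0 (res n0 \<tau>)) * q) \<le> pw n0 * (nstr L (DD b n (t + 1)) * q)"
      by (intro mult_left_mono mult_right_mono) simp_all
    moreover have "pw n0 * (nstr L (\<lambda>\<tau>. DD b n m0 (res n0 \<tau>)) * q) = pw L * (nstr n0 (DD b n m0) * q)"
      using nstr_res[OF n0L dm[of n m0]] by (simp add: mult.left_commute mult.commute)
    moreover have "pw L * (p * pw n0) < pw L * (nstr n0 (DD b n m0) * q)" using m0 by (rule mult_strict_left_mono) simp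
    ultimately have "pw n0 * (p * pw L) < pw n0 * (nstr L (DD b n (t + 1)) * q)" by (simp add: ac_simps)
    then show ?thesis by (rule mult_less_cancel)
  qed
  have dg: "dec (\<lambda>\<sigma>. gg \<sigma> s)" "dec (\<lambda>\<tau>. gg (res n \<tau>) s)" by (intro dec2_comp[OF dec_gg] dec_intros)+
  define G where "G = nstr L (\<lambda>\<tau>. gg (res n \<tau>) s)"
  have "nstr L (DD b n (t + 1)) \<le> nstr L (\<lambda>\<tau>. gg (res n \<tau>) s \<or> (\<exists>i. i < n + 1 \<and> Bad i \<tau>))"
  proof (intro nstr_mono dm dec_disj dg dU)
    fix \<tau> assume tau: "bs \<tau> L" "DD b n (t + 1) \<tau>"
    show "gg (res n \<tau>) s \<or> (\<exists>i. i < n + 1 \<and> Bad i \<tau>)"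
    proof (rule disjCI)
      assume nb: "\<not> (\<exists>i. i < n + 1 \<and> Bad i \<tau>)"
      have "compat i (mm i s) (res n \<tau>)" if i: "i \<le> n" for i
      proof (rule compatI[OF tau(1)])
        have "n + level b (i + mm i s) < v" using v i by (simp add: less_Suc_iff)
        then show "n + level b (i + mm i s) \<le> L" using t(5) tL by (meson less_imp_le order_trans)
        have "DD b i (t + 1) \<tau>" using DD_mono[OF tau(2) i order_refl prefix_refl] .
        moreover have "\<not> Bad i \<tau>" using nb i by (auto simp: less_Suc_iff)
        ultimately show "DD b i (mm i s) \<tau>" unfolding Bad_def by blast
      qed
      then show "gg (res n \<tau>) s" unfolding gg_def bs_slen[OF bs_res] using bs_res by blast
    qed
  qed
  also have "\<dots> \<le> G + U" unfolding G_def U_def by (rule nstr_disj_le[OF dg(2) dU])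
  finally have "nstr L (DD b n (t + 1)) * q \<le> (G + U) * q" by (rule mult_right_mono) simp
  with big have "p * pw L < (G + U) * q" by (rule less_le_trans)
  then have "p * pw L + p * pw L < (G + U) * q + (G + U) * q" by (intro add_strict_mono)
  also have "\<dots> = G * (q + q) + q * (U + U)" by (simp add: algebra_simps)
  also have "\<dots> \<le> G * (q + q) + p * pw L" using U by simp
  finally have G: "p * pw L < G * (q + q)" by simp
  have nL: "n \<le> L" using t(2) tL by (rule order_trans)
  have "pw L * (p * pw n) = pw n * (p * pw L)" by (simp add: ac_simps)
  also have "\<dots> < pw n * (G * (q + q))" using G by (rule mult_strict_left_mono) simp
  also have "\<dots> = (G * pw n) * (q + q)" by (simp add: ac_simps)
  also have "\<dots> = pw L * (nstr n (\<lambda>\<sigma>. gg \<sigma> s) * (q + q))"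
    using nstr_res[OF nL dg(1)] by (simp add: G_def ac_simps)
  finally show ?thesis by (rule mult_less_cancel)
qed

lemma positive_class_member:
  assumes WWKL: "two_WWKL (MM :: 'a l2_structure)"
  shows "\<exists>Y\<in>SS. \<forall>i. \<exists>j. Y \<in> opn b (pp i j)"
proof -
  obtain X e where X: "X \<in> SS" "\<And>x s. \<forall>t. s \<le> t \<longrightarrow> (gg x t \<longleftrightarrow> gg x s) \<Longrightarrow> phi MM (jump MM X) e x (if gg x s then 1 else 0)"
    using jump_computes_limits[OF dec_gg] by blast
  define T where "T = tree_of MM (jump MM X) e"
  have T: "x \<in> T \<longleftrightarrow> gg x s" if "\<forall>t. s \<le> t \<longrightarrow> (gg x t \<longleftrightarrow> gg x s)" for x s
    using X(2)[OF that] phi_det[OF X(2)[OF that], of 1] by (auto simp: T_def tree_of_def split: if_splits)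
  \<comment> \<open>A common stage is needed to compare a string with its prefixes and to count a
    whole level.\<close>
  have nstable: "\<exists>s. \<forall>x l t. bs x l \<longrightarrow> l \<le> n \<longrightarrow> s \<le> t \<longrightarrow> (gg x t \<longleftrightarrow> gg x s)" for n
    using mm_stable[of n] gg_stable[of _ n] by meson
  have stable: "\<exists>s. \<forall>t. s \<le> t \<longrightarrow> (gg x t \<longleftrightarrow> gg x s)" for x
  proof (cases "bs x (slen x)")
    case True
    then show ?thesis using nstable[of "slen x"] by blast
  qed (simp add: gg_def)
  have bsT: "\<exists>l. bs x l" if "x \<in> T" for x
    using stable[of x] T that unfolding gg_def by blast
  have "phi MM (jump MM X) e x 0 \<or> phi MM (jump MM X) e x 1" for x
  proof -
    obtain s where "\<forall>t. s \<le> t \<longrightarrow> (gg x t \<longleftrightarrow> gg x s)" using stable by blast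
    from X(2)[OF this] show ?thesis by (cases "gg x s") simp_all
  qed
  moreover have "\<sigma> \<in> T" if t: "\<tau> \<in> T" and s: "bs \<sigma> l" "prefix MM \<sigma> \<tau>" for \<tau> \<sigma> l
  proof -
    obtain n where n: "bs \<tau> n" using bsT t by blast
    have ln: "l \<le> n" using s prefix_iff n by blast
    obtain s0 where st: "\<And>x l t. bs x l \<Longrightarrow> l \<le> n \<Longrightarrow> s0 \<le> t \<Longrightarrow> gg x t \<longleftrightarrow> gg x s0" using nstable[of n] by blast
    have "gg \<tau> s0" using T[of s0 \<tau>] st[OF n] t by blast
    then have "compat i (mm i s0) \<tau>" if "i \<le> l" for i
      using that ln unfolding gg_def bs_slen[OF n] by (meson order_trans)
    then have "compat i (mm i s0) \<sigma>" if "i \<le> l" for i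
      using that compat_prefix[OF _ n s] by blast
    then have "gg \<sigma> s0" using s(1) unfolding gg_def bs_slen[OF s(1)] by blast
    then show "\<sigma> \<in> T" using T[of s0 \<sigma>] st[OF s(1) ln] by blast
  qed
  ultimately have bti: "binary_tree_index MM (jump MM X) e"
    unfolding binary_tree_index_def is_binary_tree_def T_def[symmetric] MM_simps using bsT by blast
  have dens: "\<exists>s. card_is MM {\<sigma> \<in> T. bs \<sigma> n} (nstr n (\<lambda>\<sigma>. gg \<sigma> s)) \<and> p * pw n < nstr n (\<lambda>\<sigma>. gg \<sigma> s) * (q + q)" for n
  proof -
    obtain s where s: "\<forall>t i. s \<le> t \<longrightarrow> i \<le> n \<longrightarrow> mm i t = mm i s" using mm_stable by blast
    have dg: "dec (\<lambda>\<sigma>. gg \<sigma> s)" by (intro dec2_comp[OF dec_gg] dec_intros)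
    have "x \<in> T \<longleftrightarrow> gg x s" if "bs x n" for x
      by (rule T, rule gg_stable[OF _ that order_refl]) (use s in blast)
    then have "{\<sigma> \<in> T. bs \<sigma> n} = {\<sigma>. bs \<sigma> n \<and> gg \<sigma> s}" by blast
    moreover have "card_is MM {\<sigma>. bs \<sigma> n \<and> gg \<sigma> s} (nstr n (\<lambda>\<sigma>. gg \<sigma> s))"
      unfolding nstr_def by (subst card_is_iff[OF dec_bsP[OF dg]]) (auto simp: bs_less_SB)
    moreover have "p * pw n < nstr n (\<lambda>\<sigma>. gg \<sigma> s) * (q + q)" by (rule gg_density) (use s in blast)
    ultimately show ?thesis by auto
  qed
  have unb: "unbounded MM T"
    unfolding unbounded_def MM_simps
  proof
    fix m
    obtain s where s: "card_is MM {\<sigma> \<in> T. bs \<sigma> (m + 1)} (nstr (m + 1) (\<lambda>\<sigma>. gg \<sigma> s))"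
        "p * pw (m + 1) < nstr (m + 1) (\<lambda>\<sigma>. gg \<sigma> s) * (q + q)" using dens by blast
    obtain A where A: "dec A" "\<And>\<sigma>. A \<sigma> \<longleftrightarrow> \<sigma> \<in> T \<and> bs \<sigma> (m + 1)" "nstr (m + 1) (\<lambda>\<sigma>. gg \<sigma> s) = nstr (m + 1) A"
      using card_is_strings[OF s(1)] by metis
    have "\<exists>\<sigma>. A \<sigma>"
    proof (rule ccontr)
      assume "\<not> ?thesis"
      then have "nstr (m + 1) A = nstr (m + 1) (\<lambda>_. False)" by (intro nstr_cong A(1) dec_const) blast
      then show False using s(2) A(3) by (simp add: nstr_False)
    qed
    then obtain \<sigma> where "\<sigma> \<in> T" "bs \<sigma> (m + 1)" using A(2) by blast
    then show "\<exists>x\<in>T. m < x" using bs_length_le less_iff_Suc_le by blast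
  qed
  have "positive_density MM T"
    unfolding positive_density_def MM_simps pow2_iff
  proof -
    have "0 < q + q" using q by (simp add: add_pos_pos)
    moreover have "\<exists>k N. card_is MM {\<sigma> \<in> T. bs \<sigma> n} k \<and> N = pw n \<and> p * N < k * (q + q)" for n
      using dens[of n] by blast
    ultimately show "\<exists>p q. 0 < p \<and> 0 < q \<and> (\<forall>n. \<exists>k N. card_is MM {\<sigma> \<in> T. bs \<sigma> n} k \<and> N = pw n \<and> p * N < k * q)"
      using p by blast
  qed
  then obtain Y where Y: "Y \<in> SS" "path_through MM Y T"
    using WWKL X(1) bti unb unfolding two_WWKL_def MM_simps T_def by blast
  have "\<exists>j. Y \<in> opn b (pp i j)" for i
  proof -
    obtain s where s: "\<forall>t i'. s \<le> t \<longrightarrow> i' \<le> i \<longrightarrow> mm i' t = mm i' s" using mm_stable by blast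
    \<comment> \<open>At this length the initial segment \<sigma> of Y decides the final
      approximation of the i-th set. So a compatible extension in that approximation already puts
      \<sigma> itself there.\<close>
    define n where "n = i + level b (i + mm i s)"
    obtain \<sigma> where \<sigma>: "bs \<sigma> n" "init_seg MM \<sigma> Y" using init_seg_ex[OF Y(1)] by blast
    obtain s' where s': "\<And>x l t. bs x l \<Longrightarrow> l \<le> n \<Longrightarrow> s' \<le> t \<Longrightarrow> gg x t \<longleftrightarrow> gg x s'" using nstable[of n] by blast
    have "\<sigma> \<in> T" using Y(2) \<sigma>(2) unfolding path_through_def by blast
    then have "gg \<sigma> s'" using T[of s' \<sigma>] s'[OF \<sigma>(1)] by blast
    then have "gg \<sigma> (s + s')" using s'[OF \<sigma>(1) order_refl, of "s + s'"] by (simp add: add_increasing)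
    moreover have "i \<le> n" by (simp add: n_def)
    ultimately have "compat i (mm i (s + s')) \<sigma>" unfolding gg_def bs_slen[OF \<sigma>(1)] by blast
    moreover have "mm i (s + s') = mm i s" using s[rule_format, of "s + s'" i] by simp
    ultimately have "compat i (mm i s) \<sigma>" by simp
    then obtain \<tau> where \<tau>: "bs \<tau> (n + level b (i + mm i s))" "prefix MM \<sigma> \<tau>" "DD b i (mm i s) \<tau>"
      unfolding compat_def bs_slen[OF \<sigma>(1)] by blast
    have "DD b i (mm i s) (res n \<tau>)"
      using DD_level[OF b, of i "i + mm i s" "mm i s" n, OF _ _ _ _ \<tau>(1)] \<tau>(3) by (simp add: n_def add_increasing)
    moreover have "res n \<tau> = \<sigma>" using prefix_eq_res[OF \<sigma>(1) \<tau>(1,2)] by blast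
    ultimately have "DD b i (mm i s) \<sigma>" by simp
    moreover have "Y \<in> cyl MM \<sigma>" using \<sigma>(2) Y(1) by (simp add: mem_cyl)
    ultimately show ?thesis using DD_mem[OF b] by blast
  qed
  then show ?thesis using Y(1) by blast
qed

end

lemma two_WWKL_imp_POS:
  assumes "two_WWKL (MM :: 'a::rca l2_structure)"
  shows "two_POS (MM :: 'a l2_structure)"
  by (rule two_POS_I) (rule positive_class.positive_class_member[OF _ assms], unfold_locales, assumption+)

theorem theorem3p7:
  fixes M :: "'a l2_structure"
  assumes "RCA0 M"
  shows "(two_WWKL M \<longleftrightarrow> two_POS M) \<and> (two_POS M \<longleftrightarrow> BSigma2 M \<and> two_RAN M)"
proof -
  have "reversal (MM :: 'a mdl l2_structure)"
    unfolding reversal_def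
    using two_WWKL_imp_POS two_POS_imp_WWKL two_POS_imp_BSigma2 two_POS_imp_RAN BSigma2_RAN_imp_POS by blast
  then have "reversal M" using assms by (rule reversal_if_classes)
  then show ?thesis unfolding reversal_def .
qed

end
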